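(* Let $r\ge2$ and let $M,M'\in\mathcal{F}_r$ (with the orientations induced from Euclidean space), with eta functions $\eta(s,M)$, $\eta(s,M')$ and eta invariants $\eta(M)$, $\eta(M')$ of the respective Atiyah-Patodi-Singer operators. If $\eta(M)=\eta(M')$, then $\eta(s,M)=\eta(s,M')$ as meromorphic functions on $\mathbb{C}$.
   Context: The family $\mathcal{F}_r$: for $i\ge1$ let $C_i\in\mathrm{SO}(2^i,\mathbb{Z})$ be the companion matrix of $x^{2^i}+1$, i.e. $C_ie_j=e_{j+1}$ for $1\le j\le 2^i-1$ and $C_ie_{2^i}=-e_1$. Let $J_0=(-1)$ and, for $i\ge1$, $J_i=\begin{pmatrix}0&J_{i-1}\\ I_{2^{i-1}}&0\end{pmatrix}\in\mathrm{SO}(2^i,\mathbb{Z})$ (blocks of size $2^{i-1}$); so $C_1=J_1$. For $r\ge2$ and nonnegative integers $k_{r-1},k'_{r-1},\dots,k_2,k_2',k_1$ put $k_1'=0$, $j_i=k_i+k_i'$, and assume $j_{r-1}>0$ and $j_1$ odd. Let $k(r)=(k_{r-1},k_{r-1}',\dots,k_2,k_2',k_1)$ and let $B=B_{k(r)}$ be the block-diagonal matrix with $k_i$ blocks $C_i$ and $k_i'$ blocks $J_i$ for $i=r-1,\dots,1$ (in this order, $C_i$'s before $J_i$'s), followed by a last block $1$. It lies in $\mathrm{SO}(n,\mathbb{Z})$ and has order $2^r$, with $n=2^{r-1}j_{r-1}+\cdots+4j_2+2j_1+1\equiv3\pmod4$. Let $\Gamma_{k(r)}$ be generated by $BL_{b}$,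 $b=\frac1{2^r}e_n$, and the translations $L_\lambda$, $\lambda\in\mathbb{Z}^n$, where $L_b$ is translation by $b$ and $BL_b$ is $x\mapsto B(x+b)$. Put $M_{k(r)}=\Gamma_{k(r)}\backslash\mathbb{R}^n$, an orientable compact flat manifold with holonomy group $\mathbb{Z}_{2^r}$. $\mathcal{F}_r$ is the set of all such manifolds for the given $r$ (the dimension $n$ is not fixed). APS operator: for an oriented compact Riemannian manifold of dimension $n=4h-1$, $\mathcal{D}$ acts on smooth even forms $\bigoplus_{p}\Omega^{2p}(M)$ by $\mathcal{D}\phi=(-1)^{h+p-1}( *d-d* )\phi$ for $\phi\in\Omega^{2p}(M)$. The eta function $\eta(s,M)$ is the meromorphic continuation to $\mathbb{C}$ of $\sum_{0\ne\lambda\in\mathrm{Spec}_{\mathcal D}(M)}\mathrm{sign}(\lambda)|\lambda|^{-s}$, $\mathrm{Re}(s)>n$ (with multiplicity), and $\eta(M)=\eta(0,M)$ is the eta invariant. *)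

theory Defs
  imports
    "HOL-Complex_Analysis.Complex_Analysis"
    "HOL-Library.Function_Algebras"
    "HOL-Algebra.Bij"
    "HOL-Algebra.Generated_Groups"
    "Jordan_Normal_Form.Determinant"
begin

no_notation Matrix.vec_index (infixl "$" 100)

section \<open>Smooth functions and differential forms on Euclidean space\<close>

text \<open>
  The coordinates of \<open>real ^ 'n\<close> are ordered by the linear order on \<open>'n\<close>, which also fixes the
  standard orientation.
\<close>

type_synonym 'n sq_matrix = "real ^ 'n ^ 'n"

type_synonym 'n self_map = "real ^ 'n \<Rightarrow> real ^ 'n"

definition partial_deriv :: "'n \<Rightarrow> (real ^ 'n \<Rightarrow> real) \<Rightarrow> real ^ 'n \<Rightarrow> real" where
  "partial_deriv i f x = frechet_derivative f (at x) (axis i 1)"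

fun C_k :: "nat \<Rightarrow> (real ^ 'n \<Rightarrow> real) \<Rightarrow> bool" where
  "C_k 0 f \<longleftrightarrow> continuous_on UNIV f"
| "C_k (Suc m) f \<longleftrightarrow> f differentiable_on UNIV \<and> (\<forall>i. C_k m (partial_deriv i f))"

definition C_infinity :: "(real ^ 'n \<Rightarrow> real) \<Rightarrow> bool" where
  "C_infinity f \<longleftrightarrow> (\<forall>m. C_k m f)"

text \<open>
  A form of mixed degree is given by its coefficients: \<open>\<phi> x I\<close> is the coefficient at \<open>x\<close> of
  \<open>dx_I = dx_i1 \<and> ... \<and> dx_ip\<close>, where \<open>I = {i1 < ... < ip}\<close>.
\<close>

type_synonym 'n form = "real ^ 'n \<Rightarrow> 'n set \<Rightarrow> real"

definition form_scale :: "real \<Rightarrow> 'n form \<Rightarrow> 'n form" where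
  "form_scale c \<phi> = (\<lambda>x I. c * \<phi> x I)"

global_interpretation forms: vector_space "form_scale :: real \<Rightarrow> 'n form \<Rightarrow> 'n form"
  by unfold_locales (auto simp: form_scale_def fun_eq_iff algebra_simps)

definition smooth_form :: "'n::finite form \<Rightarrow> bool" where
  "smooth_form \<phi> \<longleftrightarrow> (\<forall>I. C_infinity (\<lambda>x. \<phi> x I))"

definition even_form :: "'n form \<Rightarrow> bool" where
  "even_form \<phi> \<longleftrightarrow> (\<forall>x I. odd (card I) \<longrightarrow> \<phi> x I = 0)"

definition degree_part :: "nat \<Rightarrow> 'n form \<Rightarrow> 'n form" where
  "degree_part q \<phi> = (\<lambda>x I. if card I = q then \<phi> x I else 0)"

text \<open>The sign in \<open>dx_j \<and> dx_(J - {j}) = (-1) ^ card {i \<in> J. i < j} * dx_J\<close>.\<close>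

definition ext_d :: "'n::{finite,linorder} form \<Rightarrow> 'n form" where
  "ext_d \<phi> = (\<lambda>x J. \<Sum>j\<in>J. (-1) ^ card {i \<in> J. i < j} *
      partial_deriv j (\<lambda>y. \<phi> y (J - {j})) x)"

text \<open>
  The star operator of the Euclidean metric: \<open>* dx_I = \<epsilon> * dx_J\<close> with \<open>J\<close> the complement of \<open>I\<close>
  and \<open>\<epsilon>\<close> the sign for which \<open>dx_I \<and> * dx_I = dx_1 \<and> ... \<and> dx_n\<close>.
\<close>

definition hodge :: "'n::{finite,linorder} form \<Rightarrow> 'n form" where
  "hodge \<phi> = (\<lambda>x J. (-1) ^ card {(i, j). i \<in> - J \<and> j \<in> J \<and> j < i} * \<phi> x (- J))"

definition minor :: "'n::{finite,linorder} sq_matrix \<Rightarrow> 'n set \<Rightarrow> 'n set \<Rightarrow> real" where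
  "minor A I J = Determinant.det (Matrix.mat (card I) (card J)
      (\<lambda>(a, b). A $ (sorted_list_of_set I ! a) $ (sorted_list_of_set J ! b)))"

definition pullback ::
  "'n::{finite,linorder} self_map \<Rightarrow> 'n form \<Rightarrow> 'n form" where
  "pullback g \<phi> = (\<lambda>x J. \<Sum>I | card I = card J.
      \<phi> (g x) I * minor (matrix (frechet_derivative g (at x))) I J)"


section \<open>The APS operator and the eta function of a compact flat manifold\<close>

text \<open>
  A compact flat manifold \<open>\<Gamma>\<setminus>real ^ 'n\<close>, with the metric and (for \<open>\<Gamma>\<close> orientation preserving) the
  orientation induced from Euclidean space, is represented by its group \<open>\<Gamma>\<close> of deck
  transformations. Its differential forms are the \<open>\<Gamma>\<close>-invariant forms on \<open>real ^ 'n\<close>, and its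
  exterior derivative and star operator are the Euclidean ones.
\<close>

definition even_forms :: "'n::{finite,linorder} self_map set \<Rightarrow> 'n form set" where
  "even_forms \<Gamma> = {\<phi>. smooth_form \<phi> \<and> even_form \<phi> \<and> (\<forall>g\<in>\<Gamma>. pullback g \<phi> = \<phi>)}"

text \<open>
  In dimension \<open>n = 4 * h - 1\<close>. As \<open>h > 0\<close>, the truncated subtraction \<open>h + p - 1\<close> is the true one.
\<close>

definition aps_op :: "'n::{finite,linorder} form \<Rightarrow> 'n form" where
  "aps_op \<phi> = (let n = CARD('n); h = (n + 1) div 4 in
      \<Sum>p\<le>n div 2. let \<psi> = degree_part (2 * p) \<phi> in
        form_scale ((-1) ^ (h + p - 1)) (hodge (ext_d \<psi>) - ext_d (hodge \<psi>)))"

definition eigenspace ::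
  "'n::{finite,linorder} self_map set \<Rightarrow> real \<Rightarrow> 'n form set" where
  "eigenspace \<Gamma> l = {\<phi> \<in> even_forms \<Gamma>. aps_op \<phi> = form_scale l \<phi>}"

definition multiplicity ::
  "'n::{finite,linorder} self_map set \<Rightarrow> real \<Rightarrow> nat" where
  "multiplicity \<Gamma> l = forms.dim (eigenspace \<Gamma> l)"

definition spectrum :: "'n::{finite,linorder} self_map set \<Rightarrow> real set" where
  "spectrum \<Gamma> = {l. \<exists>\<phi>\<in>eigenspace \<Gamma> l. \<phi> \<noteq> 0}"

definition eta_series ::
  "'n::{finite,linorder} self_map set \<Rightarrow> complex \<Rightarrow> complex" where
  "eta_series \<Gamma> s = (\<Sum>\<^sub>\<infinity>l\<in>spectrum \<Gamma> - {0}.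
      of_nat (multiplicity \<Gamma> l) * of_real (sgn l) * of_real \<bar>l\<bar> powr (- s))"

text \<open>
  Meromorphic functions are normalised to be continuous outside their poles and \<open>0\<close> at the poles,
  so that equality of functions is equality of meromorphic functions.
\<close>

definition eta_function ::
  "'n::{finite,linorder} self_map set \<Rightarrow> complex \<Rightarrow> complex" where
  "eta_function \<Gamma> = (THE f. f nicely_meromorphic_on UNIV \<and>
      (\<forall>s. Re s > real CARD('n) \<longrightarrow> f s = eta_series \<Gamma> s))"

definition eta_invariant :: "'n::{finite,linorder} self_map set \<Rightarrow> complex" where
  "eta_invariant \<Gamma> = eta_function \<Gamma> 0"


section \<open>The family of manifolds with holonomy group of order \<open>2 ^ r\<close>\<close>

text \<open>Rows and columns of \<open>real mat\<close> are numbered from 0.\<close>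

definition C_block :: "nat \<Rightarrow> real mat" where
  "C_block i = Matrix.mat (2 ^ i) (2 ^ i) (\<lambda>(a, b).
      if a = b + 1 then 1 else if a = 0 \<and> b = 2 ^ i - 1 then - 1 else 0)"

fun J_block :: "nat \<Rightarrow> real mat" where
  "J_block 0 = Matrix.mat 1 1 (\<lambda>_. - 1)"
| "J_block (Suc i) = four_block_mat (0\<^sub>m (2 ^ i) (2 ^ i)) (J_block i)
      (1\<^sub>m (2 ^ i)) (0\<^sub>m (2 ^ i) (2 ^ i))"

definition B_mat :: "nat \<Rightarrow> (nat \<Rightarrow> nat) \<Rightarrow> (nat \<Rightarrow> nat) \<Rightarrow> real mat" where
  "B_mat r k k' = diag_block_mat
      (concat (map (\<lambda>i. replicate (k i) (C_block i) @ replicate (k' i) (J_block i)) (rev [1..<r]))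
       @ [1\<^sub>m 1])"

definition B_dim :: "nat \<Rightarrow> (nat \<Rightarrow> nat) \<Rightarrow> (nat \<Rightarrow> nat) \<Rightarrow> nat" where
  "B_dim r k k' = (\<Sum>i = 1..<r. 2 ^ i * (k i + k' i)) + 1"

lemma J_block_carrier: "J_block i \<in> carrier_mat (2 ^ i) (2 ^ i)"
  by (induction i) auto

lemma B_mat_carrier: "B_mat r k k' \<in> carrier_mat (B_dim r k k') (B_dim r k k')"
proof -
  have C: "C_block i \<in> carrier_mat (2 ^ i) (2 ^ i)" for i
    by (simp add: C_block_def)
  note [simp] = carrier_matD[OF C] carrier_matD[OF J_block_carrier]
  have "sum_list (map f (concat (map g (rev [1..<r])))) = (\<Sum>i = 1..<r. 2 ^ i * (k i + k' i))"
    if "\<And>i. sum_list (map f (g i)) = 2 ^ i * (k i + k' i)"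
    for f :: "real mat \<Rightarrow> nat" and g :: "nat \<Rightarrow> real mat list"
    by (induction r) (auto simp: that)
  then show ?thesis
    by (intro carrier_matI)
       (simp_all add: B_mat_def B_dim_def dim_diag_block_mat sum_list_replicate algebra_simps)
qed

definition mat_transfer :: "real mat \<Rightarrow> 'n::{finite,linorder} sq_matrix" where
  "mat_transfer A = (\<chi> i j. A $$ (card {..<i}, card {..<j}))"

definition translation :: "real ^ 'n \<Rightarrow> 'n self_map" where
  "translation v = (\<lambda>x. x + v)"

definition \<Gamma>_group ::
  "nat \<Rightarrow> (nat \<Rightarrow> nat) \<Rightarrow> (nat \<Rightarrow> nat) \<Rightarrow> 'n::{finite,linorder} self_map set" where
  "\<Gamma>_group r k k' = generate (BijGroup UNIV)
      (insert (\<lambda>x. mat_transfer (B_mat r k k') *v translation (axis (Max UNIV) (1 / 2 ^ r)) x)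
        {translation v | v. \<forall>i. v $ i \<in> \<int>})"

text \<open>
  The members of dimension \<open>CARD('n)\<close>. Only the values of \<open>k\<close> and \<open>k'\<close> at \<open>1, ..., r - 1\<close> matter.
\<close>

definition family_F :: "nat \<Rightarrow> 'n::{finite,linorder} self_map set set" where
  "family_F r = {\<Gamma>_group r k k' | k k'. k' 1 = 0 \<and> k (r - 1) + k' (r - 1) > 0 \<and>
      odd (k 1 + k' 1) \<and> CARD('n) = B_dim r k k'}"

end

(* In dimension n = 4h - 1 the symbol of the APS operator is i times Clifford multiplication c on even
   forms, with c(v)^2 = -|v|^2. Expanding in Fourier series on the torus, the eigenspace for l consists of
   amplitudes on the lattice points mu with 2 pi |mu| = |l| that are invariant under the holonomy
   generator B, twisted by the phase exp(2 pi i mu_n / 2^r). Away from the axis fixed by B the B-orbits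
   have even length, and reflecting alternately in the two coordinates exchanged by B up to sign (they
   exist because j_1 is odd) interchanges the eigenvalues l and -l. So the spectral asymmetry comes from
   the frequencies m e_n, and depends on m modulo 2^r only. It is odd in m, changes sign under
   m -> m + 2^(r-1) because B^2 commutes with such a reflection, and is invariant under m -> 5m because
   B is conjugate to B^5 by a rotation fixing e_n. These three properties determine it up to a constant d: the eta function is
   d (2^(r-1) pi)^(-s) sum_k (-1)^k (2k+1)^(-s), and its value d/2 at s = 0 determines d. *)

theory Submission
  imports Defs
begin

text \<open>Forms are real, so a Fourier mode is a pair of a cosine and a sine amplitude. The
  eigenvalue equation determines the sine amplitude from the cosine one through
  \<open>2 * pi / l\<close> times the symbol, an operator of square -1 on the sphere 2 pi |mu| =
  |l|. It plays the part of the imaginary unit: the twist by a phase becomes a rotation, eigenspaces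
  are described by cosine amplitudes alone, and multiplicities are compared by linear injections of
  finite-dimensional real spaces. Neither traces nor the value of d are computed. The number 5
  enters because on an odd multiple m of 2^j, j < r - 2, a suitable power of 5 adds an odd multiple
  of 2^(r-1) to m, so invariance and sign change force the asymmetry to vanish there. At multiples
  of 2^(r-1) it is, up to sign, the asymmetry at 0. What is left are the odd multiples of 2^(r-2),
  with alternating signs. The eta series is only given in a half-plane, whereas the hypothesis
  concerns s = 0; hence the alternating Dirichlet series is continued explicitly, by Euler
  summation, which also yields its nonzero value at 0.\<close>

no_notation fps_nth (infixl "$" 75)


section \<open>Minors and the exterior algebra\<close>

text \<open>Minors index rows and columns by positions in a sorted list, whereas the signs of the
  exterior derivative count smaller elements; this translates between the two.\<close>

lemma nth_sorted_list_of_set_card: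
  fixes S :: "'a::linorder set"
  assumes "finite S" "x \<in> S"
  shows "sorted_list_of_set S ! card {i \<in> S. i < x} = x"
proof -
  let ?xs = "sorted_list_of_set S"
  obtain p where p: "p < length ?xs" "?xs ! p = x"
    using assms by (metis in_set_conv_nth set_sorted_list_of_set)
  have sd: "sorted_wrt (<) ?xs" by simp
  have "{i \<in> S. i < x} = (!) ?xs ` {..<p}"
  proof (intro equalityI subsetI)
    fix y assume y: "y \<in> {i \<in> S. i < x}"
    then obtain q where q: "q < length ?xs" "?xs ! q = y"
      using assms by (metis (lifting) in_set_conv_nth mem_Collect_eq set_sorted_list_of_set)
    have "q < p"
    proof (rule ccontr)
      assume "\<not> q < p"
      then have "x \<le> y"
        using sorted_nth_mono[of ?xs p q] p q by auto
      then show False using y by auto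
    qed
    then show "y \<in> (!) ?xs ` {..<p}" using q by auto
  next
    fix y assume "y \<in> (!) ?xs ` {..<p}"
    then obtain q where q: "q < p" "y = ?xs ! q" by auto
    then have "y < x" using sorted_wrt_nth_less[OF sd, of q p] p by auto
    moreover have "y \<in> S" using q p assms
      by (metis dual_order.strict_trans nth_mem set_sorted_list_of_set)
    ultimately show "y \<in> {i \<in> S. i < x}" by auto
  qed
  moreover have "inj_on ((!) ?xs) {..<p}"
    using p by (intro inj_on_nth) auto
  ultimately have "card {i \<in> S. i < x} = p"
    by (simp add: card_image)
  then show ?thesis using p by simp
qed

lemma card_less_bound:
  assumes "finite S" "x \<in> (S :: 'a::linorder set)"
  shows "card {i \<in> S. i < x} < card S"
  by (rule psubset_card_mono) (use assms in auto)

text \<open>The case distinction is that of \<open>mat_delete\<close>, so deleting a row or column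
  from the matrix of a minor gives the matrix of the minor for the smaller index set.\<close>

lemma nth_sorted_list_of_set_remove:
  fixes S :: "'a::linorder set"
  assumes "finite S" "x \<in> S" "a < card S - 1"
  shows "sorted_list_of_set (S - {x}) ! a
    = sorted_list_of_set S ! (if a < card {i \<in> S. i < x} then a else Suc a)"
proof -
  let ?p = "card {i \<in> S. i < x}"
  have p: "?p < length (sorted_list_of_set S)" "sorted_list_of_set S ! ?p = x"
    using card_less_bound[OF assms(1,2)] nth_sorted_list_of_set_card[OF assms(1,2)] by auto
  then obtain ys zs where d: "sorted_list_of_set S = ys @ x # zs" and l: "length ys = ?p"
    by (metis id_take_nth_drop length_take min.absorb4)
  have sw: "sorted_wrt (<) (ys @ x # zs)"
    unfolding d[symmetric] by simp
  have "set (ys @ x # zs) = S"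
    unfolding d[symmetric] using assms by simp
  then have "set (ys @ zs) = S - {x}"
    using sw by (auto simp: sorted_wrt_append)
  moreover have "sorted_wrt (<) (ys @ zs)"
    using sw by (auto simp: sorted_wrt_append)
  then have "sorted_list_of_set (set (ys @ zs)) = ys @ zs"
    by (intro sorted_list_of_set.idem_if_sorted_distinct) (simp_all add: strict_sorted_iff)
  ultimately have "sorted_list_of_set (S - {x}) = ys @ zs" by simp
  then show ?thesis unfolding d l[symmetric] by (simp add: nth_append)
qed

lemma sum_sorted_list_of_set:
  fixes J :: "'a::linorder set"
  assumes "finite J"
  shows "(\<Sum>q<card J. f q (sorted_list_of_set J ! q)) = (\<Sum>k\<in>J. f (card {i \<in> J. i < k}) k)"
proof -
  have "bij_betw (\<lambda>k. card {i \<in> J. i < k}) J {..<card J}"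
  proof (rule bij_betwI[where g = "\<lambda>q. sorted_list_of_set J ! q"])
    show "(\<lambda>k. card {i \<in> J. i < k}) \<in> J \<rightarrow> {..<card J}"
      using card_less_bound[OF assms] by auto
    show "(\<lambda>q. sorted_list_of_set J ! q) \<in> {..<card J} \<rightarrow> J"
      using assms by (metis (mono_tags, lifting) Pi_I lessThan_iff nth_mem
          set_sorted_list_of_set sorted_list_of_set.length_sorted_key_list_of_set)
    show "sorted_list_of_set J ! card {i \<in> J. i < x} = x" if "x \<in> J" for x
      using nth_sorted_list_of_set_card[OF assms that] .
    show "card {i \<in> J. i < sorted_list_of_set J ! y} = y" if "y \<in> {..<card J}" for y
    proof -
      have "sorted_list_of_set J ! y \<in> J"
        using assms that by (metis lessThan_iff nth_mem set_sorted_list_of_set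
            sorted_list_of_set.length_sorted_key_list_of_set)
      from nth_sorted_list_of_set_card[OF assms this] card_less_bound[OF assms this] that
      show ?thesis
        by (metis lessThan_iff nth_eq_iff_index_eq sorted_list_of_set.distinct_sorted_key_list_of_set
            sorted_list_of_set.length_sorted_key_list_of_set)
    qed
  qed
  then show ?thesis
    by (subst sum.reindex_bij_betw[symmetric, of _ J])
      (auto intro!: sum.cong simp: nth_sorted_list_of_set_card[OF assms])
qed

text \<open>Laplace expansion along row \<open>j\<close>. If \<open>j \<in> I\<close>, the sum is
  the determinant of a matrix in which row \<open>j\<close> occurs twice, hence 0; otherwise it
  expands \<open>minor A (insert j I) J\<close>, and the place of \<open>j\<close> among the sorted
  rows gives the sign. In coordinates this is the compatibility of pullback with the product by
  \<open>dx_j\<close>.\<close>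

lemma minor_laplace:
  fixes A :: "'n::{finite,linorder} sq_matrix"
  assumes "card J = Suc (card I)"
  shows "(\<Sum>k\<in>J. (-1) ^ card {i \<in> J. i < k} * A $ j $ k * minor A I (J - {k}))
    = (if j \<in> I then 0 else (-1) ^ card {i \<in> I. i < j} * minor A (insert j I) J)"
proof -
  let ?c = "\<lambda>S::'n set. sorted_list_of_set S"
  let ?N = "card J"
  have fin: "finite S" for S :: "'n set" by simp
  have col: "?c (J - {?c J ! q}) ! b = ?c J ! (if b < q then b else Suc b)"
    if "q < ?N" "b < card I" for q b
  proof -
    have 1: "?c J ! q \<in> J"
      using that by (metis fin nth_mem set_sorted_list_of_set
          sorted_list_of_set.length_sorted_key_list_of_set)
    then have "card {i \<in> J. i < ?c J ! q} = q"
      using nth_sorted_list_of_set_card[OF fin 1] card_less_bound[OF fin 1] that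
      by (metis nth_eq_iff_index_eq sorted_list_of_set.distinct_sorted_key_list_of_set
            sorted_list_of_set.length_sorted_key_list_of_set)
    then show ?thesis
      using nth_sorted_list_of_set_remove[OF fin 1, of b] that assms by auto
  qed
  have mem: "?c J ! q \<in> J" if "q < ?N" for q
    using that by (metis fin nth_mem set_sorted_list_of_set
          sorted_list_of_set.length_sorted_key_list_of_set)
  have LHS: "(\<Sum>k\<in>J. (-1) ^ card {i \<in> J. i < k} * A $ j $ k * minor A I (J - {k}))
    = (\<Sum>q<?N. (-1) ^ q * A $ j $ (?c J ! q) * minor A I (J - {?c J ! q}))"
    by (rule sum_sorted_list_of_set[OF fin, symmetric])
  show ?thesis
  proof (cases "j \<in> I")
    case True
    define M where "M = Matrix.mat ?N ?N (\<lambda>(a, b). A $ ((j # ?c I) ! a) $ (?c J ! b))"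
    have M: "M \<in> carrier_mat ?N ?N" by (simp add: M_def)
    let ?p = "card {i \<in> I. i < j}"
    have p: "?p < card I" "?c I ! ?p = j"
      using card_less_bound[OF fin True] nth_sorted_list_of_set_card[OF fin True] by auto
    have "Determinant.det M = 0"
    proof (rule det_identical_rows[OF M, of 0 "Suc ?p"])
      show "Matrix.row M 0 = Matrix.row M (Suc ?p)"
        using p assms by (intro eq_vecI) (auto simp: M_def)
    qed (use p assms in auto)
    moreover have "Determinant.det M = (\<Sum>q<?N. M $$ (0, q) * cofactor M 0 q)"
      by (rule laplace_expansion_row[OF M]) (use assms in auto)
    moreover have "M $$ (0, q) * cofactor M 0 q
        = (-1) ^ q * A $ j $ (?c J ! q) * minor A I (J - {?c J ! q})" if "q < ?N" for q
    proof -
      have "mat_delete M 0 q = Matrix.mat (card I) (card (J - {?c J ! q}))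
         (\<lambda>(a, b). A $ (?c I ! a) $ (?c (J - {?c J ! q}) ! b))"
        using that assms mem[OF that] col[OF that]
        by (intro eq_matI) (auto simp: mat_delete_def M_def)
      then show ?thesis
        using that assms by (simp add: cofactor_def minor_def M_def)
    qed
    ultimately show ?thesis using LHS True by simp
  next
    case False
    let ?I = "insert j I"
    let ?p = "card {i \<in> ?I. i < j}"
    have cI: "card ?I = ?N" using False assms by simp
    have peq: "?p = card {i \<in> I. i < j}" by (rule arg_cong[of _ _ card]) auto
    have jI: "j \<in> ?I" by simp
    have p: "?p < ?N" "?c ?I ! ?p = j"
      using card_less_bound[OF fin jI] nth_sorted_list_of_set_card[OF fin jI] cI by auto
    define M where "M = Matrix.mat ?N ?N (\<lambda>(a, b). A $ (?c ?I ! a) $ (?c J ! b))"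
    have M: "M \<in> carrier_mat ?N ?N" by (simp add: M_def)
    have "minor A ?I J = Determinant.det M"
      unfolding minor_def M_def cI ..
    also have "Determinant.det M = (\<Sum>q<?N. M $$ (?p, q) * cofactor M ?p q)"
      by (rule laplace_expansion_row[OF M p(1)])
    also have "\<dots> = (\<Sum>q<?N. (-1) ^ ?p * ((-1) ^ q * A $ j $ (?c J ! q) * minor A I (J - {?c J ! q})))"
    proof (rule sum.cong[OF refl])
      fix q assume "q \<in> {..<?N}"
      then have q: "q < ?N" by simp
      have "?I - {j} = I" using False by auto
      then have row: "?c I ! a = ?c ?I ! (if a < ?p then a else Suc a)" if "a < card I" for a
        using nth_sorted_list_of_set_remove[OF fin jI, of a] that cI assms by simp
      have "mat_delete M ?p q = Matrix.mat (card I) (card (J - {?c J ! q}))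
         (\<lambda>(a, b). A $ (?c I ! a) $ (?c (J - {?c J ! q}) ! b))"
        using assms mem[OF q] col[OF q] row q
        by (intro eq_matI) (auto simp: mat_delete_def M_def)
      then have "cofactor M ?p q = (-1) ^ (?p + q) * minor A I (J - {?c J ! q})"
        by (simp add: cofactor_def minor_def)
      moreover have "M $$ (?p, q) = A $ j $ (?c J ! q)"
        using q p by (simp add: M_def)
      ultimately show "M $$ (?p, q) * cofactor M ?p q
         = (-1) ^ ?p * ((-1) ^ q * A $ j $ (?c J ! q) * minor A I (J - {?c J ! q}))"
        by (simp add: power_add)
    qed
    also have "\<dots> = (-1) ^ ?p * (\<Sum>k\<in>J. (-1) ^ card {i \<in> J. i < k} * A $ j $ k * minor A I (J - {k}))"
      unfolding LHS by (simp add: sum_distrib_left)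
    finally have "(-1) ^ ?p * minor A ?I J
        = (-1) ^ ?p * ((-1) ^ ?p * (\<Sum>k\<in>J. (-1) ^ card {i \<in> J. i < k} * A $ j $ k * minor A I (J - {k})))"
      by simp
    then have "(-1) ^ ?p * minor A ?I J
        = (\<Sum>k\<in>J. (-1) ^ card {i \<in> J. i < k} * A $ j $ k * minor A I (J - {k}))"
      by (simp flip: mult.assoc power_add)
    then show ?thesis using False peq by simp
  qed
qed

lemma minor_transpose:
  assumes "card I = card J"
  shows "minor (transpose A) I J = minor A J I"
proof -
  have "Determinant.det (Matrix.mat (card J) (card I)
      (\<lambda>(a, b). A $ (sorted_list_of_set J ! a) $ (sorted_list_of_set I ! b)))
    = Determinant.det (transpose_mat (Matrix.mat (card J) (card I)
      (\<lambda>(a, b). A $ (sorted_list_of_set J ! a) $ (sorted_list_of_set I ! b))))"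
    using assms by (subst det_transpose) auto
  also have "transpose_mat (Matrix.mat (card J) (card I)
      (\<lambda>(a, b). A $ (sorted_list_of_set J ! a) $ (sorted_list_of_set I ! b)))
     = Matrix.mat (card I) (card J)
      (\<lambda>(a, b). transpose A $ (sorted_list_of_set I ! a) $ (sorted_list_of_set J ! b))"
    by (intro eq_matI) (auto simp: Finite_Cartesian_Product.transpose_def)
  finally show ?thesis by (simp add: minor_def)
qed

section \<open>The exterior algebra over one point and its functoriality\<close>

type_synonym 'n ext = "'n set \<Rightarrow> real"

definition ext_mult :: "'n::{finite,linorder} \<Rightarrow> 'n ext \<Rightarrow> 'n ext" where
  "ext_mult j w = (\<lambda>J. if j \<in> J then (-1) ^ card {i \<in> J. i < j} * w (J - {j}) else 0)"

definition contract :: "'n::{finite,linorder} \<Rightarrow> 'n ext \<Rightarrow> 'n ext" where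
  "contract j w = (\<lambda>J. if j \<notin> J then (-1) ^ card {i \<in> J. i < j} * w (insert j J) else 0)"

definition star_sign :: "'n::{finite,linorder} set \<Rightarrow> real" where
  "star_sign J = (-1) ^ card {(i, j). i \<in> - J \<and> j \<in> J \<and> j < i}"

definition star :: "'n::{finite,linorder} ext \<Rightarrow> 'n ext" where
  "star w = (\<lambda>J. star_sign J * w (- J))"

text \<open>The fibre of \<open>pullback\<close>, with \<open>A\<close> as Jacobian. Since only
  affine maps occur, all the algebra can be done on one fibre; likewise \<open>star\<close> is the
  fibre of \<open>hodge\<close>, and \<open>ext_mult j\<close> is what \<open>ext_d\<close> applies
  to the \<open>j\<close>-th partial derivative.\<close>

definition pull :: "'n::{finite,linorder} sq_matrix \<Rightarrow> 'n ext \<Rightarrow> 'n ext" where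
  "pull A w = (\<lambda>J. \<Sum>I | card I = card J. w I * minor A I J)"

definition delta :: "'a \<Rightarrow> 'a \<Rightarrow> real" where
  "delta I = (\<lambda>J. if J = I then 1 else 0)"

definition even_vec :: "'n ext \<Rightarrow> bool" where
  "even_vec w \<longleftrightarrow> (\<forall>I. odd (card I) \<longrightarrow> w I = 0)"

text \<open>Each \<open>delta I\<close> arises from \<open>delta {}\<close> by successive products
  with \<open>dx_j\<close>, up to sign, and these span. An identity between linear operators thereby
  reduces to the way in which they commute with \<open>ext_mult\<close>.\<close>

lemma ext_induct:
  fixes P :: "'n::{finite,linorder} ext \<Rightarrow> bool"
  assumes zero: "P (\<lambda>_. 0)"
    and add: "\<And>v w. P v \<Longrightarrow> P w \<Longrightarrow> P (\<lambda>I. v I + w I)"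
    and scale: "\<And>c w. P w \<Longrightarrow> P (\<lambda>I. c * w I)"
    and unit: "P (delta {})"
    and mult: "\<And>j w. P w \<Longrightarrow> P (ext_mult j w)"
  shows "P w"
proof -
  have d: "P (delta I)" for I :: "'n set"
  proof (induction I rule: finite_induct[OF finite])
    case 1 show ?case by (rule unit)
  next
    case (2 j I)
    let ?e = "(-1) ^ card {i \<in> insert j I. i < j} :: real"
    have "delta (insert j I) = (\<lambda>J. ?e * ext_mult j (delta I) J)"
    proof
      fix J show "delta (insert j I) J = ?e * ext_mult j (delta I) J"
      proof (cases "J = insert j I")
        case True
        then have "J - {j} = I" using 2 by auto
        then show ?thesis using True
          by (simp add: delta_def ext_mult_def flip: power_add mult_2)
      next
        case False
        then have "j \<in> J \<Longrightarrow> J - {j} \<noteq> I" by auto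
        then show ?thesis using False by (auto simp: delta_def ext_mult_def)
      qed
    qed
    then show ?case using scale[OF mult[OF 2(3)]] by metis
  qed
  have "P (\<lambda>J. \<Sum>I\<in>S. w I * delta I J)" for S :: "'n set set"
    by (induction S rule: finite_induct[OF finite]) (auto intro!: zero add scale d)
  from this[of UNIV] show ?thesis
    by (simp add: delta_def if_distrib cong: if_cong)
qed

lemma pull_sum: "pull A (\<lambda>I. \<Sum>k\<in>S. a k * f k I) J = (\<Sum>k\<in>S. a k * pull A (f k) J)"
  unfolding pull_def
  by (subst sum_distrib_left, subst sum.swap) (simp add: sum_distrib_left sum_distrib_right mult_ac)

lemma pull_add: "pull A (\<lambda>I. v I + w I) J = pull A v J + pull A w J"
  by (simp add: pull_def sum.distrib distrib_right)

lemma pull_diff: "pull A (\<lambda>I. v I - w I) J = pull A v J - pull A w J"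
  by (simp add: pull_def sum_subtractf left_diff_distrib)

lemma pull_scale: "pull A (\<lambda>I. c * w I) J = c * pull A w J"
  by (simp add: pull_def sum_distrib_left mult_ac)

lemma pull_zero: "pull A (\<lambda>_. 0) J = 0"
  by (simp add: pull_def)

text \<open>Pullback preserves the degree, so signs that depend on the degree alone pass through
  it.\<close>

lemma pull_degree: "pull A (\<lambda>I. g (card I) * w I) J = g (card J) * pull A w J"
  unfolding pull_def sum_distrib_left by (rule sum.cong) (auto simp: mult_ac)

lemma ext_mult_sum: "ext_mult j (\<lambda>I. \<Sum>k\<in>S. a k * f k I) J = (\<Sum>k\<in>S. a k * ext_mult j (f k) J)"
  by (simp add: ext_mult_def sum_distrib_left mult.left_commute)

lemma contract_scale: "contract j (\<lambda>I. c * f I) J = c * contract j f J"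
  by (simp add: contract_def mult_ac)

lemma star_sum: "star (\<lambda>I. \<Sum>k\<in>S. a k * f k I) J = (\<Sum>k\<in>S. a k * star (f k) J)"
  by (simp add: star_def sum_distrib_left mult_ac)

text \<open>Pullback is multiplicative and sends \<open>dx_j\<close> to the combination of the
  \<open>dx_k\<close> given by row \<open>j\<close> of \<open>A\<close>. On coefficients this is the
  Laplace expansion of minors.\<close>

lemma pull_ext_mult:
  fixes A :: "'n::{finite,linorder} sq_matrix"
  shows "pull A (ext_mult j w) J = (\<Sum>k\<in>UNIV. A $ j $ k * ext_mult k (pull A w) J)"
proof (cases "card J")
  case 0
  then have "J = {}" by simp
  moreover have "I = {}" if "card I = 0" for I :: "'n set" using that by simp
  ultimately show ?thesis by (simp add: pull_def ext_mult_def)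
next
  case (Suc m)
  have "pull A (ext_mult j w) J
      = (\<Sum>I | card I = Suc m \<and> j \<in> I. (-1) ^ card {i \<in> I. i < j} * w (I - {j}) * minor A I J)"
    unfolding pull_def ext_mult_def Suc by (rule sum.mono_neutral_cong_right) auto
  also have "\<dots> = (\<Sum>I | card I = m \<and> j \<notin> I. (-1) ^ card {i \<in> I. i < j} * w I * minor A (insert j I) J)"
  proof (rule sum.reindex_bij_witness[where i = "insert j" and j = "\<lambda>I. I - {j}"])
    fix I assume "I \<in> {I. card I = Suc m \<and> j \<in> I}"
    then show "(-1) ^ card {i \<in> I - {j}. i < j} * w (I - {j}) * minor A (insert j (I - {j})) J =
         (-1) ^ card {i \<in> I. i < j} * w (I - {j}) * minor A I J"
      by (auto simp: insert_absorb intro!: arg_cong[of _ _ "\<lambda>S. (-1) ^ card S"])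
  qed (auto simp: insert_absorb)
  also have "\<dots> = (\<Sum>I | card I = m. w I *
      (if j \<in> I then 0 else (-1) ^ card {i \<in> I. i < j} * minor A (insert j I) J))"
    by (rule sum.mono_neutral_cong_left) auto
  also have "\<dots> = (\<Sum>I | card I = m. w I *
      (\<Sum>k\<in>J. (-1) ^ card {i \<in> J. i < k} * A $ j $ k * minor A I (J - {k})))"
    by (rule sum.cong) (auto simp: minor_laplace Suc)
  also have "\<dots> = (\<Sum>k\<in>J. A $ j $ k * ((-1) ^ card {i \<in> J. i < k} *
      (\<Sum>I | card I = m. w I * minor A I (J - {k}))))"
    unfolding sum_distrib_left by (subst sum.swap) (simp add: mult_ac)
  also have "\<dots> = (\<Sum>k\<in>J. A $ j $ k * ext_mult k (pull A w) J)"
    by (rule sum.cong) (auto simp: ext_mult_def pull_def Suc)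
  also have "\<dots> = (\<Sum>k\<in>UNIV. A $ j $ k * ext_mult k (pull A w) J)"
    by (rule sum.mono_neutral_left) (auto simp: ext_mult_def)
  finally show ?thesis .
qed

lemma minor_empty: "minor A {} {} = 1"
  by (simp add: minor_def det_def)

lemma pull_unit: "pull A (delta {}) = delta {}"
proof
  fix J show "pull A (delta {}) J = delta {} J"
  proof (cases "J = {}")
    case True
    then have "pull A (delta {}) J = (\<Sum>I\<in>{{}}. delta {} I * minor A I J)"
      unfolding pull_def by (intro sum.cong) auto
    then show ?thesis using True by (simp add: minor_empty delta_def)
  next
    case False
    then have "card J \<noteq> 0" by simp
    then have "I \<noteq> {}" if "card I = card J" for I :: "'a set" using that by auto
    then show ?thesis using False by (auto simp: pull_def delta_def intro!: sum.neutral)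
  qed
qed

text \<open>The Cauchy-Binet formula, obtained without determinants: both sides commute with
  \<open>ext_mult\<close> in the same way.\<close>

lemma pull_pull: "pull B (pull A w) = pull (A ** B) w"
proof (induction w rule: ext_induct)
  case (5 j w)
  show ?case
  proof
    fix J
    have "pull B (pull A (ext_mult j w)) J
        = (\<Sum>k\<in>UNIV. A $ j $ k * pull B (ext_mult k (pull A w)) J)"
      by (simp add: pull_ext_mult[abs_def] pull_sum)
    also have "\<dots> = (\<Sum>m\<in>UNIV. (A ** B) $ j $ m * ext_mult m (pull (A ** B) w) J)"
      unfolding pull_ext_mult 5 matrix_matrix_mult_def sum_distrib_left
      by (subst sum.swap) (simp add: sum_distrib_right sum_distrib_left mult_ac)
    finally show "pull B (pull A (ext_mult j w)) J = pull (A ** B) (ext_mult j w) J"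
      by (simp add: pull_ext_mult)
  qed
qed (auto simp: pull_add pull_scale pull_zero pull_unit fun_eq_iff)

abbreviation idm :: "'n::finite sq_matrix" where
  "idm \<equiv> Finite_Cartesian_Product.mat 1"

lemma pull_mat_1: "pull idm w = w"
proof (induction w rule: ext_induct)
  case (5 j w)
  have "pull idm (ext_mult j w) J = ext_mult j w J" for J
    unfolding pull_ext_mult 5
    by (simp add: Finite_Cartesian_Product.mat_def if_distrib[of "\<lambda>x. x * _"] cong: if_cong)
  then show ?case ..
qed (auto simp: pull_add pull_scale pull_zero pull_unit fun_eq_iff)

lemma even_vec_pull: "even_vec w \<Longrightarrow> even_vec (pull A w)"
  by (auto simp: even_vec_def pull_def intro!: sum.neutral)

section \<open>Adjoints, and interior products under pullback\<close>

lemma pull_adjoint: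
  fixes A :: "'n::{finite,linorder} sq_matrix"
  shows "(\<Sum>J\<in>UNIV. pull A w J * v J) = (\<Sum>I\<in>UNIV. w I * pull (transpose A) v I)"
proof -
  have "(\<Sum>J\<in>UNIV. pull A w J * v J)
      = (\<Sum>J\<in>UNIV. \<Sum>I\<in>UNIV. if card I = card J then w I * minor A I J * v J else 0)"
    by (simp add: pull_def sum_distrib_right sum.If_cases)
  also have "\<dots> = (\<Sum>I\<in>UNIV. \<Sum>J\<in>UNIV. if card I = card J then w I * minor A I J * v J else 0)"
    by (rule sum.swap)
  also have "\<dots> = (\<Sum>I\<in>UNIV. \<Sum>J\<in>UNIV. if card J = card I then w I * (v J * minor (transpose A) J I) else 0)"
    by (intro sum.cong refl) (auto simp: minor_transpose)
  also have "\<dots> = (\<Sum>I\<in>UNIV. w I * pull (transpose A) v I)"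
    by (simp add: pull_def sum_distrib_left sum.If_cases)
  finally show ?thesis .
qed

lemma ext_mult_adjoint:
  "(\<Sum>J\<in>UNIV. ext_mult j w J * v J) = (\<Sum>J\<in>UNIV. w J * contract j v J)"
proof -
  have "(\<Sum>J\<in>UNIV. ext_mult j w J * v J)
      = (\<Sum>J | j \<in> J. (-1) ^ card {i \<in> J. i < j} * w (J - {j}) * v J)"
    by (rule sum.mono_neutral_cong_right) (auto simp: ext_mult_def)
  also have "\<dots> = (\<Sum>J | j \<notin> J. w J * ((-1) ^ card {i \<in> J. i < j} * v (insert j J)))"
  proof (rule sum.reindex_bij_witness[where i = "insert j" and j = "\<lambda>I. I - {j}"])
    fix I assume "I \<in> {I. j \<in> I}"
    moreover have "{i \<in> I - {j}. i < j} = {i \<in> I. i < j}" by auto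
    ultimately show "w (I - {j}) * ((-1) ^ card {i \<in> I - {j}. i < j} * v (insert j (I - {j}))) =
         (-1) ^ card {i \<in> I. i < j} * w (I - {j}) * v I"
      by (simp add: insert_absorb)
  qed (auto simp: insert_absorb)
  also have "\<dots> = (\<Sum>J\<in>UNIV. w J * contract j v J)"
    by (rule sum.mono_neutral_cong_left) (auto simp: contract_def)
  finally show ?thesis .
qed

lemma ext_mult_scale: "ext_mult j (\<lambda>I. c * f I) J = c * ext_mult j f J"
  by (simp add: ext_mult_def mult_ac)

lemma sum_times_delta: "(\<Sum>I\<in>UNIV. w I * delta J I) = (w J :: real)" for J :: "'a::finite"
  by (simp add: delta_def if_distrib[of "\<lambda>x. _ * x"] cong: if_cong)

text \<open>The adjoint of \<open>pull_ext_mult\<close>: both operators are moved to the test vector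
  \<open>delta J\<close>, where the product rule applies, and back again.\<close>

lemma contract_pull:
  "contract k (pull A w) J = (\<Sum>j\<in>UNIV. A $ j $ k * pull A (contract j w) J)"
proof -
  have "contract k (pull A w) J = (\<Sum>I\<in>UNIV. delta J I * contract k (pull A w) I)"
    using sum_times_delta[of "contract k (pull A w)" J] by (simp add: mult.commute)
  also have "\<dots> = (\<Sum>I\<in>UNIV. pull A w I * ext_mult k (delta J) I)"
    by (subst ext_mult_adjoint[symmetric]) (simp add: mult.commute)
  also have "\<dots> = (\<Sum>I\<in>UNIV. w I * (\<Sum>j\<in>UNIV. A $ j $ k * ext_mult j (pull (transpose A) (delta J)) I))"
    by (simp add: pull_adjoint pull_ext_mult Finite_Cartesian_Product.transpose_def)
  also have "\<dots> = (\<Sum>j\<in>UNIV. A $ j $ k * (\<Sum>I\<in>UNIV. ext_mult j (pull (transpose A) (delta J)) I * w I))"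
    unfolding sum_distrib_left by (subst sum.swap) (simp add: mult_ac)
  also have "\<dots> = (\<Sum>j\<in>UNIV. A $ j $ k * (\<Sum>I\<in>UNIV. pull A (contract j w) I * delta J I))"
    by (subst ext_mult_adjoint, subst pull_adjoint) (simp add: mult.commute)
  finally show ?thesis by (simp add: sum_times_delta)
qed

text \<open>For orthogonal \<open>A\<close> the coefficients in \<open>contract_pull\<close> can be
  inverted. Interior products then transform with the same coefficients as exterior ones, which is
  what the star operator requires.\<close>

lemma pull_contract:
  assumes "A ** transpose A = idm"
  shows "pull A (contract m w) J = (\<Sum>k\<in>UNIV. A $ m $ k * contract k (pull A w) J)"
proof -
  have "(\<Sum>k\<in>UNIV. A $ m $ k * contract k (pull A w) J)
      = (\<Sum>j\<in>UNIV. (A ** transpose A) $ m $ j * pull A (contract j w) J)"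
    unfolding contract_pull sum_distrib_left matrix_matrix_mult_def
    by (subst sum.swap) (simp add: sum_distrib_left sum_distrib_right Finite_Cartesian_Product.transpose_def mult_ac)
  also have "\<dots> = pull A (contract m w) J"
    unfolding assms
    by (simp add: Finite_Cartesian_Product.mat_def if_distrib[of "\<lambda>x. x * _"] cong: if_cong)
  finally show ?thesis ..
qed

section \<open>The star operator under pullback\<close>

lemma star_sign_insert:
  assumes "j \<notin> J"
  shows "star_sign (insert j J)
    = star_sign J * (-1) ^ card {i \<in> J. i < j} * (-1) ^ card {i \<in> - J. j < i}"
proof -
  let ?inv = "\<lambda>J. {(i, m). i \<in> - J \<and> m \<in> J \<and> m < i}"
  let ?X = "{(i, m). i \<in> - J \<and> i \<noteq> j \<and> m \<in> J \<and> m < i}"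
  \<comment> \<open>Moving \<open>j\<close> into \<open>J\<close> creates one inversion for each
    element of the complement above \<open>j\<close> and destroys one for each element of
    \<open>J\<close> below \<open>j\<close>; all the others form \<open>?X\<close>.\<close>
  have 1: "?inv (insert j J) = ?X \<union> (\<lambda>i. (i, j)) ` {i \<in> - J. j < i}"
    using assms by auto
  have 2: "?inv J = ?X \<union> Pair j ` {i \<in> J. i < j}"
    using assms by auto
  have f: "finite S" for S :: "('a \<times> 'a) set" by simp
  have c1: "card (?inv (insert j J)) = card ?X + card {i \<in> - J. j < i}"
    unfolding 1 by (subst card_Un_disjoint) (use assms in \<open>auto simp: card_image inj_on_def\<close>)
  have c2: "card (?inv J) = card ?X + card {i \<in> J. i < j}"
    unfolding 2 by (subst card_Un_disjoint) (use assms in \<open>auto simp: card_image inj_on_def\<close>)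
  show ?thesis
    unfolding star_sign_def c1 c2 by (simp add: power_add flip: power_mult_distrib)
qed

lemma card_split_at:
  fixes S :: "'n::{finite,linorder} set"
  shows "card {i \<in> S. i < j} + card {i \<in> S. j < i} = card (S - {j})"
proof -
  have "S - {j} = {i \<in> S. i < j} \<union> {i \<in> S. j < i}" by auto
  moreover have "{i \<in> S. i < j} \<inter> {i \<in> S. j < i} = {}" by auto
  ultimately show ?thesis by (metis card_Un_disjoint finite)
qed

lemma card_Compl: "card (- J) = CARD('n) - card J" for J :: "'n::finite set"
  by (simp add: Compl_eq_Diff_UNIV card_Diff_subset)

lemma card_le_CARD: "card J \<le> CARD('n)" for J :: "'n::finite set"
  by (simp add: card_mono)

text \<open>The star operator turns exterior products into interior ones. The sign depends on the
  degree only, so \<open>pull_degree\<close> moves it through pullbacks.\<close>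

lemma star_ext_mult:
  fixes w :: "'n::{finite,linorder} ext"
  shows "star (ext_mult j w) J = (-1) ^ (CARD('n) - 1 + card J) * contract j (star w) J"
proof (cases "j \<in> J")
  case True
  then show ?thesis by (simp add: star_def ext_mult_def contract_def)
next
  case False
  have "card (- J - {j}) = CARD('n) - card J - 1"
    using False by (simp add: card_Compl)
  then have c: "card {i \<in> - J. i < j} + card {i \<in> - J. j < i} = CARD('n) - card J - 1"
    using card_split_at[of "- J" j] by simp
  have le: "card J < CARD('n)"
    using False by (metis UNIV_I card_mono card_subset_eq finite le_neq_implies_less subset_UNIV)
  then have "CARD('n) - 1 + card J = card {i \<in> - J. i < j} + card {i \<in> - J. j < i} + 2 * card J"
    using c by simp
  then have s: "(-1) ^ (CARD('n) - 1 + card J)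
      = ((-1) ^ card {i \<in> - J. i < j} * (-1) ^ card {i \<in> - J. j < i} :: real)"
    by (simp add: power_add power_mult)
  have "- insert j J = - J - {j}" by auto
  then show ?thesis
    using False unfolding star_def contract_def ext_mult_def s
    by (simp add: star_sign_insert flip: power_add mult_2) (simp add: power_add)
qed

text \<open>The star of 1 is the volume form, which pulls back with the determinant.\<close>

lemma pull_star_unit:
  "pull A (star (delta {})) J = minor A UNIV UNIV * star (pull A (delta {})) J"
proof -
  have s: "star (delta {}) = delta UNIV"
    by (auto simp: star_def delta_def star_sign_def fun_eq_iff)
  have "pull A (delta UNIV) J = minor A UNIV UNIV * delta UNIV J"
  proof (cases "J = UNIV")
    case True
    then show ?thesis
      by (simp add: pull_def delta_def if_distrib[of "\<lambda>x. x * _"] cong: if_cong)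
  next
    case False
    then have "card J \<noteq> card (UNIV :: 'a set)" by (metis card_eq_UNIV_imp_eq_UNIV finite)
    then have "delta UNIV I = 0" if "card I = card J" for I :: "'a set"
      using that by (auto simp: delta_def)
    then show ?thesis using False by (auto simp: pull_def intro!: sum.neutral)
  qed
  then show ?thesis by (simp add: s pull_unit)
qed

text \<open>Induction over exterior products: the star makes them interior products, which an
  orthogonal matrix transforms with the same coefficients. The determinant therefore comes from the
  volume form alone.\<close>

lemma pull_star:
  fixes A :: "'n::{finite,linorder} sq_matrix"
  assumes "A ** transpose A = idm"
  shows "pull A (star w) J = minor A UNIV UNIV * star (pull A w) J"
proof (induction w arbitrary: J rule: ext_induct)
  case 1 show ?case by (simp add: star_def pull_def)
next
  case (2 v w)
  have "star (\<lambda>I. v I + w I) = (\<lambda>J. star v J + star w J)" for v w :: "'n ext"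
    by (simp add: star_def distrib_left fun_eq_iff)
  then show ?case using 2 by (simp add: pull_add[abs_def] distrib_left)
next
  case (3 c w)
  have "star (\<lambda>I. c * w I) = (\<lambda>J. c * star w J)" for w :: "'n ext"
    by (simp add: star_def fun_eq_iff)
  then show ?case using 3 by (simp add: pull_scale[abs_def])
next
  case 4 show ?case by (rule pull_star_unit)
next
  case (5 j w)
  let ?g = "\<lambda>n. (-1) ^ (CARD('n) - 1 + n) :: real"
  have "pull A (star (ext_mult j w)) J = ?g (card J) * pull A (contract j (star w)) J"
    unfolding star_ext_mult[abs_def] by (rule pull_degree)
  also have "\<dots> = (\<Sum>k\<in>UNIV. A $ j $ k * (?g (card J) * contract k (pull A (star w)) J))"
    by (simp add: pull_contract[OF assms] sum_distrib_left mult_ac)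
  also have "pull A (star w) = (\<lambda>J. minor A UNIV UNIV * star (pull A w) J)"
    using 5 by blast
  also have "(\<Sum>k\<in>UNIV. A $ j $ k * (?g (card J) * contract k (\<lambda>J. minor A UNIV UNIV * star (pull A w) J) J))
     = minor A UNIV UNIV * (\<Sum>k\<in>UNIV. A $ j $ k * star (ext_mult k (pull A w)) J)"
    by (simp add: contract_scale star_ext_mult sum_distrib_left mult_ac)
  also have "\<dots> = minor A UNIV UNIV * star (pull A (ext_mult j w)) J"
    by (simp add: pull_ext_mult[abs_def] star_sum)
  finally show ?case .
qed

section \<open>The APS operator as Clifford multiplication\<close>

definition degree_vec :: "nat \<Rightarrow> 'n ext \<Rightarrow> 'n ext" where
  "degree_vec q w = (\<lambda>I. if card I = q then w I else 0)"

text \<open>The value of the APS operator at \<open>w dx_j\<close>, that is, minus \<open>i\<close> times its symbol.\<close>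

definition cliff :: "'n::{finite,linorder} \<Rightarrow> 'n ext \<Rightarrow> 'n ext" where
  "cliff j w = (\<lambda>J. \<Sum>p\<le>CARD('n) div 2. (-1) ^ ((CARD('n) + 1) div 4 + p - 1) *
      (star (ext_mult j (degree_vec (2 * p) w)) J - ext_mult j (star (degree_vec (2 * p) w)) J))"

lemma pull_degree_vec: "pull A (degree_vec q w) = degree_vec q (pull A w)"
proof
  fix J
  let ?g = "\<lambda>c. if c = q then 1 else 0 :: real"
  have d: "degree_vec q w = (\<lambda>I. ?g (card I) * w I)" for w :: "'a ext"
    by (auto simp: degree_vec_def)
  show "pull A (degree_vec q w) J = degree_vec q (pull A w) J"
    unfolding d by (rule pull_degree[of A ?g w J])
qed

text \<open>Each of the two terms of \<open>cliff\<close> contains the star once, hence a single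
  factor \<open>minor A UNIV UNIV\<close>. For orientation-reversing isometries it is -1; this is
  the sign that exchanges \<open>l\<close> and \<open>- l\<close>.\<close>

lemma pull_cliff:
  fixes A :: "'n::{finite,linorder} sq_matrix"
  assumes "A ** transpose A = idm"
  shows "pull A (cliff j w) J
    = minor A UNIV UNIV * (\<Sum>k\<in>UNIV. A $ j $ k * cliff k (pull A w) J)"
proof -
  let ?s = "\<lambda>p. (-1) ^ ((CARD('n) + 1) div 4 + p - 1) :: real"
  let ?w = "\<lambda>p. degree_vec (2 * p) (pull A w)"
  let ?d = "minor A UNIV UNIV"
  have 1: "pull A (star (ext_mult j (degree_vec q w))) J
      = ?d * (\<Sum>k\<in>UNIV. A $ j $ k * star (ext_mult k (degree_vec q (pull A w))) J)" for q
    by (simp add: pull_star[OF assms] pull_ext_mult[abs_def] star_sum pull_degree_vec)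
  have "pull A (star v) = (\<lambda>J. ?d * star (pull A v) J)" for v
    using pull_star[OF assms] by blast
  then have 2: "pull A (ext_mult j (star (degree_vec q w))) J
      = ?d * (\<Sum>k\<in>UNIV. A $ j $ k * ext_mult k (star (degree_vec q (pull A w))) J)" for q
    unfolding pull_ext_mult by (simp add: ext_mult_scale pull_degree_vec sum_distrib_left mult_ac)
  have "pull A (cliff j w) J = (\<Sum>p\<le>CARD('n) div 2. ?s p *
     (\<Sum>k\<in>UNIV. ?d * A $ j $ k * (star (ext_mult k (?w p)) J - ext_mult k (star (?w p)) J)))"
    unfolding cliff_def pull_sum pull_diff 1 2
    by (simp add: sum_distrib_left right_diff_distrib mult_ac flip: sum_subtractf)
  also have "\<dots> = (\<Sum>k\<in>UNIV. ?d * A $ j $ k * cliff k (pull A w) J)"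
    unfolding cliff_def sum_distrib_left by (subst sum.swap) (simp add: mult_ac)
  finally show ?thesis by (simp add: sum_distrib_left mult_ac)
qed

text \<open>The symmetric difference with \<open>{j}\<close>. The complement of
  \<open>flip j J\<close> is the only index set whose coefficient enters
  \<open>cliff j w J\<close>.\<close>

abbreviation flip :: "'n \<Rightarrow> 'n set \<Rightarrow> 'n set" where
  "flip j J \<equiv> (if j \<in> J then J - {j} else insert j J)"

lemma card_partition:
  fixes P Q R :: "'a::finite \<Rightarrow> bool"
  assumes "\<And>i. P i \<longleftrightarrow> Q i \<or> R i" "\<And>i. \<not> (Q i \<and> R i)"
  shows "card {i. P i} = card {i. Q i} + card {i. R i}"
proof -
  have "{i. P i} = {i. Q i} \<union> {i. R i}" using assms(1) by auto
  moreover have "card ({i. Q i} \<union> {i. R i}) = card {i. Q i} + card {i. R i}"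
    by (rule card_Un_disjoint) (use assms(2) in auto)
  ultimately show ?thesis by simp
qed

lemma power_minus1_even_cong:
  "even (a + b) \<Longrightarrow> (-1 :: real) ^ a = (-1) ^ b"
  by (metis even_add minus_one_power_iff)

text \<open>By \<open>star_sign_insert\<close> the change is counted by elements of \<open>J\<close>
  below \<open>j\<close> and of its complement above \<open>j\<close>. As the dimension is odd and
  \<open>card J\<close> even, this number agrees modulo 2 with the number of all elements below
  \<open>j\<close>, up to the one due to \<open>j\<close> itself.\<close>

lemma star_sign_flip:
  fixes J :: "'n::{finite,linorder} set"
  assumes "odd CARD('n)" "even (card J)"
  shows "star_sign (flip j J) = star_sign J * (-1) ^ card {i. i < j} * (if j \<in> J then -1 else 1)"
proof -
  have tot: "card {i. i < j} + card {i. j < i} = CARD('n) - 1"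
    using card_split_at[of UNIV j] by simp
  have up: "card {i \<in> - J. j < i} + card {i \<in> J. j < i} = card {i. j < i}" for J :: "'n set"
    by (subst card_partition[of _ "\<lambda>i. i \<in> - J \<and> j < i" "\<lambda>i. i \<in> J \<and> j < i"]) auto
  show ?thesis
  proof (cases "j \<in> J")
    case False
    have "card {i \<in> J. i < j} + card {i \<in> J. j < i} = card J"
      using card_split_at[of J j] False by simp
    then have "even ((card {i \<in> J. i < j} + card {i \<in> - J. j < i}) + card {i. i < j})"
      using up[of J] tot assms card_le_CARD[of J] by presburger
    then have "(-1::real) ^ (card {i \<in> J. i < j} + card {i \<in> - J. j < i}) = (-1) ^ card {i. i < j}"
      by (intro power_minus1_even_cong) presburger
    then show ?thesis using False by (simp add: star_sign_insert power_add mult.assoc)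
  next
    case True
    let ?J = "J - {j}"
    have "card {i \<in> ?J. i < j} + card {i \<in> ?J. j < i} = card J - 1"
      using card_split_at[of ?J j] True by simp
    moreover have "card J > 0" using True by (auto simp: card_gt_0_iff)
    ultimately have "even ((card {i \<in> ?J. i < j} + card {i \<in> - ?J. j < i}) + Suc (card {i. i < j}))"
      using up[of ?J] tot assms by presburger
    then have e: "(-1::real) ^ (card {i \<in> ?J. i < j} + card {i \<in> - ?J. j < i}) = (-1) ^ Suc (card {i. i < j})"
      by (intro power_minus1_even_cong) presburger
    have "star_sign J = star_sign ?J * (-1) ^ (card {i \<in> ?J. i < j} + card {i \<in> - ?J. j < i})"
      using star_sign_insert[of j ?J] True by (simp add: insert_absorb power_add mult.assoc)
    then show ?thesis using True unfolding e by (simp flip: power_add mult_2)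
  qed
qed

text \<open>The inversions of \<open>J\<close> and those of its complement together make up all
  pairs in \<open>(- J) \<times> J\<close>; in odd dimension one of the two sets has even
  size.\<close>

lemma star_sign_Compl:
  fixes J :: "'n::{finite,linorder} set"
  assumes "odd CARD('n)"
  shows "star_sign (- J) = star_sign J"
proof -
  let ?inv = "\<lambda>J::'n set. {(i, m). i \<in> - J \<and> m \<in> J \<and> m < i}"
  have "(- J) \<times> J = ?inv J \<union> prod.swap ` ?inv (- J)"
    by (auto simp: image_iff) (metis linorder_neqE)
  moreover have "?inv J \<inter> prod.swap ` ?inv (- J) = {}" by auto
  moreover have "card (prod.swap ` ?inv (- J)) = card (?inv (- J))"
    by (intro card_image) (auto simp: inj_on_def)
  ultimately have "card (?inv J) + card (?inv (- J)) = card ((- J) \<times> J)"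
    by (metis (lifting) card_Un_disjoint finite)
  also have "\<dots> = (CARD('n) - card J) * card J"
    by (simp add: card_cartesian_product card_Compl)
  also have "even \<dots>" using assms card_le_CARD[of J] by auto
  finally show ?thesis
    unfolding star_sign_def by (intro power_minus1_even_cong) (simp add: add.commute)
qed

text \<open>In odd dimension the star reverses the parity of the degree, and so does the product
  with \<open>dx_j\<close>.\<close>

lemma even_vec_cliff:
  fixes w :: "'n::{finite,linorder} ext"
  assumes "odd CARD('n)" "even_vec w"
  shows "even_vec (cliff j w)"
  unfolding even_vec_def
proof (intro allI impI)
  fix J :: "'n set" assume J: "odd (card J)"
  show "cliff j w J = 0"
    unfolding cliff_def
  proof (intro sum.neutral ballI)
    fix p
    have "star (ext_mult j (degree_vec (2 * p) w)) J = 0"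
    proof (cases "j \<in> J")
      case False
      then have "card (- J - {j}) = CARD('n) - card J - 1" by (simp add: card_Compl)
      moreover have "card J < CARD('n)"
        using False by (metis UNIV_I card_mono card_subset_eq finite le_neq_implies_less subset_UNIV)
      ultimately have "card (- J - {j}) \<noteq> 2 * p" using J assms(1) by presburger
      then have "degree_vec (2 * p) w (- J - {j}) = 0"
        unfolding degree_vec_def by (simp only: if_False)
      then show ?thesis by (simp add: star_def ext_mult_def)
    qed (simp add: star_def ext_mult_def)
    moreover have "ext_mult j (star (degree_vec (2 * p) w)) J = 0"
    proof (cases "j \<in> J")
      case True
      then have "card (J - {j}) = card J - 1" by simp
      then have "card (- (J - {j})) = CARD('n) - (card J - 1)" by (metis card_Compl)
      then have "card (- (J - {j})) \<noteq> 2 * p"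
        using J assms(1) card_le_CARD[of J] by presburger
      then have "degree_vec (2 * p) w (- (J - {j})) = 0"
        unfolding degree_vec_def by (simp only: if_False)
      then show ?thesis unfolding star_def ext_mult_def by simp
    qed (simp add: ext_mult_def)
    ultimately show "(- 1) ^ ((CARD('n) + 1) div 4 + p - 1) *
         (star (ext_mult j (degree_vec (2 * p) w)) J - ext_mult j (star (degree_vec (2 * p) w)) J) = 0"
      by simp
  qed
qed

text \<open>The sign \<open>(-1) ^ (h + p - 1)\<close> of the operator in terms of the target index
  set \<open>J\<close>, for \<open>j \<notin> J\<close>: there the contributing degree is
  \<open>2 * p = CARD('n) - 1 - card J\<close>. For \<open>j \<in> J\<close> the degree is larger by
  2 and the sign the opposite one.\<close>

definition kappa :: "'n::finite set \<Rightarrow> real" where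
  "kappa J = - ((-1) ^ ((CARD('n) + 1) div 4 + (CARD('n) - 1 - card J) div 2))"

text \<open>For even \<open>J\<close> a single term survives: star after exterior product if
  \<open>j \<notin> J\<close>, exterior product after star if \<open>j \<in> J\<close>. One formula
  covers both, because counting \<open>j\<close> itself in \<open>{i \<in> J. i \<le> j}\<close>
  accounts for the minus sign that \<open>star_sign_flip\<close> gives in the second case.\<close>

lemma cliff_eq:
  fixes w :: "'n::{finite,linorder} ext"
  assumes n: "CARD('n) mod 4 = 3" and J: "even (card J)"
  shows "cliff j w J = kappa J * star_sign J * (-1) ^ card {i. i < j} * (-1) ^ card {i \<in> J. i \<le> j}
    * w (- flip j J)"
proof -
  let ?n = "CARD('n)"
  let ?h = "(?n + 1) div 4"
  define p where "p = (?n - 1 - card J) div 2 + (if j \<in> J then 1 else 0)"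
  have h: "?h > 0" and on: "odd ?n" using n by presburger+
  have jc: "j \<in> J \<Longrightarrow> card J > 0" by (auto simp: card_gt_0_iff)
  have lt: "card J < ?n" using card_le_CARD[of J] J on by (cases "card J = CARD('n)") auto
  have cf: "card (flip j J) = (if j \<in> J then card J - 1 else card J + 1)" by auto
  have cn: "card (- flip j J) = 2 * p"
    unfolding card_Compl cf p_def using J on lt jc by (cases "j \<in> J"; simp; presburger)
  have p: "p \<le> ?n div 2"
    using J on lt jc unfolding p_def by (cases "j \<in> J"; simp; presburger)
  let ?t = "\<lambda>q. (-1) ^ (?h + q - 1) *
      (star (ext_mult j (degree_vec (2 * q) w)) J - ext_mult j (star (degree_vec (2 * q) w)) J) :: real"
  have "cliff j w J = (\<Sum>q\<le>?n div 2. if q = p then ?t p else 0)"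
    unfolding cliff_def
  proof (rule sum.cong[OF refl])
    fix q
    show "?t q = (if q = p then ?t p else 0)"
    proof (cases "q = p")
      case False
      then have z: "degree_vec (2 * q) w (- flip j J) = 0" using cn by (simp add: degree_vec_def)
      have "star (ext_mult j (degree_vec (2 * q) w)) J = 0"
        using z by (cases "j \<in> J") (simp_all add: star_def ext_mult_def Compl_insert)
      moreover have "ext_mult j (star (degree_vec (2 * q) w)) J = 0"
        using z by (cases "j \<in> J") (simp_all add: star_def ext_mult_def)
      ultimately show ?thesis using False by simp
    qed simp
  qed
  also have "\<dots> = ?t p" using p by simp
  also have "\<dots> = kappa J * star_sign J * (-1) ^ card {i. i < j} * (-1) ^ card {i \<in> J. i \<le> j}
    * w (- flip j J)"
  proof (cases "j \<in> J")
    case False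
    have "card {i. i < j} = card {i \<in> - J. i < j} + card {i \<in> J. i < j}"
      by (subst card_partition[of _ "\<lambda>i. i \<in> - J \<and> i < j" "\<lambda>i. i \<in> J \<and> i < j"]) auto
    moreover have "{i \<in> J. i \<le> j} = {i \<in> J. i < j}" using False by (auto simp: le_less)
    ultimately have "(-1::real) ^ (card {i. i < j} + card {i \<in> J. i \<le> j}) = (-1) ^ card {i \<in> - J. i < j}"
      by (intro power_minus1_even_cong) presburger
    moreover have "ext_mult j (star (degree_vec (2 * p) w)) J = 0"
      using False by (simp add: ext_mult_def)
    moreover have "star (ext_mult j (degree_vec (2 * p) w)) J
        = star_sign J * ((-1) ^ card {i \<in> - J. i < j} * w (- flip j J))"
      using False cn by (simp add: star_def ext_mult_def degree_vec_def Compl_insert)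
    moreover have "(-1) ^ (?h + p - 1) = kappa J"
      using False h by (cases ?h) (simp_all add: kappa_def p_def)
    ultimately show ?thesis by (simp add: power_add)
  next
    case True
    have "{i \<in> J. i \<le> j} = insert j {i \<in> J. i < j}" using True by auto
    then have le: "card {i \<in> J. i \<le> j} = Suc (card {i \<in> J. i < j})" by simp
    have "star (ext_mult j (degree_vec (2 * p) w)) J = 0"
      using True by (simp add: ext_mult_def star_def)
    moreover have "ext_mult j (star (degree_vec (2 * p) w)) J
        = (-1) ^ card {i \<in> J. i < j} * (star_sign (flip j J) * w (- flip j J))"
      using True cn by (simp add: star_def ext_mult_def degree_vec_def)
    moreover have "(-1) ^ (?h + p - 1) = - kappa J"
      using True h by (cases ?h) (simp_all add: kappa_def p_def)
    ultimately show ?thesis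
      unfolding star_sign_flip[OF on J] le using True by simp
  qed
  finally show ?thesis .
qed

text \<open>The signs stemming from star and degree cancel between the two factors, and only the
  comparison \<open>j \<le> k\<close> is not symmetric in \<open>j\<close> and \<open>k\<close>. So
  the operators anticommute for \<open>j \<noteq> k\<close> and square to -1 for
  \<open>j = k\<close>.\<close>

lemma cliff_cliff:
  fixes w :: "'n::{finite,linorder} ext"
  assumes n: "CARD('n) mod 4 = 3" and J: "even (card J)"
  shows "cliff j (cliff k w) J = (if j \<le> k then -1 else 1) *
    ((-1) ^ card {i \<in> J. i \<le> j} * (-1) ^ card {i \<in> J. i \<le> k}) * w (flip k (flip j J))"
proof -
  let ?n = "CARD('n)"
  let ?K = "- flip j J"
  let ?e = "if j \<in> J then -1 else 1 :: real"
  have on: "odd ?n" using n by presburger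
  have half: "(n - 1 - c) div 2 + (n - 1 - (n - c - 1)) div 2 = (n - 1) div 2"
    if "n mod 4 = 3" "even c" "c < n" for n c :: nat
  proof -
    have "odd n" using that(1) by presburger
    then obtain m where "n = 2 * m + 1" by (rule oddE)
    moreover from that(2) obtain b where "c = 2 * b" by (rule evenE)
    ultimately show ?thesis using that(3) by (simp flip: diff_mult_distrib2)
  qed
  have half': "(n - 1 - c) div 2 + (n - 1 - (n - (c - 1))) div 2 = (n - 3) div 2"
    if "n mod 4 = 3" "even c" "c < n" "c > 0" for n c :: nat
  proof -
    have "odd n" using that(1) by presburger
    then obtain m where m: "n = 2 * m + 1" by (rule oddE)
    from that(2) obtain b where b: "c = 2 * b" by (rule evenE)
    have "n - 1 - (n - (c - 1)) = 2 * (b - 1)" "n - 1 - c = 2 * (m - b)" "n - 3 = 2 * (m - 1)"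
      using that(3,4) m b by auto
    then show ?thesis using that(3,4) m b by simp
  qed
  have parity: "even (B + Suc (D + F + E))"
    if "A = B + C" "A = Suc D" "even (C + F + E)" for A B C D E F :: nat
    using that by presburger
  have rearrange: "a * s * l * q * (b * (s * l * e) * l' * - (l' * q' * d) * x)
      = (a * b) * (s * s) * (l * l) * (l' * l') * - e * (q * q') * d * x"
    for a b s l q e l' q' d x :: real
    by (simp add: mult_ac)
  have jc: "j \<in> J \<Longrightarrow> card J > 0" by (auto simp: card_gt_0_iff)
  have lt: "card J < ?n" using card_le_CARD[of J] J on by (cases "card J = CARD('n)") auto
  have cf: "card (flip j J) = (if j \<in> J then card J - 1 else card J + 1)" by auto
  have cK: "card ?K = (if j \<in> J then ?n - (card J - 1) else ?n - card J - 1)"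
    unfolding card_Compl cf by simp
  have eK: "even (card ?K)"
    unfolding cK using J on lt jc by (cases "j \<in> J"; simp; presburger)
  have flipK: "- flip k ?K = flip k (flip j J)"
    by (cases "k \<in> flip j J") (simp_all only: Compl_iff not_True_eq_False not_False_eq_True if_True if_False
        Compl_insert Compl_Diff_eq double_complement Un_insert_right Un_empty_right)
  have sK: "star_sign ?K = star_sign J * (-1) ^ card {i. i < j} * ?e"
    unfolding star_sign_Compl[OF on] star_sign_flip[OF on J] ..
  \<comment> \<open>The dimension modulo 4 matters here: for n = 4h - 1 the number (n - 1)/2 is odd
    and (n - 3)/2 is even. In dimension 4h + 1 the sign would be the opposite one.\<close>
  have kK: "kappa J * kappa ?K = - ?e"
  proof -
    let ?a = "(?n + 1) div 4"
    have "kappa J * kappa ?K = (-1) ^ (2 * ?a + ((?n - 1 - card J) div 2 + (?n - 1 - card ?K) div 2))"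
      unfolding kappa_def by (simp add: power_add mult_2)
    also have "\<dots> = (-1) ^ ((?n - 1 - card J) div 2 + (?n - 1 - card ?K) div 2)"
      by (simp add: power_add power_mult)
    also have "(?n - 1 - card J) div 2 + (?n - 1 - card ?K) div 2
        = (if j \<in> J then (?n - 3) div 2 else (?n - 1) div 2)"
      unfolding cK using half[OF n J lt] half'[OF n J lt jc] by (cases "j \<in> J") (simp_all only: if_True if_False)
    also have "(-1::real) ^ \<dots> = - ?e"
    proof -
      have "odd ((?n - 1) div 2)" "even ((?n - 3) div 2)" using n by presburger+
      then show ?thesis by simp
    qed
    finally show ?thesis .
  qed
  \<comment> \<open>Passing to the complement adds the number of all \<open>i \<le> k\<close>;
    toggling \<open>j\<close> changes the count exactly if \<open>j \<le> k\<close>. The second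
    effect is the asymmetric sign.\<close>
  have qK: "(-1::real) ^ card {i \<in> ?K. i \<le> k}
      = - ((-1) ^ card {i. i < k} * (-1) ^ card {i \<in> J. i \<le> k} * (if j \<le> k then -1 else 1))"
  proof -
    have a: "card {i. i \<le> k} = card {i \<in> ?K. i \<le> k} + card {i \<in> flip j J. i \<le> k}"
      by (rule card_partition) auto
    have "{i. i \<le> k} = insert k {i. i < k}" by auto
    then have b: "card {i. i \<le> k} = Suc (card {i. i < k})" by simp
    have c: "even (card {i \<in> flip j J. i \<le> k} + card {i \<in> J. i \<le> k} + (if j \<le> k then 1 else 0))"
    proof (cases "j \<le> k")
      case False
      then have "{i \<in> flip j J. i \<le> k} = {i \<in> J. i \<le> k}" by auto
      then show ?thesis using False by simp
    next
      case le: True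
      show ?thesis
      proof (cases "j \<in> J")
        case True
        then have "card {i \<in> J. i \<le> k} = card {i \<in> flip j J. i \<le> k} + card {i. i = j}"
          using le by (intro card_partition) auto
        then show ?thesis using le by simp
      next
        case False
        then have "card {i \<in> flip j J. i \<le> k} = card {i \<in> J. i \<le> k} + card {i. i = j}"
          using le by (intro card_partition) auto
        then show ?thesis using le by simp
      qed
    qed
    have "(-1::real) ^ card {i \<in> ?K. i \<le> k}
      = (-1) ^ Suc (card {i. i < k} + card {i \<in> J. i \<le> k} + (if j \<le> k then 1 else 0))"
      by (rule power_minus1_even_cong[OF parity[OF a b c]])
    then show ?thesis by (simp add: power_add)
  qed
  have sq: "((-1::real) ^ m) * (-1) ^ m = 1" for m by (simp flip: power_add mult_2)
  have ss: "star_sign J * star_sign J = 1" unfolding star_sign_def by (rule sq)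
  let ?l = "\<lambda>j. (-1::real) ^ card {i. i < j}" and ?q = "\<lambda>j. (-1::real) ^ card {i \<in> J. i \<le> j}"
  have "cliff j (cliff k w) J = kappa J * star_sign J * ?l j * ?q j *
      (kappa ?K * star_sign ?K * ?l k * (-1) ^ card {i \<in> ?K. i \<le> k} * w (flip k (flip j J)))"
    unfolding cliff_eq[OF n J] cliff_eq[OF n eK] flipK ..
  also have "\<dots> = (kappa J * kappa ?K) * (star_sign J * star_sign J) * (?l j * ?l j) * (?l k * ?l k)
      * - ?e * (?q j * ?q k) * (if j \<le> k then -1 else 1) * w (flip k (flip j J))"
    unfolding sK qK by (rule rearrange)
  also have "\<dots> = (if j \<le> k then -1 else 1) * (?q j * ?q k) * w (flip k (flip j J))"
    unfolding kK ss sq by simp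
  finally show ?thesis .
qed

text \<open>Clifford multiplication by \<open>\<mu>\<close>. On waves of frequency
  \<open>\<mu>\<close> the APS operator acts by this, up to the factor \<open>2 * pi\<close> and the
  exchange of cosine and sine.\<close>

definition symb :: "real ^ ('n::{finite,linorder}) \<Rightarrow> 'n ext \<Rightarrow> 'n ext" where
  "symb \<mu> w = (\<lambda>J. \<Sum>j\<in>UNIV. \<mu> $ j * cliff j w J)"

lemma cliff_sum: "cliff j (\<lambda>I. \<Sum>k\<in>S. a k * f k I) J = (\<Sum>k\<in>S. a k * cliff j (f k) J)"
proof -
  have d: "degree_vec q (\<lambda>I. \<Sum>k\<in>S. a k * f k I) = (\<lambda>I. \<Sum>k\<in>S. a k * degree_vec q (f k) I)" for q
    by (auto simp: degree_vec_def)
  have e: "ext_mult j (star (degree_vec q (\<lambda>I. \<Sum>k\<in>S. a k * f k I))) J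
      = (\<Sum>k\<in>S. a k * ext_mult j (star (degree_vec q (f k))) J)" for q
    unfolding d star_sum[abs_def] ext_mult_sum ..
  have s: "star (ext_mult j (degree_vec q (\<lambda>I. \<Sum>k\<in>S. a k * f k I))) J
      = (\<Sum>k\<in>S. a k * star (ext_mult j (degree_vec q (f k))) J)" for q
    unfolding d ext_mult_sum[abs_def] star_sum ..
  show ?thesis
    unfolding cliff_def e s sum_subtractf[symmetric] right_diff_distrib[symmetric] sum_distrib_left
    by (subst sum.swap) (simp only: mult.left_commute)
qed

lemma symb_sum: "symb \<mu> (\<lambda>I. \<Sum>k\<in>S. a k * f k I) J = (\<Sum>k\<in>S. a k * symb \<mu> (f k) J)"
  unfolding symb_def cliff_sum sum_distrib_left by (subst sum.swap) (simp add: mult_ac)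

lemma symb_lincomb:
  "symb \<mu> (\<lambda>I. a * v I + b * w I) J = a * symb \<mu> v J + b * symb \<mu> w J"
  using symb_sum[of \<mu> "\<lambda>t. if t then a else b" "\<lambda>t. if t then v else w" "{True, False}" J] by simp

lemma even_vec_symb:
  fixes w :: "'n::{finite,linorder} ext"
  assumes "odd CARD('n)" "even_vec w"
  shows "even_vec (symb \<mu> w)"
  using even_vec_cliff[OF assms] by (auto simp: even_vec_def symb_def)

text \<open>Adding the double sum to itself with \<open>j\<close> and \<open>k\<close> exchanged
  leaves only anticommutators, hence the diagonal terms.\<close>

lemma symb_symb:
  fixes w :: "'n::{finite,linorder} ext"
  assumes n: "CARD('n) mod 4 = 3" and w: "even_vec w"
  shows "symb \<mu> (symb \<mu> w) = (\<lambda>J. - (\<Sum>j\<in>UNIV. (\<mu> $ j)\<^sup>2) * w J)"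
proof
  fix J
  have on: "odd CARD('n)" using n by presburger
  show "symb \<mu> (symb \<mu> w) J = - (\<Sum>j\<in>UNIV. (\<mu> $ j)\<^sup>2) * w J"
  proof (cases "even (card J)")
    case False
    then show ?thesis
      using w even_vec_symb[OF on even_vec_symb[OF on w]] by (auto simp: even_vec_def)
  next
    case J: True
    let ?f = "\<lambda>(j::'n) k. cliff j (cliff k w) J"
    have anti: "?f j k + ?f k j = (if j = k then - 2 * w J else 0)" for j k
    proof (cases "j = k")
      case True
      have f: "flip k (flip k J) = J" by (auto simp: insert_absorb)
      show ?thesis
        unfolding cliff_cliff[OF n J] True f by (simp flip: power_add mult_2)
    next
      case False
      have f: "flip k (flip j J) = flip j (flip k J)"
        using False by (cases "j \<in> J"; cases "k \<in> J") (simp_all, blast+)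
      have "a * (x * y) * W + b * (y * x) * W = 0" if "a = - b" for a b x y W :: real
        unfolding that by simp
      then show ?thesis
        unfolding cliff_cliff[OF n J] f using False by (simp add: not_le less_imp_le)    qed
    have s: "symb \<mu> (symb \<mu> w) J = (\<Sum>j\<in>UNIV. \<Sum>k\<in>UNIV. \<mu> $ j * \<mu> $ k * ?f j k)" (is "_ = ?S")
      unfolding symb_def cliff_sum sum_distrib_left by (simp add: mult_ac)
    have "?S = (\<Sum>j\<in>UNIV. \<Sum>k\<in>UNIV. \<mu> $ j * \<mu> $ k * ?f k j)"
      by (subst sum.swap) (simp add: mult_ac)
    then have "?S + ?S = ?S + (\<Sum>j\<in>UNIV. \<Sum>k\<in>UNIV. \<mu> $ j * \<mu> $ k * ?f k j)"
      by (rule arg_cong)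
    also have "\<dots> = (\<Sum>j\<in>UNIV. \<Sum>k\<in>UNIV. \<mu> $ j * \<mu> $ k * (?f j k + ?f k j))"
      by (simp only: distrib_left sum.distrib)
    also have "\<dots> = (\<Sum>j\<in>UNIV. - 2 * (\<mu> $ j)\<^sup>2 * w J)"
    proof (rule sum.cong[OF refl])
      fix j
      have "(\<Sum>k\<in>UNIV. \<mu> $ j * \<mu> $ k * (?f j k + ?f k j))
          = (\<Sum>k\<in>UNIV. if j = k then - 2 * (\<mu> $ j)\<^sup>2 * w J else 0)"
        unfolding anti by (rule sum.cong) (auto simp: power2_eq_square)
      then show "(\<Sum>k\<in>UNIV. \<mu> $ j * \<mu> $ k * (?f j k + ?f k j)) = - 2 * (\<mu> $ j)\<^sup>2 * w J"
        by simp
    qed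
    also have "\<dots> = 2 * (- (\<Sum>j\<in>UNIV. (\<mu> $ j)\<^sup>2) * w J)"
      unfolding sum_distrib_right[symmetric] sum_distrib_left[symmetric] by simp
    finally have "?S = - (\<Sum>j\<in>UNIV. (\<mu> $ j)\<^sup>2) * w J" by linarith
    then show ?thesis unfolding s .
  qed
qed

lemma pull_symb:
  fixes A :: "'n::{finite,linorder} sq_matrix"
  assumes "A ** transpose A = idm"
  shows "pull A (symb \<mu> w) J = minor A UNIV UNIV * symb (transpose A *v \<mu>) (pull A w) J"
proof -
  have "pull A (symb \<mu> w) J
    = (\<Sum>j\<in>UNIV. \<Sum>k\<in>UNIV. minor A UNIV UNIV * (A $ j $ k * \<mu> $ j * cliff k (pull A w) J))"
    unfolding symb_def pull_sum pull_cliff[OF assms] by (simp add: sum_distrib_left mult_ac)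
  also have "\<dots> = (\<Sum>k\<in>UNIV. \<Sum>j\<in>UNIV. minor A UNIV UNIV * (A $ j $ k * \<mu> $ j * cliff k (pull A w) J))"
    by (rule sum.swap)
  also have "\<dots> = minor A UNIV UNIV * symb (transpose A *v \<mu>) (pull A w) J"
    unfolding symb_def matrix_vector_mult_def
    by (simp add: sum_distrib_left sum_distrib_right Finite_Cartesian_Product.transpose_def mult_ac)
  finally show ?thesis .
qed

section \<open>The alternating Dirichlet series\<close>

text \<open>The power \<open>(1 - E) ^ m\<close> of 1 minus the unit shift \<open>E\<close>, as
  produced by Euler's transformation of alternating series. The argument is complex so that
  differences can be estimated by derivatives.\<close>

fun iter_diff :: "nat \<Rightarrow> (complex \<Rightarrow> complex) \<Rightarrow> complex \<Rightarrow> complex" where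
  "iter_diff 0 f z = f z"
| "iter_diff (Suc m) f z = iter_diff m f z - iter_diff m f (z + 1)"

definition odd_power :: "complex \<Rightarrow> complex \<Rightarrow> complex" where
  "odd_power s z = (2 * z + 1) powr (- s)"

lemma has_field_derivative_iter_diff:
  assumes "Re z \<ge> 0"
  shows "(iter_diff m (odd_power s) has_field_derivative
    - (2 * s) * iter_diff m (odd_power (s + 1)) z) (at z within A)"
  using assms
proof (induction m arbitrary: z A)
  case 0
  have "2 * z + 1 \<notin> \<real>\<^sub>\<le>\<^sub>0"
    using 0 by (simp add: complex_nonpos_Reals_iff)
  then have "((\<lambda>z. (2 * z + 1) powr (- s)) has_field_derivative
      - (2 * s) * ((2 * z + 1) powr (- (s + 1)))) (at z within A)"
    by (auto intro!: derivative_eq_intros simp: mult_ac)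
  then show ?case by (simp add: odd_power_def fun_eq_iff[symmetric] cong: DERIV_cong_ev)
next
  case (Suc m)
  have 1: "(iter_diff m (odd_power s) has_field_derivative
    - (2 * s) * iter_diff m (odd_power (s + 1)) z) (at z within A)" by (rule Suc) (use Suc in auto)
  have "(iter_diff m (odd_power s) has_field_derivative
    - (2 * s) * iter_diff m (odd_power (s + 1)) (z + 1)) (at (z + 1))"
    by (rule Suc) (use Suc in auto)
  then have 2: "((\<lambda>z. iter_diff m (odd_power s) (z + 1)) has_field_derivative
    - (2 * s) * iter_diff m (odd_power (s + 1)) (z + 1)) (at z within A)"
    using DERIV_shift[of "iter_diff m (odd_power s)" _ z 1]
    by (metis DERIV_subset subset_UNIV)
  have "((\<lambda>z. iter_diff m (odd_power s) z - iter_diff m (odd_power s) (z + 1)) has_field_derivative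
    - (2 * s) * iter_diff m (odd_power (s + 1)) z
    - - (2 * s) * iter_diff m (odd_power (s + 1)) (z + 1)) (at z within A)"
    by (rule DERIV_diff[OF 1 2])
  then show ?case by (simp add: algebra_simps)
qed

text \<open>By the mean value inequality each difference costs a derivative, which lowers the
  exponent by 1 and contributes a factor 2 times the norm of the current exponent. So the
  \<open>m\<close>-th difference decays \<open>m\<close> powers faster.\<close>

lemma norm_iter_diff_le:
  assumes "Re s + real m \<ge> 0" "x \<ge> 0"
  shows "norm (iter_diff m (odd_power s) (of_real x))
    \<le> 2 ^ m * (\<Prod>i<m. norm (s + of_nat i)) * (2 * x + 1) powr (- (Re s + real m))"
  using assms
proof (induction m arbitrary: s x)
  case 0
  then show ?case
    using norm_powr_real_powr[of "of_real (2 * x + 1)" "- s"] by (simp add: odd_power_def)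
next
  case (Suc m)
  let ?g = "iter_diff m (odd_power s)"
  let ?S = "closed_segment (complex_of_real x) (of_real (x + 1))"
  define K where "K = 2 ^ Suc m * (\<Prod>i<Suc m. norm (s + of_nat i)) * (2 * x + 1) powr (- (Re s + real (Suc m)))"
  have re: "\<exists>y\<ge>x. z = of_real y" if z: "z \<in> ?S" for z
    using z unfolding closed_segment_of_real using Suc.prems by (auto simp: closed_segment_eq_real_ivl)
  have "norm (?g (of_real x) - ?g (of_real (x + 1))) \<le> K * norm (complex_of_real x - of_real (x + 1))"
  proof (rule field_differentiable_bound[where S = ?S])
    fix z assume "z \<in> ?S"
    with re obtain y where y: "y \<ge> x" "z = of_real y" by blast
    show "(?g has_field_derivative - (2 * s) * iter_diff m (odd_power (s + 1)) z) (at z within ?S)"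
      by (rule has_field_derivative_iter_diff) (use y Suc.prems in simp)
    have "norm (iter_diff m (odd_power (s + 1)) z)
       \<le> 2 ^ m * (\<Prod>i<m. norm (s + 1 + of_nat i)) * (2 * y + 1) powr (- (Re (s + 1) + real m))"
      unfolding y by (rule Suc.IH) (use Suc.prems y in auto)
    also have "\<dots> \<le> 2 ^ m * (\<Prod>i<m. norm (s + 1 + of_nat i)) * (2 * x + 1) powr (- (Re (s + 1) + real m))"
      by (intro mult_left_mono powr_mono2') (use y Suc.prems in \<open>auto intro!: mult_nonneg_nonneg prod_nonneg\<close>)
    finally have "norm (iter_diff m (odd_power (s + 1)) z)
       \<le> 2 ^ m * (\<Prod>i<m. norm (s + of_nat (Suc i))) * (2 * x + 1) powr (- (Re s + real (Suc m)))"
      by (simp add: add_ac)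
    then have "2 * norm s * norm (iter_diff m (odd_power (s + 1)) z)
       \<le> 2 * norm s * (2 ^ m * (\<Prod>i<m. norm (s + of_nat (Suc i))) * (2 * x + 1) powr (- (Re s + real (Suc m))))"
      by (intro mult_left_mono) auto
    also have "\<dots> = K"
      unfolding K_def prod.lessThan_Suc_shift by simp
    finally show "norm (- (2 * s) * iter_diff m (odd_power (s + 1)) z) \<le> K"
      by (simp add: norm_mult)
  qed auto
  then show ?case by (simp add: K_def)
qed

text \<open>What remains of the alternating series after \<open>m\<close> Euler steps;
  \<open>head_sum\<close> collects the boundary terms split off on the way.\<close>

definition tail_series :: "nat \<Rightarrow> complex \<Rightarrow> complex" where
  "tail_series m s = (\<Sum>k. (-1) ^ k / 2 ^ m * iter_diff m (odd_power s) (of_nat k))"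

definition head_sum :: "nat \<Rightarrow> complex \<Rightarrow> complex" where
  "head_sum m s = (\<Sum>j<m. iter_diff j (odd_power s) 0 / 2 ^ Suc j)"

lemma tail_bound:
  assumes "Re s \<ge> \<rho>" "\<rho> + real m > 0" "norm s \<le> R"
  shows "norm ((-1) ^ k / 2 ^ m * iter_diff m (odd_power s) (of_nat k))
    \<le> (\<Prod>i<m. R + real i) * real (Suc k) powr (- (\<rho> + real m))"
proof -
  have "norm (iter_diff m (odd_power s) (of_real (real k)))
      \<le> 2 ^ m * (\<Prod>i<m. norm (s + of_nat i)) * (2 * real k + 1) powr (- (Re s + real m))"
    by (rule norm_iter_diff_le) (use assms in auto)
  also have "\<dots> \<le> 2 ^ m * (\<Prod>i<m. R + real i) * real (Suc k) powr (- (\<rho> + real m))"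
  proof (intro mult_mono prod_mono conjI)
    fix i show "norm (s + of_nat i) \<le> R + real i"
      using norm_triangle_ineq[of s "of_nat i"] assms by simp
    have "(2 * real k + 1) powr (- (Re s + real m)) \<le> (2 * real k + 1) powr (- (\<rho> + real m))"
      using assms by (intro powr_mono) auto
    also have "\<dots> \<le> real (Suc k) powr (- (\<rho> + real m))"
      using assms by (intro powr_mono2') auto
    finally show "(2 * real k + 1) powr (- (Re s + real m)) \<le> real (Suc k) powr (- (\<rho> + real m))" .
    have "0 \<le> R" using assms(3) norm_ge_zero order_trans by blast
    then show "0 \<le> 2 ^ m * (\<Prod>i<m. R + real i)"
      by (intro mult_nonneg_nonneg prod_nonneg) auto
  qed (auto intro!: prod_nonneg)
  finally show ?thesis by (simp add: norm_mult norm_divide norm_power field_simps)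
qed

lemma summable_tail_bound:
  assumes "\<rho> + real m > 1"
  shows "summable (\<lambda>k. C * real (Suc k) powr (- (\<rho> + real m)))"
proof -
  have "summable (\<lambda>n. real n powr (- (\<rho> + real m)))"
    unfolding summable_real_powr_iff using assms by simp
  then show ?thesis
    by (intro summable_mult iffD2[OF summable_Suc_iff[of "\<lambda>n. real n powr (- (\<rho> + real m))"]])
qed

lemma holomorphic_iter_diff: "(\<lambda>s. iter_diff m (odd_power s) (of_nat k)) holomorphic_on A"
proof (induction m arbitrary: k)
  case 0
  have "2 * of_nat k + 1 \<noteq> (0 :: complex)"
    by (metis of_nat_1 of_nat_Suc of_nat_eq_0_iff of_nat_mult of_nat_numeral add.commute Suc_not_Zero)
  then show ?case by (auto simp: odd_power_def intro!: holomorphic_intros)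
next
  case (Suc m)
  have "(\<lambda>s. iter_diff m (odd_power s) (of_nat k) - iter_diff m (odd_power s) (of_nat (Suc k))) holomorphic_on A"
    by (intro holomorphic_intros Suc)
  then show ?case by (simp add: add.commute)
qed

text \<open>Locally uniform convergence by the Weierstrass test; \<open>m\<close> Euler steps push
  the half-plane of absolute convergence to the left by \<open>m\<close>.\<close>

lemma holomorphic_tail_series: "tail_series m holomorphic_on {s. Re s > 1 - real m}"
proof (rule holomorphic_uniform_sequence)
  let ?U = "{s. Re s > 1 - real m}"
  let ?t = "\<lambda>k s. (-1) ^ k / 2 ^ m * iter_diff m (odd_power s) (of_nat k)"
  show "open ?U" by (rule open_halfspace_Re_gt)
  show "(\<lambda>s. \<Sum>k<n. ?t k s) holomorphic_on ?U" for n
    by (intro holomorphic_intros holomorphic_iter_diff)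
  fix x assume x: "x \<in> ?U"
  \<comment> \<open>Half the distance to the boundary line, so that the exponent
    \<open>Re x - d + real m\<close> of the majorant still exceeds 1.\<close>
  define d where "d = (Re x - (1 - real m)) / 2"
  have d: "d > 0" using x by (simp add: d_def)
  have re: "Re s \<ge> Re x - d" if "s \<in> cball x d" for s
    using that abs_Re_le_cmod[of "x - s"] by (auto simp: dist_norm)
  have dd: "Re x - d + real m > 1" using x by (simp add: d_def field_simps)
  have "cball x d \<subseteq> ?U"
  proof
    fix s assume "s \<in> cball x d"
    then have "Re s \<ge> Re x - d" by (rule re)
    then show "s \<in> ?U" using dd by simp
  qed
  moreover have "uniform_limit (cball x d) (\<lambda>n s. \<Sum>k<n. ?t k s) (\<lambda>s. \<Sum>k. ?t k s) sequentially"
  proof (rule Weierstrass_m_test)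
    show "summable (\<lambda>k. (\<Prod>i<m. (norm x + d) + real i) * real (Suc k) powr (- ((Re x - d) + real m)))"
      by (rule summable_tail_bound) (rule dd)
    fix k s assume s: "s \<in> cball x d"
    have "norm s \<le> norm x + d"
      using s norm_triangle_ineq2[of s x] by (auto simp: dist_norm norm_minus_commute)
    then show "norm (?t k s) \<le> (\<Prod>i<m. (norm x + d) + real i) * real (Suc k) powr (- ((Re x - d) + real m))"
      by (intro tail_bound re s) (use dd in simp_all)
  qed
  ultimately show "\<exists>d>0. cball x d \<subseteq> ?U \<and> uniform_limit (cball x d) (\<lambda>n s. \<Sum>k<n. ?t k s) (tail_series m) sequentially"
    using d unfolding tail_series_def[abs_def] by blast
qed

lemma summable_tail:
  assumes "Re s > 1 - real m"
  shows "summable (\<lambda>k. (-1) ^ k / 2 ^ m * iter_diff m (odd_power s) (of_nat k))"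
proof (rule summable_comparison_test[OF _ summable_tail_bound])
  show "\<exists>N. \<forall>k\<ge>N. norm ((-1) ^ k / 2 ^ m * iter_diff m (odd_power s) (of_nat k))
      \<le> (\<Prod>i<m. norm s + real i) * real (Suc k) powr (- (Re s + real m))"
    by (intro exI allI impI tail_bound) (use assms in auto)
qed (use assms in auto)

text \<open>The Euler step: averaging consecutive terms \<open>?a k\<close> and
  \<open>?a (Suc k)\<close> turns their alternating signs into a further difference, and the series
  of averages falls short of the original one by half the first term.\<close>

lemma tail_series_Suc:
  assumes "Re s > 1 - real m"
  shows "tail_series m s = iter_diff m (odd_power s) 0 / 2 ^ Suc m + tail_series (Suc m) s"
proof -
  let ?a = "\<lambda>k. (-1) ^ k / 2 ^ m * iter_diff m (odd_power s) (of_nat k)"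
  have sm: "summable ?a" by (rule summable_tail[OF assms])
  then have sm1: "summable (\<lambda>k. ?a (Suc k))" by (subst summable_Suc_iff)
  have "(\<lambda>k. (-1) ^ k / 2 ^ Suc m * iter_diff (Suc m) (odd_power s) (of_nat k)) = (\<lambda>k. (?a k + ?a (Suc k)) / 2)"
    by (auto simp: field_simps)
  then have "tail_series (Suc m) s = (suminf ?a + (\<Sum>k. ?a (Suc k))) / 2"
    unfolding tail_series_def using sm sm1 by (simp only: suminf_divide summable_add suminf_add)
  also have "(\<Sum>k. ?a (Suc k)) = suminf ?a - ?a 0"
    by (rule suminf_split_head[OF sm])
  finally show ?thesis by (simp add: tail_series_def field_simps)
qed

lemma head_tail_mono:
  assumes "Re s > 1 - real m"
  shows "head_sum (m + d) s + tail_series (m + d) s = head_sum m s + tail_series m s"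
proof (induction d)
  case (Suc d)
  have "tail_series (m + d) s = iter_diff (m + d) (odd_power s) 0 / 2 ^ Suc (m + d) + tail_series (Suc (m + d)) s"
    by (rule tail_series_Suc) (use assms in simp)
  then show ?case using Suc by (simp add: head_sum_def add.assoc)
qed simp

text \<open>The entire continuation of \<open>\<Sum>k. (-1)^k (2k+1)^(-s)\<close> by repeated Euler transformation.\<close>

definition L4 :: "complex \<Rightarrow> complex" where
  "L4 s = (let m = nat \<lceil>2 - Re s\<rceil> in head_sum m s + tail_series m s)"

text \<open>All numbers of Euler steps that suffice for convergence give the same value. The
  definition chooses \<open>m\<close> depending on \<open>s\<close>; holomorphy needs one
  \<open>m\<close> on a whole half-plane.\<close>

lemma L4_eq:
  assumes "Re s > 1 - real m"
  shows "L4 s = head_sum m s + tail_series m s"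
proof -
  define l where "l = nat \<lceil>2 - Re s\<rceil>"
  have l: "Re s > 1 - real l" unfolding l_def by linarith
  show ?thesis
  proof (cases "l \<le> m")
    case True
    then show ?thesis using head_tail_mono[OF l, of "m - l"]
      unfolding L4_def Let_def l_def[symmetric] by simp
  next
    case False
    then show ?thesis using head_tail_mono[OF assms, of "l - m"]
      unfolding L4_def Let_def l_def[symmetric] by simp
  qed
qed

lemma holomorphic_L4: "L4 holomorphic_on UNIV"
proof -
  have "L4 holomorphic_on (\<Union>m. {s. Re s > 1 - real m})"
  proof (rule holomorphic_on_UN_open)
    fix m
    have "(\<lambda>s. head_sum m s + tail_series m s) holomorphic_on {s. Re s > 1 - real m}"
      unfolding head_sum_def using holomorphic_iter_diff[of _ 0]
      by (intro holomorphic_intros holomorphic_tail_series) auto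
    then show "L4 holomorphic_on {s. Re s > 1 - real m}"
      by (rule holomorphic_transform) (simp add: L4_eq)
    show "open {s. Re s > 1 - real m}" by (rule open_halfspace_Re_gt)
  qed
  moreover have "(\<Union>m. {s. Re s > 1 - real m}) = UNIV"
  proof (intro equalityI subsetI)
    fix s :: complex
    obtain m :: nat where "real m > 1 - Re s" using reals_Archimedean2 by blast
    then have "s \<in> {s. Re s > 1 - real m}" by simp
    then show "s \<in> (\<Union>m. {s. Re s > 1 - real m})" by blast
  qed simp
  ultimately show ?thesis by simp
qed

lemma L4_series:
  assumes "Re s > 1"
  shows "L4 s = (\<Sum>k. (-1) ^ k * of_nat (2 * k + 1) powr (- s))"
  using L4_eq[of 0 s] assms by (simp add: head_sum_def tail_series_def odd_power_def add.commute)

lemma summable_L4: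
  assumes "Re s > 1"
  shows "summable (\<lambda>k. norm ((-1) ^ k * of_nat (2 * k + 1) powr (- s) :: complex))"
proof (rule summable_comparison_test[OF _ summable_tail_bound[where m = 0 and C = 1 and \<rho> = "Re s"]])
  show "\<exists>N. \<forall>k\<ge>N. norm (norm ((-1) ^ k * of_nat (2 * k + 1) powr (- s) :: complex))
     \<le> 1 * real (Suc k) powr (- (Re s + real 0))"
    using tail_bound[of "Re s" s 0 "norm s"] assms
    by (intro exI allI impI) (simp add: odd_power_def add.commute)
qed (use assms in simp)

text \<open>At \<open>s = 0\<close> all terms are 1, so all differences vanish and only the first
  boundary term is left: the Abel sum of 1 - 1 + 1 - ... The value \<open>m = 2\<close> is the least
  one with \<open>0 > 1 - m\<close>.\<close>

lemma L4_0: "L4 0 = 1 / 2"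
proof -
  have "odd_power 0 (of_nat k) = 1" for k
  proof -
    have "2 * of_nat k + 1 = (of_nat (Suc (2 * k)) :: complex)" by simp
    then show ?thesis unfolding odd_power_def by (simp add: powr_def del: of_nat_Suc)
  qed
  then have d0: "iter_diff 0 (odd_power 0) (of_nat k) = 1" for k by simp
  have d1: "iter_diff 1 (odd_power 0) (of_nat k) = 0" for k
    using d0[of k] d0[of "Suc k"] by (simp add: add.commute)
  have d2: "iter_diff 2 (odd_power 0) (of_nat k) = 0" for k
    using d1[of k] d1[of "Suc k"] unfolding numeral_2_eq_2 by (simp add: add.commute)
  have "head_sum 2 0 = iter_diff 0 (odd_power 0) (of_nat 0) / 2 + iter_diff 1 (odd_power 0) (of_nat 0) / 4"
    by (simp add: head_sum_def numeral_2_eq_2 lessThan_Suc)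
  then have "head_sum 2 0 = 1 / 2" unfolding d0 d1 by simp
  moreover have "tail_series 2 0 = 0" unfolding tail_series_def d2 by simp
  ultimately show ?thesis using L4_eq[of 2 0] by simp
qed

text \<open>Uniqueness of the continuation: a competitor is analytic off a sparse set, whose
  complement is connected, so it agrees with \<open>F\<close> there by the identity theorem. A point
  of the sparse set would be a pole of \<open>F\<close>, which is entire.\<close>

lemma eta_function_eq:
  fixes \<Gamma> :: "'n::{finite,linorder} self_map set"
  assumes F: "F holomorphic_on UNIV"
    and eq: "\<And>s. Re s > real CARD('n) \<Longrightarrow> eta_series \<Gamma> s = F s"
  shows "eta_function \<Gamma> = F"
  unfolding eta_function_def
proof (rule the_equality)
  show "F nicely_meromorphic_on UNIV \<and> (\<forall>s. real CARD('n) < Re s \<longrightarrow> F s = eta_series \<Gamma> s)"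
    using F eq by (auto intro!: analytic_on_imp_nicely_meromorphic_on simp: analytic_on_open)
next
  fix g assume g: "g nicely_meromorphic_on UNIV \<and> (\<forall>s. real CARD('n) < Re s \<longrightarrow> g s = eta_series \<Gamma> s)"
  then have gn: "g nicely_meromorphic_on UNIV" by blast
  obtain pts where "pts \<subseteq> UNIV" and p: "pts sparse_in UNIV" "g analytic_on UNIV - pts"
    "\<forall>z\<in>pts. is_pole g z \<and> g z = 0"
    by (rule nicely_meromorphic_onE[OF gn]) blast
  have op: "open (UNIV - pts)" using p(1) by (intro open_diff_sparse_pts) auto
  have con: "connected (UNIV - pts)"
    by (rule sparse_imp_connected) (use p(1) in auto)
  have gF: "g z = F z" if "z \<in> UNIV - pts" for z
  proof (rule analytic_continuation_open[OF _ op _ con, where f = g and g = F and s = "{s. Re s > real CARD('n)} - pts"])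
    show "open ({s. Re s > real CARD('n)} - pts)"
      using open_Int[OF open_halfspace_Re_gt op, of "real CARD('n)"]
      by (simp only: Diff_eq Int_UNIV_left)
    \<comment> \<open>A sparse set is countable and a ball is not; hence the exceptional points do
      not exhaust the half-plane.\<close>
    have "ball (of_real (real CARD('n) + 1)) 1 \<subseteq> {s. Re s > real CARD('n)}"
    proof
      fix s assume "s \<in> ball (complex_of_real (real CARD('n) + 1)) 1"
      then show "s \<in> {s. Re s > real CARD('n)}"
        using abs_Re_le_cmod[of "of_real (real CARD('n) + 1) - s"] by (simp add: dist_norm)
    qed
    then have unc: "uncountable {s. Re s > real CARD('n)}"
      using countable_subset uncountable_ball[of 1 "complex_of_real (real CARD('n) + 1)"] by auto
    have "countable pts" using sparse_imp_countable[OF _ p(1)] by simp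
    then have "\<not> {s. Re s > real CARD('n)} \<subseteq> pts"
      using unc countable_subset by auto
    then show "{s. Re s > real CARD('n)} - pts \<noteq> {}" by auto
    show "g holomorphic_on UNIV - pts" using p(2) by (rule analytic_imp_holomorphic)
    show "F holomorphic_on UNIV - pts" using F by (rule holomorphic_on_subset) auto
    show "g z = F z" if "z \<in> {s. Re s > real CARD('n)} - pts" for z
      using that g eq by auto
  qed (use that in auto)
  have "pts = {}"
  proof (rule ccontr)
    assume "pts \<noteq> {}"
    then obtain z where z: "z \<in> pts" by auto
    have "\<not> z islimpt pts" using p(1) unfolding sparse_in_def by blast
    then have "eventually (\<lambda>w. w \<notin> pts) (at z)"
      by (simp add: islimpt_conv_frequently_at frequently_def)
    then have "eventually (\<lambda>w. g w = F w) (at z)" by (rule eventually_mono) (simp add: gF)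
    then have "is_pole g z \<longleftrightarrow> is_pole F z" by (intro is_pole_cong) auto
    moreover have "\<not> is_pole F z"
      using F by (intro not_is_pole_holomorphic[of UNIV]) auto
    ultimately show False using p(3) z by auto
  qed
  then show "g = F" using gF by auto
qed

section \<open>The integral rotation matrices\<close>

text \<open>What \<open>C_i\<close> and \<open>J_i\<close> have in common. The size \<open>N\<close>
  is also the exponent at which the power is -1. The last clause says that a rotation
  \<open>U\<close> conjugates \<open>A\<close> to its fifth power; right-nested products let block
  multiplication rewrite it one factor at a time.\<close>

definition rotation_block :: "nat \<Rightarrow> real mat \<Rightarrow> bool" where
  "rotation_block i A \<longleftrightarrow> (let N = 2 ^ i in A \<in> carrier_mat N N \<and>
    (\<forall>a<N. \<forall>b<N. A $$ (a, b) \<in> \<int>) \<and>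
    A * transpose_mat A = 1\<^sub>m N \<and> A ^\<^sub>m N = - 1\<^sub>m N \<and>
    (\<exists>U\<in>carrier_mat N N. U * transpose_mat U = 1\<^sub>m N \<and> Determinant.det U = 1 \<and>
       U * A = A * (A * (A * (A * (A * U))))))"

lemma assoc_sq:
  fixes A :: "real mat"
  assumes "A \<in> carrier_mat N N" "B \<in> carrier_mat N N" "C \<in> carrier_mat N N"
  shows "A * B * C = A * (B * C)"
  using assms by (rule assoc_mult_mat)

lemma transpose_mult_self:
  fixes A :: "real mat"
  assumes "A \<in> carrier_mat N N" "A * transpose_mat A = 1\<^sub>m N"
  shows "transpose_mat A * A = 1\<^sub>m N"
  by (rule mat_mult_left_right_inverse[OF assms(1) _ assms(2)]) (use assms in simp)

lemma det_orthogonal_sq: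
  fixes A :: "real mat"
  assumes A: "A \<in> carrier_mat N N" and o: "A * transpose_mat A = 1\<^sub>m N"
  shows "Determinant.det A * Determinant.det A = 1"
proof -
  have "Determinant.det (A * transpose_mat A) = Determinant.det A * Determinant.det (transpose_mat A)"
    by (rule Determinant.det_mult) (use A in auto)
  then show ?thesis using o Determinant.det_transpose[OF A] by simp
qed

lemma one_four_block:
  "(1\<^sub>m (n + m) :: real mat) = four_block_mat (1\<^sub>m n) (0\<^sub>m n m) (0\<^sub>m m n) (1\<^sub>m m)"
  by (intro eq_matI) auto

lemma diag_mult:
  fixes A B C D :: "real mat"
  assumes "A \<in> carrier_mat n n" "B \<in> carrier_mat m m" "C \<in> carrier_mat n n" "D \<in> carrier_mat m m"
  shows "four_block_mat A (0\<^sub>m n m) (0\<^sub>m m n) B * four_block_mat C (0\<^sub>m n m) (0\<^sub>m m n) D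
    = four_block_mat (A * C) (0\<^sub>m n m) (0\<^sub>m m n) (B * D)"
  using assms by (subst mult_four_block_mat[OF assms(1) _ _ assms(2) assms(3) _ _ assms(4)]) auto

lemma diag_power:
  fixes A B :: "real mat"
  assumes "A \<in> carrier_mat n n" "B \<in> carrier_mat m m"
  shows "four_block_mat A (0\<^sub>m n m) (0\<^sub>m m n) B ^\<^sub>m k
    = four_block_mat (A ^\<^sub>m k) (0\<^sub>m n m) (0\<^sub>m m n) (B ^\<^sub>m k)"
proof (induction k)
  case 0
  show ?case using assms one_four_block by simp
next
  case (Suc k)
  then show ?case using diag_mult[OF _ _ assms, of "A ^\<^sub>m k" "B ^\<^sub>m k"] assms by simp
qed

lemma diag_transpose:
  fixes A B :: "real mat"
  assumes "A \<in> carrier_mat n n" "B \<in> carrier_mat m m"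
  shows "transpose_mat (four_block_mat A (0\<^sub>m n m) (0\<^sub>m m n) B)
    = four_block_mat (transpose_mat A) (0\<^sub>m n m) (0\<^sub>m m n) (transpose_mat B)"
  using assms by (intro eq_matI) auto

section \<open>Doubling a block: the passage from \<open>J_i\<close> to
  \<open>J_(i+1)\<close>\<close>

definition double_block :: "real mat \<Rightarrow> real mat" where
  "double_block A = four_block_mat (0\<^sub>m (dim_row A) (dim_row A)) A (1\<^sub>m (dim_row A))
     (0\<^sub>m (dim_row A) (dim_row A))"

lemma double_block_mult:
  fixes A B :: "real mat"
  assumes "A \<in> carrier_mat N N" "B \<in> carrier_mat N N" "C \<in> carrier_mat N N"
  shows "double_block A * four_block_mat B (0\<^sub>m N N) (0\<^sub>m N N) C
      = four_block_mat (0\<^sub>m N N) (A * C) B (0\<^sub>m N N)"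
    and "four_block_mat B (0\<^sub>m N N) (0\<^sub>m N N) C * double_block A
      = four_block_mat (0\<^sub>m N N) (B * A) C (0\<^sub>m N N)"
    and "double_block A * four_block_mat (0\<^sub>m N N) B C (0\<^sub>m N N)
      = four_block_mat (A * C) (0\<^sub>m N N) (0\<^sub>m N N) B"
proof -
  have A: "double_block A = four_block_mat (0\<^sub>m N N) A (1\<^sub>m N) (0\<^sub>m N N)"
    using assms by (auto simp: double_block_def)
  show "double_block A * four_block_mat B (0\<^sub>m N N) (0\<^sub>m N N) C
      = four_block_mat (0\<^sub>m N N) (A * C) B (0\<^sub>m N N)"
    unfolding A mult_four_block_mat[OF zero_carrier_mat[of N N] assms(1) one_carrier_mat[of N] zero_carrier_mat[of N N] assms(2) zero_carrier_mat[of N N] zero_carrier_mat[of N N] assms(3)] using assms by simp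
  show "four_block_mat B (0\<^sub>m N N) (0\<^sub>m N N) C * double_block A
      = four_block_mat (0\<^sub>m N N) (B * A) C (0\<^sub>m N N)"
    unfolding A mult_four_block_mat[OF assms(2) zero_carrier_mat[of N N] zero_carrier_mat[of N N] assms(3) zero_carrier_mat[of N N] assms(1) one_carrier_mat[of N] zero_carrier_mat[of N N]] using assms by simp
  show "double_block A * four_block_mat (0\<^sub>m N N) B C (0\<^sub>m N N)
      = four_block_mat (A * C) (0\<^sub>m N N) (0\<^sub>m N N) B"
    unfolding A mult_four_block_mat[OF zero_carrier_mat[of N N] assms(1) one_carrier_mat[of N] zero_carrier_mat[of N N] zero_carrier_mat[of N N] assms(2) assms(3) zero_carrier_mat[of N N]] using assms by simp
qed

lemma double_block_carrier:
  "A \<in> carrier_mat N N \<Longrightarrow> double_block A \<in> carrier_mat (N + N) (N + N)"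
  by (auto simp: double_block_def)

lemma double_block_square:
  assumes "A \<in> carrier_mat N N"
  shows "double_block A * double_block A = four_block_mat A (0\<^sub>m N N) (0\<^sub>m N N) A"
proof -
  have "double_block A = four_block_mat (0\<^sub>m N N) A (1\<^sub>m N) (0\<^sub>m N N)"
    using assms by (auto simp: double_block_def)
  then show ?thesis using double_block_mult(3)[OF assms assms, of "1\<^sub>m N"] assms by simp
qed

lemma double_block_power:
  assumes "A \<in> carrier_mat N N"
  shows "double_block A ^\<^sub>m (2 * k) = four_block_mat (A ^\<^sub>m k) (0\<^sub>m N N) (0\<^sub>m N N) (A ^\<^sub>m k)"
proof (induction k)
  case 0
  show ?case using assms double_block_carrier[OF assms] one_four_block[of N N] by simp
next
  case (Suc k)
  note D = double_block_carrier[OF assms]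
  have "double_block A ^\<^sub>m (2 * Suc k) = double_block A ^\<^sub>m (2 * k) * (double_block A * double_block A)"
    using assoc_sq[OF pow_carrier_mat[OF D] D D] by simp
  also have "\<dots> = four_block_mat (A ^\<^sub>m Suc k) (0\<^sub>m N N) (0\<^sub>m N N) (A ^\<^sub>m Suc k)"
    unfolding Suc double_block_square[OF assms] using assms by (subst diag_mult) auto
  finally show ?case .
qed

text \<open>The conjugating matrix of the doubled block is \<open>diag(U, A^2 U)\<close>, of determinant
  \<open>det(U)^2 det(A)^2 = 1\<close>.\<close>

lemma rotation_block_double:
  assumes "rotation_block i A"
  shows "rotation_block (Suc i) (double_block A)"
proof -
  let ?N = "2 ^ i :: nat"
  let ?Z = "0\<^sub>m ?N ?N"
  from assms obtain U where A: "A \<in> carrier_mat ?N ?N"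
    and int: "\<And>a b. a < ?N \<Longrightarrow> b < ?N \<Longrightarrow> A $$ (a, b) \<in> \<int>"
    and o: "A * transpose_mat A = 1\<^sub>m ?N" and p: "A ^\<^sub>m ?N = - 1\<^sub>m ?N"
    and U: "U \<in> carrier_mat ?N ?N" and oU: "U * transpose_mat U = 1\<^sub>m ?N"
    and dU: "Determinant.det U = 1" and UA: "U * A = A * (A * (A * (A * (A * U))))"
    by (auto simp: rotation_block_def Let_def)
  note as = assoc_sq[where N = ?N]
  let ?D = "double_block A"
  have D: "?D = four_block_mat ?Z A (1\<^sub>m ?N) ?Z" using A by (auto simp: double_block_def)
  have tD: "transpose_mat ?D = four_block_mat ?Z (1\<^sub>m ?N) (transpose_mat A) ?Z"
    unfolding D using A by (intro eq_matI) auto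
  let ?V = "A * (A * U)"
  have V: "?V \<in> carrier_mat ?N ?N" using A U by simp
  let ?W = "four_block_mat U ?Z ?Z ?V"
  have W: "?W \<in> carrier_mat (?N + ?N) (?N + ?N)" using U V by simp
  have AA: "transpose_mat A \<in> carrier_mat ?N ?N" "transpose_mat U \<in> carrier_mat ?N ?N" using A U by auto
  have oV: "?V * transpose_mat ?V = 1\<^sub>m ?N"
  proof -
    have "?V * transpose_mat ?V = A * (A * (U * (transpose_mat U * (transpose_mat A * transpose_mat A))))"
      using A U AA transpose_mult[OF A, of "A * U" ?N] transpose_mult[OF A U] by (simp add: as)
    also have "U * (transpose_mat U * (transpose_mat A * transpose_mat A)) = (U * transpose_mat U) * (transpose_mat A * transpose_mat A)"
      by (rule as[symmetric]) (use U AA in auto)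
    also have "\<dots> = transpose_mat A * transpose_mat A" unfolding oU using AA by simp
    also have "A * (transpose_mat A * transpose_mat A) = (A * transpose_mat A) * transpose_mat A"
      by (rule as[symmetric]) (use A AA in auto)
    also have "\<dots> = transpose_mat A" unfolding o using AA by simp
    finally show ?thesis using o by simp
  qed
  have oW: "?W * transpose_mat ?W = 1\<^sub>m (?N + ?N)"
    unfolding diag_transpose[OF U V] using U V oU oV one_four_block[of ?N ?N]
    by (subst diag_mult) auto
  have dW: "Determinant.det ?W = 1"
  proof -
    have "Determinant.det ?W = Determinant.det U * Determinant.det ?V"
      by (rule det_four_block_mat_upper_right_zero) (use U V in auto)
    also have "Determinant.det ?V = Determinant.det A * (Determinant.det A * Determinant.det U)"
      using A U by (simp add: Determinant.det_mult[where n = ?N])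
    finally show ?thesis using dU det_orthogonal_sq[OF A o] by simp
  qed
  \<comment> \<open>With \<open>?W = diag(U, V)\<close> the off-diagonal blocks demand
    \<open>V = A^2 U\<close> and \<open>U A = A^3 V\<close>. The first dictates the second diagonal
    block, and the second is then the hypothesis on \<open>U\<close>.\<close>
  have WD: "?W * ?D = ?D * (?D * (?D * (?D * (?D * ?W))))"
  proof -
    have "?D * (?D * (?D * (?D * (?D * ?W)))) = four_block_mat ?Z (A * (A * (A * ?V))) (A * (A * U)) ?Z"
    proof -
      have c: "A * U \<in> carrier_mat ?N ?N" "A * ?V \<in> carrier_mat ?N ?N"
        "A * (A * ?V) \<in> carrier_mat ?N ?N" using A U by auto
      show ?thesis
        unfolding double_block_mult(1)[OF A U V] double_block_mult(3)[OF A c(2) U]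
          double_block_mult(1)[OF A c(1,2)] double_block_mult(3)[OF A c(3,1)]
          double_block_mult(1)[OF A V c(3)] ..
    qed
    also have "A * (A * (A * ?V)) = U * A" unfolding UA ..
    finally show ?thesis unfolding double_block_mult(2)[OF A U V] by (rule sym)
  qed
  have "?D * transpose_mat ?D = 1\<^sub>m (?N + ?N)"
    unfolding tD double_block_mult(3)[OF A one_carrier_mat AA(1)] o one_four_block ..
  moreover have "?D ^\<^sub>m (?N + ?N) = - 1\<^sub>m (?N + ?N)"
  proof -
    have "?D ^\<^sub>m (?N + ?N) = four_block_mat (- 1\<^sub>m ?N) ?Z ?Z (- 1\<^sub>m ?N)"
      using double_block_power[OF A, of ?N] unfolding mult_2 p .
    also have "\<dots> = - 1\<^sub>m (?N + ?N)" by (intro eq_matI) auto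
    finally show ?thesis .
  qed
  moreover have "?D $$ (a, b) \<in> \<int>" if "a < ?N + ?N" "b < ?N + ?N" for a b
    using that A int by (auto simp: D)
  moreover have e: "2 ^ Suc i = ?N + ?N" by simp
  ultimately show ?thesis
    unfolding rotation_block_def Let_def e
    by (intro conjI allI impI bexI[of _ ?W] double_block_carrier[OF A] W oW dW WD)
qed

lemma J_block_Suc: "J_block (Suc i) = double_block (J_block i)"
  using J_block_carrier[of i] by (simp add: double_block_def)

lemma rotation_block_J: "rotation_block i (J_block i)"
proof (induction i)
  case 0
  let ?J = "Matrix.mat 1 1 (\<lambda>_. - 1) :: real mat"
  have 1: "?J * transpose_mat ?J = 1\<^sub>m 1" "?J ^\<^sub>m 1 = - 1\<^sub>m 1"
    "1\<^sub>m 1 * ?J = ?J * (?J * (?J * (?J * (?J * 1\<^sub>m 1))))"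
    by (intro eq_matI; auto simp: scalar_prod_def)+
  show ?case
    unfolding rotation_block_def Let_def
    using 1 by (auto intro!: bexI[of _ "1\<^sub>m 1"])
next
  case (Suc i)
  then show ?case unfolding J_block_Suc by (rule rotation_block_double)
qed

text \<open>Doubling multiplies the determinant by \<open>(-1) ^ 2 ^ i\<close>, which is -1 for
  \<open>i = 0\<close> only and there corrects the determinant -1 of \<open>J_0\<close>.\<close>

lemma det_J_block: "i \<ge> 1 \<Longrightarrow> Determinant.det (J_block i) = 1"
proof (induction i rule: dec_induct)
  have step: "Determinant.det (J_block (Suc i)) = (-1) ^ 2 ^ i * Determinant.det (J_block i)" for i
  proof -
    note J = J_block_carrier[of i]
    have "Determinant.det (J_block (Suc i)) = Determinant.det (0\<^sub>m (2 ^ i) (2 ^ i) * 0\<^sub>m (2 ^ i) (2 ^ i) - J_block i * 1\<^sub>m (2 ^ i))"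
      unfolding J_block.simps by (rule det_four_block_mat) (use J in auto)
    also have "0\<^sub>m (2 ^ i) (2 ^ i) * 0\<^sub>m (2 ^ i) (2 ^ i) - J_block i * 1\<^sub>m (2 ^ i) = (-1) \<cdot>\<^sub>m J_block i"
      using J by (intro eq_matI) auto
    finally show ?thesis using J by simp
  qed
  {
    case base
    have "Determinant.det (J_block 0) = -1" by (simp add: det_single)
    then show ?case using step[of 0] by simp
  next
    case (step n)
    then show ?case using \<open>Determinant.det (J_block (Suc n)) = _\<close> by simp
  }
qed

text \<open>Even powers are block diagonal and lead back to smaller \<open>i\<close>; odd powers
  have zero diagonal blocks. As \<open>J\<close> is orthogonal, the vectors \<open>J^a e_0\<close>
  with \<open>a < 2 ^ i\<close> are therefore orthonormal.\<close>

lemma J_block_power_00: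
  "0 < c \<Longrightarrow> c < 2 ^ i \<Longrightarrow> (J_block i ^\<^sub>m c) $$ (0, 0) = 0"
proof (induction i arbitrary: c)
  case (Suc i)
  note J = J_block_carrier[of i]
  have pos: "(0::nat) < 2 ^ i" by simp
  show ?case
  proof (cases "even c")
    case True
    then obtain k where k: "c = 2 * k" by (rule evenE)
    then have "(J_block i ^\<^sub>m k) $$ (0, 0) = 0" using Suc by auto
    then show ?thesis unfolding J_block_Suc k double_block_power[OF J] using J pos by simp
  next
    case False
    then obtain k where k: "c = 2 * k + 1" by (rule oddE)
    have "J_block (Suc i) ^\<^sub>m c = four_block_mat (J_block i ^\<^sub>m k) (0\<^sub>m (2 ^ i) (2 ^ i)) (0\<^sub>m (2 ^ i) (2 ^ i)) (J_block i ^\<^sub>m k) * double_block (J_block i)"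
      unfolding J_block_Suc k by (simp add: double_block_power[OF J, of k, simplified])
    also have "\<dots> = four_block_mat (0\<^sub>m (2 ^ i) (2 ^ i)) (J_block i ^\<^sub>m k * J_block i) (J_block i ^\<^sub>m k) (0\<^sub>m (2 ^ i) (2 ^ i))"
      by (rule double_block_mult(2)) (use J in auto)
    finally show ?thesis using J pos by simp
  qed
qed simp

text \<open>\<open>C\<close> and \<open>J\<close> are conjugate by the signed permutation matrix with columns \<open>J^a e_0\<close>.\<close>

lemma conjugate_C_J:
  assumes "i \<ge> 1"
  obtains Y where "Y \<in> carrier_mat (2 ^ i) (2 ^ i)" "transpose_mat Y * Y = 1\<^sub>m (2 ^ i)"
    "Y * C_block i = J_block i * Y"
proof -
  let ?N = "2 ^ i :: nat" and ?J = "J_block i"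
  note J = J_block_carrier[of i]
  have rb: "?J * transpose_mat ?J = 1\<^sub>m ?N" "?J ^\<^sub>m ?N = - 1\<^sub>m ?N"
    using rotation_block_J[of i] by (auto simp: rotation_block_def Let_def)
  have JJ: "transpose_mat ?J * ?J = 1\<^sub>m ?N" by (rule transpose_mult_self[OF J rb(1)])
  have N: "?N \<ge> 2" using assms by (cases i) auto
  define Y where "Y = Matrix.mat ?N ?N (\<lambda>(c, a). (?J ^\<^sub>m a) $$ (c, 0))"
  have Y: "Y \<in> carrier_mat ?N ?N" by (simp add: Y_def)
  have Jp: "?J ^\<^sub>m a \<in> carrier_mat ?N ?N" for a using J by simp
  \<comment> \<open>So the inner product of the columns \<open>a\<close> and \<open>a + d\<close> of
    \<open>Y\<close> is an entry of \<open>J^d\<close>.\<close>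
  have tp: "transpose_mat (?J ^\<^sub>m a) * ?J ^\<^sub>m (a + d) = ?J ^\<^sub>m d" for a d
  proof (induction a)
    case 0
    then show ?case using J by simp
  next
    case (Suc a)
    have T: "transpose_mat ?J \<in> carrier_mat ?N ?N" "transpose_mat (?J ^\<^sub>m a) \<in> carrier_mat ?N ?N"
      using J Jp by auto
    have s: "?J ^\<^sub>m Suc k = ?J * ?J ^\<^sub>m k" for k
    proof (induction k)
      case (Suc k)
      then show ?case using assoc_sq[OF J Jp J] by simp
    qed (use J in simp)
    have "transpose_mat (?J ^\<^sub>m Suc a) * ?J ^\<^sub>m (Suc a + d)
        = (transpose_mat (?J ^\<^sub>m a) * transpose_mat ?J) * (?J * ?J ^\<^sub>m (a + d))"
      unfolding add_Suc s transpose_mult[OF J Jp[of a]] ..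
    also have "\<dots> = transpose_mat (?J ^\<^sub>m a) * ((transpose_mat ?J * ?J) * ?J ^\<^sub>m (a + d))"
      using T J Jp[of a] Jp[of "a + d"] by (simp add: assoc_sq[where N = ?N])
    also have "\<dots> = ?J ^\<^sub>m d" unfolding JJ left_mult_one_mat[OF Jp] by (rule Suc)
    finally show ?case .
  qed
  have entry: "(transpose_mat Y * Y) $$ (a, b) = (transpose_mat (?J ^\<^sub>m a) * ?J ^\<^sub>m b) $$ (0, 0)"
    if "a < ?N" "b < ?N" for a b
    using that N J Jp carrier_matD[OF Jp] by (simp add: Y_def scalar_prod_def)
  have pos: "0 < ?N" by simp
  have le: "(transpose_mat Y * Y) $$ (a, b) = (if a = b then 1 else 0)" if "a \<le> b" "b < ?N" for a b
  proof -
    have "(transpose_mat Y * Y) $$ (a, b) = (?J ^\<^sub>m (b - a)) $$ (0, 0)"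
      using entry[of a b] tp[of a "b - a"] that by simp
    then show ?thesis
      using that J_block_power_00[of "b - a" i] J pos by (cases "a = b") auto
  qed
  have sym: "(transpose_mat Y * Y) $$ (a, b) = (transpose_mat Y * Y) $$ (b, a)" if "a < ?N" "b < ?N" for a b
    using that Y by (simp add: comm_scalar_prod[of _ ?N])
  have 1: "transpose_mat Y * Y = 1\<^sub>m ?N"
  proof (rule eq_matI)
    fix a b assume "a < dim_row (1\<^sub>m ?N :: real mat)" "b < dim_col (1\<^sub>m ?N :: real mat)"
    then have ab: "a < ?N" "b < ?N" by auto
    show "(transpose_mat Y * Y) $$ (a, b) = 1\<^sub>m ?N $$ (a, b)"
      using le[of a b] le[of b a] sym[OF ab] ab by (cases "a \<le> b") auto
  qed (use Y in auto)
  have s: "?J ^\<^sub>m Suc k = ?J * ?J ^\<^sub>m k" for k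
  proof (induction k)
    case (Suc k)
    then show ?case using assoc_sq[OF J Jp J] by simp
  qed (use J in simp)
  \<comment> \<open>\<open>C\<close> moves each basis vector to the next one and \<open>J\<close>
    moves \<open>J^a e_0\<close> to \<open>J^(a+1) e_0\<close>; in the last column the entry -1 of
    \<open>C\<close> corresponds to \<open>J^N = -1\<close>.\<close>
  have 2: "Y * C_block i = ?J * Y"
  proof (rule eq_matI)
    fix c a assume "c < dim_row (?J * Y)" "a < dim_col (?J * Y)"
    then have ca: "c < ?N" "a < ?N" using J Y by auto
    have R: "(?J * Y) $$ (c, a) = (?J ^\<^sub>m Suc a) $$ (c, 0)"
      unfolding s using ca J Y Jp[of a] carrier_matD[OF Jp[of a]] carrier_matD[OF J] pos
      by (simp add: scalar_prod_def Y_def)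
    have "(Y * C_block i) $$ (c, a) = (\<Sum>d = 0..<?N. (?J ^\<^sub>m d) $$ (c, 0) *
        (if d = a + 1 then 1 else if d = 0 \<and> a = ?N - 1 then - 1 else 0))"
      using ca by (simp add: scalar_prod_def Y_def C_block_def)
    also have "\<dots> = (?J ^\<^sub>m Suc a) $$ (c, 0)"
    proof (cases "a = ?N - 1")
      case True
      then have "(\<Sum>d = 0..<?N. (?J ^\<^sub>m d) $$ (c, 0) *
        (if d = a + 1 then 1 else if d = 0 \<and> a = ?N - 1 then - 1 else 0))
        = (\<Sum>d = 0..<?N. if d = 0 then - ((?J ^\<^sub>m 0) $$ (c, 0)) else 0)"
        by (intro sum.cong) auto
      also have "\<dots> = - (1\<^sub>m ?N $$ (c, 0))" using J pos by simp
      also have "\<dots> = (?J ^\<^sub>m Suc a) $$ (c, 0)"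
      proof -
        have "Suc a = ?N" using True N by simp
        then show ?thesis using rb(2) ca by simp
      qed
      finally show ?thesis .
    next
      case False
      then have "(\<Sum>d = 0..<?N. (?J ^\<^sub>m d) $$ (c, 0) *
        (if d = a + 1 then 1 else if d = 0 \<and> a = ?N - 1 then - 1 else 0))
        = (\<Sum>d = 0..<?N. if d = a + 1 then (?J ^\<^sub>m (a + 1)) $$ (c, 0) else 0)"
        by (intro sum.cong) auto
      also have "\<dots> = (?J ^\<^sub>m Suc a) $$ (c, 0)" using False ca by simp
      finally show ?thesis .
    qed
    finally show "(Y * C_block i) $$ (c, a) = (?J * Y) $$ (c, a)" using R by simp
  qed (use J Y in \<open>auto simp: C_block_def\<close>)
  show ?thesis by (rule that[OF Y 1 2])
qed

text \<open>All clauses but integrality are invariant under conjugation by the orthogonal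
  \<open>Y\<close> and are transported from \<open>J\<close>; integrality is visible from the
  entries.\<close>

lemma rotation_block_C:
  assumes i: "i \<ge> 1"
  shows "rotation_block i (C_block i)" "Determinant.det (C_block i) = 1"
proof -
  let ?N = "2 ^ i :: nat" and ?J = "J_block i" and ?C = "C_block i"
  obtain Y where Y: "Y \<in> carrier_mat ?N ?N" and YY: "transpose_mat Y * Y = 1\<^sub>m ?N"
    and YC: "Y * ?C = ?J * Y"
    using conjugate_C_J[OF i] by blast
  let ?T = "transpose_mat Y"
  note J = J_block_carrier[of i]
  have C: "?C \<in> carrier_mat ?N ?N" by (simp add: C_block_def)
  have T: "?T \<in> carrier_mat ?N ?N" using Y by simp
  have YT: "Y * ?T = 1\<^sub>m ?N" by (rule mat_mult_left_right_inverse[OF T Y YY])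
  from rotation_block_J[of i] obtain U where o: "?J * transpose_mat ?J = 1\<^sub>m ?N"
    and p: "?J ^\<^sub>m ?N = - 1\<^sub>m ?N" and U: "U \<in> carrier_mat ?N ?N"
    and oU: "U * transpose_mat U = 1\<^sub>m ?N" and dU: "Determinant.det U = 1"
    and UJ: "U * ?J = ?J * (?J * (?J * (?J * (?J * U))))"
    by (auto simp: rotation_block_def Let_def)
  note as = assoc_sq[where N = ?N]
  have conj_mult: "(?T * (A * Y)) * (?T * (B * Y)) = ?T * ((A * B) * Y)"
    if "A \<in> carrier_mat ?N ?N" "B \<in> carrier_mat ?N ?N" for A B
  proof -
    have "(?T * (A * Y)) * (?T * (B * Y)) = ?T * (A * ((Y * ?T) * (B * Y)))"
      using that T Y as by (simp add: assoc_sq[where N = ?N])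
    also have "\<dots> = ?T * (A * (B * Y))" unfolding YT using that Y by simp
    also have "A * (B * Y) = (A * B) * Y" by (rule as[symmetric]) (use that Y in auto)
    finally show ?thesis .
  qed
  have conj_transpose: "transpose_mat (?T * (A * Y)) = ?T * (transpose_mat A * Y)"
    if "A \<in> carrier_mat ?N ?N" for A
  proof -
    have "transpose_mat (?T * (A * Y)) = transpose_mat (A * Y) * transpose_mat ?T"
      by (rule transpose_mult) (use that T Y in auto)
    also have "\<dots> = (?T * transpose_mat A) * Y"
      using transpose_mult[OF that Y] by simp
    also have "\<dots> = ?T * (transpose_mat A * Y)" by (rule as) (use that T Y in auto)
    finally show ?thesis .
  qed
  have conj_one: "?T * (1\<^sub>m ?N * Y) = 1\<^sub>m ?N" using YY Y by simp
  have conj_det: "Determinant.det (?T * (A * Y)) = Determinant.det A"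
    if "A \<in> carrier_mat ?N ?N" for A
  proof -
    have "Determinant.det (?T * (A * Y)) = Determinant.det ?T * Determinant.det (A * Y)"
      by (rule Determinant.det_mult) (use that T Y in auto)
    also have "Determinant.det (A * Y) = Determinant.det A * Determinant.det Y"
      by (rule Determinant.det_mult) (use that Y in auto)
    also have "Determinant.det ?T = Determinant.det Y" by (rule Determinant.det_transpose[OF Y])
    finally have "Determinant.det (?T * (A * Y)) = Determinant.det A * (Determinant.det Y * Determinant.det Y)"
      by (simp add: mult_ac)
    then show ?thesis unfolding det_orthogonal_sq[OF Y YT] by simp
  qed
  have CJ: "?C = ?T * (?J * Y)"
  proof -
    have "?T * (Y * ?C) = (?T * Y) * ?C" by (rule as[symmetric]) (use T Y C in auto)
    then show ?thesis unfolding YY YC using C by simp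
  qed
  have pow: "?C ^\<^sub>m k = ?T * (?J ^\<^sub>m k * Y)" for k
  proof (induction k)
    case 0
    then show ?case using C J conj_one by simp
  next
    case (Suc k)
    have Jk: "?J ^\<^sub>m k \<in> carrier_mat ?N ?N" using J by simp
    have "?C ^\<^sub>m Suc k = (?T * (?J ^\<^sub>m k * Y)) * (?T * (?J * Y))"
      unfolding pow_mat.simps(2) Suc CJ[symmetric] ..
    also have "\<dots> = ?T * (?J ^\<^sub>m Suc k * Y)"
      unfolding conj_mult[OF Jk J] pow_mat.simps(2) ..
    finally show ?case .
  qed
  have "?C ^\<^sub>m ?N = ?T * ((- 1\<^sub>m ?N) * Y)" unfolding pow p ..
  also have "\<dots> = - (?T * (1\<^sub>m ?N * Y))" using T Y by simp
  finally have Cp: "?C ^\<^sub>m ?N = - 1\<^sub>m ?N" unfolding conj_one .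
  have Co: "?C * transpose_mat ?C = 1\<^sub>m ?N"
    unfolding CJ conj_transpose[OF J] conj_mult[OF J transpose_carrier_mat[THEN iffD2, OF J]] o
    by (rule conj_one)
  let ?V = "?T * (U * Y)"
  have V: "?V \<in> carrier_mat ?N ?N" using T U Y by simp
  have Vo: "?V * transpose_mat ?V = 1\<^sub>m ?N"
    unfolding conj_transpose[OF U] conj_mult[OF U transpose_carrier_mat[THEN iffD2, OF U]] oU
    by (rule conj_one)
  have Vd: "Determinant.det ?V = 1" unfolding conj_det[OF U] by (rule dU)
  have VC: "?V * ?C = ?C * (?C * (?C * (?C * (?C * ?V))))"
  proof -
    have c: "?J * U \<in> carrier_mat ?N ?N" "?J * (?J * U) \<in> carrier_mat ?N ?N"
      "?J * (?J * (?J * U)) \<in> carrier_mat ?N ?N" "?J * (?J * (?J * (?J * U))) \<in> carrier_mat ?N ?N"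
      using J U by auto
    show ?thesis
      unfolding CJ conj_mult[OF U J] conj_mult[OF J U] conj_mult[OF J c(1)] conj_mult[OF J c(2)]
        conj_mult[OF J c(3)] conj_mult[OF J c(4)] UJ ..
  qed
  have "?C $$ (a, b) \<in> \<int>" if "a < ?N" "b < ?N" for a b
    using that by (simp add: C_block_def)
  then show "rotation_block i ?C"
    unfolding rotation_block_def Let_def
    by (intro conjI allI impI bexI[of _ ?V] C Co Cp V Vo Vd VC)
  show "Determinant.det ?C = 1"
    unfolding CJ conj_det[OF J] by (rule det_J_block[OF i])
qed

text \<open>\<open>e_a, e_b\<close> span the plane of a block \<open>C_1\<close>;
  \<open>e_m\<close> is the fixed direction.\<close>

definition holonomy_mat :: "nat \<Rightarrow> nat \<Rightarrow> real mat \<Rightarrow> bool" where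
  "holonomy_mat r m A \<longleftrightarrow> A \<in> carrier_mat (Suc m) (Suc m) \<and>
    (\<forall>a<Suc m. \<forall>b<Suc m. A $$ (a, b) \<in> \<int>) \<and>
    A * transpose_mat A = 1\<^sub>m (Suc m) \<and> Determinant.det A = 1 \<and>
    (\<exists>U\<in>carrier_mat (Suc m) (Suc m). U * transpose_mat U = 1\<^sub>m (Suc m) \<and> Determinant.det U = 1 \<and>
       U * A = A * (A * (A * (A * (A * U)))) \<and> (\<forall>c\<le>m. U $$ (m, c) = (if c = m then 1 else 0))) \<and>
    (\<forall>c\<le>m. A $$ (m, c) = (if c = m then 1 else 0) \<and> A $$ (c, m) = (if c = m then 1 else 0)) \<and>
    (\<forall>j<m. \<exists>i. 1 \<le> i \<and> i < r \<and> (\<forall>c\<le>m. (A ^\<^sub>m 2 ^ i) $$ (j, c) = (if c = j then -1 else 0))) \<and>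
    (\<exists>a b. a < m \<and> b < m \<and> a \<noteq> b \<and>
      (\<forall>p\<le>m. \<forall>q\<le>m. A $$ (p, q) \<noteq> 0 \<longrightarrow> (p = b \<longleftrightarrow> q = a) \<and> (p = a \<longleftrightarrow> q = b)))"

text \<open>\<open>C_1\<close> is a quarter turn: it exchanges its two coordinates up to sign, and
  its square is -1, so \<open>i = 1\<close> serves for both of them.\<close>

lemma holonomy_mat_base:
  assumes "r \<ge> 2"
  shows "holonomy_mat r 2 (diag_block_mat [C_block 1, 1\<^sub>m 1])"
proof -
  let ?A = "four_block_mat (C_block 1) (0\<^sub>m 2 1) (0\<^sub>m 1 2) (1\<^sub>m 1)"
  have C: "C_block 1 \<in> carrier_mat 2 2" by (simp add: C_block_def)
  have A: "diag_block_mat [C_block 1, 1\<^sub>m 1] = ?A"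
    using diag_block_mat_last[of "[C_block 1]" "1\<^sub>m 1"] carrier_matD[OF C] by (simp add: Let_def del: diag_block_mat.simps)
  have rb: "rotation_block 1 (C_block 1)" "Determinant.det (C_block 1) = 1"
    by (rule rotation_block_C; simp)+
  then obtain U where o: "C_block 1 * transpose_mat (C_block 1) = 1\<^sub>m 2" and p: "C_block 1 ^\<^sub>m 2 = - 1\<^sub>m 2"
    and U: "U \<in> carrier_mat 2 2" and oU: "U * transpose_mat U = 1\<^sub>m 2" and dU: "Determinant.det U = 1"
    and UC: "U * C_block 1 = C_block 1 * (C_block 1 * (C_block 1 * (C_block 1 * (C_block 1 * U))))"
    by (auto simp: rotation_block_def Let_def)
  have one: "(1\<^sub>m 1 :: real mat) \<in> carrier_mat 1 1" by simp
  have oneb: "(1\<^sub>m (Suc 2) :: real mat) = four_block_mat (1\<^sub>m 2) (0\<^sub>m 2 1) (0\<^sub>m 1 2) (1\<^sub>m 1)"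
    using one_four_block[of 2 1] by simp
  let ?U = "four_block_mat U (0\<^sub>m 2 1) (0\<^sub>m 1 2) (1\<^sub>m 1)"
  have tone: "transpose_mat (1\<^sub>m 1) = (1\<^sub>m 1 :: real mat)" by simp
  have 1: "?A * transpose_mat ?A = 1\<^sub>m (Suc 2)"
    unfolding diag_transpose[OF C one] tone diag_mult[OF C one transpose_carrier_mat[THEN iffD2, OF C] one] o oneb
    by simp
  have 2: "?U * transpose_mat ?U = 1\<^sub>m (Suc 2)"
    unfolding diag_transpose[OF U one] tone diag_mult[OF U one transpose_carrier_mat[THEN iffD2, OF U] one] oU oneb
    by simp
  have 3: "?U * ?A = ?A * (?A * (?A * (?A * (?A * ?U))))"
  proof -
    have c: "C_block 1 * U \<in> carrier_mat 2 2" "C_block 1 * (C_block 1 * U) \<in> carrier_mat 2 2"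
      "C_block 1 * (C_block 1 * (C_block 1 * U)) \<in> carrier_mat 2 2"
      "C_block 1 * (C_block 1 * (C_block 1 * (C_block 1 * U))) \<in> carrier_mat 2 2"
      using C U by auto
    have o1: "1\<^sub>m 1 * 1\<^sub>m 1 = (1\<^sub>m 1 :: real mat)" by simp
    show ?thesis
      unfolding diag_mult[OF U one C one] diag_mult[OF C one U one] o1 diag_mult[OF C one c(1) one]
        diag_mult[OF C one c(2) one] diag_mult[OF C one c(3) one] diag_mult[OF C one c(4) one] UC ..
  qed
  have d: "Determinant.det (four_block_mat V (0\<^sub>m 2 1) (0\<^sub>m 1 2) (1\<^sub>m 1)) = Determinant.det V"
    if "V \<in> carrier_mat 2 2" for V :: "real mat"
    using det_four_block_mat_upper_right_zero[OF that refl zero_carrier_mat one] by simp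
  have 4: "(?A ^\<^sub>m 2 ^ 1) $$ (j, c) = (if c = j then -1 else 0)" if "j < 2" "c \<le> 2" for j c
  proof -
    have "1\<^sub>m 1 ^\<^sub>m 2 = (1\<^sub>m 1 :: real mat)" by (simp add: numeral_2_eq_2)
    then have "?A ^\<^sub>m 2 ^ 1 = four_block_mat (- 1\<^sub>m 2) (0\<^sub>m 2 1) (0\<^sub>m 1 2) (1\<^sub>m 1)"
      unfolding power_one_right diag_power[OF C one] p by (rule arg_cong)
    then show ?thesis using that by auto
  qed
  have ent: "?A $$ (a, b) = (if (a, b) = (1, 0) then 1 else if (a, b) = (0, 1) then -1
      else if (a, b) = (2, 2) then 1 else 0)" if "a \<le> 2" "b \<le> 2" for a b
    using that by (auto simp: C_block_def le_Suc_eq numeral_2_eq_2)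
  have Um: "?U $$ (2, c) = (if c = 2 then 1 else 0)" if "c \<le> 2" for c
    using that U by auto
  show ?thesis
    unfolding holonomy_mat_def A
  proof (intro conjI allI impI)
    show "?A \<in> carrier_mat (Suc 2) (Suc 2)" using C by auto
    show "?A $$ (a, b) \<in> \<int>" if "a < Suc 2" "b < Suc 2" for a b
      using that by (subst ent) auto
    show "?A * transpose_mat ?A = 1\<^sub>m (Suc 2)" by (rule 1)
    show "Determinant.det ?A = 1" using d[OF C] rb by simp
    show "\<exists>U\<in>carrier_mat (Suc 2) (Suc 2). U * transpose_mat U = 1\<^sub>m (Suc 2) \<and> Determinant.det U = 1 \<and>
       U * ?A = ?A * (?A * (?A * (?A * (?A * U)))) \<and> (\<forall>c\<le>2. U $$ (2, c) = (if c = 2 then 1 else 0))"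
      using U 2 3 d[OF U] dU Um by (intro bexI[of _ ?U] conjI) auto
    show "?A $$ (2, c) = (if c = 2 then 1 else 0)" "?A $$ (c, 2) = (if c = 2 then 1 else 0)" if "c \<le> 2" for c
      by (subst ent; use that in auto)+
    show "\<exists>i. 1 \<le> i \<and> i < r \<and> (\<forall>c\<le>2. (?A ^\<^sub>m 2 ^ i) $$ (j, c) = (if c = j then -1 else 0))" if "j < 2" for j
      using 4[OF that] assms by (intro exI[of _ 1]) auto
    show "\<exists>a b. a < 2 \<and> b < 2 \<and> a \<noteq> b \<and>
      (\<forall>p\<le>2. \<forall>q\<le>2. ?A $$ (p, q) \<noteq> 0 \<longrightarrow> (p = b \<longleftrightarrow> q = a) \<and> (p = a \<longleftrightarrow> q = b))"
    proof -
      have pl: "(p = 1 \<longleftrightarrow> q = 0) \<and> (p = 0 \<longleftrightarrow> q = 1)" if "p \<le> 2" "q \<le> 2" "?A $$ (p, q) \<noteq> 0" for p q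
        using that(3) unfolding ent[OF that(1,2)] by (auto split: if_splits)
      then have "(0::nat) < 2 \<and> (1::nat) < 2 \<and> (0::nat) \<noteq> 1 \<and>
        (\<forall>p\<le>2. \<forall>q\<le>2. ?A $$ (p, q) \<noteq> 0 \<longrightarrow> (p = 1 \<longleftrightarrow> q = 0) \<and> (p = 0 \<longleftrightarrow> q = 1))"
        by (intro conjI allI impI pl[THEN conjunct1] pl[THEN conjunct2]) simp_all
      then show ?thesis by blast
    qed
  qed
qed

text \<open>Every clause is checked blockwise. The fixed axis and the plane of \<open>C_1\<close>
  are inherited from the lower block, shifted by \<open>2 ^ i\<close>.\<close>

lemma holonomy_mat_step:
  assumes D: "rotation_block i D" "Determinant.det D = 1" "1 \<le> i" "i < r"
    and H: "holonomy_mat r m A"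
  shows "holonomy_mat r (2 ^ i + m)
    (four_block_mat D (0\<^sub>m (2 ^ i) (Suc m)) (0\<^sub>m (Suc m) (2 ^ i)) A)"
proof -
  let ?N = "2 ^ i :: nat" and ?M = "Suc m"
  from D(1) obtain V where cD: "D \<in> carrier_mat ?N ?N"
    and iD: "\<And>a b. a < ?N \<Longrightarrow> b < ?N \<Longrightarrow> D $$ (a, b) \<in> \<int>"
    and oD: "D * transpose_mat D = 1\<^sub>m ?N" and pD: "D ^\<^sub>m ?N = - 1\<^sub>m ?N"
    and cV: "V \<in> carrier_mat ?N ?N" and oV: "V * transpose_mat V = 1\<^sub>m ?N" and dV: "Determinant.det V = 1"
    and VD: "V * D = D * (D * (D * (D * (D * V))))"
    by (auto simp: rotation_block_def Let_def)
  note H' = H[unfolded holonomy_mat_def]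
  have cA: "A \<in> carrier_mat ?M ?M" using H' by (elim conjE)
  have oA: "A * transpose_mat A = 1\<^sub>m ?M" using H' by (elim conjE)
  have dA: "Determinant.det A = 1" using H' by (elim conjE)
  have iA': "\<forall>a<?M. \<forall>b<?M. A $$ (a, b) \<in> \<int>" using H' by (elim conjE)
  have lA': "\<forall>c\<le>m. A $$ (m, c) = (if c = m then 1 else 0) \<and> A $$ (c, m) = (if c = m then 1 else 0)"
    using H' by (elim conjE)
  have kA: "\<forall>j<m. \<exists>i. 1 \<le> i \<and> i < r \<and> (\<forall>c\<le>m. (A ^\<^sub>m 2 ^ i) $$ (j, c) = (if c = j then -1 else 0))"
    using H' by (elim conjE)
  have "\<exists>U\<in>carrier_mat ?M ?M. U * transpose_mat U = 1\<^sub>m ?M \<and> Determinant.det U = 1 \<and>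
       U * A = A * (A * (A * (A * (A * U)))) \<and> (\<forall>c\<le>m. U $$ (m, c) = (if c = m then 1 else 0))"
    using H' by (elim conjE)
  then obtain U where cU: "U \<in> carrier_mat ?M ?M" and oU: "U * transpose_mat U = 1\<^sub>m ?M"
    and dU: "Determinant.det U = 1" and UA: "U * A = A * (A * (A * (A * (A * U))))"
    and lU': "\<forall>c\<le>m. U $$ (m, c) = (if c = m then 1 else 0)" by blast
  have "\<exists>a b. a < m \<and> b < m \<and> a \<noteq> b \<and>
      (\<forall>p\<le>m. \<forall>q\<le>m. A $$ (p, q) \<noteq> 0 \<longrightarrow> (p = b \<longleftrightarrow> q = a) \<and> (p = a \<longleftrightarrow> q = b))"
    using H' by (elim conjE)
  then obtain a b where ab: "a < m" "b < m" "a \<noteq> b"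
    and pA': "\<forall>p\<le>m. \<forall>q\<le>m. A $$ (p, q) \<noteq> 0 \<longrightarrow> (p = b \<longleftrightarrow> q = a) \<and> (p = a \<longleftrightarrow> q = b)" by blast
  have iA: "A $$ (p, q) \<in> \<int>" if "p < ?M" "q < ?M" for p q using iA' that by blast
  have lU: "U $$ (m, c) = (if c = m then 1 else 0)" if "c \<le> m" for c using lU' that by blast
  have lA: "A $$ (m, c) = (if c = m then 1 else 0)" "A $$ (c, m) = (if c = m then 1 else 0)" if "c \<le> m" for c
    using lA' that by blast+
  have pA: "(p = b \<longleftrightarrow> q = a) \<and> (p = a \<longleftrightarrow> q = b)" if "p \<le> m" "q \<le> m" "A $$ (p, q) \<noteq> 0" for p q
    using pA' that by blast
  let ?d = "\<lambda>X Y. four_block_mat X (0\<^sub>m ?N ?M) (0\<^sub>m ?M ?N) (Y :: real mat)"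
  have t: "transpose_mat X \<in> carrier_mat k k" if "X \<in> carrier_mat k k" for X :: "real mat" and k
    using that by simp
  have orth: "?d X Y * transpose_mat (?d X Y) = 1\<^sub>m (Suc (?N + m))"
    if "X \<in> carrier_mat ?N ?N" "Y \<in> carrier_mat ?M ?M" "X * transpose_mat X = 1\<^sub>m ?N" "Y * transpose_mat Y = 1\<^sub>m ?M" for X Y
    unfolding diag_transpose[OF that(1,2)] diag_mult[OF that(1,2) t[OF that(1)] t[OF that(2)]] that(3,4)
    by (simp only: one_four_block[symmetric] add_Suc_right)
  have det: "Determinant.det (?d X Y) = Determinant.det X * Determinant.det Y"
    if "X \<in> carrier_mat ?N ?N" "Y \<in> carrier_mat ?M ?M" for X Y :: "real mat"
    by (rule det_four_block_mat_upper_right_zero[OF that(1) refl zero_carrier_mat that(2)])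
  have e: "?d X Y $$ (p, q) = (if p < ?N then if q < ?N then X $$ (p, q) else 0
      else if q < ?N then 0 else Y $$ (p - ?N, q - ?N))"
    if "X \<in> carrier_mat ?N ?N" "Y \<in> carrier_mat ?M ?M" "p \<le> ?N + m" "q \<le> ?N + m" for X Y p q
    using that by auto
  have conj: "?d V U * ?d D A = ?d D A * (?d D A * (?d D A * (?d D A * (?d D A * ?d V U))))"
  proof -
    have c1: "D * V \<in> carrier_mat ?N ?N" "D * (D * V) \<in> carrier_mat ?N ?N"
      "D * (D * (D * V)) \<in> carrier_mat ?N ?N" "D * (D * (D * (D * V))) \<in> carrier_mat ?N ?N"
      using cD cV by auto
    have c2: "A * U \<in> carrier_mat ?M ?M" "A * (A * U) \<in> carrier_mat ?M ?M"
      "A * (A * (A * U)) \<in> carrier_mat ?M ?M" "A * (A * (A * (A * U))) \<in> carrier_mat ?M ?M"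
      using cA cU by auto
    show ?thesis
      unfolding diag_mult[OF cV cU cD cA] diag_mult[OF cD cA cV cU] diag_mult[OF cD cA c1(1) c2(1)]
        diag_mult[OF cD cA c1(2) c2(2)] diag_mult[OF cD cA c1(3) c2(3)]
        diag_mult[OF cD cA c1(4) c2(4)] UA VD ..
  qed
  show ?thesis
    unfolding holonomy_mat_def
  proof (intro conjI allI impI)
    show "?d D A \<in> carrier_mat (Suc (?N + m)) (Suc (?N + m))" using cD cA by auto
    show "?d D A $$ (p, q) \<in> \<int>" if "p < Suc (?N + m)" "q < Suc (?N + m)" for p q
      using that iD iA by (subst e[OF cD cA]) auto
    show "?d D A * transpose_mat (?d D A) = 1\<^sub>m (Suc (?N + m))" by (rule orth[OF cD cA oD oA])
    show "Determinant.det (?d D A) = 1" unfolding det[OF cD cA] D(2) dA by simp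
    show "\<exists>U\<in>carrier_mat (Suc (?N + m)) (Suc (?N + m)). U * transpose_mat U = 1\<^sub>m (Suc (?N + m)) \<and>
       Determinant.det U = 1 \<and> U * ?d D A = ?d D A * (?d D A * (?d D A * (?d D A * (?d D A * U)))) \<and>
       (\<forall>c\<le>?N + m. U $$ (?N + m, c) = (if c = ?N + m then 1 else 0))"
    proof (intro bexI[of _ "?d V U"] conjI allI impI)
      show "?d V U * transpose_mat (?d V U) = 1\<^sub>m (Suc (?N + m))" by (rule orth[OF cV cU oV oU])
      show "Determinant.det (?d V U) = 1" unfolding det[OF cV cU] dV dU by simp
      show "?d V U $$ (?N + m, c) = (if c = ?N + m then 1 else 0)" if "c \<le> ?N + m" for c
        using that lU[of "c - ?N"] by (subst e[OF cV cU]) auto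
      show "?d V U \<in> carrier_mat (Suc (?N + m)) (Suc (?N + m))" using cV cU by auto
    qed (rule conj)
    show "?d D A $$ (?N + m, c) = (if c = ?N + m then 1 else 0)" if "c \<le> ?N + m" for c
      using that lA(1)[of "c - ?N"] by (subst e[OF cD cA]) auto
    show "?d D A $$ (c, ?N + m) = (if c = ?N + m then 1 else 0)" if "c \<le> ?N + m" for c
      using that lA(2)[of "c - ?N"] by (subst e[OF cD cA]) auto
    show "\<exists>i. 1 \<le> i \<and> i < r \<and> (\<forall>c\<le>?N + m. (?d D A ^\<^sub>m 2 ^ i) $$ (j, c) = (if c = j then -1 else 0))"
      if j: "j < ?N + m" for j
    proof (cases "j < ?N")
      case True
      have "(?d D A ^\<^sub>m ?N) $$ (j, c) = (if c = j then -1 else 0)" if "c \<le> ?N + m" for c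
        unfolding diag_power[OF cD cA] pD
        using True that cA by (subst e) auto
      then show ?thesis using D(3,4) by blast
    next
      case False
      then have "j - ?N < m" using j by simp
      then obtain l where l: "1 \<le> l" "l < r"
        "\<And>c. c \<le> m \<Longrightarrow> (A ^\<^sub>m 2 ^ l) $$ (j - ?N, c) = (if c = j - ?N then -1 else 0)"
        using kA by blast
      have "(?d D A ^\<^sub>m 2 ^ l) $$ (j, c) = (if c = j then -1 else 0)" if "c \<le> ?N + m" for c
        unfolding diag_power[OF cD cA]
        using False that j cA cD l(3)[of "c - ?N"] by (subst e) auto
      then show ?thesis using l(1,2) by blast
    qed
    show "\<exists>a b. a < ?N + m \<and> b < ?N + m \<and> a \<noteq> b \<and>
      (\<forall>p\<le>?N + m. \<forall>q\<le>?N + m. ?d D A $$ (p, q) \<noteq> 0 \<longrightarrow> (p = b \<longleftrightarrow> q = a) \<and> (p = a \<longleftrightarrow> q = b))"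
    proof -
      have pl: "(p = ?N + b \<longleftrightarrow> q = ?N + a) \<and> (p = ?N + a \<longleftrightarrow> q = ?N + b)"
        if pq: "p \<le> ?N + m" "q \<le> ?N + m" "?d D A $$ (p, q) \<noteq> 0" for p q
      proof -
        consider "p < ?N" "q < ?N" | "\<not> p < ?N" "\<not> q < ?N" "A $$ (p - ?N, q - ?N) \<noteq> 0"
          using pq(3) unfolding e[OF cD cA pq(1,2)] by (auto split: if_splits)
        then show ?thesis
        proof cases
          case 2
          obtain p' where p: "p = ?N + p'" using 2(1) le_Suc_ex[of ?N p] by (auto simp: not_less)
          obtain q' where q: "q = ?N + q'" using 2(2) le_Suc_ex[of ?N q] by (auto simp: not_less)
          have "(p' = b \<longleftrightarrow> q' = a) \<and> (p' = a \<longleftrightarrow> q' = b)"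
            by (rule pA) (use pq(1,2) 2(3) in \<open>simp_all add: p q\<close>)
          then show ?thesis unfolding p q add_left_cancel .
        next
          case 1
          then have "p \<noteq> ?N + x" "q \<noteq> ?N + x" for x by linarith+
          then show ?thesis by blast
        qed
      qed
      show ?thesis
      proof (rule exI[of _ "?N + a"], rule exI[of _ "?N + b"], intro conjI allI impI)
        fix p q assume "p \<le> ?N + m" "q \<le> ?N + m" "?d D A $$ (p, q) \<noteq> 0"
        from pl[OF this] show "p = ?N + b \<longleftrightarrow> q = ?N + a" by (rule conjunct1)
      next
        fix p q assume "p \<le> ?N + m" "q \<le> ?N + m" "?d D A $$ (p, q) \<noteq> 0"
        from pl[OF this] show "p = ?N + a \<longleftrightarrow> q = ?N + b" by (rule conjunct2)
      qed (use ab in simp_all)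
    qed
  qed
qed

lemma holonomy_mat_list:
  assumes "r \<ge> 2" and "\<And>D. D \<in> set Ds \<Longrightarrow> \<exists>i. rotation_block i D \<and> Determinant.det D = 1 \<and> 1 \<le> i \<and> i < r"
  shows "\<exists>m. holonomy_mat r m (diag_block_mat (Ds @ [C_block 1, 1\<^sub>m 1]))"
  using assms(2)
proof (induction Ds)
  case Nil
  then show ?case using holonomy_mat_base[OF assms(1)] by auto
next
  case (Cons D Ds)
  then obtain m where H: "holonomy_mat r m (diag_block_mat (Ds @ [C_block 1, 1\<^sub>m 1]))" by auto
  obtain i where i: "rotation_block i D" "Determinant.det D = 1" "1 \<le> i" "i < r"
    using Cons.prems by auto
  have "D \<in> carrier_mat (2 ^ i) (2 ^ i)" using i(1) by (simp add: rotation_block_def Let_def)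
  moreover have "diag_block_mat (Ds @ [C_block 1, 1\<^sub>m 1]) \<in> carrier_mat (Suc m) (Suc m)"
    using H by (simp add: holonomy_mat_def)
  ultimately have eq: "diag_block_mat ((D # Ds) @ [C_block 1, 1\<^sub>m 1])
     = four_block_mat D (0\<^sub>m (2 ^ i) (Suc m)) (0\<^sub>m (Suc m) (2 ^ i)) (diag_block_mat (Ds @ [C_block 1, 1\<^sub>m 1]))"
    by (simp only: append_Cons diag_block_mat.simps Let_def carrier_matD)
  show ?case unfolding eq using holonomy_mat_step[OF i H] by blast
qed

text \<open>As \<open>k' 1 = 0\<close>, oddness provides at least one block \<open>C_1\<close>. The
  last of them and the final 1 form the base case, to which the remaining blocks are
  prepended.\<close>

lemma holonomy_mat_B:
  assumes r: "r \<ge> 2" and k: "k' 1 = 0" "odd (k 1 + k' 1)"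
  shows "holonomy_mat r (B_dim r k k' - 1) (B_mat r k k')"
proof -
  let ?f = "\<lambda>i. replicate (k i) (C_block i) @ replicate (k' i) (J_block i)"
  obtain l where l: "k 1 = Suc l" using k by (cases "k 1") auto
  have "[1..<r] = 1 # [2..<r]" using r by (simp add: upt_rec numeral_2_eq_2)
  then have "concat (map ?f (rev [1..<r])) @ [1\<^sub>m 1]
    = (concat (map ?f (rev [2..<r])) @ replicate l (C_block 1)) @ [C_block 1, 1\<^sub>m 1]"
    using k l by (simp add: replicate_append_same[symmetric])
  moreover have "\<exists>m. holonomy_mat r m (diag_block_mat
      ((concat (map ?f (rev [2..<r])) @ replicate l (C_block 1)) @ [C_block 1, 1\<^sub>m 1]))"
  proof (rule holonomy_mat_list[OF r])
    fix D assume "D \<in> set (concat (map ?f (rev [2..<r])) @ replicate l (C_block 1))"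
    then have "D \<in> (\<Union>i\<in>{2..<r}. {C_block i, J_block i}) \<union> {C_block 1}"
      by (auto split: if_splits)
    then obtain i where "i = 1 \<and> D = C_block 1 \<or> i \<in> {2..<r} \<and> (D = C_block i \<or> D = J_block i)"
      by blast
    then have i: "1 \<le> i" "i < r" "D = C_block i \<or> D = J_block i"
      using r by auto
    then show "\<exists>i. rotation_block i D \<and> Determinant.det D = 1 \<and> 1 \<le> i \<and> i < r"
      using rotation_block_C[OF i(1)] rotation_block_J[of i] det_J_block[OF i(1)] by blast
  qed
  ultimately obtain m where m: "holonomy_mat r m (B_mat r k k')" by (auto simp: B_mat_def)
  then have "B_mat r k k' \<in> carrier_mat (Suc m) (Suc m)" by (simp add: holonomy_mat_def)
  then have "Suc m = B_dim r k k'" using B_mat_carrier[of r k k'] by auto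
  then show ?thesis using m by (metis diff_Suc_1)
qed

lemma B_dim_mod_4:
  assumes "r \<ge> 2" "odd (k 1 + k' 1)"
  shows "B_dim r k k' mod 4 = 3"
proof -
  have "{1..<r} = insert 1 {2..<r}" using assms by auto
  then have sum: "(\<Sum>i = 1..<r. 2 ^ i * (k i + k' i)) = 2 * (k 1 + k' 1) + (\<Sum>i = 2..<r. 2 ^ i * (k i + k' i))"
    by simp
  have "4 dvd (\<Sum>i = 2..<r. 2 ^ i * (k i + k' i))"
  proof (rule dvd_sum)
    fix i assume "i \<in> {2..<r}"
    then have "(2::nat) ^ 2 dvd 2 ^ i" by (intro le_imp_power_dvd) simp
    then show "4 dvd 2 ^ i * (k i + k' i)" by simp
  qed
  then obtain t where t: "(\<Sum>i = 2..<r. 2 ^ i * (k i + k' i)) = 4 * t" by (rule dvdE)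
  obtain q where q: "k 1 + k' 1 = 2 * q + 1" using assms(2) by (rule oddE)
  have "B_dim r k k' = 4 * (q + t) + 3" unfolding B_dim_def sum q t by simp
  then show ?thesis by presburger
qed

section \<open>Transfer to matrices indexed by a linear order\<close>

abbreviation pos :: "'n::{finite,linorder} \<Rightarrow> nat" where
  "pos i \<equiv> card {..<i}"

lemma bij_pos: "bij_betw pos (UNIV :: 'n::{finite,linorder} set) {0..<CARD('n)}"
proof -
  have "strict_mono (pos :: 'n \<Rightarrow> nat)"
    by (intro strict_monoI psubset_card_mono) auto
  then have inj: "inj (pos :: 'n \<Rightarrow> nat)" by (rule strict_mono_imp_inj_on)
  have lt: "pos i < CARD('n)" for i :: 'n
    by (intro psubset_card_mono) auto
  have "pos ` (UNIV :: 'n set) = {0..<CARD('n)}"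
    by (rule card_subset_eq) (use lt inj in \<open>auto simp: card_image\<close>)
  then show ?thesis using inj by (simp add: bij_betw_def)
qed

lemma pos_less: "pos (i :: 'n::{finite,linorder}) < CARD('n)"
  by (intro psubset_card_mono) auto

lemma pos_inject: "pos i = pos j \<longleftrightarrow> i = (j :: 'n::{finite,linorder})"
  using bij_pos by (auto simp: bij_betw_def dest: injD)

lemma pos_surj: "a < CARD('n) \<Longrightarrow> \<exists>i :: 'n::{finite,linorder}. pos i = a"
proof -
  assume "a < CARD('n)"
  then have "a \<in> pos ` (UNIV :: 'n set)"
    using bij_betw_imp_surj_on[OF bij_pos[where ?'n = 'n]] by simp
  then show ?thesis by auto
qed

lemma pos_Max: "pos (Max (UNIV :: 'n::{finite,linorder} set)) = CARD('n) - 1"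
proof -
  have "{..<Max (UNIV :: 'n set)} = UNIV - {Max UNIV}"
    by (auto simp: order.strict_iff_order)
  then show ?thesis by simp
qed

lemma mat_transfer_nth: "mat_transfer A $ i $ j = A $$ (pos i, pos j)"
  by (simp add: mat_transfer_def)

lemma mat_transfer_mult:
  assumes "A \<in> carrier_mat CARD('n) CARD('n)" "B \<in> carrier_mat CARD('n) CARD('n)"
  shows "(mat_transfer (A * B) :: 'n::{finite,linorder} sq_matrix) = mat_transfer A ** mat_transfer B"
proof -
  have "(mat_transfer (A * B) :: 'n sq_matrix) $ i $ j = (mat_transfer A ** mat_transfer B) $ i $ j" for i j
  proof -
    have "(mat_transfer (A * B) :: 'n sq_matrix) $ i $ j
        = (\<Sum>k = 0..<CARD('n). A $$ (pos i, k) * B $$ (k, pos j))"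
      using assms pos_less[of i] pos_less[of j] by (simp add: mat_transfer_nth scalar_prod_def)
    also have "\<dots> = (\<Sum>k\<in>UNIV. A $$ (pos i, pos (k :: 'n)) * B $$ (pos k, pos j))"
      by (rule sum.reindex_bij_betw[OF bij_pos, symmetric])
    finally show ?thesis by (simp add: matrix_matrix_mult_def mat_transfer_nth)
  qed
  then show ?thesis by (simp add: Finite_Cartesian_Product.vec_eq_iff)
qed

lemma mat_transfer_one: "(mat_transfer (1\<^sub>m CARD('n)) :: 'n::{finite,linorder} sq_matrix) = idm"
  by (auto simp: Finite_Cartesian_Product.vec_eq_iff mat_transfer_nth pos_less pos_inject Finite_Cartesian_Product.mat_def)

lemma mat_transfer_transpose:
  assumes "A \<in> carrier_mat CARD('n) CARD('n)"
  shows "(mat_transfer (transpose_mat A) :: 'n::{finite,linorder} sq_matrix) = transpose (mat_transfer A)"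
  using assms
  by (auto simp: Finite_Cartesian_Product.vec_eq_iff mat_transfer_nth pos_less Finite_Cartesian_Product.transpose_def)

lemma mat_transfer_power:
  assumes "A \<in> carrier_mat CARD('n) CARD('n)"
  shows "(mat_transfer (A ^\<^sub>m k) :: 'n::{finite,linorder} sq_matrix) *v x = ((*v) (mat_transfer A) ^^ k) x"
proof (induction k arbitrary: x)
  case 0
  then show ?case using assms by (simp add: mat_transfer_one)
next
  case (Suc k)
  then show ?case using assms
    by (simp add: mat_transfer_mult matrix_vector_mul_assoc[symmetric] funpow_swap1)
qed

lemma minor_mat_transfer:
  assumes "A \<in> carrier_mat CARD('n) CARD('n)"
  shows "minor (mat_transfer A :: 'n::{finite,linorder} sq_matrix) UNIV UNIV = Determinant.det A"
proof -
  let ?xs = "sorted_list_of_set (UNIV :: 'n set)"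
  have p: "pos (?xs ! a) = a" if "a < CARD('n)" for a
  proof -
    have "\<exists>i :: 'n. pos i = a" by (rule pos_surj[OF that])
    then obtain i :: 'n where i: "pos i = a" by blast
    have "?xs ! card {j \<in> UNIV. j < i} = i" by (rule nth_sorted_list_of_set_card) auto
    moreover have "{j \<in> UNIV. j < i} = {..<i}" by auto
    ultimately show ?thesis using i by simp
  qed
  have "Matrix.mat CARD('n) CARD('n) (\<lambda>(a, b). (mat_transfer A :: 'n sq_matrix) $ (?xs ! a) $ (?xs ! b)) = A"
    using assms p by (intro eq_matI) (auto simp: mat_transfer_nth)
  then show ?thesis by (simp add: minor_def)
qed

section \<open>Coordinate reflections\<close>

definition reflection :: "'n \<Rightarrow> 'n::finite sq_matrix" where
  "reflection a = (\<chi> i j. if i = j then if i = a then -1 else 1 else 0)"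

lemma reflection_mult_right: "(A ** reflection a) $ i $ j = A $ i $ j * (if j = a then -1 else 1)"
  by (simp add: matrix_matrix_mult_def reflection_def if_distrib[of "\<lambda>x. _ * x"] cong: if_cong)

lemma reflection_mult_left: "(reflection a ** A) $ i $ j = (if i = a then -1 else 1) * A $ i $ j"
  by (simp add: matrix_matrix_mult_def reflection_def if_distrib[of "\<lambda>x. x * _"] cong: if_cong)

lemma reflection_apply: "(reflection a *v x) $ i = (if i = a then - x $ i else x $ i)"
  by (simp add: matrix_vector_mult_def reflection_def if_distrib[of "\<lambda>x. x * _"] cong: if_cong)

lemma reflection_reflection: "reflection a ** reflection a = idm"
proof -
  have "(reflection a ** reflection a) $ i $ j = idm $ i $ j" for i j
    unfolding reflection_mult_left by (simp add: reflection_def Finite_Cartesian_Product.mat_def)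
  then show ?thesis by (simp add: Finite_Cartesian_Product.vec_eq_iff)
qed

lemma transpose_reflection: "transpose (reflection a) = reflection a"
  by (auto simp: Finite_Cartesian_Product.vec_eq_iff reflection_def Finite_Cartesian_Product.transpose_def)

lemma minor_reflection: "minor (reflection a :: 'n::{finite,linorder} sq_matrix) UNIV UNIV = -1"
proof -
  define D where "D = Matrix.mat CARD('n) CARD('n) (\<lambda>(p, q). if p = q then if p = pos a then -1 else 1 else 0 :: real)"
  have D: "D \<in> carrier_mat CARD('n) CARD('n)" by (simp add: D_def)
  have "reflection a = mat_transfer D"
    by (auto simp: Finite_Cartesian_Product.vec_eq_iff mat_transfer_nth reflection_def D_def pos_less pos_inject)
  then have "minor (reflection a) UNIV UNIV = Determinant.det D" using minor_mat_transfer[OF D] by simp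
  also have "\<dots> = prod_list (diag_mat D)"
    by (rule det_upper_triangular[OF _ D]) (auto simp: upper_triangular_def D_def)
  also have "\<dots> = (\<Prod>p = 0..<CARD('n). D $$ (p, p))"
    unfolding prod_list_diag_prod carrier_matD(1)[OF D] ..
  also have "\<dots> = (\<Prod>p = 0..<CARD('n). if p = pos a then -1 else 1)"
    by (rule prod.cong) (auto simp: D_def)
  also have "\<dots> = -1" using pos_less[of a] by (simp add: prod.delta)
  finally show ?thesis .
qed

text \<open>\<open>U\<close> conjugates \<open>B\<close> to \<open>B^5\<close> and fixes the axis of \<open>B\<close>; the coordinates \<open>a, b\<close>
  belong to a block \<open>C_1\<close>, which exists because \<open>j_1\<close> is odd.\<close>

locale holonomy =
  fixes B U :: "'n::{finite,linorder} sq_matrix" and r :: nat and a b :: 'n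
  assumes r: "r \<ge> 2" and card_mod_4: "CARD('n) mod 4 = 3"
    and B_int: "\<And>i j. B $ i $ j \<in> \<int>"
    and B_orth: "B ** transpose B = idm" and B_det: "minor B UNIV UNIV = 1"
    and B_row: "\<And>j. B $ Max UNIV $ j = (if j = Max UNIV then 1 else 0)"
    and B_col: "\<And>j. B $ j $ Max UNIV = (if j = Max UNIV then 1 else 0)"
    and B_pow: "\<And>j. j \<noteq> Max UNIV \<Longrightarrow> \<exists>i. 1 \<le> i \<and> i < r \<and> (\<forall>x. (((*v) B ^^ 2 ^ i) x) $ j = - (x $ j))"
    and ab: "a \<noteq> b" "a \<noteq> Max UNIV" "b \<noteq> Max UNIV"
    and B_refl: "B ** reflection a = reflection b ** B" "B ** reflection b = reflection a ** B"
    and U_orth: "U ** transpose U = idm" and U_det: "minor U UNIV UNIV = 1"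
    and U_row: "\<And>j. U $ Max UNIV $ j = (if j = Max UNIV then 1 else 0)"
    and U_conj: "U ** B = B ** (B ** (B ** (B ** (B ** U))))"

lemma holonomy_exists:
  assumes r: "r \<ge> 2" and k: "k' 1 = 0" "odd (k 1 + k' 1)" and n: "CARD('n) = B_dim r k k'"
  obtains U :: "'n::{finite,linorder} sq_matrix" and a b :: 'n
  where "holonomy (mat_transfer (B_mat r k k')) U r a b"
proof -
  let ?n = "CARD('n)" and ?m = "B_dim r k k' - 1" and ?A = "B_mat r k k'"
  let ?B = "mat_transfer ?A :: 'n sq_matrix" and ?M = "Max UNIV :: 'n"
  have nm: "Suc ?m = ?n" using n by (simp add: B_dim_def)
  have H: "holonomy_mat r ?m ?A" by (rule holonomy_mat_B[where k = k and k' = k', OF r k])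
  note H' = H[unfolded holonomy_mat_def nm]
  have pM: "pos ?M = ?m" using nm by (simp add: pos_Max)
  have le: "pos i \<le> ?m" for i :: 'n using pos_less[of i] nm by simp
  have eqM: "pos i = ?m \<longleftrightarrow> i = ?M" for i :: 'n using pos_inject[of i ?M] pM by simp
  have cA: "?A \<in> carrier_mat ?n ?n" using H' by (elim conjE)
  have oA: "?A * transpose_mat ?A = 1\<^sub>m ?n" using H' by (elim conjE)
  have dA: "Determinant.det ?A = 1" using H' by (elim conjE)
  have iA: "\<forall>a<?n. \<forall>b<?n. ?A $$ (a, b) \<in> \<int>" using H' by (elim conjE)
  have lA: "\<forall>c\<le>?m. ?A $$ (?m, c) = (if c = ?m then 1 else 0) \<and> ?A $$ (c, ?m) = (if c = ?m then 1 else 0)"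
    using H' by (elim conjE)
  have kA: "\<forall>j<?m. \<exists>i. 1 \<le> i \<and> i < r \<and> (\<forall>c\<le>?m. (?A ^\<^sub>m 2 ^ i) $$ (j, c) = (if c = j then -1 else 0))"
    using H' by (elim conjE)
  have pA: "\<exists>a b. a < ?m \<and> b < ?m \<and> a \<noteq> b \<and>
      (\<forall>p\<le>?m. \<forall>q\<le>?m. ?A $$ (p, q) \<noteq> 0 \<longrightarrow> (p = b \<longleftrightarrow> q = a) \<and> (p = a \<longleftrightarrow> q = b))"
    using H' by (elim conjE)
  have "\<exists>U\<in>carrier_mat ?n ?n. U * transpose_mat U = 1\<^sub>m ?n \<and> Determinant.det U = 1 \<and>
       U * ?A = ?A * (?A * (?A * (?A * (?A * U)))) \<and> (\<forall>c\<le>?m. U $$ (?m, c) = (if c = ?m then 1 else 0))"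
    using H' by (elim conjE)
  then obtain U where cU: "U \<in> carrier_mat ?n ?n" and oU: "U * transpose_mat U = 1\<^sub>m ?n"
    and dU: "Determinant.det U = 1" and UA: "U * ?A = ?A * (?A * (?A * (?A * (?A * U))))"
    and lU: "\<forall>c\<le>?m. U $$ (?m, c) = (if c = ?m then 1 else 0)" by blast
  from pA obtain a' b' where ab: "a' < ?m" "b' < ?m" "a' \<noteq> b'"
    and pl: "\<forall>p\<le>?m. \<forall>q\<le>?m. ?A $$ (p, q) \<noteq> 0 \<longrightarrow> (p = b' \<longleftrightarrow> q = a') \<and> (p = a' \<longleftrightarrow> q = b')" by blast
  have "a' < ?n" "b' < ?n" using ab nm by auto
  then obtain a b :: 'n where a: "pos a = a'" and b: "pos b = b'" by (metis pos_surj)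
  let ?U = "mat_transfer U :: 'n sq_matrix"
  have t: "transpose_mat X \<in> carrier_mat ?n ?n" if "X \<in> carrier_mat ?n ?n" for X :: "real mat"
    using that by simp
  have nz: "(i = b \<longleftrightarrow> j = a) \<and> (i = a \<longleftrightarrow> j = b)" if "?B $ i $ j \<noteq> 0" for i j
    using pl le[of i] le[of j] that unfolding mat_transfer_nth a[symmetric] b[symmetric] pos_inject[symmetric]
    by blast
  have "holonomy ?B ?U r a b"
  proof
    show "?n mod 4 = 3" using B_dim_mod_4[where k = k and k' = k', OF r k(2)] n by simp
    show "?B $ i $ j \<in> \<int>" for i j using iA pos_less[of i] pos_less[of j] by (simp add: mat_transfer_nth)
    show "?B ** transpose ?B = idm"
      unfolding mat_transfer_transpose[OF cA, symmetric] mat_transfer_mult[OF cA t[OF cA], symmetric] oA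
      by (rule mat_transfer_one)
    show "?U ** transpose ?U = idm"
      unfolding mat_transfer_transpose[OF cU, symmetric] mat_transfer_mult[OF cU t[OF cU], symmetric] oU
      by (rule mat_transfer_one)
    show "minor ?B UNIV UNIV = 1" "minor ?U UNIV UNIV = 1"
      using minor_mat_transfer[OF cA] minor_mat_transfer[OF cU] dA dU by simp_all
    show "?B $ ?M $ j = (if j = ?M then 1 else 0)" "?B $ j $ ?M = (if j = ?M then 1 else 0)" for j
      using lA le[of j] eqM[of j] unfolding mat_transfer_nth pM by simp_all
    show "?U $ ?M $ j = (if j = ?M then 1 else 0)" for j
      using lU le[of j] eqM[of j] unfolding mat_transfer_nth pM by simp
    show "a \<noteq> b" using ab a b by auto
    show "a \<noteq> ?M" "b \<noteq> ?M" using ab a b pM by auto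
    show "?B ** reflection a = reflection b ** ?B"
    proof -
      have "(?B ** reflection a) $ i $ j = (reflection b ** ?B) $ i $ j" for i j
        unfolding reflection_mult_left reflection_mult_right using nz[of i j] by (cases "?B $ i $ j = 0") auto
      then show ?thesis by (simp add: Finite_Cartesian_Product.vec_eq_iff)
    qed
    show "?B ** reflection b = reflection a ** ?B"
    proof -
      have "(?B ** reflection b) $ i $ j = (reflection a ** ?B) $ i $ j" for i j
        unfolding reflection_mult_left reflection_mult_right using nz[of i j] by (cases "?B $ i $ j = 0") auto
      then show ?thesis by (simp add: Finite_Cartesian_Product.vec_eq_iff)
    qed
    show "?U ** ?B = ?B ** (?B ** (?B ** (?B ** (?B ** ?U))))"
    proof -
      have c: "?A * U \<in> carrier_mat ?n ?n" "?A * (?A * U) \<in> carrier_mat ?n ?n"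
        "?A * (?A * (?A * U)) \<in> carrier_mat ?n ?n" "?A * (?A * (?A * (?A * U))) \<in> carrier_mat ?n ?n"
        using cA cU by auto
      show ?thesis
        unfolding mat_transfer_mult[OF cU cA, symmetric] mat_transfer_mult[OF cA cU, symmetric]
          mat_transfer_mult[OF cA c(1), symmetric] mat_transfer_mult[OF cA c(2), symmetric]
          mat_transfer_mult[OF cA c(3), symmetric] mat_transfer_mult[OF cA c(4), symmetric] UA ..
    qed
    show "\<exists>i. 1 \<le> i \<and> i < r \<and> (\<forall>x. (((*v) ?B ^^ 2 ^ i) x) $ j = - (x $ j))" if j: "j \<noteq> ?M" for j
    proof -
      have "pos j < ?m" using le[of j] eqM[of j] j by simp
      then obtain i where i: "1 \<le> i" "i < r"
        and e: "\<And>c. c \<le> ?m \<Longrightarrow> (?A ^\<^sub>m 2 ^ i) $$ (pos j, c) = (if c = pos j then -1 else 0)"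
        using kA by blast
      have "(((*v) ?B ^^ 2 ^ i) x) $ j = - (x $ j)" for x
      proof -
        have "(((*v) ?B ^^ 2 ^ i) x) $ j = (mat_transfer (?A ^\<^sub>m 2 ^ i) *v x) $ j"
          by (simp add: mat_transfer_power[OF cA])
        also have "\<dots> = (\<Sum>c\<in>UNIV. (if c = j then -1 else 0) * x $ c)"
          unfolding matrix_vector_mult_def using e[OF le]
          by (simp add: mat_transfer_nth pos_inject)
        also have "\<dots> = - (x $ j)" by (simp add: if_distrib[of "\<lambda>x. x * _"] cong: if_cong)
        finally show ?thesis .
      qed
      then show ?thesis using i by blast
    qed
  qed (rule r)
  then show ?thesis by (rule that)
qed

no_notation scalar_prod (infix "\<bullet>" 70)

section \<open>Fourier series of periodic functions\<close>

definition lattice_pt :: "real ^ 'n \<Rightarrow> bool" where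
  "lattice_pt v \<longleftrightarrow> (\<forall>i. v $ i \<in> \<int>)"

definition periodic :: "(real ^ 'n \<Rightarrow> real) \<Rightarrow> bool" where
  "periodic f \<longleftrightarrow> (\<forall>x v. lattice_pt v \<longrightarrow> f (x + v) = f x)"

definition C1 :: "(real ^ 'n::finite \<Rightarrow> real) \<Rightarrow> bool" where
  "C1 f \<longleftrightarrow> (\<forall>x. f differentiable (at x)) \<and> (\<forall>j. continuous_on UNIV (partial_deriv j f))"

definition ones :: "real ^ 'n::finite" where
  "ones = One"

lemma ones_nth [simp]: "ones $ i = 1"
proof -
  have "(One :: real ^ 'a) \<bullet> axis i 1 = 1"
    using inner_sum_left_Basis[of "axis i 1 :: real ^ 'a" "\<lambda>_. 1"] by (simp add: axis_in_Basis_iff)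
  then show ?thesis unfolding ones_def inner_axis by simp
qed

text \<open>The fundamental cube has volume 1, so for periodic functions this is the average over
  the torus.\<close>

definition mean :: "(real ^ 'n::finite \<Rightarrow> real) \<Rightarrow> real" where
  "mean f = integral (cbox 0 ones) f"

abbreviation cosw :: "real ^ 'n::finite \<Rightarrow> real ^ 'n \<Rightarrow> real" where
  "cosw \<mu> x \<equiv> cos (2 * pi * (\<mu> \<bullet> x))"

abbreviation sinw :: "real ^ 'n::finite \<Rightarrow> real ^ 'n \<Rightarrow> real" where
  "sinw \<mu> x \<equiv> sin (2 * pi * (\<mu> \<bullet> x))"

lemma partial_deriv_eq: "(f has_derivative f') (at x) \<Longrightarrow> partial_deriv j f x = f' (axis j 1)"
  unfolding partial_deriv_def by (simp add: frechet_derivative_at[symmetric])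

lemma has_derivative_C1: "C1 f \<Longrightarrow> (f has_derivative frechet_derivative f (at x)) (at x)"
  by (simp add: C1_def frechet_derivative_works)

lemma continuous_C1: "C1 f \<Longrightarrow> continuous_on UNIV f"
  by (simp add: C1_def differentiable_imp_continuous_on differentiable_on_def)

lemma C_infinity_C1:
  assumes "C_infinity f"
  shows "C1 f"
proof -
  have "C_k (Suc 0) f" using assms unfolding C_infinity_def by blast
  then show ?thesis by (simp add: C1_def differentiable_on_def)
qed

lemma partial_deriv_mult:
  assumes "C1 f" "C1 g"
  shows "partial_deriv j (\<lambda>x. f x * g x) x = f x * partial_deriv j g x + partial_deriv j f x * g x"
  unfolding partial_deriv_eq[OF has_derivative_mult[OF has_derivative_C1[OF assms(1)] has_derivative_C1[OF assms(2)]]]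
  by (simp add: partial_deriv_def)

lemma C1_mult:
  assumes "C1 f" "C1 g"
  shows "C1 (\<lambda>x. f x * g x)"
proof -
  have "partial_deriv j (\<lambda>x. f x * g x) = (\<lambda>x. f x * partial_deriv j g x + partial_deriv j f x * g x)" for j
    by (intro ext partial_deriv_mult assms)
  then show ?thesis
    using assms continuous_C1[OF assms(1)] continuous_C1[OF assms(2)]
    by (auto simp: C1_def intro!: differentiable_mult continuous_intros)
qed

lemma has_derivative_cosw: "(cosw \<mu> has_derivative (\<lambda>h. - sinw \<mu> x * (2 * pi * (\<mu> \<bullet> h)))) (at x)"
  by (auto intro!: derivative_eq_intros)

lemma has_derivative_sinw: "(sinw \<mu> has_derivative (\<lambda>h. cosw \<mu> x * (2 * pi * (\<mu> \<bullet> h)))) (at x)"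
  by (auto intro!: derivative_eq_intros)

lemma partial_deriv_cosw: "partial_deriv j (cosw \<mu>) = (\<lambda>x. - (2 * pi * \<mu> $ j) * sinw \<mu> x)"
  by (rule ext, subst partial_deriv_eq[OF has_derivative_cosw]) (simp add: inner_axis)

lemma partial_deriv_sinw: "partial_deriv j (sinw \<mu>) = (\<lambda>x. (2 * pi * \<mu> $ j) * cosw \<mu> x)"
  by (rule ext, subst partial_deriv_eq[OF has_derivative_sinw]) (simp add: inner_axis)

lemma C1_cosw: "C1 (cosw \<mu>)"
  unfolding C1_def partial_deriv_cosw
proof (intro conjI allI)
  show "cosw \<mu> differentiable at x" for x
    by (rule differentiableI[OF has_derivative_cosw])
  show "continuous_on UNIV (\<lambda>x. - (2 * pi * \<mu> $ j) * sinw \<mu> x)" for j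
    by (intro continuous_intros)
qed

lemma C1_sinw: "C1 (sinw \<mu>)"
  unfolding C1_def partial_deriv_sinw
proof (intro conjI allI)
  show "sinw \<mu> differentiable at x" for x
    by (rule differentiableI[OF has_derivative_sinw])
  show "continuous_on UNIV (\<lambda>x. 2 * pi * \<mu> $ j * cosw \<mu> x)" for j
    by (intro continuous_intros)
qed

lemma lattice_pt_inner: "lattice_pt \<mu> \<Longrightarrow> lattice_pt v \<Longrightarrow> \<mu> \<bullet> v \<in> \<int>"
  unfolding inner_vec_def lattice_pt_def by (auto intro!: Ints_sum)

lemma cos_sin_add_Int:
  assumes "k \<in> \<int>"
  shows "cos (2 * pi * (t + k)) = cos (2 * pi * t)" "sin (2 * pi * (t + k)) = sin (2 * pi * t)"
proof -
  have e: "2 * pi * (t + k) = 2 * pi * t + 2 * pi * k" by (simp add: algebra_simps)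
  obtain z where k: "k = of_int z" using assms by (rule Ints_cases)
  have "cos (2 * pi * k) = 1" "sin (2 * pi * k) = 0"
    unfolding k by (rule cos_int_2pin, rule sin_int_2pin)
  then show "cos (2 * pi * (t + k)) = cos (2 * pi * t)" "sin (2 * pi * (t + k)) = sin (2 * pi * t)"
    unfolding e cos_add sin_add by simp_all
qed

lemma periodic_cosw: "lattice_pt \<mu> \<Longrightarrow> periodic (cosw \<mu>)"
  by (simp add: periodic_def inner_add_right cos_sin_add_Int lattice_pt_inner)

lemma periodic_sinw: "lattice_pt \<mu> \<Longrightarrow> periodic (sinw \<mu>)"
  by (simp add: periodic_def inner_add_right cos_sin_add_Int lattice_pt_inner)

lemma lattice_pt_axis: "lattice_pt (axis j 1)"
  by (simp add: lattice_pt_def axis_def)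

lemma integrable_cube: "continuous_on UNIV (f :: real ^ 'n::finite \<Rightarrow> real) \<Longrightarrow> f integrable_on cbox a b"
  by (rule integrable_continuous) (rule continuous_on_subset, auto)

lemma mean_add: "continuous_on UNIV f \<Longrightarrow> continuous_on UNIV g \<Longrightarrow> mean (\<lambda>x. f x + g x) = mean f + mean g"
  unfolding mean_def by (intro integral_add integrable_cube)

lemma mean_scale: "mean (\<lambda>x. c * f x) = c * mean f"
  by (simp add: mean_def)

lemma mean_sum:
  "finite S \<Longrightarrow> (\<And>k. k \<in> S \<Longrightarrow> continuous_on UNIV (f k)) \<Longrightarrow> mean (\<lambda>x. \<Sum>k\<in>S. f k x) = (\<Sum>k\<in>S. mean (f k))"
  unfolding mean_def by (intro integral_sum integrable_cube)

text \<open>The shifted cube is cut at \<open>x $ j = 1\<close>, and the part beyond is moved back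
  by one period.\<close>

lemma mean_shift:
  fixes f :: "real ^ 'n::finite \<Rightarrow> real"
  assumes cont: "continuous_on UNIV f" and per: "periodic f" and t: "0 \<le> t" "t \<le> 1"
  shows "integral (cbox 0 ones) (\<lambda>y. f (y + t *\<^sub>R axis j 1)) = mean f"
proof -
  let ?e = "axis j 1 :: real ^ 'n"
  have all_split: "(\<forall>i. P i) \<longleftrightarrow> P j \<and> (\<forall>i. i \<noteq> j \<longrightarrow> P i)" for P by auto
  have mem: "x \<in> cbox u v \<longleftrightarrow> (u $ j \<le> x $ j \<and> x $ j \<le> v $ j) \<and>
      (\<forall>i. i \<noteq> j \<longrightarrow> u $ i \<le> x $ i \<and> x $ i \<le> v $ i)" for x u v :: "real ^ 'n"
    unfolding mem_box_cart by (rule all_split)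
  have ip: "x \<bullet> ?e = x $ j" for x :: "real ^ 'n" by (simp add: inner_axis)
  have int: "f integrable_on cbox a b" for a b by (rule integrable_cube[OF cont])
  have B: "?e \<in> Basis" by (simp add: axis_in_Basis_iff)
  have "integral (cbox 0 ones) (\<lambda>y. f (y + t *\<^sub>R ?e)) = integral (cbox (t *\<^sub>R ?e) (ones + t *\<^sub>R ?e)) f"
    using integral_shift_cbox[of "t *\<^sub>R ?e" "t *\<^sub>R ?e" "ones + t *\<^sub>R ?e" f] by simp
  also have "\<dots> = integral (cbox (t *\<^sub>R ?e) (ones + t *\<^sub>R ?e) \<inter> {x. x \<bullet> ?e \<le> 1}) f
      + integral (cbox (t *\<^sub>R ?e) (ones + t *\<^sub>R ?e) \<inter> {x. x \<bullet> ?e \<ge> 1}) f"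
    by (rule integral_split[OF int B])
  also have "cbox (t *\<^sub>R ?e) (ones + t *\<^sub>R ?e) \<inter> {x. x \<bullet> ?e \<le> 1} = cbox (t *\<^sub>R ?e) ones"
    unfolding ip
    by (rule Set.set_eqI, unfold Int_iff mem_Collect_eq mem)
      (use t in \<open>auto simp: axis_def\<close>)
  also have "cbox (t *\<^sub>R ?e) (ones + t *\<^sub>R ?e) \<inter> {x. x \<bullet> ?e \<ge> 1} = cbox (0 + ?e) (ones + (t - 1) *\<^sub>R ?e + ?e)"
    unfolding ip
    by (rule Set.set_eqI, unfold Int_iff mem_Collect_eq mem)
      (use t in \<open>auto simp: axis_def\<close>)
  also have "integral (cbox (0 + ?e) (ones + (t - 1) *\<^sub>R ?e + ?e)) f
      = integral (cbox 0 (ones + (t - 1) *\<^sub>R ?e)) (\<lambda>y. f (y + ?e))"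
    using integral_shift_cbox[of "0 + ?e" ?e "ones + (t - 1) *\<^sub>R ?e + ?e" f] by simp
  also have "(\<lambda>y. f (y + ?e)) = f"
    using per lattice_pt_axis[of j] by (auto simp: periodic_def)
  also have "cbox 0 (ones + (t - 1) *\<^sub>R ?e) = cbox 0 ones \<inter> {x. x \<bullet> ?e \<le> t}"
    unfolding ip
    by (rule Set.set_eqI, unfold Int_iff mem_Collect_eq mem)
      (use t in \<open>auto simp: axis_def\<close>)
  also have "cbox (t *\<^sub>R ?e) ones = cbox 0 ones \<inter> {x. x \<bullet> ?e \<ge> t}"
    unfolding ip
    by (rule Set.set_eqI, unfold Int_iff mem_Collect_eq mem)
      (use t in \<open>auto simp: axis_def\<close>)
  also have "integral (cbox 0 ones \<inter> {x. x \<bullet> ?e \<ge> t}) f + integral (cbox 0 ones \<inter> {x. x \<bullet> ?e \<le> t}) f = mean f"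
    unfolding mean_def using integral_split[OF int B, of 0 ones t] by simp
  finally show ?thesis .
qed

text \<open>The mean of \<open>f (y + t e_j)\<close> is constant in \<open>t\<close> by
  \<open>mean_shift\<close>; differentiate under the integral at \<open>t = 0\<close>.\<close>

lemma mean_partial_deriv:
  fixes f :: "real ^ 'n::finite \<Rightarrow> real"
  assumes C: "C1 f" and per: "periodic f"
  shows "mean (partial_deriv j f) = 0"
proof -
  let ?e = "axis j 1 :: real ^ 'n"
  have cont: "continuous_on UNIV f" by (rule continuous_C1[OF C])
  have cd: "continuous_on UNIV (partial_deriv j f)" using C by (simp add: C1_def)
  have "((\<lambda>t. integral (cbox 0 ones) (\<lambda>y. f (y + t *\<^sub>R ?e))) has_vector_derivative
      integral (cbox 0 ones) (\<lambda>y. partial_deriv j f (y + 0 *\<^sub>R ?e))) (at 0 within {0..1})"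
  proof (rule leibniz_rule_vector_derivative[where U = "{0..1}"])
    fix t :: real and y :: "real ^ 'n"
    have "((\<lambda>t. f (y + t *\<^sub>R ?e)) has_derivative
        (\<lambda>h. frechet_derivative f (at (y + t *\<^sub>R ?e)) (h *\<^sub>R ?e))) (at t within {0..1})"
      by (rule has_derivative_compose[OF _ has_derivative_C1[OF C], where f = "\<lambda>t. y + t *\<^sub>R ?e"])
        (auto intro!: derivative_eq_intros)
    moreover have "frechet_derivative f (at (y + t *\<^sub>R ?e)) (h *\<^sub>R ?e) = h *\<^sub>R partial_deriv j f (y + t *\<^sub>R ?e)" for h
      unfolding partial_deriv_def
      using linear_frechet_derivative[of f] C by (simp add: C1_def linear_cmul)
    ultimately show "((\<lambda>t. f (y + t *\<^sub>R ?e)) has_vector_derivative partial_deriv j f (y + t *\<^sub>R ?e)) (at t within {0..1})"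
      by (simp add: has_vector_derivative_def)
  next
    fix t :: real
    show "(\<lambda>y. f (y + t *\<^sub>R ?e)) integrable_on cbox 0 ones"
      by (intro integrable_cube continuous_on_compose2[OF cont]) (auto intro!: continuous_intros)
  next
    show "continuous_on ({0..1} \<times> cbox 0 ones) (\<lambda>(t, y). partial_deriv j f (y + t *\<^sub>R ?e))"
      unfolding case_prod_unfold
      by (rule continuous_on_compose2[OF cd]) (auto intro!: continuous_intros)
  qed auto
  then have 1: "((\<lambda>t. integral (cbox 0 ones) (\<lambda>y. f (y + t *\<^sub>R ?e))) has_vector_derivative
      mean (partial_deriv j f)) (at 0 within {0..1})"
    by (simp add: mean_def)
  have "((\<lambda>t. mean f) has_vector_derivative 0) (at (0::real) within {0..1})" by simp
  then have 2: "((\<lambda>t. integral (cbox 0 ones) (\<lambda>y. f (y + t *\<^sub>R ?e))) has_vector_derivative 0) (at 0 within {0..1})"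
    by (rule has_vector_derivative_transform[rotated 2]) (auto simp: mean_shift[OF cont per])
  show ?thesis
    using vector_derivative_unique_within_closed_interval[of 0 1 0, OF _ _ 1[folded box_real] 2[folded box_real]]
      vector_derivative_unique_within[OF _ 1 2] by (auto simp: at_within_Icc_at_right)
qed

section \<open>Real Fourier coefficients\<close>

definition Fc :: "real ^ 'n::finite \<Rightarrow> (real ^ 'n \<Rightarrow> real) \<Rightarrow> real" where
  "Fc \<mu> f = mean (\<lambda>x. cosw \<mu> x * f x)"

definition Fs :: "real ^ 'n::finite \<Rightarrow> (real ^ 'n \<Rightarrow> real) \<Rightarrow> real" where
  "Fs \<mu> f = mean (\<lambda>x. sinw \<mu> x * f x)"

lemma periodic_mult: "periodic f \<Longrightarrow> periodic g \<Longrightarrow> periodic (\<lambda>x. f x * g x)"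
  by (simp add: periodic_def)

lemma continuous_cosw: "continuous_on UNIV (cosw \<mu>)" and continuous_sinw: "continuous_on UNIV (sinw \<mu>)"
  by (intro continuous_intros)+

text \<open>Integration by parts: the derivative of the periodic function
  \<open>cosw \<mu> * f\<close> has mean 0.\<close>

lemma Fc_partial_deriv:
  assumes "C1 f" "periodic f" "lattice_pt \<mu>"
  shows "Fc \<mu> (partial_deriv j f) = 2 * pi * \<mu> $ j * Fs \<mu> f"
proof -
  have cd: "continuous_on UNIV (partial_deriv j f)" using assms by (simp add: C1_def)
  note cf = continuous_C1[OF assms(1)]
  have "0 = mean (partial_deriv j (\<lambda>x. cosw \<mu> x * f x))"
    by (rule mean_partial_deriv[symmetric]) (intro C1_mult C1_cosw periodic_mult periodic_cosw assms)+
  also have "partial_deriv j (\<lambda>x. cosw \<mu> x * f x)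
      = (\<lambda>x. cosw \<mu> x * partial_deriv j f x + (- (2 * pi * \<mu> $ j)) * (sinw \<mu> x * f x))"
    by (intro ext, subst partial_deriv_mult[OF C1_cosw assms(1)]) (simp add: partial_deriv_cosw)
  also have "mean \<dots> = Fc \<mu> (partial_deriv j f) + (- (2 * pi * \<mu> $ j)) * Fs \<mu> f"
    unfolding Fc_def Fs_def mean_scale[symmetric]
    by (intro mean_add continuous_on_mult continuous_on_const cd cf continuous_cosw continuous_sinw)
  finally show ?thesis by simp
qed

lemma Fs_partial_deriv:
  assumes "C1 f" "periodic f" "lattice_pt \<mu>"
  shows "Fs \<mu> (partial_deriv j f) = - (2 * pi * \<mu> $ j * Fc \<mu> f)"
proof -
  have cd: "continuous_on UNIV (partial_deriv j f)" using assms by (simp add: C1_def)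
  note cf = continuous_C1[OF assms(1)]
  have "0 = mean (partial_deriv j (\<lambda>x. sinw \<mu> x * f x))"
    by (rule mean_partial_deriv[symmetric]) (intro C1_mult C1_sinw periodic_mult periodic_sinw assms)+
  also have "partial_deriv j (\<lambda>x. sinw \<mu> x * f x)
      = (\<lambda>x. sinw \<mu> x * partial_deriv j f x + (2 * pi * \<mu> $ j) * (cosw \<mu> x * f x))"
    by (intro ext, subst partial_deriv_mult[OF C1_sinw assms(1)]) (simp add: partial_deriv_sinw)
  also have "mean \<dots> = Fs \<mu> (partial_deriv j f) + (2 * pi * \<mu> $ j) * Fc \<mu> f"
    unfolding Fc_def Fs_def mean_scale[symmetric]
    by (intro mean_add continuous_on_mult continuous_on_const cd cf continuous_cosw continuous_sinw)
  finally show ?thesis by simp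
qed

text \<open>A nonzero coordinate of \<open>\<mu>\<close> exhibits the cosine as a multiple of a
  partial derivative of the sine.\<close>

lemma mean_cosw:
  assumes "lattice_pt \<mu>"
  shows "mean (cosw \<mu>) = (if \<mu> = 0 then 1 else 0)"
proof (cases "\<mu> = 0")
  case True
  then show ?thesis by (simp add: mean_def ones_def)
next
  case False
  then obtain j where j: "\<mu> $ j \<noteq> 0" by (auto simp: Finite_Cartesian_Product.vec_eq_iff)
  have "(2 * pi * \<mu> $ j) * mean (cosw \<mu>) = 0"
    using mean_partial_deriv[OF C1_sinw periodic_sinw[OF assms], of j]
    unfolding partial_deriv_sinw mean_scale .
  then show ?thesis using j False by simp
qed

lemma mean_sinw:
  assumes "lattice_pt \<mu>"
  shows "mean (sinw \<mu>) = 0"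
proof (cases "\<mu> = 0")
  case True
  then show ?thesis by (simp add: mean_def ones_def)
next
  case False
  then obtain j where j: "\<mu> $ j \<noteq> 0" by (auto simp: Finite_Cartesian_Product.vec_eq_iff)
  have "- (2 * pi * \<mu> $ j) * mean (sinw \<mu>) = 0"
    using mean_partial_deriv[OF C1_cosw periodic_cosw[OF assms], of j]
    unfolding partial_deriv_cosw mean_scale .
  then show ?thesis using j by simp
qed

lemma lattice_pt_add: "lattice_pt u \<Longrightarrow> lattice_pt v \<Longrightarrow> lattice_pt (u + v)"
  and lattice_pt_diff: "lattice_pt u \<Longrightarrow> lattice_pt v \<Longrightarrow> lattice_pt (u - v)"
  and lattice_pt_uminus: "lattice_pt u \<Longrightarrow> lattice_pt (- u)"
  by (simp_all add: lattice_pt_def)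

lemma trig_products:
  "cosw \<mu> x * cosw \<nu> x = 1 / 2 * cosw (\<mu> - \<nu>) x + 1 / 2 * cosw (\<mu> + \<nu>) x"
  "sinw \<mu> x * sinw \<nu> x = 1 / 2 * cosw (\<mu> - \<nu>) x + - (1 / 2) * cosw (\<mu> + \<nu>) x"
  "cosw \<mu> x * sinw \<nu> x = 1 / 2 * sinw (\<mu> + \<nu>) x + - (1 / 2) * sinw (\<mu> - \<nu>) x"
  by (simp_all add: inner_add_left inner_diff_left distrib_left right_diff_distrib
      cos_add cos_diff sin_add sin_diff)

text \<open>Opposite frequencies carry the same cosine, so a nonzero one is detected twice with
  weight 1/2, and both halves add up at frequency 0.\<close>

lemma Fc_cosw:
  assumes "lattice_pt \<mu>" "lattice_pt \<nu>"
  shows "Fc \<mu> (cosw \<nu>) = 1 / 2 * (if \<mu> = \<nu> then 1 else 0) + 1 / 2 * (if \<mu> = - \<nu> then 1 else 0)"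
proof -
  have "Fc \<mu> (cosw \<nu>) = mean (\<lambda>x. 1 / 2 * cosw (\<mu> - \<nu>) x + 1 / 2 * cosw (\<mu> + \<nu>) x)"
    unfolding Fc_def trig_products(1) ..
  also have "\<dots> = mean (\<lambda>x. 1 / 2 * cosw (\<mu> - \<nu>) x) + mean (\<lambda>x. 1 / 2 * cosw (\<mu> + \<nu>) x)"
    by (rule mean_add) (intro continuous_intros)+
  also have "\<dots> = 1 / 2 * mean (cosw (\<mu> - \<nu>)) + 1 / 2 * mean (cosw (\<mu> + \<nu>))"
    unfolding mean_scale ..
  finally show ?thesis
    unfolding mean_cosw[OF lattice_pt_diff[OF assms]] mean_cosw[OF lattice_pt_add[OF assms]]
    by (simp add: eq_neg_iff_add_eq_0)
qed

lemma Fc_sinw: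
  assumes "lattice_pt \<mu>" "lattice_pt \<nu>"
  shows "Fc \<mu> (sinw \<nu>) = 0"
proof -
  have "Fc \<mu> (sinw \<nu>) = mean (\<lambda>x. 1 / 2 * sinw (\<mu> + \<nu>) x + - (1 / 2) * sinw (\<mu> - \<nu>) x)"
    unfolding Fc_def trig_products(3) ..
  also have "\<dots> = mean (\<lambda>x. 1 / 2 * sinw (\<mu> + \<nu>) x) + mean (\<lambda>x. - (1 / 2) * sinw (\<mu> - \<nu>) x)"
    by (rule mean_add) (intro continuous_intros)+
  also have "\<dots> = 1 / 2 * mean (sinw (\<mu> + \<nu>)) + - (1 / 2) * mean (sinw (\<mu> - \<nu>))"
    unfolding mean_scale ..
  finally show ?thesis
    unfolding mean_sinw[OF lattice_pt_diff[OF assms]] mean_sinw[OF lattice_pt_add[OF assms]]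
    by simp
qed

section \<open>Density of trigonometric polynomials and completeness\<close>

inductive_set trig_polys :: "(real ^ 'n::finite \<Rightarrow> real) set" where
  cos: "lattice_pt \<mu> \<Longrightarrow> cosw \<mu> \<in> trig_polys"
| sin: "lattice_pt \<mu> \<Longrightarrow> sinw \<mu> \<in> trig_polys"
| lincomb: "f \<in> trig_polys \<Longrightarrow> g \<in> trig_polys \<Longrightarrow> (\<lambda>x. a * f x + b * g x) \<in> trig_polys"

lemma trig_polys_mult:
  assumes "f \<in> trig_polys" "g \<in> trig_polys"
  shows "(\<lambda>x. f x * g x) \<in> trig_polys"
  using assms
proof (induction f arbitrary: g)
  case (cos \<mu>)
  from \<open>g \<in> trig_polys\<close> show ?case
  proof (induction g)
    case (cos \<nu>)
    show ?case unfolding trig_products(1)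
      by (intro trig_polys.intros lattice_pt_add lattice_pt_diff \<open>lattice_pt \<mu>\<close> cos)
  next
    case (sin \<nu>)
    show ?case unfolding trig_products(3)
      by (intro trig_polys.intros lattice_pt_add lattice_pt_diff \<open>lattice_pt \<mu>\<close> sin)
  next
    case (lincomb f g a b)
    have "(\<lambda>x. cosw \<mu> x * (a * f x + b * g x)) = (\<lambda>x. a * (cosw \<mu> x * f x) + b * (cosw \<mu> x * g x))"
      by (simp add: algebra_simps)
    then show ?case using trig_polys.lincomb[OF lincomb(3,4), of a b] by simp
  qed
next
  case (sin \<mu>)
  from \<open>g \<in> trig_polys\<close> show ?case
  proof (induction g)
    case (cos \<nu>)
    have "(\<lambda>x. sinw \<mu> x * cosw \<nu> x) = (\<lambda>x. 1 / 2 * sinw (\<nu> + \<mu>) x + - (1 / 2) * sinw (\<nu> - \<mu>) x)"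
      unfolding trig_products(3)[symmetric] by (simp add: mult.commute)
    then show ?case
      by (simp only:) (intro trig_polys.intros lattice_pt_add lattice_pt_diff \<open>lattice_pt \<mu>\<close> cos)
  next
    case (sin \<nu>)
    show ?case unfolding trig_products(2)
      by (intro trig_polys.intros lattice_pt_add lattice_pt_diff \<open>lattice_pt \<mu>\<close> sin)
  next
    case (lincomb f g a b)
    have "(\<lambda>x. sinw \<mu> x * (a * f x + b * g x)) = (\<lambda>x. a * (sinw \<mu> x * f x) + b * (sinw \<mu> x * g x))"
      by (simp add: algebra_simps)
    then show ?case using trig_polys.lincomb[OF lincomb(3,4), of a b] by simp
  qed
next
  case (lincomb f h a b)
  have "(\<lambda>x. (a * f x + b * h x) * g x) = (\<lambda>x. a * (f x * g x) + b * (h x * g x))"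
    by (simp add: algebra_simps)
  then show ?case using trig_polys.lincomb[OF lincomb(3,4)[OF lincomb(5)], of a b] by simp
qed

lemma continuous_trig_polys: "p \<in> trig_polys \<Longrightarrow> continuous_on UNIV p"
  by (induction rule: trig_polys.induct) (auto intro!: continuous_intros)

lemma mean_mult_trig_poly:
  assumes "p \<in> trig_polys" "continuous_on UNIV f"
    and "\<And>\<mu>. lattice_pt \<mu> \<Longrightarrow> Fc \<mu> f = 0" "\<And>\<mu>. lattice_pt \<mu> \<Longrightarrow> Fs \<mu> f = 0"
  shows "mean (\<lambda>x. p x * f x) = 0"
  using assms(1)
proof (induction p)
  case (lincomb p q a b)
  have "(\<lambda>x. (a * p x + b * q x) * f x) = (\<lambda>x. a * (p x * f x) + b * (q x * f x))"
    by (simp add: algebra_simps)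
  then have "mean (\<lambda>x. (a * p x + b * q x) * f x) = mean (\<lambda>x. a * (p x * f x)) + mean (\<lambda>x. b * (q x * f x))"
    by (simp only:) (intro mean_add continuous_on_mult continuous_on_const assms(2) continuous_trig_polys lincomb(1,2))
  then show ?case using lincomb unfolding mean_scale by simp
qed (use assms(3,4) in \<open>simp_all add: Fc_def Fs_def\<close>)

lemma periodic_cube:
  fixes f :: "real ^ 'n::finite \<Rightarrow> real"
  assumes "periodic f"
  obtains y where "y \<in> cbox 0 ones" "f y = f x" "lattice_pt (x - y)"
proof -
  define v :: "real ^ 'n" where "v = (\<chi> i. of_int \<lfloor>x $ i\<rfloor>)"
  have v: "lattice_pt v" by (simp add: lattice_pt_def v_def)
  have "x - v \<in> cbox 0 ones"
    unfolding mem_box_cart by (auto simp: v_def) linarith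
  moreover have "f (x - v) = f x"
    using assms v unfolding periodic_def by (metis diff_add_cancel)
  moreover have "lattice_pt (x - (x - v))" using v by simp
  ultimately show ?thesis by (rule that)
qed

text \<open>Stone-Weierstrass on the torus, the image of the cube under \<open>x \<mapsto> (cos 2\<pi>x_j, sin 2\<pi>x_j)_j\<close>.\<close>

lemma trig_poly_dense:
  fixes f :: "real ^ 'n::finite \<Rightarrow> real"
  assumes cont: "continuous_on UNIV f" and per: "periodic f" and e: "e > 0"
  shows "\<exists>p\<in>trig_polys. \<forall>x\<in>cbox 0 ones. \<bar>f x - p x\<bar> < e"
proof -
  define h :: "real ^ 'n \<Rightarrow> (real ^ 'n) \<times> (real ^ 'n)"
    where "h x = ((\<chi> j. cosw (axis j 1) x), (\<chi> j. sinw (axis j 1) x))" for x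
  let ?S = "h ` cbox 0 ones"
  have ch: "continuous_on UNIV h"
    unfolding h_def by (intro continuous_intros)
  have cS: "compact ?S"
    by (intro compact_continuous_image continuous_on_subset[OF ch]) auto
  have same: "f x = f x'" if "h x = h x'" for x x'
  proof -
    have "lattice_pt (x - x')"
      unfolding lattice_pt_def
    proof
      fix j
      have "cos (2 * pi * x $ j) = cos (2 * pi * x' $ j)" "sin (2 * pi * x $ j) = sin (2 * pi * x' $ j)"
        using that by (auto simp: h_def Finite_Cartesian_Product.vec_eq_iff inner_axis' mult.assoc)
      then have "cos (2 * pi * x $ j - 2 * pi * x' $ j) = 1"
        unfolding cos_diff by (simp flip: power2_eq_square)
      then obtain m :: int where "2 * pi * x $ j - 2 * pi * x' $ j = of_int m * 2 * pi"
        unfolding cos_one_2pi_int by blast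
      then have "2 * pi * ((x - x') $ j) = 2 * pi * of_int m" by (simp add: algebra_simps)
      then have "(x - x') $ j = of_int m" by simp
      then show "(x - x') $ j \<in> \<int>" by simp
    qed
    then have "f (x' + (x - x')) = f x'" using per unfolding periodic_def by blast
    then show ?thesis by simp
  qed
  \<comment> \<open>\<open>f\<close> factors through \<open>h\<close>: by \<open>same\<close> it
    takes one value on each fibre, whatever point is chosen.\<close>
  define F where "F y = f (SOME x. h x = y)" for y
  have F: "F (h x) = f x" for x
    unfolding F_def by (rule same) (rule someI[of "\<lambda>x'. h x' = h x"], rule refl)
  \<comment> \<open>\<open>h\<close> maps closed subsets of the compact cube to closed sets, so the
    factor inherits continuity from \<open>f\<close>.\<close>
  have cF: "continuous_on ?S F"
  proof (subst continuous_on_closed_vimage)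
    show "closed ?S" using cS by (rule compact_imp_closed)
    show "\<forall>C. closed C \<longrightarrow> closed (F -` C \<inter> ?S)"
    proof (intro allI impI)
      fix C :: "real set" assume C: "closed C"
      have "F -` C \<inter> ?S = h ` (cbox 0 ones \<inter> f -` C)" using F by auto
      moreover have "closed (f -` C)" by (rule closed_vimage[OF C cont])
      then have "compact (cbox 0 ones \<inter> f -` C)" by (intro compact_Int_closed) auto
      then have "compact (h ` (cbox 0 ones \<inter> f -` C))"
        by (intro compact_continuous_image continuous_on_subset[OF ch]) auto
      ultimately show "closed (F -` C \<inter> ?S)" by (simp add: compact_imp_closed)
    qed
  qed
  define R where "R = {g. continuous_on ?S g \<and> (\<lambda>x. g (h x)) \<in> trig_polys}"
  have zero: "cosw 0 \<in> trig_polys" by (rule trig_polys.cos) (simp add: lattice_pt_def)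
  have "function_ring_on R ?S"
  proof
    show "compact ?S" by (rule cS)
    show "continuous_on ?S g" if "g \<in> R" for g using that by (simp add: R_def)
    show "(\<lambda>y. g y + g' y) \<in> R" if "g \<in> R" "g' \<in> R" for g g'
      using that trig_polys.lincomb[of "\<lambda>x. g (h x)" "\<lambda>x. g' (h x)" 1 1]
      by (auto simp: R_def intro: continuous_on_add)
    show "(\<lambda>y. g y * g' y) \<in> R" if "g \<in> R" "g' \<in> R" for g g'
      using that trig_polys_mult[of "\<lambda>x. g (h x)" "\<lambda>x. g' (h x)"]
      by (auto simp: R_def intro: continuous_on_mult)
    show "(\<lambda>_. c) \<in> R" for c
      using trig_polys.lincomb[OF zero zero, of c 0] by (auto simp: R_def)
    show "\<exists>g\<in>R. g y \<noteq> g y'" if "y \<in> ?S" "y' \<in> ?S" "y \<noteq> y'" for y y'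
    proof -
      have "fst y \<noteq> fst y' \<or> snd y \<noteq> snd y'" using that(3) by (auto simp: prod_eq_iff)
      then consider j where "fst y $ j \<noteq> fst y' $ j" | j where "snd y $ j \<noteq> snd y' $ j"
        by (auto simp: Finite_Cartesian_Product.vec_eq_iff)
      then show ?thesis
      proof cases
        case 1
        have "(\<lambda>y. fst y $ j) \<in> R"
          using trig_polys.cos[OF lattice_pt_axis[of j]]
          by (auto simp: R_def h_def intro!: continuous_intros)
        then show ?thesis using 1 by (intro bexI[of _ "\<lambda>y. fst y $ j"])
      next
        case 2
        have "(\<lambda>y. snd y $ j) \<in> R"
          using trig_polys.sin[OF lattice_pt_axis[of j]]
          by (auto simp: R_def h_def intro!: continuous_intros)
        then show ?thesis using 2 by (intro bexI[of _ "\<lambda>y. snd y $ j"])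
      qed
    qed
  qed
  from function_ring_on.Stone_Weierstrass_basic[OF this cF e]
  obtain g where g: "g \<in> R" "\<forall>y\<in>?S. \<bar>F y - g y\<bar> < e" by blast
  then show ?thesis
    using F by (intro bexI[of _ "\<lambda>x. g (h x)"]) (auto simp: R_def)
qed

text \<open>\<open>f\<close> is orthogonal to all trigonometric polynomials \<open>p\<close>, so the
  integral of \<open>f^2\<close> equals that of \<open>(f - p) f\<close>, which is at most
  \<open>e\<close> times the integral of the absolute value of \<open>f\<close> for \<open>p\<close>
  uniformly \<open>e\<close>-close to \<open>f\<close>.\<close>

lemma Fourier_unique:
  fixes f :: "real ^ 'n::finite \<Rightarrow> real"
  assumes cont: "continuous_on UNIV f" and per: "periodic f"
    and c: "\<And>\<mu>. lattice_pt \<mu> \<Longrightarrow> Fc \<mu> f = 0" and s: "\<And>\<mu>. lattice_pt \<mu> \<Longrightarrow> Fs \<mu> f = 0"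
  shows "f x = 0"
proof -
  let ?M = "mean (\<lambda>x. \<bar>f x\<bar>)"
  have int: "g integrable_on cbox 0 ones" if "continuous_on UNIV g" for g :: "real ^ 'n \<Rightarrow> real"
    by (rule integrable_cube[OF that])
  have cabs: "continuous_on UNIV (\<lambda>x. \<bar>f x\<bar>)" and csq: "continuous_on UNIV (\<lambda>x. f x * f x)"
    using cont by (auto intro!: continuous_intros)
  have M: "?M \<ge> 0" unfolding mean_def by (rule integral_nonneg[OF int[OF cabs]]) simp
  have bound: "mean (\<lambda>x. f x * f x) \<le> e * ?M" if pos: "e > 0" for e
  proof -
    obtain p where p: "p \<in> trig_polys" "\<forall>x\<in>cbox 0 ones. \<bar>f x - p x\<bar> < e"
      using trig_poly_dense[OF cont per pos] by blast
    note cp = continuous_trig_polys[OF p(1)]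
    have "mean (\<lambda>x. f x * f x) = mean (\<lambda>x. (f x - p x) * f x + p x * f x)"
      by (simp add: algebra_simps)
    also have "\<dots> = mean (\<lambda>x. (f x - p x) * f x)"
      using mean_mult_trig_poly[OF p(1) cont c s] cont cp
      by (subst mean_add) (auto intro!: continuous_intros)
    also have "\<dots> \<le> mean (\<lambda>x. e * \<bar>f x\<bar>)"
      unfolding mean_def
    proof (rule integral_le)
      show "(\<lambda>x. (f x - p x) * f x) integrable_on cbox 0 ones" "(\<lambda>x. e * \<bar>f x\<bar>) integrable_on cbox 0 ones"
        using cont cp by (auto intro!: int continuous_intros)
      fix x assume "x \<in> cbox 0 (ones :: real ^ 'n)"
      then have "\<bar>f x - p x\<bar> \<le> e" using p(2) by force
      then have "\<bar>f x - p x\<bar> * \<bar>f x\<bar> \<le> e * \<bar>f x\<bar>" by (rule mult_right_mono) simp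
      then show "(f x - p x) * f x \<le> e * \<bar>f x\<bar>"
        using abs_ge_self[of "(f x - p x) * f x"] by (simp add: abs_mult)
    qed
    finally show ?thesis unfolding mean_scale .
  qed
  have "mean (\<lambda>x. f x * f x) \<le> 0"
  proof (rule field_le_epsilon)
    fix e :: real assume "e > 0"
    \<comment> \<open>The summand 1 guards against \<open>?M = 0\<close>.\<close>
    then have pos: "e / (?M + 1) > 0" using M by simp
    have "e / (?M + 1) * ?M \<le> e" using M \<open>e > 0\<close> by (simp add: field_simps)
    then show "mean (\<lambda>x. f x * f x) \<le> 0 + e" using bound[OF pos] by simp
  qed
  moreover have "mean (\<lambda>x. f x * f x) \<ge> 0"
    unfolding mean_def by (rule integral_nonneg[OF int[OF csq]]) simp
  ultimately have z: "((\<lambda>x. f x * f x) has_integral 0) (cbox 0 ones)"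
    using integrable_integral[OF int[OF csq]] by (simp add: mean_def)
  obtain y where y: "y \<in> cbox 0 ones" "f y = f x"
    using periodic_cube[OF per] by blast
  have "box 0 (ones :: real ^ 'n) \<noteq> {}"
    by (simp add: box_ne_empty ones_def)
  then have "f y * f y = 0"
    by (intro has_integral_0_cbox_imp_0[OF _ _ z _ y(1)] continuous_on_subset[OF csq]) auto
  then show ?thesis using y by simp
qed

section \<open>Eigenforms on the torus\<close>

lemma sum_fun_apply: "(\<Sum>p\<in>S. f p) x = (\<Sum>p\<in>S. f p x)"
  by (induction S rule: infinite_finite_induct) auto

lemma partial_deriv_const: "partial_deriv j (\<lambda>_. c) x = 0"
  by (simp add: partial_deriv_def)

lemma partial_deriv_scale:
  assumes "f differentiable (at x)"
  shows "partial_deriv j (\<lambda>x. c * f x) x = c * partial_deriv j f x"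
proof -
  have "(f has_derivative frechet_derivative f (at x)) (at x)"
    using assms by (simp add: frechet_derivative_works)
  from partial_deriv_eq[OF has_derivative_mult_right[OF this]] show ?thesis
    by (simp add: partial_deriv_def)
qed

definition dform :: "'n \<Rightarrow> 'n form \<Rightarrow> real ^ 'n \<Rightarrow> 'n ext" where
  "dform j \<phi> x = (\<lambda>K. partial_deriv j (\<lambda>y. \<phi> y K) x)"

text \<open>\<open>ext_d\<close> sums \<open>dx_j\<close> times the partial derivatives, and the
  star and the degree projections have constant coefficients. Differentiability serves to take the
  sign of the star out of the derivative.\<close>

lemma aps_op_eq:
  fixes \<phi> :: "'n::{finite,linorder} form"
  assumes d: "\<And>K x. (\<lambda>y. \<phi> y K) differentiable (at x)"
  shows "aps_op \<phi> x I = (\<Sum>j\<in>UNIV. cliff j (dform j \<phi> x) I)"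
proof -
  have deg: "partial_deriv j (\<lambda>y. degree_part q \<phi> y K) x = degree_vec q (dform j \<phi> x) K" for q j K x
    by (cases "card K = q") (simp_all add: degree_part_def degree_vec_def dform_def partial_deriv_const)
  have 1: "hodge (ext_d (degree_part q \<phi>)) x I = (\<Sum>j\<in>UNIV. star (ext_mult j (degree_vec q (dform j \<phi> x))) I)" for q
  proof -
    have "ext_d (degree_part q \<phi>) x = (\<lambda>J. \<Sum>j\<in>UNIV. 1 * ext_mult j (degree_vec q (dform j \<phi> x)) J)"
    proof
      fix J
      have "ext_d (degree_part q \<phi>) x J = (\<Sum>j\<in>J. (-1) ^ card {i \<in> J. i < j} * degree_vec q (dform j \<phi> x) (J - {j}))"
        by (simp add: ext_d_def deg)
      also have "\<dots> = (\<Sum>j\<in>UNIV. 1 * ext_mult j (degree_vec q (dform j \<phi> x)) J)"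
        by (rule sum.mono_neutral_cong_left) (auto simp: ext_mult_def)
      finally show "ext_d (degree_part q \<phi>) x J = (\<Sum>j\<in>UNIV. 1 * ext_mult j (degree_vec q (dform j \<phi> x)) J)" .
    qed
    then have "hodge (ext_d (degree_part q \<phi>)) x I
        = star (\<lambda>J. \<Sum>j\<in>UNIV. 1 * ext_mult j (degree_vec q (dform j \<phi> x)) J) I"
      by (simp add: hodge_def star_def star_sign_def)
    then show ?thesis unfolding star_sum by simp
  qed
  have 2: "ext_d (hodge (degree_part q \<phi>)) x I = (\<Sum>j\<in>UNIV. ext_mult j (star (degree_vec q (dform j \<phi> x))) I)" for q
  proof -
    have dd: "(\<lambda>y. degree_part q \<phi> y K) differentiable (at x)" for K
      using d[of K] by (cases "card K = q") (simp_all add: degree_part_def)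
    have h: "partial_deriv j (\<lambda>y. hodge (degree_part q \<phi>) y K) x = star (degree_vec q (dform j \<phi> x)) K" for j K
      unfolding hodge_def star_def star_sign_def by (subst partial_deriv_scale[OF dd]) (simp add: deg)
    have "ext_d (hodge (degree_part q \<phi>)) x I
        = (\<Sum>j\<in>I. (-1) ^ card {i \<in> I. i < j} * star (degree_vec q (dform j \<phi> x)) (I - {j}))"
      by (simp add: ext_d_def h)
    also have "\<dots> = (\<Sum>j\<in>UNIV. ext_mult j (star (degree_vec q (dform j \<phi> x))) I)"
      by (rule sum.mono_neutral_cong_left) (auto simp: ext_mult_def)
    finally show ?thesis .
  qed
  have "aps_op \<phi> x I = (\<Sum>p\<le>CARD('n) div 2. (-1) ^ ((CARD('n) + 1) div 4 + p - 1) *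
      (hodge (ext_d (degree_part (2 * p) \<phi>)) x I - ext_d (hodge (degree_part (2 * p) \<phi>)) x I))"
    by (simp add: aps_op_def Let_def sum_fun_apply form_scale_def)
  also have "\<dots> = (\<Sum>j\<in>UNIV. cliff j (dform j \<phi> x) I)"
    unfolding 1 2 cliff_def sum_subtractf[symmetric] sum_distrib_left by (rule sum.swap)
  finally show ?thesis .
qed

lemma cliff_expand: "cliff j w I = (\<Sum>K\<in>UNIV. w K * cliff j (delta K) I)"
proof -
  have "w = (\<lambda>J. \<Sum>K\<in>UNIV. w K * delta K J)"
    by (simp add: delta_def if_distrib[of "\<lambda>x. _ * x"] cong: if_cong)
  then have "cliff j w I = cliff j (\<lambda>J. \<Sum>K\<in>UNIV. w K * delta K J) I" by (rule arg_cong)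
  then show ?thesis unfolding cliff_sum .
qed

lemma mean_cliff:
  assumes "\<And>K. continuous_on UNIV (\<lambda>x. w x K)" "continuous_on UNIV g"
  shows "mean (\<lambda>x. g x * cliff j (w x) I) = cliff j (\<lambda>K. mean (\<lambda>x. g x * w x K)) I"
proof -
  have "(\<lambda>x. g x * cliff j (w x) I) = (\<lambda>x. \<Sum>K\<in>UNIV. cliff j (delta K) I * (g x * w x K))"
    by (subst cliff_expand) (simp add: sum_distrib_left mult_ac)
  then have "mean (\<lambda>x. g x * cliff j (w x) I) = (\<Sum>K\<in>UNIV. mean (\<lambda>x. cliff j (delta K) I * (g x * w x K)))"
    using assms by (simp only:) (intro mean_sum continuous_intros; simp)
  also have "\<dots> = (\<Sum>K\<in>UNIV. mean (\<lambda>x. g x * w x K) * cliff j (delta K) I)"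
    unfolding mean_scale by (simp add: mult.commute)
  finally show ?thesis unfolding cliff_expand[of j "\<lambda>K. mean (\<lambda>x. g x * w x K)"] .
qed

lemma cliff_scale: "cliff j (\<lambda>I. c * w I) J = c * cliff j w J"
  using cliff_sum[of j "\<lambda>_. c" "\<lambda>_. w" "{()}" J] by simp

definition torus_form :: "'n::{finite,linorder} form \<Rightarrow> bool" where
  "torus_form \<phi> \<longleftrightarrow> (\<forall>K. C1 (\<lambda>x. \<phi> x K) \<and> periodic (\<lambda>x. \<phi> x K))"

text \<open>Integration by parts turns each partial derivative into a factor
  \<open>2 * pi * \<mu> $ j\<close> and exchanges cosine and sine; the constant operators
  \<open>cliff j\<close> commute with taking means.\<close>

lemma Fourier_aps:
  fixes \<phi> :: "'n::{finite,linorder} form"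
  assumes t: "torus_form \<phi>" and \<mu>: "lattice_pt \<mu>"
  shows "Fc \<mu> (\<lambda>x. aps_op \<phi> x I) = 2 * pi * symb \<mu> (\<lambda>K. Fs \<mu> (\<lambda>x. \<phi> x K)) I"
    and "Fs \<mu> (\<lambda>x. aps_op \<phi> x I) = - (2 * pi * symb \<mu> (\<lambda>K. Fc \<mu> (\<lambda>x. \<phi> x K)) I)"
proof -
  have C: "C1 (\<lambda>x. \<phi> x K)" and P: "periodic (\<lambda>x. \<phi> x K)" for K using t by (auto simp: torus_form_def)
  have d: "(\<lambda>y. \<phi> y K) differentiable (at x)" for K x using C by (simp add: C1_def)
  have cd: "continuous_on UNIV (\<lambda>x. dform j \<phi> x K)" for j K
    using C[of K] unfolding C1_def dform_def by blast
  have cc: "continuous_on UNIV (\<lambda>x. cliff j (dform j \<phi> x) I)" for j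
    by (subst cliff_expand) (intro continuous_intros cd)
  have key: "mean (\<lambda>x. g x * aps_op \<phi> x I) = (\<Sum>j\<in>UNIV. cliff j (\<lambda>K. mean (\<lambda>x. g x * dform j \<phi> x K)) I)"
    if g: "continuous_on UNIV g" for g
  proof -
    have "mean (\<lambda>x. g x * aps_op \<phi> x I) = mean (\<lambda>x. \<Sum>j\<in>UNIV. g x * cliff j (dform j \<phi> x) I)"
      unfolding aps_op_eq[OF d] sum_distrib_left ..
    also have "\<dots> = (\<Sum>j\<in>UNIV. mean (\<lambda>x. g x * cliff j (dform j \<phi> x) I))"
      by (rule mean_sum) (auto intro!: continuous_on_mult g cc)
    finally show ?thesis unfolding mean_cliff[OF cd g] .
  qed
  have "(\<lambda>K. mean (\<lambda>x. cosw \<mu> x * dform j \<phi> x K)) = (\<lambda>K. (2 * pi * \<mu> $ j) * Fs \<mu> (\<lambda>x. \<phi> x K))" for j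
  proof
    fix K
    have "mean (\<lambda>x. cosw \<mu> x * dform j \<phi> x K) = Fc \<mu> (partial_deriv j (\<lambda>x. \<phi> x K))"
      by (simp add: Fc_def dform_def)
    then show "mean (\<lambda>x. cosw \<mu> x * dform j \<phi> x K) = (2 * pi * \<mu> $ j) * Fs \<mu> (\<lambda>x. \<phi> x K)"
      unfolding Fc_partial_deriv[OF C P \<mu>] .
  qed
  then show "Fc \<mu> (\<lambda>x. aps_op \<phi> x I) = 2 * pi * symb \<mu> (\<lambda>K. Fs \<mu> (\<lambda>x. \<phi> x K)) I"
    unfolding Fc_def key[OF continuous_cosw] symb_def
    by (simp add: cliff_scale sum_distrib_left mult.assoc)
  have "(\<lambda>K. mean (\<lambda>x. sinw \<mu> x * dform j \<phi> x K)) = (\<lambda>K. (- (2 * pi * \<mu> $ j)) * Fc \<mu> (\<lambda>x. \<phi> x K))" for j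
  proof
    fix K
    have "mean (\<lambda>x. sinw \<mu> x * dform j \<phi> x K) = Fs \<mu> (partial_deriv j (\<lambda>x. \<phi> x K))"
      by (simp add: Fs_def dform_def)
    then show "mean (\<lambda>x. sinw \<mu> x * dform j \<phi> x K) = (- (2 * pi * \<mu> $ j)) * Fc \<mu> (\<lambda>x. \<phi> x K)"
      unfolding Fs_partial_deriv[OF C P \<mu>] by simp
  qed
  then show "Fs \<mu> (\<lambda>x. aps_op \<phi> x I) = - (2 * pi * symb \<mu> (\<lambda>K. Fc \<mu> (\<lambda>x. \<phi> x K)) I)"
    unfolding Fs_def key[OF continuous_sinw] symb_def
    by (simp only: cliff_scale) (simp add: sum_distrib_left mult.assoc sum_negf)
qed

section \<open>Dimensions of spaces of forms\<close>

abbreviation linear_form_map :: "('n form \<Rightarrow> 'n form) \<Rightarrow> bool" where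
  "linear_form_map f \<equiv> Vector_Spaces.linear form_scale form_scale f"

text \<open>The space of all forms is infinite-dimensional, so finiteness is carried along
  explicitly to make inequalities between dimensions meaningful.\<close>

definition fin_dim :: "'n form set \<Rightarrow> bool" where
  "fin_dim S \<longleftrightarrow> (\<exists>X. finite X \<and> S \<subseteq> forms.span X)"

lemma linear_form_mapI:
  fixes f :: "'n form \<Rightarrow> 'n form"
  assumes "\<And>x y. f (x + y) = f x + f y" "\<And>c x. f (form_scale c x) = form_scale c (f x)"
  shows "linear_form_map f"
  using assms by unfold_locales

lemma fin_dim_subset: "S \<subseteq> T \<Longrightarrow> fin_dim T \<Longrightarrow> fin_dim S"
  unfolding fin_dim_def by blast

lemma fin_dim_basis:
  assumes "fin_dim S"
  obtains B where "B \<subseteq> S" "forms.independent B" "S \<subseteq> forms.span B" "card B = forms.dim S" "finite B"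
proof -
  obtain B where B: "B \<subseteq> S" "forms.independent B" "S \<subseteq> forms.span B" "card B = forms.dim S"
    using forms.basis_exists by blast
  obtain X where "finite X" "S \<subseteq> forms.span X" using assms unfolding fin_dim_def by blast
  then have "finite B" using forms.independent_span_bound[of X B] B by auto
  with B show ?thesis by (rule that)
qed

text \<open>Serves for the comparisons of multiplicities below: equalities are obtained from
  injections in both directions.\<close>

lemma dim_le_inj:
  assumes lin: "linear_form_map f" and sub: "forms.subspace S"
    and inj: "\<And>x. x \<in> S \<Longrightarrow> f x = 0 \<Longrightarrow> x = 0"
    and im: "\<And>x. x \<in> S \<Longrightarrow> f x \<in> T" and fin: "fin_dim T"
  shows "forms.dim S \<le> forms.dim T"
proof -
  interpret f: Vector_Spaces.linear form_scale form_scale f by (rule lin)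
  obtain B where B: "B \<subseteq> S" "forms.independent B" "S \<subseteq> forms.span B" "card B = forms.dim S"
    using forms.basis_exists by blast
  obtain C where C: "C \<subseteq> T" "forms.independent C" "T \<subseteq> forms.span C" "card C = forms.dim T" "finite C"
    using fin_dim_basis[OF fin] by blast
  have sB: "forms.span B \<subseteq> S" using B(1) sub by (rule forms.span_minimal)
  have i: "inj_on f (forms.span B)"
  proof (rule inj_onI)
    fix x y assume xy: "x \<in> forms.span B" "y \<in> forms.span B" "f x = f y"
    then have "x - y \<in> S" using sB sub forms.subspace_diff by blast
    moreover have "f (x - y) = 0" using xy by (simp add: f.diff)
    ultimately have "x - y = 0" by (rule inj)
    then show "x = y" by simp
  qed
  have "forms.independent (f ` B)"
    using f.independent_injective_image[OF B(2)] i by blast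
  moreover have "f ` B \<subseteq> forms.span C" using B(1) im C(3) by blast
  ultimately have "card (f ` B) \<le> card C"
    using forms.independent_span_bound[OF C(5)] by blast
  moreover have "card (f ` B) = card B"
    by (rule card_image) (rule inj_on_subset[OF i forms.span_superset])
  ultimately show ?thesis using B(4) C(4) by simp
qed

lemma dim_direct_sum:
  assumes S: "forms.subspace S" "fin_dim S" and T: "forms.subspace T" "fin_dim T"
    and ST: "\<And>x. x \<in> S \<Longrightarrow> x \<in> T \<Longrightarrow> x = 0"
    and V: "\<And>v. v \<in> V \<longleftrightarrow> (\<exists>s\<in>S. \<exists>t\<in>T. v = s + t)"
  shows "forms.dim V = forms.dim S + forms.dim T"
proof -
  obtain B where B: "B \<subseteq> S" "forms.independent B" "S \<subseteq> forms.span B" "card B = forms.dim S" "finite B"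
    using fin_dim_basis[OF S(2)] by blast
  obtain C where C: "C \<subseteq> T" "forms.independent C" "T \<subseteq> forms.span C" "card C = forms.dim T" "finite C"
    using fin_dim_basis[OF T(2)] by blast
  have z: "0 \<notin> B" using B(2) forms.dependent_zero by blast
  have disj: "B \<inter> C = {}" using ST B(1) C(1) z by blast
  have ind: "forms.independent (B \<union> C)"
  proof
    assume "forms.dependent (B \<union> C)"
    then obtain u where u: "\<exists>v\<in>B \<union> C. u v \<noteq> 0" "(\<Sum>v\<in>B \<union> C. form_scale (u v) v) = 0"
      using forms.dependent_finite[of "B \<union> C"] B(5) C(5) by auto
    let ?b = "\<Sum>v\<in>B. form_scale (u v) v" and ?c = "\<Sum>v\<in>C. form_scale (u v) v"
    have sum: "?b + ?c = 0" using u(2) unfolding sum.union_disjoint[OF B(5) C(5) disj] .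
    have bS: "?b \<in> S" by (intro forms.subspace_sum S(1) forms.subspace_scale) (use B(1) in auto)
    have cT: "?c \<in> T" by (intro forms.subspace_sum T(1) forms.subspace_scale) (use C(1) in auto)
    have "?b = - ?c" by (rule eq_neg_iff_add_eq_0[THEN iffD2, OF sum])
    then have "?b \<in> T" using forms.subspace_neg[OF T(1) cT] by (simp only:)
    then have b0: "?b = 0" by (rule ST[OF bS])
    then have c0: "?c = 0" using sum by (simp only: add_0_left)
    have zero: "u v = 0" if "finite D" "forms.independent D" "(\<Sum>v\<in>D. form_scale (u v) v) = 0" "v \<in> D" for v D
    proof (rule ccontr)
      assume "u v \<noteq> 0"
      then have "forms.dependent D"
        unfolding forms.dependent_finite[OF that(1)] using that(3,4)
        by (intro exI[of _ u] conjI bexI[of _ v])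
      then show False using that(2) by (rule notE[rotated])
    qed
    have "u v = 0" if "v \<in> B" for v by (rule zero[OF B(5,2) b0 that])
    moreover have "u v = 0" if "v \<in> C" for v by (rule zero[OF C(5,2) c0 that])
    ultimately show False using u(1) by blast
  qed
  have sub: "B \<union> C \<subseteq> V"
  proof
    fix v assume "v \<in> B \<union> C"
    then consider "v \<in> S" | "v \<in> T" using B(1) C(1) by blast
    then show "v \<in> V"
    proof cases
      case 1
      have "v = v + 0" by simp
      then show ?thesis unfolding V using 1 forms.subspace_0[OF T(1)] by (intro bexI)
    next
      case 2
      have "v = 0 + v" by simp
      then show ?thesis unfolding V using 2 forms.subspace_0[OF S(1)] by (intro bexI)
    qed
  qed
  have sp: "V \<subseteq> forms.span (B \<union> C)"
  proof
    fix v assume "v \<in> V"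
    then obtain s t where st: "s \<in> S" "t \<in> T" "v = s + t" using V by blast
    have "s \<in> forms.span (B \<union> C)" using st(1) B(3) forms.span_mono[of B "B \<union> C"] by blast
    moreover have "t \<in> forms.span (B \<union> C)" using st(2) C(3) forms.span_mono[of C "B \<union> C"] by blast
    ultimately show "v \<in> forms.span (B \<union> C)" unfolding st(3) by (rule forms.span_add)
  qed
  have "forms.dim V = card (B \<union> C)"
    by (rule forms.dim_unique[OF sub sp ind refl])
  then show ?thesis using card_Un_disjoint[OF B(5) C(5) disj] B(4) C(4) by simp
qed

section \<open>Forms supported on finitely many frequencies\<close>

definition delta_form :: "real ^ 'n \<Rightarrow> 'n set \<Rightarrow> 'n form" where
  "delta_form \<mu> K = (\<lambda>x I. if x = \<mu> \<and> I = K then 1 else 0)"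

lemma finite_support_span:
  fixes A :: "'n::finite form"
  assumes "finite S" "\<And>\<mu> I. \<mu> \<notin> S \<Longrightarrow> A \<mu> I = 0"
  shows "A \<in> forms.span ((\<lambda>(\<mu>, K). delta_form \<mu> K) ` (S \<times> UNIV))"
proof -
  have "A = (\<Sum>p\<in>S \<times> UNIV. form_scale (A (fst p) (snd p)) (delta_form (fst p) (snd p)))"
  proof (intro ext)
    fix x I
    have "(\<Sum>p\<in>S \<times> UNIV. form_scale (A (fst p) (snd p)) (delta_form (fst p) (snd p))) x I
       = (\<Sum>p\<in>S \<times> UNIV. if p = (x, I) then A x I else 0)"
      unfolding sum_fun_apply by (rule sum.cong) (auto simp: form_scale_def delta_form_def)
    also have "\<dots> = A x I" using assms by (auto simp: sum.delta)
    finally show "A x I = (\<Sum>p\<in>S \<times> UNIV. form_scale (A (fst p) (snd p)) (delta_form (fst p) (snd p))) x I" ..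
  qed
  also have "\<dots> \<in> forms.span ((\<lambda>(\<mu>, K). delta_form \<mu> K) ` (S \<times> UNIV))"
    by (intro forms.span_sum forms.span_scale forms.span_base) auto
  finally show ?thesis .
qed

text \<open>Amplitudes are typed as forms, with the frequency in place of the point. The explicit
  bound later controls the growth of multiplicities, and with \<open>S\<close> empty it shows that
  trivial spaces have dimension 0.\<close>

lemma finite_support_fin_dim:
  fixes V :: "'n::finite form set"
  assumes "finite S" "\<And>A \<mu> I. A \<in> V \<Longrightarrow> \<mu> \<notin> S \<Longrightarrow> A \<mu> I = 0"
  shows "fin_dim V" "forms.dim V \<le> card S * 2 ^ CARD('n)"
proof -
  let ?X = "(\<lambda>(\<mu>, K). delta_form \<mu> K) ` (S \<times> (UNIV :: 'n set set))"
  have f: "finite ?X" using assms(1) by simp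
  have s: "V \<subseteq> forms.span ?X"
  proof
    fix A assume "A \<in> V"
    then show "A \<in> forms.span ?X" by (intro finite_support_span assms(1)) (rule assms(2))
  qed
  show "fin_dim V" unfolding fin_dim_def using f s by blast
  have "forms.dim V \<le> card ?X" by (rule forms.dim_le_card[OF s f])
  also have "\<dots> \<le> card (S \<times> (UNIV :: 'n set set))" by (rule card_image_le) (use assms(1) in simp)
  also have "\<dots> = card S * 2 ^ CARD('n)" by (simp add: card_cartesian_product card_Pow flip: Pow_UNIV)
  finally show "forms.dim V \<le> card S * 2 ^ CARD('n)" .
qed

section \<open>Fourier description of the eigenspaces\<close>

text \<open>The frequencies compatible with the eigenvalue \<open>l\<close>: by
  \<open>symb_symb\<close> the square of the operator multiplies waves by
  \<open>(2 pi |\<mu>|)^2\<close>.\<close>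

definition sphere_pts :: "real \<Rightarrow> (real ^ 'n::finite) set" where
  "sphere_pts l = {\<mu>. lattice_pt \<mu> \<and> (2 * pi)\<^sup>2 * (\<Sum>j\<in>UNIV. (\<mu> $ j)\<^sup>2) = l\<^sup>2}"

lemma finite_sphere_pts: "finite (sphere_pts l :: (real ^ 'n::finite) set)"
proof -
  define N where "N = \<lceil>\<bar>l\<bar>\<rceil>"
  have "sphere_pts l \<subseteq> (\<lambda>f. \<chi> j. of_int (f j)) ` PiE (UNIV :: 'n set) (\<lambda>_. {-N..N})"
  proof
    fix \<mu> :: "real ^ 'n" assume \<mu>: "\<mu> \<in> sphere_pts l"
    have le: "\<bar>\<mu> $ j\<bar> \<le> \<bar>l\<bar>" for j
    proof -
      have "(\<mu> $ j)\<^sup>2 \<le> (\<Sum>j\<in>UNIV. (\<mu> $ j)\<^sup>2)" by (rule member_le_sum) auto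
      also have "\<dots> \<le> (2 * pi)\<^sup>2 * (\<Sum>j\<in>UNIV. (\<mu> $ j)\<^sup>2)"
      proof -
        have "1 \<le> (2 * pi)\<^sup>2" using pi_gt3 by (intro one_le_power) simp
        then show ?thesis using mult_right_mono[of 1 "(2 * pi)\<^sup>2" "\<Sum>j\<in>UNIV. (\<mu> $ j)\<^sup>2"] by (simp add: sum_nonneg)
      qed
      finally have "(\<mu> $ j)\<^sup>2 \<le> l\<^sup>2" using \<mu> by (simp add: sphere_pts_def)
      then show ?thesis by (simp add: abs_le_square_iff)
    qed
    define f where "f j = \<lfloor>\<mu> $ j\<rfloor>" for j
    have f: "of_int (f j) = \<mu> $ j" for j
      using \<mu> by (auto simp: sphere_pts_def lattice_pt_def f_def elim!: Ints_cases dest: spec[of _ j])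
    have "f j \<in> {-N..N}" for j
    proof -
      have "\<bar>of_int (f j)\<bar> \<le> (of_int N :: real)" unfolding f N_def using le[of j] by linarith
      then have "\<bar>f j\<bar> \<le> N" by linarith
      then show ?thesis by auto
    qed
    moreover have "\<mu> = (\<chi> j. of_int (f j))" by (simp add: Finite_Cartesian_Product.vec_eq_iff f)
    ultimately show "\<mu> \<in> (\<lambda>f. \<chi> j. of_int (f j)) ` PiE (UNIV :: 'n set) (\<lambda>_. {-N..N})" by auto
  qed
  then show ?thesis by (rule finite_subset) (intro finite_imageI finite_PiE; simp)
qed

lemma sphere_pts_lattice: "\<mu> \<in> sphere_pts l \<Longrightarrow> lattice_pt \<mu>"
  by (simp add: sphere_pts_def)

lemma sphere_pts_uminus: "- \<mu> \<in> sphere_pts l \<longleftrightarrow> \<mu> \<in> sphere_pts l"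
  by (simp add: sphere_pts_def lattice_pt_def)

text \<open>A complex structure on even amplitudes at a point of the sphere. It changes sign with
  \<open>l\<close> and with \<open>\<mu>\<close>.\<close>

definition rot :: "real \<Rightarrow> real ^ 'n::{finite,linorder} \<Rightarrow> 'n ext \<Rightarrow> 'n ext" where
  "rot l \<mu> w = (\<lambda>I. 2 * pi / l * symb \<mu> w I)"

text \<open>Only cosine amplitudes are recorded, the sine amplitudes being \<open>- rot\<close> of
  them. As \<open>\<mu>\<close> and \<open>- \<mu>\<close> carry the same cosine, evenness in
  \<open>\<mu>\<close> makes the description unique.\<close>

definition amplitudes :: "real \<Rightarrow> 'n::{finite,linorder} form set" where
  "amplitudes l = {A. (\<forall>\<mu> I. \<mu> \<notin> sphere_pts l \<longrightarrow> A \<mu> I = 0) \<and> (\<forall>\<mu>. even_vec (A \<mu>)) \<and> (\<forall>\<mu>. A (- \<mu>) = A \<mu>)}"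

text \<open>For even \<open>A\<close> the summands at \<open>\<mu>\<close> and
  \<open>- \<mu>\<close> coincide, which compensates the factor 1/2 in \<open>Fc_cosw\<close>: the
  cosine coefficient at \<open>\<mu>\<close> is exactly \<open>A \<mu>\<close>.\<close>

definition synth :: "real \<Rightarrow> 'n::{finite,linorder} form \<Rightarrow> 'n form" where
  "synth l A = (\<lambda>x I. \<Sum>\<mu>\<in>sphere_pts l. cosw \<mu> x * A \<mu> I - sinw \<mu> x * rot l \<mu> (A \<mu>) I)"

definition torus_eigenspace :: "real \<Rightarrow> 'n::{finite,linorder} form set" where
  "torus_eigenspace l = {\<phi>. smooth_form \<phi> \<and> even_form \<phi> \<and> (\<forall>K. periodic (\<lambda>x. \<phi> x K)) \<and>
     aps_op \<phi> = form_scale l \<phi>}"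

lemma rot_rot:
  fixes w :: "'n::{finite,linorder} ext"
  assumes n: "CARD('n) mod 4 = 3" and w: "even_vec w" and \<mu>: "\<mu> \<in> sphere_pts l" and l: "l \<noteq> 0"
  shows "rot l \<mu> (rot l \<mu> w) = (\<lambda>I. - w I)"
proof
  fix I
  have "rot l \<mu> (rot l \<mu> w) I = (2 * pi / l) * ((2 * pi / l) * symb \<mu> (symb \<mu> w) I)"
    unfolding rot_def using symb_lincomb[of \<mu> "2 * pi / l" "symb \<mu> w" 0 w] by simp
  also have "\<dots> = - (((2 * pi)\<^sup>2 * (\<Sum>j\<in>UNIV. (\<mu> $ j)\<^sup>2)) / l\<^sup>2 * w I)"
    unfolding symb_symb[OF n w] by (simp add: power2_eq_square)
  also have "\<dots> = - w I" using \<mu> l by (simp add: sphere_pts_def)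
  finally show "rot l \<mu> (rot l \<mu> w) I = - w I" .
qed

lemma even_vec_rot:
  fixes w :: "'n::{finite,linorder} ext"
  assumes "CARD('n) mod 4 = 3" "even_vec w"
  shows "even_vec (rot l \<mu> w)"
proof -
  have "odd CARD('n)" using assms(1) by presburger
  then have "even_vec (symb \<mu> w)" using assms(2) by (rule even_vec_symb)
  then show ?thesis by (simp add: even_vec_def rot_def)
qed

lemma rot_lincomb: "rot l \<mu> (\<lambda>I. a * v I + b * w I) I = a * rot l \<mu> v I + b * rot l \<mu> w I"
  unfolding rot_def symb_lincomb by (simp add: algebra_simps)

text \<open>Such sums are closed under partial derivatives, so smoothness follows by induction over
  \<open>m\<close> with arbitrary coefficients.\<close>

lemma C_k_trig: "C_k m (\<lambda>x. \<Sum>\<mu>\<in>S. a \<mu> * cosw \<mu> x + b \<mu> * sinw \<mu> x)"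
  and partial_deriv_trig: "partial_deriv j (\<lambda>x. \<Sum>\<mu>\<in>S. a \<mu> * cosw \<mu> x + b \<mu> * sinw \<mu> x)
    = (\<lambda>x. \<Sum>\<mu>\<in>S. (2 * pi * \<mu> $ j * b \<mu>) * cosw \<mu> x + (- (2 * pi * \<mu> $ j * a \<mu>)) * sinw \<mu> x)"
proof -
  have d: "((\<lambda>x. \<Sum>\<mu>\<in>S. a \<mu> * cosw \<mu> x + b \<mu> * sinw \<mu> x) has_derivative
      (\<lambda>h. \<Sum>\<mu>\<in>S. a \<mu> * (- sinw \<mu> x * (2 * pi * (\<mu> \<bullet> h))) + b \<mu> * (cosw \<mu> x * (2 * pi * (\<mu> \<bullet> h))))) (at x)" for x a b
    by (intro has_derivative_sum has_derivative_add has_derivative_mult_right has_derivative_cosw has_derivative_sinw)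
  have p: "partial_deriv j (\<lambda>x. \<Sum>\<mu>\<in>S. a \<mu> * cosw \<mu> x + b \<mu> * sinw \<mu> x)
    = (\<lambda>x. \<Sum>\<mu>\<in>S. (2 * pi * \<mu> $ j * b \<mu>) * cosw \<mu> x + (- (2 * pi * \<mu> $ j * a \<mu>)) * sinw \<mu> x)" for j a b
    by (rule ext, subst partial_deriv_eq[OF d]) (intro sum.cong refl, simp add: inner_axis mult_ac)
  show "partial_deriv j (\<lambda>x. \<Sum>\<mu>\<in>S. a \<mu> * cosw \<mu> x + b \<mu> * sinw \<mu> x)
    = (\<lambda>x. \<Sum>\<mu>\<in>S. (2 * pi * \<mu> $ j * b \<mu>) * cosw \<mu> x + (- (2 * pi * \<mu> $ j * a \<mu>)) * sinw \<mu> x)"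
    by (rule p)
  show "C_k m (\<lambda>x. \<Sum>\<mu>\<in>S. a \<mu> * cosw \<mu> x + b \<mu> * sinw \<mu> x)"
  proof (induction m arbitrary: a b)
    case 0
    show ?case unfolding C_k.simps by (intro continuous_intros)
  next
    case (Suc m)
    have dd: "(\<lambda>x. \<Sum>\<mu>\<in>S. a \<mu> * cosw \<mu> x + b \<mu> * sinw \<mu> x) differentiable_on UNIV"
      unfolding differentiable_on_def using d by (auto simp: differentiable_def)
    show ?case unfolding C_k.simps p by (intro conjI allI dd Suc.IH)
  qed
qed

lemma synth_alt:
  "(\<lambda>x. synth l A x I) = (\<lambda>x. \<Sum>\<mu>\<in>sphere_pts l. A \<mu> I * cosw \<mu> x + (- rot l \<mu> (A \<mu>) I) * sinw \<mu> x)"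
  unfolding synth_def by (simp add: mult.commute)

lemma synth_eigen:
  fixes A :: "'n::{finite,linorder} form"
  assumes n: "CARD('n) mod 4 = 3" and l: "l \<noteq> 0" and A: "A \<in> amplitudes l"
  shows "synth l A \<in> torus_eigenspace l"
proof -
  have ev: "even_vec (A \<mu>)" for \<mu> using A by (simp add: amplitudes_def)
  have sm: "smooth_form (synth l A)"
    unfolding smooth_form_def C_infinity_def synth_alt by (intro allI C_k_trig)
  have "even_form (synth l A)"
    using ev even_vec_rot[OF n ev] by (auto simp: even_form_def even_vec_def synth_def intro!: sum.neutral)
  moreover have "periodic (\<lambda>x. synth l A x K)" for K
    unfolding synth_def periodic_def
  proof (intro allI impI)
    fix x v :: "real ^ ('n::{finite,linorder})" assume v: "lattice_pt v"
    have e: "cosw \<mu> (x + v) = cosw \<mu> x" "sinw \<mu> (x + v) = sinw \<mu> x" if "\<mu> \<in> sphere_pts l" for \<mu>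
      using periodic_cosw[OF sphere_pts_lattice[OF that]] periodic_sinw[OF sphere_pts_lattice[OF that]] v
      unfolding periodic_def by blast+
    show "(\<Sum>\<mu>\<in>sphere_pts l. cosw \<mu> (x + v) * A \<mu> K - sinw \<mu> (x + v) * rot l \<mu> (A \<mu>) K)
      = (\<Sum>\<mu>\<in>sphere_pts l. cosw \<mu> x * A \<mu> K - sinw \<mu> x * rot l \<mu> (A \<mu>) K)"
      by (intro sum.cong refl) (simp only: e)
  qed
  moreover have "aps_op (synth l A) = form_scale l (synth l A)"
  proof (intro ext)
    fix x I
    have "(\<lambda>y. synth l A y K) differentiable at x" for K x
      using sm C_infinity_C1[of "\<lambda>y. synth l A y K"] by (simp add: smooth_form_def C1_def)
    note 1 = aps_op_eq[OF this]
    have d: "dform j (synth l A) x = (\<lambda>K. \<Sum>\<mu>\<in>sphere_pts l. 1 * (\<mu> $ j *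
        ((- (2 * pi * cosw \<mu> x)) * rot l \<mu> (A \<mu>) K + (- (2 * pi * sinw \<mu> x)) * A \<mu> K)))" for j
      unfolding dform_def synth_alt partial_deriv_trig by (simp add: algebra_simps)
    have "aps_op (synth l A) x I = (\<Sum>j\<in>UNIV. \<Sum>\<mu>\<in>sphere_pts l. \<mu> $ j *
        cliff j (\<lambda>K. (- (2 * pi * cosw \<mu> x)) * rot l \<mu> (A \<mu>) K + (- (2 * pi * sinw \<mu> x)) * A \<mu> K) I)"
      unfolding 1 d cliff_sum cliff_scale by simp
    also have "\<dots> = (\<Sum>\<mu>\<in>sphere_pts l. symb \<mu> (\<lambda>K. (- (2 * pi * cosw \<mu> x)) * rot l \<mu> (A \<mu>) K + (- (2 * pi * sinw \<mu> x)) * A \<mu> K) I)"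
      unfolding symb_def by (rule sum.swap)
    also have "\<dots> = (\<Sum>\<mu>\<in>sphere_pts l. l * (cosw \<mu> x * A \<mu> I - sinw \<mu> x * rot l \<mu> (A \<mu>) I))"
    proof (rule sum.cong[OF refl])
      fix \<mu> :: "real ^ ('n::{finite,linorder})" assume \<mu>: "\<mu> \<in> sphere_pts l"
      have s: "2 * pi * symb \<mu> w I = l * rot l \<mu> w I" for w using l by (simp add: rot_def)
      have "symb \<mu> (\<lambda>K. (- (2 * pi * cosw \<mu> x)) * rot l \<mu> (A \<mu>) K + (- (2 * pi * sinw \<mu> x)) * A \<mu> K) I
        = - cosw \<mu> x * (2 * pi * symb \<mu> (rot l \<mu> (A \<mu>)) I) + - sinw \<mu> x * (2 * pi * symb \<mu> (A \<mu>) I)"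
        unfolding symb_lincomb by simp
      also have "\<dots> = l * (cosw \<mu> x * A \<mu> I - sinw \<mu> x * rot l \<mu> (A \<mu>) I)"
        unfolding s rot_rot[OF n ev \<mu> l] by (simp add: algebra_simps)
      finally show "symb \<mu> (\<lambda>K. (- (2 * pi * cosw \<mu> x)) * rot l \<mu> (A \<mu>) K + (- (2 * pi * sinw \<mu> x)) * A \<mu> K) I
        = l * (cosw \<mu> x * A \<mu> I - sinw \<mu> x * rot l \<mu> (A \<mu>) I)" .
    qed
    finally show "aps_op (synth l A) x I = form_scale l (synth l A) x I"
      by (simp add: form_scale_def synth_def sum_distrib_left)
  qed
  ultimately show ?thesis using sm by (simp add: torus_eigenspace_def)
qed

lemma Fc_synth:
  fixes A :: "'n::{finite,linorder} form"
  assumes A: "A \<in> amplitudes l" and \<kappa>: "\<kappa> \<in> sphere_pts l"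
  shows "Fc \<kappa> (\<lambda>x. synth l A x I) = A \<kappa> I"
proof -
  note fin = finite_sphere_pts[of l]
  have lk: "lattice_pt \<kappa>" by (rule sphere_pts_lattice[OF \<kappa>])
  have "Fc \<kappa> (\<lambda>x. synth l A x I)
      = mean (\<lambda>x. \<Sum>\<mu>\<in>sphere_pts l. A \<mu> I * (cosw \<kappa> x * cosw \<mu> x) + (- rot l \<mu> (A \<mu>) I) * (cosw \<kappa> x * sinw \<mu> x))"
    unfolding Fc_def synth_def by (simp add: sum_distrib_left algebra_simps)
  also have "\<dots> = (\<Sum>\<mu>\<in>sphere_pts l. mean (\<lambda>x. A \<mu> I * (cosw \<kappa> x * cosw \<mu> x) + (- rot l \<mu> (A \<mu>) I) * (cosw \<kappa> x * sinw \<mu> x)))"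
    by (rule mean_sum[OF fin]) (intro continuous_intros)
  also have "\<dots> = (\<Sum>\<mu>\<in>sphere_pts l. A \<mu> I * Fc \<kappa> (cosw \<mu>) + (- rot l \<mu> (A \<mu>) I) * Fc \<kappa> (sinw \<mu>))"
    unfolding Fc_def mean_scale[symmetric]
    by (intro sum.cong refl mean_add) (intro continuous_intros)+
  also have "\<dots> = (\<Sum>\<mu>\<in>sphere_pts l. 1 / 2 * (if \<mu> = \<kappa> then A \<kappa> I else 0) + 1 / 2 * (if \<mu> = - \<kappa> then A \<kappa> I else 0))"
  proof (rule sum.cong[OF refl])
    fix \<mu> :: "real ^ ('n::{finite,linorder})" assume "\<mu> \<in> sphere_pts l"
    then have \<mu>: "lattice_pt \<mu>" by (rule sphere_pts_lattice)
    have m: "\<kappa> = - \<mu> \<longleftrightarrow> \<mu> = - \<kappa>" by auto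
    have ev: "A (- \<kappa>) I = A \<kappa> I" using A by (simp add: amplitudes_def)
    show "A \<mu> I * Fc \<kappa> (cosw \<mu>) + (- rot l \<mu> (A \<mu>) I) * Fc \<kappa> (sinw \<mu>)
      = 1 / 2 * (if \<mu> = \<kappa> then A \<kappa> I else 0) + 1 / 2 * (if \<mu> = - \<kappa> then A \<kappa> I else 0)"
      unfolding Fc_cosw[OF lk \<mu>] Fc_sinw[OF lk \<mu>] m
      by (cases "\<mu> = \<kappa>"; cases "\<mu> = - \<kappa>") (simp_all add: ev)
  qed
  also have "\<dots> = 1 / 2 * A \<kappa> I + 1 / 2 * A \<kappa> I"
    unfolding sum.distrib sum_distrib_left[symmetric]
    using \<kappa> sphere_pts_uminus[of \<kappa> l] by (simp add: finite_sphere_pts)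
  also have "\<dots> = A \<kappa> I" by simp
  finally show ?thesis .
qed

lemma synth_inject:
  assumes A: "A \<in> amplitudes l" "A' \<in> amplitudes l" and e: "synth l A = synth l A'"
  shows "A = A'"
proof (intro ext)
  fix \<mu> I
  show "A \<mu> I = A' \<mu> I"
  proof (cases "\<mu> \<in> sphere_pts l")
    case True
    then show ?thesis using Fc_synth[OF A(1)] Fc_synth[OF A(2)] e by metis
  next
    case False
    then show ?thesis using A by (simp add: amplitudes_def)
  qed
qed

text \<open>The two identities of \<open>Fourier_aps\<close> are coupled; eliminating the sine
  coefficient gives \<open>l^2 c = (2 pi |\<mu>|)^2 c\<close> for the cosine coefficient
  \<open>c\<close>.\<close>

lemma eigen_Fourier:
  fixes \<phi> :: "'n::{finite,linorder} form"
  assumes n: "CARD('n) mod 4 = 3" and l: "l \<noteq> 0" and t: "torus_form \<phi>" and ev: "even_form \<phi>"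
    and e: "aps_op \<phi> = form_scale l \<phi>" and \<mu>: "lattice_pt \<mu>"
  shows "Fs \<mu> (\<lambda>x. \<phi> x I) = - rot l \<mu> (\<lambda>K. Fc \<mu> (\<lambda>x. \<phi> x K)) I"
    and "\<mu> \<notin> sphere_pts l \<Longrightarrow> Fc \<mu> (\<lambda>x. \<phi> x I) = 0"
proof -
  let ?c = "\<lambda>K. Fc \<mu> (\<lambda>x. \<phi> x K)" and ?s = "\<lambda>K. Fs \<mu> (\<lambda>x. \<phi> x K)"
  have c: "l * ?c I = 2 * pi * symb \<mu> ?s I" for I
    using Fourier_aps(1)[OF t \<mu>, of I] unfolding e form_scale_def Fc_def[of _ "\<lambda>x. l * _ x"]
    by (simp add: Fc_def mult.left_commute[of _ l] mean_scale)
  have s: "l * ?s I = - (2 * pi * symb \<mu> ?c I)" for I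
    using Fourier_aps(2)[OF t \<mu>, of I] unfolding e form_scale_def
    by (simp add: Fs_def mult.left_commute[of _ l] mean_scale)
  show s': "?s I = - rot l \<mu> ?c I" for I
    using s[of I] l by (simp add: rot_def field_simps)
  assume \<mu>': "\<mu> \<notin> sphere_pts l"
  have evc: "even_vec ?c" using ev by (simp add: even_vec_def even_form_def Fc_def mean_def)
  have "l * ?c I = 2 * pi * symb \<mu> (\<lambda>K. (- (2 * pi / l)) * symb \<mu> ?c K + 0 * ?c K) I"
    unfolding c using s' by (simp add: rot_def)
  also have "\<dots> = 2 * pi * (2 * pi / l) * (\<Sum>j\<in>UNIV. (\<mu> $ j)\<^sup>2) * ?c I"
    unfolding symb_lincomb symb_symb[OF n evc] by simp
  finally have "(l\<^sup>2 - (2 * pi)\<^sup>2 * (\<Sum>j\<in>UNIV. (\<mu> $ j)\<^sup>2)) * ?c I = 0"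
    using l by (simp add: field_simps power2_eq_square)
  then show "?c I = 0" using \<mu>' \<mu> by (simp add: sphere_pts_def)
qed

text \<open>\<open>\<phi>\<close> is compared with the synthesis of its own cosine coefficients;
  both are eigenforms, so their sine coefficients agree as well, and completeness applies to the
  difference.\<close>

lemma torus_eigenspace_synth:
  fixes \<phi> :: "'n::{finite,linorder} form"
  assumes n: "CARD('n) mod 4 = 3" and l: "l \<noteq> 0" and \<phi>: "\<phi> \<in> torus_eigenspace l"
  shows "\<exists>A\<in>amplitudes l. \<phi> = synth l A"
proof -
  have tf: "torus_form \<psi>" if "\<psi> \<in> torus_eigenspace l" for \<psi> :: "'n form"
    using that by (auto simp: torus_eigenspace_def torus_form_def smooth_form_def intro: C_infinity_C1)
  define A :: "'n form" where "A \<mu> I = (if \<mu> \<in> sphere_pts l then Fc \<mu> (\<lambda>x. \<phi> x I) else 0)" for \<mu> I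
  have A: "A \<in> amplitudes l"
    unfolding amplitudes_def
  proof (intro CollectI conjI allI impI)
    show "A \<mu> I = 0" if "\<mu> \<notin> sphere_pts l" for \<mu> I using that by (simp add: A_def)
    show "even_vec (A \<mu>)" for \<mu>
      using \<phi> by (simp add: even_vec_def A_def torus_eigenspace_def even_form_def Fc_def mean_def)
    show "A (- \<mu>) = A \<mu>" for \<mu> by (simp add: A_def fun_eq_iff sphere_pts_uminus Fc_def)
  qed
  let ?s = "synth l A"
  have s: "?s \<in> torus_eigenspace l" by (rule synth_eigen[OF n l A])
  have t1: "torus_form \<phi>" and t2: "torus_form ?s" by (rule tf[OF \<phi>], rule tf[OF s])
  have Cc: "continuous_on UNIV (\<lambda>x. \<phi> x K)" "continuous_on UNIV (\<lambda>x. ?s x K)" for K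
    using t1 t2 continuous_C1 by (auto simp: torus_form_def)
  have e1: "even_form \<phi>" "aps_op \<phi> = form_scale l \<phi>" and e2: "even_form ?s" "aps_op ?s = form_scale l ?s"
    using \<phi> s by (auto simp: torus_eigenspace_def)
  have c: "Fc \<mu> (\<lambda>x. \<phi> x I) = Fc \<mu> (\<lambda>x. ?s x I)" if \<mu>: "lattice_pt \<mu>" for \<mu> I
  proof (cases "\<mu> \<in> sphere_pts l")
    case True
    then show ?thesis using Fc_synth[OF A True, of I] by (simp add: A_def)
  next
    case False
    then show ?thesis
      using eigen_Fourier(2)[OF n l t1 e1 \<mu>] eigen_Fourier(2)[OF n l t2 e2 \<mu>] by simp
  qed
  have sn: "Fs \<mu> (\<lambda>x. \<phi> x I) = Fs \<mu> (\<lambda>x. ?s x I)" if \<mu>: "lattice_pt \<mu>" for \<mu> I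
    unfolding eigen_Fourier(1)[OF n l t1 e1 \<mu>] eigen_Fourier(1)[OF n l t2 e2 \<mu>] c[OF \<mu>] ..
  have "\<phi> x I = ?s x I" for x I
  proof -
    have "\<phi> x I + (-1) * ?s x I = 0"
    proof (rule Fourier_unique[where f = "\<lambda>x. \<phi> x I + (-1) * ?s x I"])
      show "continuous_on UNIV (\<lambda>x. \<phi> x I + (-1) * ?s x I)" by (intro continuous_intros Cc)
      show "periodic (\<lambda>x. \<phi> x I + (-1) * ?s x I)"
        using t1 t2 by (auto simp: torus_form_def periodic_def)
      fix \<mu> :: "real ^ ('n::{finite,linorder})" assume \<mu>: "lattice_pt \<mu>"
      have "Fc \<mu> (\<lambda>x. \<phi> x I + (-1) * ?s x I) = mean (\<lambda>x. cosw \<mu> x * \<phi> x I + (-1) * (cosw \<mu> x * ?s x I))"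
        unfolding Fc_def by (simp add: algebra_simps)
      also have "\<dots> = Fc \<mu> (\<lambda>x. \<phi> x I) + (-1) * Fc \<mu> (\<lambda>x. ?s x I)"
        unfolding Fc_def mean_scale[symmetric] by (intro mean_add continuous_intros Cc)
      finally show "Fc \<mu> (\<lambda>x. \<phi> x I + (-1) * ?s x I) = 0" using c[OF \<mu>] by simp
      have "Fs \<mu> (\<lambda>x. \<phi> x I + (-1) * ?s x I) = mean (\<lambda>x. sinw \<mu> x * \<phi> x I + (-1) * (sinw \<mu> x * ?s x I))"
        unfolding Fs_def by (simp add: algebra_simps)
      also have "\<dots> = Fs \<mu> (\<lambda>x. \<phi> x I) + (-1) * Fs \<mu> (\<lambda>x. ?s x I)"
        unfolding Fs_def mean_scale[symmetric] by (intro mean_add continuous_intros Cc)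
      finally show "Fs \<mu> (\<lambda>x. \<phi> x I + (-1) * ?s x I) = 0" using sn[OF \<mu>] by simp
    qed
    then show ?thesis by simp
  qed
  then have "\<phi> = ?s" by (intro ext)
  then show ?thesis using A by blast
qed

type_synonym 'n rvec = "(real, 'n) Finite_Cartesian_Product.vec"

section \<open>Pullback along affine isometries\<close>

lemma pullback_affine:
  "pullback (\<lambda>x. A *v x + v) \<phi> x = pull A (\<phi> (A *v x + v))"
proof -
  have "((\<lambda>x. A *v x + v) has_derivative (*v) A) (at x)"
    by (auto intro!: derivative_eq_intros bounded_linear_imp_has_derivative matrix_vector_mul_bounded_linear)
  then have "frechet_derivative (\<lambda>x. A *v x + v) (at x) = (*v) A"
    by (rule frechet_derivative_at[symmetric])
  then show ?thesis
    unfolding pullback_def pull_def by (simp add: matrix_of_matrix_vector_mul)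
qed

lemma orthogonal_flip:
  fixes A :: "'n::finite sq_matrix"
  shows "A ** transpose A = idm \<Longrightarrow> transpose A ** A = idm"
  by (rule iffD1[OF matrix_left_right_inverse])

text \<open>The induction over the generated group needs closure under composition and inverse.
  Carrying the affine form of \<open>g\<close> along reduces the chain rule to
  \<open>pull_pull\<close>.\<close>

definition affine_invariant :: "'n::{finite,linorder} form \<Rightarrow> 'n self_map \<Rightarrow> bool" where
  "affine_invariant \<phi> g \<longleftrightarrow> (\<exists>A v. g = (\<lambda>x. A *v x + v) \<and> A ** transpose A = idm \<and>
     (\<forall>x. pull A (\<phi> (A *v x + v)) = \<phi> x))"

lemma affine_invariantI:
  assumes "g = (\<lambda>x. A *v x + v)" "A ** transpose A = idm" "\<And>x. pull A (\<phi> (A *v x + v)) = \<phi> x"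
  shows "affine_invariant \<phi> g"
  unfolding affine_invariant_def by (rule exI[of _ A], rule exI[of _ v], intro conjI allI assms)

lemma affine_invariant_pullback:
  assumes "affine_invariant \<phi> g"
  shows "pullback g \<phi> = \<phi>"
proof -
  obtain A v where g: "g = (\<lambda>x. A *v x + v)" and iA: "\<And>x. pull A (\<phi> (A *v x + v)) = \<phi> x"
    using assms unfolding affine_invariant_def by blast
  show ?thesis unfolding g by (rule ext) (simp only: pullback_affine iA)
qed

lemma affine_invariant_compose:
  assumes "affine_invariant \<phi> g" "affine_invariant \<phi> h"
  shows "affine_invariant \<phi> (\<lambda>x. g (h x))"
proof -
  obtain A v where g: "g = (\<lambda>x. A *v x + v)" and A: "A ** transpose A = idm"
    and iA: "\<And>x. pull A (\<phi> (A *v x + v)) = \<phi> x"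
    using assms(1) unfolding affine_invariant_def by blast
  obtain C w where h: "h = (\<lambda>x. C *v x + w)" and C: "C ** transpose C = idm"
    and iC: "\<And>x. pull C (\<phi> (C *v x + w)) = \<phi> x"
    using assms(2) unfolding affine_invariant_def by blast
  have e: "A *v (C *v x + w) + v = (A ** C) *v x + (A *v w + v)" for x
    by (simp add: matrix_vector_right_distrib matrix_vector_mul_assoc add.assoc)
  have "(A ** C) ** transpose (A ** C) = A ** ((C ** transpose C) ** transpose A)"
    by (simp add: matrix_transpose_mul matrix_mul_assoc)
  also have "\<dots> = idm" unfolding C by (simp add: A)
  finally have 1: "(A ** C) ** transpose (A ** C) = idm" .
  have 2: "pull (A ** C) (\<phi> ((A ** C) *v x + (A *v w + v))) = \<phi> x" for x
    unfolding e[symmetric] pull_pull[symmetric] iA iC ..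
  show ?thesis
  proof (rule affine_invariantI[where A = "A ** C" and v = "A *v w + v"])
    show "(\<lambda>x. g (h x)) = (\<lambda>x. (A ** C) *v x + (A *v w + v))" by (simp only: g h e)
  qed (rule 1, rule 2)
qed

lemma affine_invariant_inverse:
  assumes "affine_invariant \<phi> g" "\<And>x. g (h x) = x"
  shows "affine_invariant \<phi> h"
proof -
  obtain A v where g: "g = (\<lambda>x. A *v x + v)" and A: "A ** transpose A = idm"
    and iA: "\<And>x. pull A (\<phi> (A *v x + v)) = \<phi> x"
    using assms(1) unfolding affine_invariant_def by blast
  let ?T = "transpose A"
  have TA: "?T ** A = idm" by (rule orthogonal_flip[OF A])
  have h: "h x = ?T *v x + (- (?T *v v))" for x
  proof -
    have "?T *v (A *v h x + v) = ?T *v x" using assms(2)[of x] unfolding g by simp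
    then have "h x + ?T *v v = ?T *v x"
      by (simp add: matrix_vector_right_distrib matrix_vector_mul_assoc TA)
    then show ?thesis by (simp add: eq_diff_eq)
  qed
  have "pull ?T (\<phi> (?T *v x + (- (?T *v v)))) = \<phi> x" for x
  proof -
    have "pull ?T (\<phi> (h x)) = pull ?T (pull A (\<phi> (A *v h x + v)))" unfolding iA ..
    also have "A *v h x + v = x" using assms(2)[of x] unfolding g .
    also have "pull ?T (pull A (\<phi> x)) = \<phi> x" unfolding pull_pull A pull_mat_1 ..
    finally show ?thesis unfolding h .
  qed
  then show ?thesis
  proof (rule affine_invariantI[where A = ?T and v = "- (?T *v v)", rotated 2])
    show "h = (\<lambda>x. ?T *v x + - (?T *v v))" by (rule ext) (rule h)
    show "?T ** transpose ?T = idm" using TA by simp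
  qed
qed

lemma (in vector_space) dim_image_inj:
  assumes lin: "Vector_Spaces.linear scale scale f" and sub: "subspace S"
    and inj: "\<And>x. x \<in> S \<Longrightarrow> f x = 0 \<Longrightarrow> x = 0" and fin: "finite X" "S \<subseteq> span X"
  shows "dim (f ` S) = dim S"
proof -
  interpret f: Vector_Spaces.linear scale scale f by (rule lin)
  obtain B where B: "B \<subseteq> S" "independent B" "S \<subseteq> span B" "card B = dim S"
    using basis_exists by blast
  have sB: "span B = S" using span_minimal[OF B(1) sub] B(3) by blast
  have i: "inj_on f S"
  proof (rule inj_onI)
    fix x y assume xy: "x \<in> S" "y \<in> S" "f x = f y"
    then have "x - y \<in> S" using sub subspace_diff by blast
    moreover have "f (x - y) = 0" using xy by (simp add: f.diff)
    ultimately have "x - y = 0" by (rule inj)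
    then show "x = y" by simp
  qed
  have "independent (f ` B)"
    using f.independent_injective_image[OF B(2)] i sB by simp
  moreover have "f ` S \<subseteq> span (f ` B)" using f.span_image[of B] sB by blast
  ultimately have "dim (f ` S) = card (f ` B)"
    using B(1) by (intro dim_unique[of "f ` B"]) auto
  also have "\<dots> = card B" by (rule card_image) (rule inj_on_subset[OF i B(1)])
  finally show ?thesis using B(4) by simp
qed

section \<open>The group of deck transformations and its invariant forms\<close>

context holonomy
begin

abbreviation M :: 'n where "M \<equiv> Max UNIV"

abbreviation bv :: "'n rvec" where "bv \<equiv> axis M (1 / 2 ^ r)"

definition gen :: "'n self_map" where "gen = (\<lambda>x. B *v translation bv x)"

definition \<Gamma> :: "'n self_map set" where
  "\<Gamma> = generate (BijGroup UNIV) (insert gen {translation v | v. \<forall>i. v $ i \<in> \<int>})"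

lemma odd_card: "odd CARD('n)" using card_mod_4 by presburger

lemma B_axis: "B *v axis M t = axis M t"
  by (simp add: Finite_Cartesian_Product.vec_eq_iff matrix_vector_mult_def axis_def B_col
      if_distrib[of "\<lambda>x. _ * x"] cong: if_cong)

lemma B_nth_M: "(B *v x) $ M = x $ M"
  by (simp add: matrix_vector_mult_def B_row if_distrib[of "\<lambda>x. x * _"] cong: if_cong)

lemma gen_eq: "gen = (\<lambda>x. B *v x + bv)"
  by (simp add: gen_def translation_def matrix_vector_right_distrib B_axis)

lemma BT: "transpose B ** B = idm" by (rule orthogonal_flip[OF B_orth])

definition Binv :: "'n rvec \<Rightarrow> 'n rvec" where "Binv x = transpose B *v x"

lemma B_inverse: "Binv (B *v x) = x" "B *v (Binv x) = x"
  unfolding Binv_def matrix_vector_mul_assoc BT B_orth by simp_all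

lemma inner_B: "(B *v x) \<bullet> (B *v y) = x \<bullet> y"
proof -
  have "(B *v x) \<bullet> (B *v y) = Binv (B *v x) \<bullet> y"
    unfolding Binv_def transpose_matrix_vector dot_lmul_matrix ..
  then show ?thesis by (simp add: B_inverse)
qed

lemma lattice_B: "lattice_pt x \<Longrightarrow> lattice_pt (B *v x)"
  unfolding lattice_pt_def matrix_vector_mult_def using B_int by (auto intro!: Ints_sum Ints_mult)

lemma lattice_BT: "lattice_pt x \<Longrightarrow> lattice_pt (Binv x)"
  unfolding lattice_pt_def Binv_def matrix_vector_mult_def using B_int
  by (auto simp: Finite_Cartesian_Product.transpose_def intro!: Ints_sum Ints_mult)

lemma sum_sq_inner: "(\<Sum>j\<in>UNIV. (x $ j)\<^sup>2) = x \<bullet> (x :: 'n rvec)"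
  by (simp add: inner_vec_def power2_eq_square)

lemma sphere_B: "B *v \<mu> \<in> sphere_pts l \<longleftrightarrow> \<mu> \<in> sphere_pts l"
proof -
  have "lattice_pt (B *v \<mu>) \<longleftrightarrow> lattice_pt \<mu>"
    using lattice_B[of \<mu>] lattice_BT[of "B *v \<mu>"] by (auto simp: B_inverse)
  then show ?thesis by (simp add: sphere_pts_def sum_sq_inner inner_B)
qed

lemma invariant_iff:
  "(\<forall>g\<in>\<Gamma>. pullback g \<phi> = \<phi>) \<longleftrightarrow> pullback gen \<phi> = \<phi> \<and> (\<forall>K. periodic (\<lambda>x. \<phi> x K))"
proof
  let ?T = "{translation v | v. \<forall>i. v $ i \<in> \<int>} :: 'n self_map set"
  assume L: "\<forall>g\<in>\<Gamma>. pullback g \<phi> = \<phi>"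
  have "gen \<in> \<Gamma>" unfolding \<Gamma>_def by (rule generate.incl) simp
  moreover have "periodic (\<lambda>x. \<phi> x K)" for K
    unfolding periodic_def
  proof (intro allI impI)
    fix x v :: "'n rvec" assume v: "lattice_pt v"
    have t: "translation v = (\<lambda>x. idm *v x + v)" by (simp add: translation_def)
    have "translation v \<in> \<Gamma>"
      unfolding \<Gamma>_def by (rule generate.incl) (use v in \<open>auto simp: lattice_pt_def\<close>)
    then have "pullback (translation v) \<phi> x = \<phi> x" using L by simp
    then have "pull idm (\<phi> (idm *v x + v)) = \<phi> x" unfolding t pullback_affine .
    then show "\<phi> (x + v) K = \<phi> x K" by (simp add: pull_mat_1)
  qed
  ultimately show "pullback gen \<phi> = \<phi> \<and> (\<forall>K. periodic (\<lambda>x. \<phi> x K))" using L by blast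
next
  let ?T = "{translation v | v. \<forall>i. v $ i \<in> \<int>} :: 'n self_map set"
  assume R: "pullback gen \<phi> = \<phi> \<and> (\<forall>K. periodic (\<lambda>x. \<phi> x K))"
  have bij_gen: "bij gen"
    by (rule bij_betw_byWitness[where f' = "\<lambda>y. Binv (y - bv)"])
      (auto simp: gen_eq B_inverse)
  have bij_tr: "bij (translation v)" for v :: "'n rvec"
    by (rule bij_betw_byWitness[where f' = "\<lambda>y. y - v"]) (auto simp: translation_def)
  have inB: "h \<in> Bij UNIV" if "h \<in> insert gen ?T" for h
    using that bij_gen bij_tr by (auto simp: Bij_def)
  have sub: "insert gen ?T \<subseteq> carrier (BijGroup UNIV)"
    using inB by (auto simp: BijGroup_def)
  have base: "affine_invariant \<phi> h" if h: "h \<in> insert gen ?T" for h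
  proof -
    consider "h = gen" | v where "h = translation v" "\<forall>i. v $ i \<in> \<int>"
      using h by blast
    then show ?thesis
    proof cases
      case 1
      have "pull B (\<phi> (B *v x + bv)) = \<phi> x" for x
        using R pullback_affine[of B bv \<phi> x] unfolding gen_eq by simp
      then show ?thesis unfolding 1 by (rule affine_invariantI[OF gen_eq B_orth])
    next
      case 2
      have "\<phi> (x + v) = \<phi> x" for x
        using R 2(2) by (auto simp: periodic_def lattice_pt_def)
      then have "pull idm (\<phi> (idm *v x + v)) = \<phi> x" for x by (simp add: pull_mat_1)
      moreover have "translation v = (\<lambda>x. idm *v x + v)" by (simp add: translation_def)
      ultimately show ?thesis unfolding 2
        by (intro affine_invariantI[of "translation v" idm v]) (simp_all add: transpose_mat)
    qed
  qed
  have "affine_invariant \<phi> g" if "g \<in> \<Gamma>" for g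
    using that unfolding \<Gamma>_def
  proof (induction rule: generate.induct)
    case one
    have "\<one>\<^bsub>BijGroup UNIV\<^esub> = (\<lambda>x. idm *v x + 0 :: 'n rvec)" by (simp add: BijGroup_def fun_eq_iff)
    then show ?case
      by (rule affine_invariantI[where A = idm and v = 0]) (simp_all add: pull_mat_1 transpose_mat)
  next
    case (incl h)
    then show ?case by (rule base)
  next
    case (inv h)
    have h: "h \<in> Bij UNIV" by (rule inB[OF inv])
    then have "inv\<^bsub>BijGroup UNIV\<^esub> h = inv_into UNIV h" by (simp add: inv_BijGroup fun_eq_iff)
    moreover have "h (inv_into UNIV h x) = x" for x
      using h by (simp add: Bij_def bij_betw_def surj_f_inv_f)
    ultimately show ?case using affine_invariant_inverse[OF base[OF inv]] by simp
  next
    case (eng h1 h2)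
    interpret G: Group.group "BijGroup (UNIV :: 'n rvec set)" by (rule group_BijGroup)
    have "h1 \<in> Bij UNIV" "h2 \<in> Bij UNIV"
      using G.generate_in_carrier[OF sub eng(1)] G.generate_in_carrier[OF sub eng(2)]
      by (simp_all add: BijGroup_def)
    then have "h1 \<otimes>\<^bsub>BijGroup UNIV\<^esub> h2 = (\<lambda>x. h1 (h2 x))"
      by (simp add: BijGroup_def compose_def fun_eq_iff)
    then show ?case using affine_invariant_compose[OF eng(3,4)] by simp
  qed
  then show "\<forall>g\<in>\<Gamma>. pullback g \<phi> = \<phi>" using affine_invariant_pullback by blast
qed

section \<open>Invariant amplitudes\<close>

definition phase :: "'n rvec \<Rightarrow> real" where "phase \<nu> = 2 * pi * (\<nu> $ M) / 2 ^ r"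

text \<open>Pullback by \<open>gen\<close>, read on cosine amplitudes: the amplitude at
  \<open>\<nu>\<close> comes from \<open>B *v \<nu>\<close> and is multiplied by the exponential of
  i times the phase, with \<open>- rot\<close> in the place of i.\<close>

definition act :: "real \<Rightarrow> 'n form \<Rightarrow> 'n form" where
  "act l A = (\<lambda>\<nu> I. cos (phase \<nu>) * pull B (A (B *v \<nu>)) I - sin (phase \<nu>) * rot l \<nu> (pull B (A (B *v \<nu>))) I)"

definition inv_amp :: "real \<Rightarrow> 'n form set" where
  "inv_amp l = {A \<in> amplitudes l. act l A = A}"

lemma pull_rot_gen:
  assumes "C ** transpose C = idm"
  shows "pull C (rot l \<mu> w) I = minor C UNIV UNIV * rot l (transpose C *v \<mu>) (pull C w) I"
  unfolding rot_def pull_scale pull_symb[OF assms] by simp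

lemma rot_uminus: "rot l (- \<mu>) w I = - rot l \<mu> w I"
  by (simp add: rot_def symb_def sum_negf)

lemma rot_minus: "rot (- l) \<mu> w I = - rot l \<mu> w I"
  by (simp add: rot_def)

lemma phase_uminus: "phase (- \<nu>) = - phase \<nu>"
  by (simp add: phase_def)

lemma amplitudesD:
  assumes "A \<in> amplitudes l"
  shows "\<mu> \<notin> sphere_pts l \<Longrightarrow> A \<mu> I = 0" "even_vec (A \<mu>)" "A (- \<mu>) = A \<mu>"
  using assms by (auto simp: amplitudes_def)

lemma rot_zero: "rot l \<mu> (\<lambda>_. 0) I = 0"
  using rot_lincomb[of l \<mu> 0 "\<lambda>_. 0" 0 "\<lambda>_. 0" I] by simp

lemma even_vec_diff: "even_vec v \<Longrightarrow> even_vec w \<Longrightarrow> even_vec (\<lambda>I. x * v I - y * w I)"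
  by (simp add: even_vec_def)

lemma mv_uminus: "C *v (- x) = - (C *v x)" for C :: "'n sq_matrix"
  by (simp add: Finite_Cartesian_Product.vec_eq_iff matrix_vector_mult_def sum_negf)

lemma pull_zero_fun: "pull C (\<lambda>_. 0) = (\<lambda>_. 0)"
  by (rule ext) (rule pull_zero)

lemma act_amplitudes:
  assumes "A \<in> amplitudes l"
  shows "act l A \<in> amplitudes l"
  unfolding amplitudes_def
proof (intro CollectI conjI allI impI)
  fix \<mu> :: "'n rvec" and I
  show "act l A \<mu> I = 0" if "\<mu> \<notin> sphere_pts l"
  proof -
    have "A (B *v \<mu>) = (\<lambda>_. 0)" using that amplitudesD(1)[OF assms] sphere_B by blast
    then show ?thesis by (simp add: act_def pull_zero_fun rot_zero)
  qed
  show "even_vec (act l A \<mu>)"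
    unfolding act_def
    by (intro even_vec_diff even_vec_rot[OF card_mod_4] even_vec_pull amplitudesD(2)[OF assms])
  have e: "A (B *v (- \<mu>)) = A (B *v \<mu>)"
    unfolding mv_uminus by (rule amplitudesD(3)[OF assms])
  show "act l A (- \<mu>) = act l A \<mu>"
    unfolding act_def phase_uminus rot_uminus e by simp
qed

text \<open>Reindexing by \<open>\<mu> = B *v \<nu>\<close> and the addition formulas. As
  \<open>B\<close> has determinant 1, \<open>rot\<close> passes through \<open>pull B\<close>
  without a sign.\<close>

lemma pullback_synth:
  assumes A: "A \<in> amplitudes l" and l: "l \<noteq> 0"
  shows "pullback gen (synth l A) = synth l (act l A)"
proof (intro ext)
  fix x I
  let ?w = "\<lambda>\<nu>. pull B (A (B *v \<nu>))"
  have rr: "rot l \<nu> (rot l \<nu> (?w \<nu>)) I = - ?w \<nu> I" if "\<nu> \<in> sphere_pts l" for \<nu>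
    using rot_rot[OF card_mod_4 even_vec_pull[OF amplitudesD(2)[OF A]] that l] by simp
  have pr: "pull B (rot l (B *v \<nu>) w) I = rot l \<nu> (pull B w) I" for \<nu> w
    unfolding pull_rot_gen[OF B_orth] B_det Binv_def[symmetric] B_inverse by simp
  \<comment> \<open>The shift \<open>bv\<close> lies on the axis and \<open>B\<close> preserves the
    last coordinate of \<open>\<nu>\<close>, so it contributes the phase of \<open>\<nu>\<close>
    itself.\<close>
  have arg: "2 * pi * ((B *v \<nu>) \<bullet> (B *v x + bv)) = 2 * pi * (\<nu> \<bullet> x) + phase \<nu>" for \<nu>
    by (simp add: inner_add_right inner_B inner_axis B_nth_M phase_def algebra_simps)
  have "pullback gen (synth l A) x I = pull B (synth l A (B *v x + bv)) I"
    unfolding gen_eq pullback_affine ..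
  also have "\<dots> = (\<Sum>\<mu>\<in>sphere_pts l. cosw \<mu> (B *v x + bv) * pull B (A \<mu>) I
      - sinw \<mu> (B *v x + bv) * pull B (rot l \<mu> (A \<mu>)) I)"
  proof -
    have e: "synth l A (B *v x + bv) = (\<lambda>I. \<Sum>\<mu>\<in>sphere_pts l. 1 * (cosw \<mu> (B *v x + bv) * A \<mu> I
      - sinw \<mu> (B *v x + bv) * rot l \<mu> (A \<mu>) I))" by (simp add: synth_def)
    show ?thesis unfolding e pull_sum pull_diff pull_scale by simp
  qed
  also have "\<dots> = (\<Sum>\<nu>\<in>sphere_pts l. cosw (B *v \<nu>) (B *v x + bv) * ?w \<nu> I
      - sinw (B *v \<nu>) (B *v x + bv) * pull B (rot l (B *v \<nu>) (A (B *v \<nu>))) I)"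
    by (rule sum.reindex_bij_witness[where i = "(*v) B" and j = Binv])
      (use sphere_B sphere_B[of "Binv _"] in \<open>auto simp: B_inverse\<close>)
  also have "\<dots> = (\<Sum>\<nu>\<in>sphere_pts l. cosw \<nu> x * act l A \<nu> I - sinw \<nu> x * rot l \<nu> (act l A \<nu>) I)"
  proof (rule sum.cong[OF refl])
    fix \<nu> :: "'n rvec" assume \<nu>: "\<nu> \<in> sphere_pts l"
    have e: "act l A \<nu> = (\<lambda>I. cos (phase \<nu>) * ?w \<nu> I + (- sin (phase \<nu>)) * rot l \<nu> (?w \<nu>) I)"
      by (simp add: act_def)
    have "rot l \<nu> (act l A \<nu>) I = cos (phase \<nu>) * rot l \<nu> (?w \<nu>) I + sin (phase \<nu>) * ?w \<nu> I"
      unfolding e rot_lincomb rr[OF \<nu>] by simp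
    then show "cosw (B *v \<nu>) (B *v x + bv) * ?w \<nu> I
      - sinw (B *v \<nu>) (B *v x + bv) * pull B (rot l (B *v \<nu>) (A (B *v \<nu>))) I
      = cosw \<nu> x * act l A \<nu> I - sinw \<nu> x * rot l \<nu> (act l A \<nu>) I"
      unfolding arg cos_add sin_add pr by (simp add: act_def algebra_simps)
  qed
  finally show "pullback gen (synth l A) x I = synth l (act l A) x I" by (simp add: synth_def)
qed

lemma eigenspace_eq:
  assumes l: "l \<noteq> 0"
  shows "eigenspace \<Gamma> l = synth l ` inv_amp l"
proof (intro equalityI subsetI)
  fix \<phi> assume "\<phi> \<in> eigenspace \<Gamma> l"
  then have \<phi>: "smooth_form \<phi>" "even_form \<phi>" "\<forall>g\<in>\<Gamma>. pullback g \<phi> = \<phi>" "aps_op \<phi> = form_scale l \<phi>"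
    by (auto simp: eigenspace_def even_forms_def)
  then have inv: "pullback gen \<phi> = \<phi>" "\<forall>K. periodic (\<lambda>x. \<phi> x K)" using invariant_iff[of \<phi>] by auto
  then have "\<phi> \<in> torus_eigenspace l" using \<phi> by (simp add: torus_eigenspace_def)
  then obtain A where A: "A \<in> amplitudes l" "\<phi> = synth l A"
    using torus_eigenspace_synth[OF card_mod_4 l] by blast
  then have "synth l (act l A) = synth l A" using pullback_synth[OF A(1) l] inv by simp
  then have "act l A = A" by (rule synth_inject[OF act_amplitudes[OF A(1)] A(1)])
  then show "\<phi> \<in> synth l ` inv_amp l" using A by (auto simp: inv_amp_def)
next
  fix \<phi> assume "\<phi> \<in> synth l ` inv_amp l"
  then obtain A where A: "A \<in> amplitudes l" "act l A = A" "\<phi> = synth l A" by (auto simp: inv_amp_def)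
  have t: "\<phi> \<in> torus_eigenspace l" unfolding A(3) by (rule synth_eigen[OF card_mod_4 l A(1)])
  moreover have "pullback gen \<phi> = \<phi>" using pullback_synth[OF A(1) l] A by simp
  ultimately have "\<forall>g\<in>\<Gamma>. pullback g \<phi> = \<phi>"
    unfolding invariant_iff by (simp add: torus_eigenspace_def)
  then show "\<phi> \<in> eigenspace \<Gamma> l"
    using t by (simp add: eigenspace_def even_forms_def torus_eigenspace_def)
qed

lemma linear_synth: "linear_form_map (synth l :: 'n form \<Rightarrow> 'n form)"
proof (rule linear_form_mapI)
  fix A A' :: "'n form"
  have "rot l \<mu> ((A + A') \<mu>) I = rot l \<mu> (A \<mu>) I + rot l \<mu> (A' \<mu>) I" for \<mu> I
    using rot_lincomb[of l \<mu> 1 "A \<mu>" 1 "A' \<mu>" I] by (simp add: plus_fun_def)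
  then show "synth l (A + A') = synth l A + synth l A'"
    by (simp add: synth_def fun_eq_iff algebra_simps sum.distrib sum_subtractf)
next
  fix c and A :: "'n form"
  have "rot l \<mu> (form_scale c A \<mu>) I = c * rot l \<mu> (A \<mu>) I" for \<mu> I
    using rot_lincomb[of l \<mu> c "A \<mu>" 0 "A \<mu>" I] by (simp add: form_scale_def)
  then show "synth l (form_scale c A) = form_scale c (synth l A)"
    by (simp add: synth_def fun_eq_iff form_scale_def sum_distrib_left algebra_simps)
qed

lemma pull_add_fun: "pull C (A + A') = pull C A + pull C A'"
  by (simp add: fun_eq_iff pull_def sum.distrib distrib_right)

lemma act_linear: "act l (A + A') = act l A + act l A'" "act l (form_scale c A) = form_scale c (act l A)"
proof -
  have "rot l \<mu> (v + w) I = rot l \<mu> v I + rot l \<mu> w I" for \<mu> v w and I :: "'n set"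
    using rot_lincomb[of l \<mu> 1 v 1 w I] by (simp add: plus_fun_def)
  then show "act l (A + A') = act l A + act l A'"
    by (simp add: act_def fun_eq_iff pull_add_fun algebra_simps)
  have s: "rot l \<mu> (\<lambda>I. c * w I) I = c * rot l \<mu> w I" for \<mu> w and I :: "'n set"
    using rot_lincomb[of l \<mu> c w 0 w I] by simp
  have p: "pull B (form_scale c A \<mu>) = (\<lambda>I. c * pull B (A \<mu>) I)" for \<mu>
    by (simp add: fun_eq_iff form_scale_def pull_scale)
  show "act l (form_scale c A) = form_scale c (act l A)"
    by (simp add: act_def p s fun_eq_iff) (simp add: form_scale_def algebra_simps)
qed

lemma subspace_inv_amp: "forms.subspace (inv_amp l)"
proof (rule forms.subspaceI)
  have "act l (form_scale 0 (\<lambda>_ _. 0)) = form_scale 0 (act l (\<lambda>_ _. 0))" by (rule act_linear(2))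
  then have "act l 0 = 0" by simp
  then show "0 \<in> inv_amp l"
    by (simp add: inv_amp_def amplitudes_def even_vec_def)
  show "A + A' \<in> inv_amp l" if "A \<in> inv_amp l" "A' \<in> inv_amp l" for A A'
    using that by (auto simp: inv_amp_def act_linear amplitudes_def even_vec_def)
  show "form_scale c A \<in> inv_amp l" if A: "A \<in> inv_amp l" for c A
  proof -
    have "act l A = A" "A \<in> amplitudes l" using A by (auto simp: inv_amp_def)
    moreover from this(2) have "form_scale c A \<in> amplitudes l"
      by (auto simp: amplitudes_def even_vec_def form_scale_def)
    ultimately show ?thesis by (simp add: inv_amp_def act_linear(2))
  qed
qed

lemma inv_amp_support: "A \<in> inv_amp l \<Longrightarrow> \<mu> \<notin> sphere_pts l \<Longrightarrow> A \<mu> I = 0"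
  by (simp add: inv_amp_def amplitudes_def)

lemma fin_dim_inv_amp: "fin_dim (inv_amp l)"
  using finite_support_fin_dim(1)[OF finite_sphere_pts, where V = "inv_amp l"] inv_amp_support by blast

lemma multiplicity_eq:
  assumes l: "l \<noteq> 0"
  shows "multiplicity \<Gamma> l = forms.dim (inv_amp l)"
proof -
  obtain X where X: "finite X" "inv_amp l \<subseteq> forms.span X"
    using fin_dim_inv_amp[of l] unfolding fin_dim_def by blast
  have "forms.dim (synth l ` inv_amp l) = forms.dim (inv_amp l)"
  proof (rule forms.dim_image_inj[OF linear_synth subspace_inv_amp _ X])
    fix A assume A: "A \<in> inv_amp l" "synth l A = 0"
    interpret s: Vector_Spaces.linear form_scale form_scale "synth l :: 'n form \<Rightarrow> 'n form"
      by (rule linear_synth)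
    have "synth l 0 = (0 :: 'n form)" by (rule s.zero)
    then have "synth l A = synth l 0" using A by simp
    moreover have "0 \<in> inv_amp l" by (rule forms.subspace_0[OF subspace_inv_amp])
    ultimately show "A = 0" using A by (intro synth_inject[of A l 0]) (auto simp: inv_amp_def)
  qed
  then show ?thesis by (simp add: multiplicity_def eigenspace_eq[OF l])
qed

end

section \<open>Spectral asymmetry\<close>

text \<open>On the classes of \<open>E\<close> the map \<open>f\<close> is an involution, without
  fixed class on \<open>X\<close>. Choosing a representative in the union \<open>Q x\<close> of the
  classes of \<open>x\<close> and \<open>f x\<close> selects one of the two, and \<open>T\<close>
  consists of the selected classes.\<close>

lemma alternating_transversal:
  assumes refl: "\<And>x. E x x" and sym: "\<And>x y. E x y \<Longrightarrow> E y x"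
    and trans: "\<And>x y z. E x y \<Longrightarrow> E y z \<Longrightarrow> E x z"
    and cong: "\<And>x y. E x y \<Longrightarrow> E (f x) (f y)" and inv: "\<And>x. E (f (f x)) x"
    and nofix: "\<And>x. x \<in> X \<Longrightarrow> \<not> E x (f x)"
  shows "\<exists>T. (\<forall>x\<in>X. f x \<in> T \<longleftrightarrow> x \<notin> T) \<and> (\<forall>x y. E x y \<longrightarrow> (x \<in> T \<longleftrightarrow> y \<in> T))"
proof -
  define Q where "Q x = {z. E x z \<or> E (f x) z}" for x
  define c where "c x = (SOME z. z \<in> Q x)" for x
  have cQ: "c x \<in> Q x" for x
    unfolding c_def by (rule someI[of _ x]) (simp add: Q_def refl)
  have Qe: "Q x = Q y" if "E x y" for x y
    unfolding Q_def using that cong[OF that] sym trans by blast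
  have Qf: "Q (f x) = Q x" for x
  proof -
    have "E (f (f x)) z \<longleftrightarrow> E x z" for z using inv[of x] sym trans by blast
    then show ?thesis unfolding Q_def by blast
  qed
  have ce: "c x = c y" if "E x y" for x y unfolding c_def Qe[OF that] ..
  have cf: "c (f x) = c x" for x unfolding c_def Qf ..
  let ?T = "{x. E x (c x)}"
  have "f x \<in> ?T \<longleftrightarrow> x \<notin> ?T" if "x \<in> X" for x
  proof -
    have "E x (c x) \<or> E (f x) (c x)" using cQ[of x] by (simp add: Q_def)
    moreover have "\<not> (E x (c x) \<and> E (f x) (c x))"
      using nofix[OF that] sym trans by blast
    ultimately show ?thesis by (auto simp: cf)
  qed
  moreover have "x \<in> ?T \<longleftrightarrow> y \<in> ?T" if e: "E x y" for x y
  proof -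
    have "E x (c y) \<longleftrightarrow> E y (c y)" using e sym[OF e] trans by blast
    then show ?thesis by (simp add: ce[OF e])
  qed
  ultimately show ?thesis by (intro exI[of _ ?T]) blast
qed

section \<open>A set of frequencies that \<open>B\<close> exchanges with its complement off the
  axis\<close>

context holonomy
begin

definition axial :: "'n rvec \<Rightarrow> bool" where "axial x \<longleftrightarrow> (\<forall>j. j \<noteq> M \<longrightarrow> x $ j = 0)"

abbreviation bB :: "'n rvec \<Rightarrow> 'n rvec" where "bB \<equiv> (*v) B"

abbreviation sa :: "'n rvec \<Rightarrow> 'n rvec" where "sa \<equiv> (*v) (reflection a)"

abbreviation sb :: "'n rvec \<Rightarrow> 'n rvec" where "sb \<equiv> (*v) (reflection b)"

text \<open>\<open>B\<close> exchanges the two reflections, hence commutes with their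
  product.\<close>

definition tau :: "'n rvec \<Rightarrow> 'n rvec" where "tau x = sa (sb x)"

lemma tau_nth: "tau x $ i = (if i = a \<or> i = b then - x $ i else x $ i)"
  using ab by (simp add: tau_def reflection_apply)

lemma tau_tau: "tau (tau x) = x"
  by (simp add: Finite_Cartesian_Product.vec_eq_iff tau_nth)

lemma tau_scale: "tau (s *\<^sub>R x) = s *\<^sub>R tau x"
  by (simp add: Finite_Cartesian_Product.vec_eq_iff tau_nth)

lemma B_sa: "bB (sa x) = sb (bB x)" and B_sb: "bB (sb x) = sa (bB x)"
  using B_refl by (simp_all add: matrix_vector_mul_assoc)

lemma sa_sb_commute: "sa (sb x) = sb (sa x)"
  using ab by (simp add: Finite_Cartesian_Product.vec_eq_iff reflection_apply)

lemma B_tau: "bB (tau x) = tau (bB x)"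
  unfolding tau_def by (simp only: B_sa B_sb sa_sb_commute)

lemma B_scale: "bB (s *\<^sub>R x) = s *\<^sub>R bB x"
  by (rule matrix_vector_mult_scaleR)

lemma Bp_scale: "(bB ^^ k) (s *\<^sub>R x) = s *\<^sub>R (bB ^^ k) x"
  by (induction k) (simp_all add: B_scale)

lemma Bp_tau: "(bB ^^ k) (tau x) = tau ((bB ^^ k) x)"
  by (induction k) (simp_all add: B_tau)

lemma taup_scale: "(tau ^^ e) (s *\<^sub>R x) = s *\<^sub>R (tau ^^ e) x"
  by (induction e) (simp_all add: tau_scale)

lemma Bp_taup: "(bB ^^ k) ((tau ^^ e) x) = (tau ^^ e) ((bB ^^ k) x)"
  by (induction e) (simp_all add: Bp_tau)

lemma taup_double: "(tau ^^ (2 * e)) x = x"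
  by (induction e) (simp_all add: tau_tau)

lemma Bp_mult_neg:
  assumes "\<And>x. ((bB ^^ N) x) $ j = - (x $ j)"
  shows "((bB ^^ (N * q)) x) $ j = (-1) ^ q * x $ j"
proof (induction q)
  case (Suc q)
  have "((bB ^^ (N * Suc q)) x) $ j = ((bB ^^ N) ((bB ^^ (N * q)) x)) $ j"
    by (simp add: funpow_add)
  then show ?case using assms Suc by simp
qed simp

lemma Bp_M: "((bB ^^ k) x) $ M = x $ M"
  by (induction k) (simp_all add: B_nth_M)

lemma B_order: "(bB ^^ (2 ^ r)) x = x"
proof -
  have "((bB ^^ (2 ^ r)) x) $ j = x $ j" for j
  proof (cases "j = M")
    case False
    then obtain i where i: "1 \<le> i" "i < r" "\<And>x. ((bB ^^ 2 ^ i) x) $ j = - (x $ j)"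
      using B_pow by blast
    have "(2::nat) ^ r = 2 ^ i * 2 ^ (r - i)" using i by (simp flip: power_add)
    then have "((bB ^^ (2 ^ r)) x) $ j = (-1) ^ (2 ^ (r - i)) * x $ j"
      using Bp_mult_neg[OF i(3), of "2 ^ (r - i)" x] by simp
    then show ?thesis using i by simp
  qed (simp add: Bp_M)
  then show ?thesis by (simp add: Finite_Cartesian_Product.vec_eq_iff)
qed

lemma B_order_mult: "(bB ^^ (2 ^ r * k)) x = x"
  by (induction k) (simp_all add: funpow_add B_order)

text \<open>The orbits of the group generated by \<open>B^2\<close>, \<open>tau\<close> and -1.
  Invariance of the transversal under -1 is needed because amplitudes are even in the frequency, and
  under \<open>tau\<close> for the injectivity of the reflection map.\<close>

definition rel :: "'n rvec \<Rightarrow> 'n rvec \<Rightarrow> bool" where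
  "rel x y \<longleftrightarrow> (\<exists>k e s. (s = 1 \<or> s = -1) \<and> y = s *\<^sub>R (tau ^^ e) ((bB ^^ (2 * k)) x))"

lemma rel_refl: "rel x x"
  unfolding rel_def by (intro exI[of _ "0::nat"] exI[of _ "1::real"]) simp

lemma rel_trans:
  assumes "rel x y" "rel y z"
  shows "rel x z"
proof -
  obtain k e s where 1: "s = 1 \<or> s = -1" "y = s *\<^sub>R (tau ^^ e) ((bB ^^ (2 * k)) x)"
    using assms(1) unfolding rel_def by blast
  obtain k' e' s' where 2: "s' = 1 \<or> s' = -1" "z = s' *\<^sub>R (tau ^^ e') ((bB ^^ (2 * k')) y)"
    using assms(2) unfolding rel_def by blast
  have "z = (s' * s) *\<^sub>R (tau ^^ (e' + e)) ((bB ^^ (2 * (k' + k))) x)"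
    unfolding 2(2) 1(2) Bp_scale taup_scale Bp_taup by (simp add: funpow_add distrib_left)
  moreover have "s' * s = 1 \<or> s' * s = -1" using 1(1) 2(1) by auto
  ultimately show ?thesis unfolding rel_def by blast
qed

lemma rel_sym:
  assumes "rel x y"
  shows "rel y x"
proof -
  obtain k e s where 1: "s = 1 \<or> s = -1" "y = s *\<^sub>R (tau ^^ e) ((bB ^^ (2 * k)) x)"
    using assms unfolding rel_def by blast
  \<comment> \<open>Since \<open>B\<close> to the power \<open>2 ^ r\<close> is the identity, these
    further powers of \<open>B^2\<close> undo the first \<open>k\<close>.\<close>
  let ?k = "(2 ^ r - 1) * k"
  have kk: "2 * ?k + 2 * k = 2 ^ r * (2 * k)"
  proof -
    have "(2::nat) ^ r \<ge> 1" by simp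
    then obtain q where q: "(2::nat) ^ r = Suc q" by (metis Suc_le_D One_nat_def)
    show ?thesis unfolding q by (simp add: algebra_simps)
  qed
  have "s *\<^sub>R (tau ^^ e) ((bB ^^ (2 * ?k)) y) = (s * s) *\<^sub>R (tau ^^ (e + e)) ((bB ^^ (2 * ?k + 2 * k)) x)"
    unfolding 1(2) Bp_scale taup_scale Bp_taup by (simp add: funpow_add)
  also have "\<dots> = x"
    unfolding kk B_order_mult mult_2[symmetric] taup_double using 1(1) by auto
  finally have "x = s *\<^sub>R (tau ^^ e) ((bB ^^ (2 * ?k)) y)" by (rule sym)
  then show ?thesis unfolding rel_def using 1(1) by blast
qed

lemma rel_B: "rel x y \<Longrightarrow> rel (bB x) (bB y)"
proof -
  assume "rel x y"
  then obtain k e s where 1: "s = 1 \<or> s = -1" "y = s *\<^sub>R (tau ^^ e) ((bB ^^ (2 * k)) x)"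
    unfolding rel_def by blast
  have "bB y = s *\<^sub>R (tau ^^ e) ((bB ^^ (2 * k)) (bB x))"
    unfolding 1(2) B_scale using Bp_taup[of 1 e "(bB ^^ (2 * k)) x"] by (simp add: funpow_swap1)
  then show ?thesis unfolding rel_def using 1(1) by blast
qed

lemma rel_BB: "rel (bB (bB x)) x"
proof (rule rel_sym)
  have "bB (bB x) = 1 *\<^sub>R (tau ^^ 0) ((bB ^^ (2 * 1)) x)" by (simp add: numeral_2_eq_2)
  then show "rel x (bB (bB x))" unfolding rel_def by blast
qed

text \<open>A coincidence means that \<open>x\<close> is, up to sign and powers of
  \<open>tau\<close>, equal to \<open>B^q x\<close> with \<open>q\<close> odd. Iterating
  \<open>2 ^ i\<close> times with \<open>i \<ge> 1\<close> removes sign and \<open>tau\<close>,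
  leaving \<open>B^(2^i q) x = x\<close>; but on a coordinate with \<open>x $ j \<noteq> 0\<close>
  this power is -1 for a suitable \<open>i\<close>.\<close>

lemma rel_no_fix:
  assumes "\<not> axial x"
  shows "\<not> rel x (bB x)"
proof
  assume "rel x (bB x)"
  then have "rel (bB x) x" by (rule rel_sym)
  then obtain k e s where s: "s = 1 \<or> s = -1" and x: "x = s *\<^sub>R (tau ^^ e) ((bB ^^ (2 * k)) (bB x))"
    unfolding rel_def by blast
  define q where "q = 2 * k + 1"
  have q: "odd q" by (simp add: q_def)
  have L: "x = s *\<^sub>R (tau ^^ e) ((bB ^^ q) x)"
    using x unfolding q_def by (simp add: funpow_swap1)
  have it: "x = (s ^ m) *\<^sub>R (tau ^^ (e * m)) ((bB ^^ (q * m)) x)" for m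
  proof (induction m)
    case (Suc m)
    have "(s ^ Suc m) *\<^sub>R (tau ^^ (e * Suc m)) ((bB ^^ (q * Suc m)) x)
        = s *\<^sub>R (tau ^^ e) ((bB ^^ q) ((s ^ m) *\<^sub>R (tau ^^ (e * m)) ((bB ^^ (q * m)) x)))"
      by (simp add: Bp_scale taup_scale Bp_taup funpow_add)
    also have "\<dots> = s *\<^sub>R (tau ^^ e) ((bB ^^ q) x)" unfolding Suc[symmetric] ..
    also have "\<dots> = x" by (rule L[symmetric])
    finally show ?case by (rule sym)
  qed simp
  obtain j where j: "j \<noteq> M" "x $ j \<noteq> 0" using assms by (auto simp: axial_def)
  then obtain i where i: "1 \<le> i" "i < r" "\<And>x. ((bB ^^ 2 ^ i) x) $ j = - (x $ j)"
    using B_pow by blast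
  obtain N where N: "(2::nat) ^ i = 2 * N" using i(1) by (cases i) auto
  have "s ^ (2 * N) = 1" using s by (auto simp: power_mult)
  then have "x = (tau ^^ (2 * (e * N))) ((bB ^^ (2 ^ i * q)) x)"
    using it[of "2 * N"] unfolding N by (simp add: mult_ac)
  then have "x = (bB ^^ (2 ^ i * q)) x" unfolding taup_double .
  then have "x $ j = ((bB ^^ (2 ^ i * q)) x) $ j" by (rule arg_cong)
  also have "\<dots> = - (x $ j)" unfolding Bp_mult_neg[OF i(3)] using q by simp
  finally show False using j(2) by simp
qed

lemma transversal:
  "\<exists>T. (\<forall>x. \<not> axial x \<longrightarrow> (bB x \<in> T \<longleftrightarrow> x \<notin> T)) \<and> (\<forall>x. - x \<in> T \<longleftrightarrow> x \<in> T)
    \<and> (\<forall>x. tau x \<in> T \<longleftrightarrow> x \<in> T)"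
proof -
  have "\<exists>T. (\<forall>x\<in>{x. \<not> axial x}. bB x \<in> T \<longleftrightarrow> x \<notin> T) \<and> (\<forall>x y. rel x y \<longrightarrow> (x \<in> T \<longleftrightarrow> y \<in> T))"
  proof (rule alternating_transversal)
    show "rel x z" if "rel x y" "rel y z" for x y z using that by (rule rel_trans)
    show "\<not> rel x (bB x)" if "x \<in> {x. \<not> axial x}" for x using that rel_no_fix by simp
  qed (rule rel_refl | erule rel_sym | erule rel_B | rule rel_BB)+
  then obtain T where T: "\<And>x. \<not> axial x \<Longrightarrow> bB x \<in> T \<longleftrightarrow> x \<notin> T"
    and R: "\<And>x y. rel x y \<Longrightarrow> x \<in> T \<longleftrightarrow> y \<in> T"
    by blast
  have "- x = (-1) *\<^sub>R (tau ^^ 0) ((bB ^^ (2 * 0)) x)" for x by simp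
  then have 1: "rel x (- x)" for x unfolding rel_def by blast
  have "tau x = 1 *\<^sub>R (tau ^^ 1) ((bB ^^ (2 * 0)) x)" for x by simp
  then have 2: "rel x (tau x)" for x unfolding rel_def by blast
  have "bB x \<in> T \<longleftrightarrow> x \<notin> T" if "\<not> axial x" for x using T[OF that] .
  moreover have "- x \<in> T \<longleftrightarrow> x \<in> T" for x using R[OF 1[of x]] by simp
  moreover have "tau x \<in> T \<longleftrightarrow> x \<in> T" for x using R[OF 2[of x]] by simp
  ultimately show ?thesis by (intro exI[of _ T]) simp
qed

lemma axial_fix: "axial x \<Longrightarrow> bB x = x"
proof -
  assume "axial x"
  then have "x = axis M (x $ M)"
    by (auto simp: Finite_Cartesian_Product.vec_eq_iff axial_def axis_def)
  then show ?thesis using B_axis[of "x $ M"] by simp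
qed

lemma axial_B: "axial (bB x) \<longleftrightarrow> axial x"
proof
  assume h: "axial (bB x)"
  then have "bB (bB x) = bB x" by (rule axial_fix)
  then have "bB x = x" by (metis B_inverse(1))
  then show "axial x" using h by simp
qed (simp add: axial_fix)

lemma axial_refl: "axial (sa x) \<longleftrightarrow> axial x" "axial (sb x) \<longleftrightarrow> axial x"
  by (auto simp: axial_def reflection_apply)

lemma axial_uminus: "axial (- x) \<longleftrightarrow> axial x"
  by (simp add: axial_def)

section \<open>Splitting invariant amplitudes into the part on the axis and the part off it\<close>

definition axis_amp :: "real \<Rightarrow> 'n form set" where
  "axis_amp l = {A \<in> inv_amp l. \<forall>\<mu> I. \<not> axial \<mu> \<longrightarrow> A \<mu> I = 0}"

definition perp_amp :: "real \<Rightarrow> 'n form set" where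
  "perp_amp l = {A \<in> inv_amp l. \<forall>\<mu> I. axial \<mu> \<longrightarrow> A \<mu> I = 0}"

lemma inv_ampD:
  assumes "A \<in> inv_amp l"
  shows "\<mu> \<notin> sphere_pts l \<Longrightarrow> A \<mu> I = 0" "even_vec (A \<mu>)" "A (- \<mu>) = A \<mu>"
    "A \<nu> I = cos (phase \<nu>) * pull B (A (bB \<nu>)) I - sin (phase \<nu>) * rot l \<nu> (pull B (A (bB \<nu>))) I"
proof -
  have A: "A \<in> amplitudes l" "act l A = A" using assms by (auto simp: inv_amp_def)
  show "\<mu> \<notin> sphere_pts l \<Longrightarrow> A \<mu> I = 0" "even_vec (A \<mu>)" "A (- \<mu>) = A \<mu>"
    using amplitudesD[OF A(1)] by auto
  have "A \<nu> I = act l A \<nu> I" unfolding A(2) ..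
  then show "A \<nu> I = cos (phase \<nu>) * pull B (A (bB \<nu>)) I - sin (phase \<nu>) * rot l \<nu> (pull B (A (bB \<nu>))) I"
    unfolding act_def .
qed

lemma inv_ampI:
  assumes "\<And>\<mu> I. \<mu> \<notin> sphere_pts l \<Longrightarrow> A \<mu> I = 0" "\<And>\<mu>. even_vec (A \<mu>)" "\<And>\<mu>. A (- \<mu>) = A \<mu>"
    "\<And>\<nu> I. A \<nu> I = cos (phase \<nu>) * pull B (A (bB \<nu>)) I - sin (phase \<nu>) * rot l \<nu> (pull B (A (bB \<nu>))) I"
  shows "A \<in> inv_amp l"
  unfolding inv_amp_def amplitudes_def act_def using assms(1,2,3) assms(4)[symmetric] by simp

lemma restrict_inv_amp:
  assumes A: "A \<in> inv_amp l" and S: "\<And>\<mu>. S (bB \<mu>) \<longleftrightarrow> S \<mu>" "\<And>\<mu>. S (- \<mu>) \<longleftrightarrow> S \<mu>"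
  shows "(\<lambda>\<mu> I. if S \<mu> then A \<mu> I else 0) \<in> inv_amp l"
proof (rule inv_ampI)
  note D = inv_ampD[OF A]
  show "(\<lambda>I. if S (- \<mu>) then A (- \<mu>) I else 0) = (\<lambda>I. if S \<mu> then A \<mu> I else 0)" for \<mu>
    unfolding S D(3) ..
  show "(if S \<nu> then A \<nu> I else 0) = cos (phase \<nu>) * pull B (\<lambda>I. if S (bB \<nu>) then A (bB \<nu>) I else 0) I
      - sin (phase \<nu>) * rot l \<nu> (pull B (\<lambda>I. if S (bB \<nu>) then A (bB \<nu>) I else 0)) I" for \<nu> I
  proof (cases "S \<nu>")
    case True
    then show ?thesis using D(4)[of \<nu> I] by (simp add: S)
  next
    case False
    have "pull B (\<lambda>_. 0) = (\<lambda>_. 0)" by (simp add: pull_zero fun_eq_iff)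
    then show ?thesis using False by (simp add: S rot_zero)
  qed
qed (use inv_ampD[OF A] in \<open>auto simp: even_vec_def\<close>)

lemma subspace_axis_amp: "forms.subspace (axis_amp l)" and subspace_perp_amp: "forms.subspace (perp_amp l)"
  using subspace_inv_amp[of l]
  unfolding forms.subspace_def axis_amp_def perp_amp_def by (auto simp: form_scale_def)

lemma fin_dim_axis_amp: "fin_dim (axis_amp l)" and fin_dim_perp_amp: "fin_dim (perp_amp l)"
  by (rule fin_dim_subset[OF _ fin_dim_inv_amp[of l]]; auto simp: axis_amp_def perp_amp_def)+

lemma dim_inv_amp: "forms.dim (inv_amp l) = forms.dim (axis_amp l) + forms.dim (perp_amp l)"
proof (rule dim_direct_sum[OF subspace_axis_amp fin_dim_axis_amp subspace_perp_amp fin_dim_perp_amp])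
  fix A
  show "A = 0" if "A \<in> axis_amp l" "A \<in> perp_amp l"
    using that unfolding axis_amp_def perp_amp_def by (auto simp: fun_eq_iff)
  show "A \<in> inv_amp l \<longleftrightarrow> (\<exists>s\<in>axis_amp l. \<exists>t\<in>perp_amp l. A = s + t)"
  proof
    assume A: "A \<in> inv_amp l"
    let ?s = "\<lambda>\<mu> I. if axial \<mu> then A \<mu> I else 0" and ?t = "\<lambda>\<mu> I. if \<not> axial \<mu> then A \<mu> I else 0"
    have "?s \<in> axis_amp l" unfolding axis_amp_def
      using restrict_inv_amp[OF A, of axial] axial_B axial_uminus by simp
    moreover have "?t \<in> perp_amp l" unfolding perp_amp_def
      using restrict_inv_amp[OF A, of "\<lambda>\<mu>. \<not> axial \<mu>"] axial_B axial_uminus by simp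
    moreover have "A = ?s + ?t" by (auto simp: fun_eq_iff)
    ultimately show "\<exists>s\<in>axis_amp l. \<exists>t\<in>perp_amp l. A = s + t" by blast
  next
    assume "\<exists>s\<in>axis_amp l. \<exists>t\<in>perp_amp l. A = s + t"
    then show "A \<in> inv_amp l"
      using forms.subspace_add[OF subspace_inv_amp] by (auto simp: axis_amp_def perp_amp_def)
  qed
qed

section \<open>Symmetry of the spectrum off the axis\<close>

lemma refl_orth: "reflection c ** transpose (reflection c) = idm"
  by (simp add: transpose_reflection reflection_reflection)

lemma pull_rot_refl: "pull (reflection c) (rot l \<mu> w) I = - rot l (reflection c *v \<mu>) (pull (reflection c) w) I"
  unfolding pull_rot_gen[OF refl_orth] minor_reflection transpose_reflection by simp

lemma refl_refl: "reflection c *v (reflection c *v x) = x"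
  by (simp add: matrix_vector_mul_assoc reflection_reflection)

lemma pull_refl_refl: "pull (reflection c) (pull (reflection c) w) = w"
  by (simp add: pull_pull reflection_reflection pull_mat_1)

lemma sphere_refl: "reflection c *v \<mu> \<in> sphere_pts l \<longleftrightarrow> \<mu> \<in> sphere_pts l"
proof -
  have "lattice_pt (reflection c *v \<mu>) \<longleftrightarrow> lattice_pt \<mu>"
    unfolding lattice_pt_def reflection_apply by (rule all_cong1) simp
  moreover have "(\<Sum>j\<in>UNIV. ((reflection c *v \<mu>) $ j)\<^sup>2) = (\<Sum>j\<in>UNIV. (\<mu> $ j)\<^sup>2)"
    by (rule sum.cong) (simp_all add: reflection_apply)
  ultimately show ?thesis by (simp add: sphere_pts_def)
qed

lemma sphere_minus: "sphere_pts (- l) = sphere_pts l"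
  by (simp add: sphere_pts_def)

text \<open>The part of \<open>A\<close> over \<open>T\<close> is reflected by \<open>\<sigma>_a\<close> and the part over \<open>B T\<close> by \<open>\<sigma>_b = B \<sigma>_a B\<inverse>\<close>; both
  reverse the orientation, hence the sign of the eigenvalue.\<close>

lemma perp_amp_le: "forms.dim (perp_amp l) \<le> forms.dim (perp_amp (- l))"
proof -
  obtain T where T: "\<And>x. \<not> axial x \<Longrightarrow> bB x \<in> T \<longleftrightarrow> x \<notin> T" "\<And>x. - x \<in> T \<longleftrightarrow> x \<in> T"
    "\<And>x. tau x \<in> T \<longleftrightarrow> x \<in> T"
    using transversal by blast
  define \<Psi> :: "'n form \<Rightarrow> 'n form" where
    "\<Psi> A = (\<lambda>\<nu>. if \<nu> \<in> T then pull (reflection a) (A (sa \<nu>)) else pull (reflection b) (A (sb \<nu>)))" for A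
  have lin: "linear_form_map \<Psi>"
    by (rule linear_form_mapI)
      (auto simp: \<Psi>_def fun_eq_iff form_scale_def pull_add_fun pull_scale)
  have phase_refl: "phase (sa \<nu>) = phase \<nu>" "phase (sb \<nu>) = phase \<nu>" for \<nu>
    using ab by (simp_all add: phase_def reflection_apply)
  \<comment> \<open>Used for \<open>c = a, d = b\<close> and for \<open>c = b, d = a\<close>.
    Passing from \<open>\<nu>\<close> to \<open>B *v \<nu>\<close> leaves or enters
    \<open>T\<close>, and the reflection used by \<open>\<Psi>\<close> changes accordingly. The
    minus sign of \<open>pull_rot_refl\<close> turns \<open>l\<close> into
    \<open>- l\<close>.\<close>
  have step: "pull (reflection c) (A (reflection c *v \<nu>)) I
      = cos (phase \<nu>) * pull B (pull (reflection d) (A (reflection d *v (bB \<nu>)))) I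
        - sin (phase \<nu>) * rot (- l) \<nu> (pull B (pull (reflection d) (A (reflection d *v (bB \<nu>))))) I"
    if A: "A \<in> inv_amp l" and c: "B ** reflection c = reflection d ** B"
      and ph: "phase (reflection c *v \<nu>) = phase \<nu>" for A c d \<nu> I
  proof -
    let ?w = "A (reflection d *v (bB \<nu>))"
    have v: "bB (reflection c *v \<nu>) = reflection d *v (bB \<nu>)" using c by (simp add: matrix_vector_mul_assoc)
    have p: "pull B (pull (reflection d) ?w) = pull (reflection c) (pull B ?w)"
      unfolding pull_pull c ..
    have "A (reflection c *v \<nu>) = (\<lambda>I. cos (phase \<nu>) * pull B ?w I - sin (phase \<nu>) * rot l (reflection c *v \<nu>) (pull B ?w) I)"
      using inv_ampD(4)[OF A, of "reflection c *v \<nu>"] unfolding ph v by blast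
    then have "pull (reflection c) (A (reflection c *v \<nu>)) I
        = cos (phase \<nu>) * pull (reflection c) (pull B ?w) I
        - sin (phase \<nu>) * pull (reflection c) (rot l (reflection c *v \<nu>) (pull B ?w)) I"
      by (simp only: pull_diff pull_scale)
    then show ?thesis unfolding p pull_rot_refl refl_refl rot_minus by simp
  qed
  have sbB: "B ** reflection a = reflection b ** B" "B ** reflection b = reflection a ** B" using B_refl by auto
  have im: "\<Psi> A \<in> perp_amp (- l)" if A: "A \<in> perp_amp l" for A
  proof -
    have A': "A \<in> inv_amp l" and z: "\<And>\<mu>. axial \<mu> \<Longrightarrow> A \<mu> = (\<lambda>_. 0)"
      using A by (auto simp: perp_amp_def fun_eq_iff)
    note D = inv_ampD[OF A']
    have zp: "pull C (\<lambda>_. 0) = (\<lambda>_. 0)" for C :: "'n sq_matrix" by (simp add: pull_zero fun_eq_iff)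
    have ax: "\<Psi> A \<mu> = (\<lambda>_. 0)" if "axial \<mu>" for \<mu>
      using that z[of "sa \<mu>"] z[of "sb \<mu>"] by (simp add: \<Psi>_def axial_refl zp)
    have "\<Psi> A \<in> inv_amp (- l)"
    proof (rule inv_ampI)
      fix \<mu> :: "'n rvec" and I assume "\<mu> \<notin> sphere_pts (- l)"
      then have "reflection c *v \<mu> \<notin> sphere_pts l" for c
        unfolding sphere_minus sphere_refl .
      then have "A (sa \<mu>) = (\<lambda>_. 0)" "A (sb \<mu>) = (\<lambda>_. 0)"
        using D(1) by blast+
      then show "\<Psi> A \<mu> I = 0" by (simp add: \<Psi>_def zp)
    next
      show "even_vec (\<Psi> A \<mu>)" for \<mu> unfolding \<Psi>_def using even_vec_pull[OF D(2)] by simp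
      show "\<Psi> A (- \<mu>) = \<Psi> A \<mu>" for \<mu>
        by (simp add: \<Psi>_def T(2) mv_uminus D(3))
      fix \<nu> :: "'n rvec" and I
      show "\<Psi> A \<nu> I = cos (phase \<nu>) * pull B (\<Psi> A (bB \<nu>)) I - sin (phase \<nu>) * rot (- l) \<nu> (pull B (\<Psi> A (bB \<nu>))) I"
      proof (cases "axial \<nu>")
        case True
        then show ?thesis using ax[of \<nu>] ax[of "bB \<nu>"] by (simp add: axial_B zp rot_zero)
      next
        case False
        show ?thesis
        proof (cases "\<nu> \<in> T")
          case True
          then have "bB \<nu> \<notin> T" using T(1)[OF False] by simp
          then show ?thesis using True step[OF A' sbB(1) phase_refl(1), of \<nu> I] by (simp add: \<Psi>_def)
        next
          case nT: False
          then have "bB \<nu> \<in> T" using T(1)[OF False] by simp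
          then show ?thesis using nT step[OF A' sbB(2) phase_refl(2), of \<nu> I] by (simp add: \<Psi>_def)
        qed
      qed
    qed
    then show ?thesis using ax by (simp add: perp_amp_def)
  qed
  have inj: "A = 0" if A: "A \<in> perp_amp l" and e: "\<Psi> A = 0" for A
  proof -
    have A': "A \<in> inv_amp l" and z: "\<And>\<mu>. axial \<mu> \<Longrightarrow> A \<mu> = (\<lambda>_. 0)"
      using A by (auto simp: perp_amp_def fun_eq_iff)
    note D = inv_ampD[OF A']
    have t: "A (sa \<nu>) = (\<lambda>_. 0)" if "\<nu> \<in> T" for \<nu>
    proof -
      have "pull (reflection a) (A (sa \<nu>)) = (\<lambda>_. 0)"
        using fun_cong[OF e, of \<nu>] that by (simp add: \<Psi>_def zero_fun_def)
      then have "pull (reflection a) (pull (reflection a) (A (sa \<nu>))) = pull (reflection a) (\<lambda>_. 0)" by simp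
      then show ?thesis unfolding pull_refl_refl by (simp add: pull_zero fun_eq_iff)
    qed
    have "A \<mu> I = 0" for \<mu> I
    proof (cases "axial \<mu>")
      case True
      then show ?thesis using z by simp
    next
      case False
      let ?\<nu> = "sa \<mu>"
      have \<mu>: "\<mu> = sa ?\<nu>" by (simp add: refl_refl)
      have na: "\<not> axial ?\<nu>" using False axial_refl by simp
      show ?thesis
      proof (cases "?\<nu> \<in> T")
        case True
        then show ?thesis using t[OF True] \<mu> by simp
      next
        \<comment> \<open>\<open>bB \<mu>\<close> is the image under \<open>sa\<close> of
          \<open>tau (bB ?\<nu>)\<close>, which lies in \<open>T\<close> by invariance under
          \<open>tau\<close>. So \<open>A\<close> vanishes at \<open>bB \<mu>\<close>, and the
          invariance equation carries this back to \<open>\<mu>\<close>.\<close>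
        case nT: False
        then have "bB ?\<nu> \<in> T" using T(1)[OF na] by simp
        then have "tau (bB ?\<nu>) \<in> T" using T(3) by simp
        moreover have "bB \<mu> = sa (tau (bB ?\<nu>))"
          unfolding tau_def refl_refl by (subst \<mu>) (simp only: B_sa)
        ultimately have "A (bB \<mu>) = (\<lambda>_. 0)" using t by simp
        moreover have "pull B (\<lambda>_. 0) = (\<lambda>_. 0)" by (simp add: pull_zero fun_eq_iff)
        ultimately show ?thesis using D(4)[of \<mu> I] by (simp add: rot_zero)
      qed
    qed
    then show ?thesis by (intro ext) simp
  qed
  show ?thesis by (rule dim_le_inj[OF lin subspace_perp_amp inj im fin_dim_perp_amp])
qed

lemma perp_amp_eq: "forms.dim (perp_amp l) = forms.dim (perp_amp (- l))"
  using perp_amp_le[of l] perp_amp_le[of "- l"] by simp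

end

section \<open>Spaces of covectors at a single frequency\<close>

definition comb :: "real \<Rightarrow> 'n ext \<Rightarrow> real \<Rightarrow> 'n ext \<Rightarrow> 'n ext" where
  "comb x v y w = (\<lambda>I. x * v I + y * w I)"

lemma pull_comb: "pull C (comb x v y w) = comb x (pull C v) y (pull C w)"
  by (rule ext) (simp add: comb_def pull_add pull_scale)

lemma symb_comb: "symb \<mu> (comb x v y w) = comb x (symb \<mu> v) y (symb \<mu> w)"
  unfolding comb_def by (rule ext) (rule symb_lincomb)

lemma even_vec_comb: "even_vec v \<Longrightarrow> even_vec w \<Longrightarrow> even_vec (comb x v y w)"
  by (simp add: even_vec_def comb_def)

definition linear_space :: "'n ext set \<Rightarrow> bool" where
  "linear_space V \<longleftrightarrow> (\<lambda>_. 0) \<in> V \<and> (\<forall>x v y w. v \<in> V \<longrightarrow> w \<in> V \<longrightarrow> comb x v y w \<in> V)"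

text \<open>Makes the dimension of spaces of forms available for spaces of covectors: a covector
  becomes a form supported at one point, for which 0 is an arbitrary choice.\<close>

definition at0 :: "'n ext set \<Rightarrow> 'n::{finite,linorder} form set" where
  "at0 V = {A. (\<forall>\<mu> I. \<mu> \<noteq> 0 \<longrightarrow> A \<mu> I = 0) \<and> A 0 \<in> V}"

definition ldim :: "'n::{finite,linorder} ext set \<Rightarrow> nat" where
  "ldim V = forms.dim (at0 V)"

definition single :: "'n::{finite,linorder} ext \<Rightarrow> 'n form" where
  "single w = (\<lambda>\<mu>. if \<mu> = 0 then w else (\<lambda>_. 0))"

lemma single_at0: "w \<in> V \<Longrightarrow> single w \<in> at0 V"
  by (simp add: at0_def single_def)

lemma at0_single: "A \<in> at0 V \<Longrightarrow> A = single (A 0)"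
  by (intro ext) (simp add: at0_def single_def)

lemma fin_dim_at0: "fin_dim (at0 V)"
  by (rule finite_support_fin_dim(1)[of "{0}"]) (auto simp: at0_def)

lemma plus_comb: "(A + A') \<mu> = comb 1 (A \<mu>) 1 (A' \<mu>)"
  by (rule ext) (simp add: comb_def)

lemma scale_comb: "form_scale c A \<mu> = comb c (A \<mu>) 0 (A \<mu>)"
  by (rule ext) (simp add: comb_def form_scale_def)

lemma subspace_at0:
  assumes "linear_space V"
  shows "forms.subspace (at0 V)"
proof (rule forms.subspaceI)
  show "0 \<in> at0 V" using assms by (simp add: at0_def linear_space_def zero_fun_def)
  show "A + A' \<in> at0 V" if "A \<in> at0 V" "A' \<in> at0 V" for A A'
  proof -
    have "(A + A') 0 \<in> V" unfolding plus_comb using that assms by (simp add: at0_def linear_space_def)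
    then show ?thesis using that by (simp add: at0_def)
  qed
  show "form_scale c A \<in> at0 V" if "A \<in> at0 V" for c A
  proof -
    have "form_scale c A 0 \<in> V" unfolding scale_comb using that assms by (simp add: at0_def linear_space_def)
    then show ?thesis using that by (simp add: at0_def form_scale_def)
  qed
qed

lemma ldim_le:
  fixes V W :: "'n::{finite,linorder} ext set"
  assumes V: "linear_space V"
    and f: "\<And>x v y w. f (comb x v y w) = comb x (f v) y (f w)"
    and inj: "\<And>v. v \<in> V \<Longrightarrow> f v = (\<lambda>_. 0) \<Longrightarrow> v = (\<lambda>_. 0)"
    and im: "\<And>v. v \<in> V \<Longrightarrow> f v \<in> W"
  shows "ldim V \<le> ldim W"
  unfolding ldim_def
proof (rule dim_le_inj[OF _ subspace_at0[OF V] _ _ fin_dim_at0, where f = "\<lambda>A. single (f (A 0))"])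
  have s: "single (comb x v y w) = form_scale x (single v) + form_scale y (single w)" for x y and v w :: "'n ext"
    by (intro ext) (simp add: single_def comb_def form_scale_def)
  show "linear_form_map (\<lambda>A. single (f (A 0)))"
  proof (rule linear_form_mapI)
    show "single (f ((A + A') 0)) = single (f (A 0)) + single (f (A' 0))" for A A'
      unfolding plus_comb f s by simp
    show "single (f (form_scale c A 0)) = form_scale c (single (f (A 0)))" for c A
      unfolding scale_comb[of c A 0] f s by simp
  qed
  show "A = 0" if A: "A \<in> at0 V" and z: "single (f (A 0)) = 0" for A
  proof -
    have "f (A 0) = (\<lambda>_. 0)" using fun_cong[OF z, of 0] by (simp add: single_def zero_fun_def)
    then have "A 0 = (\<lambda>_. 0)" using inj A by (simp add: at0_def)
    then show ?thesis using at0_single[OF A] by (intro ext) (simp add: single_def)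
  qed
  show "single (f (A 0)) \<in> at0 W" if "A \<in> at0 V" for A
    using that im by (intro single_at0) (simp add: at0_def)
qed

lemma ldim_direct_sum:
  assumes S: "linear_space S" and T: "linear_space T"
    and ST: "\<And>v. v \<in> S \<Longrightarrow> v \<in> T \<Longrightarrow> v = (\<lambda>_. 0)"
    and V: "\<And>v. v \<in> V \<longleftrightarrow> (\<exists>s\<in>S. \<exists>t\<in>T. v = comb 1 s 1 t)"
  shows "ldim V = ldim S + ldim T"
  unfolding ldim_def
proof (rule dim_direct_sum[OF subspace_at0[OF S] fin_dim_at0 subspace_at0[OF T] fin_dim_at0])
  show "A = 0" if "A \<in> at0 S" "A \<in> at0 T" for A
  proof -
    have "A 0 = (\<lambda>_. 0)" using that ST by (simp add: at0_def)
    then show ?thesis using at0_single[OF that(1)] by (intro ext) (simp add: single_def)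
  qed
  show "A \<in> at0 V \<longleftrightarrow> (\<exists>s\<in>at0 S. \<exists>t\<in>at0 T. A = s + t)" for A
  proof
    assume A: "A \<in> at0 V"
    then have "A 0 \<in> V" by (simp add: at0_def)
    then obtain s t where st: "s \<in> S" "t \<in> T" "A 0 = comb 1 s 1 t" using V by blast
    have "A = single s + single t"
      by (subst at0_single[OF A]) (intro ext, simp add: single_def st(3) comb_def)
    then show "\<exists>s\<in>at0 S. \<exists>t\<in>at0 T. A = s + t" using single_at0 st by blast
  next
    assume "\<exists>s\<in>at0 S. \<exists>t\<in>at0 T. A = s + t"
    then obtain s t where st: "s \<in> at0 S" "t \<in> at0 T" "A = s + t" by blast
    have "A 0 = comb 1 (s 0) 1 (t 0)" unfolding st(3) by (rule plus_comb)
    then have "A 0 \<in> V" using V st(1,2) by (auto simp: at0_def)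
    then show "A \<in> at0 V" using st by (simp add: at0_def)
  qed
qed

section \<open>The holonomy generator on amplitudes over the axis\<close>

context holonomy
begin

abbreviation jj :: "'n ext \<Rightarrow> 'n ext" where "jj \<equiv> symb (axis M 1)"

abbreviation PB :: "'n ext \<Rightarrow> 'n ext" where "PB \<equiv> pull B"

text \<open>The exponential of \<open>t\<close> times \<open>jj\<close>, as \<open>jj\<close>
  squares to -1 on even covectors. Rotations fixing the axis commute with it; a reflection fixing
  the axis inverts it.\<close>

definition EE :: "real \<Rightarrow> 'n ext \<Rightarrow> 'n ext" where "EE t w = comb (cos t) w (sin t) (jj w)"

lemma jj_jj: "even_vec w \<Longrightarrow> jj (jj w) = (\<lambda>I. - w I)"
proof -
  assume w: "even_vec w"
  have "(\<Sum>j\<in>UNIV. (axis M 1 $ j :: real)\<^sup>2) = (\<Sum>j\<in>UNIV. if j = M then 1 else 0)"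
    by (rule sum.cong) (simp_all add: axis_def)
  then have "(\<Sum>j\<in>UNIV. (axis M 1 $ j :: real)\<^sup>2) = 1" by simp
  then show ?thesis unfolding symb_symb[OF card_mod_4 w] by simp
qed

lemma even_EE: "even_vec w \<Longrightarrow> even_vec (EE t w)"
  unfolding EE_def by (intro even_vec_comb even_vec_symb odd_card)

lemma EE_EE: "even_vec w \<Longrightarrow> EE s (EE t w) = EE (s + t) w"
proof
  fix I assume w: "even_vec w"
  have "EE s (EE t w) I = cos s * (cos t * w I + sin t * jj w I) + sin s * (cos t * jj w I + sin t * jj (jj w) I)"
    unfolding EE_def symb_comb by (simp add: comb_def)
  also have "\<dots> = EE (s + t) w I"
    unfolding jj_jj[OF w] EE_def comb_def cos_add sin_add by (simp add: algebra_simps)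
  finally show "EE s (EE t w) I = EE (s + t) w I" .
qed

lemma EE_0: "EE 0 w = w"
  by (rule ext) (simp add: EE_def comb_def)

lemma EE_comb: "EE t (comb x v y w) = comb x (EE t v) y (EE t w)"
  by (rule ext) (simp add: EE_def symb_comb, simp add: comb_def algebra_simps)

lemma EE_pi: "EE (t + pi) w = (\<lambda>I. - EE t w I)"
  by (rule ext) (simp add: EE_def comb_def)

lemma pull_jj:
  assumes "C ** transpose C = idm" "transpose C *v axis M 1 = axis M 1"
  shows "pull C (jj w) I = minor C UNIV UNIV * jj (pull C w) I"
  unfolding pull_symb[OF assms(1)] assms(2) ..

lemma pull_EE:
  assumes "C ** transpose C = idm" "transpose C *v axis M 1 = axis M 1" "minor C UNIV UNIV = 1"
  shows "pull C (EE t w) = EE t (pull C w)"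
  unfolding EE_def pull_comb by (rule ext) (simp only: comb_def pull_jj[OF assms(1,2)] assms(3) mult_1)

lemma pull_EE_neg:
  assumes "C ** transpose C = idm" "transpose C *v axis M 1 = axis M 1" "minor C UNIV UNIV = -1"
  shows "pull C (EE t w) = EE (- t) (pull C w)"
  unfolding EE_def pull_comb
  by (rule ext) (simp only: comb_def pull_jj[OF assms(1,2)] assms(3) cos_minus sin_minus minus_mult_commute mult_1)

lemma transpose_axis:
  assumes "\<And>j. C $ M $ j = (if j = M then 1 else 0)"
  shows "transpose C *v axis M 1 = (axis M 1 :: 'n rvec)"
proof -
  have "(transpose C *v axis M 1) $ j = axis M 1 $ j" for j
    unfolding matrix_vector_mult_def Finite_Cartesian_Product.transpose_def
    using assms by (simp add: axis_def if_distrib[of "\<lambda>x. _ * x"] cong: if_cong)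
  then show ?thesis unfolding Finite_Cartesian_Product.vec_eq_iff by blast
qed

lemma PB_EE: "PB (EE t w) = EE t (PB w)"
  by (rule pull_EE[OF B_orth transpose_axis[OF B_row] B_det])

lemma U_EE: "pull U (EE t w) = EE t (pull U w)"
  by (rule pull_EE[OF U_orth transpose_axis[OF U_row] U_det])

lemma a_EE: "pull (reflection a) (EE t w) = EE (- t) (pull (reflection a) w)"
proof (rule pull_EE_neg[OF refl_orth _ minor_reflection])
  have "sa (axis M 1) $ j = axis M 1 $ j" for j
    using ab by (simp add: reflection_apply axis_def)
  then show "transpose (reflection a) *v axis M 1 = axis M 1"
    unfolding transpose_reflection Finite_Cartesian_Product.vec_eq_iff by blast
qed

text \<open>The eigenspace of \<open>B\<close> for the eigenvalue exp(it), with \<open>jj\<close> as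
  i. By \<open>dim_axis_amp\<close> its dimension is the contribution of an axial frequency
  \<open>m\<close> if \<open>t = 2 pi m / 2^r\<close>.\<close>

definition N1 :: "real \<Rightarrow> 'n ext set" where
  "N1 t = {w. even_vec w \<and> PB w = EE t w}"

text \<open>The eigenspace of \<open>B^2\<close> for exp(2it), whose square roots are exp(it) and
  exp(i(t + pi)).\<close>

definition N2 :: "real \<Rightarrow> 'n ext set" where
  "N2 t = {w. even_vec w \<and> PB (PB w) = EE (2 * t) w}"

lemma EE_zero: "EE t (\<lambda>_. 0) = (\<lambda>_. 0)"
  using EE_comb[of t 0 "\<lambda>_. 0" 0 "\<lambda>_. 0"] by (simp add: comb_def)

lemma even_zero: "even_vec (\<lambda>_. 0)" by (simp add: even_vec_def)

lemma linear_N1: "linear_space (N1 t)"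
  unfolding linear_space_def N1_def
  by (auto simp: pull_comb EE_comb EE_zero pull_zero_fun even_zero intro: even_vec_comb)

lemma linear_N2: "linear_space (N2 t)"
  unfolding linear_space_def N2_def
  by (auto simp: pull_comb EE_comb EE_zero pull_zero_fun even_zero intro: even_vec_comb)

lemma N1_periodic: "N1 (t + 2 * pi) = N1 t"
  by (simp add: N1_def EE_def)

text \<open>The composite of \<open>PB\<close> and \<open>EE (- t)\<close> is an involution of
  \<open>N2 t\<close>; the summands are its eigenspaces for 1 and -1.\<close>

lemma ldim_N2: "ldim (N2 t) = ldim (N1 t) + ldim (N1 (t + pi))"
proof (rule ldim_direct_sum[OF linear_N1 linear_N1])
  fix v
  show "v = (\<lambda>_. 0)" if "v \<in> N1 t" "v \<in> N1 (t + pi)"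
  proof -
    have v: "even_vec v" and "EE t v = EE (t + pi) v" using that by (auto simp: N1_def)
    then have "EE t v I = - EE t v I" for I using EE_pi[of t v] by (metis)
    then have "EE t v = (\<lambda>_. 0)" by (intro ext) (simp add: equal_neg_zero)
    then have "EE (- t) (EE t v) = (\<lambda>_. 0)" by (simp add: EE_zero)
    then show ?thesis unfolding EE_EE[OF v] by (simp add: EE_0)
  qed
  show "v \<in> N2 t \<longleftrightarrow> (\<exists>s\<in>N1 t. \<exists>u\<in>N1 (t + pi). v = comb 1 s 1 u)"
  proof
    assume "v \<in> N2 t"
    then have v: "even_vec v" and P: "PB (PB v) = EE (2 * t) v" by (auto simp: N2_def)
    have ev: "even_vec (PB v)" by (rule even_vec_pull[OF v])
    let ?u = "EE (- t) (PB v)"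
    have eu: "even_vec ?u" by (rule even_EE[OF ev])
    have Pu: "PB ?u = EE t v" unfolding PB_EE P EE_EE[OF v] by simp
    have Eu: "EE t ?u = PB v" unfolding EE_EE[OF ev] by (simp add: EE_0)
    have "comb (1/2) v (1/2) ?u \<in> N1 t"
    proof -
      have "PB (comb (1/2) v (1/2) ?u) = EE t (comb (1/2) v (1/2) ?u)"
        unfolding pull_comb EE_comb Pu Eu by (rule ext) (simp add: comb_def)
      then show ?thesis using even_vec_comb[OF v eu] by (simp add: N1_def)
    qed
    moreover have "comb (1/2) v (-1/2) ?u \<in> N1 (t + pi)"
    proof -
      have "PB (comb (1/2) v (-1/2) ?u) = EE (t + pi) (comb (1/2) v (-1/2) ?u)"
        unfolding EE_pi unfolding pull_comb EE_comb Pu Eu by (rule ext) (simp add: comb_def)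
      then show ?thesis using even_vec_comb[OF v eu] by (simp add: N1_def)
    qed
    moreover have "v = comb 1 (comb (1/2) v (1/2) ?u) 1 (comb (1/2) v (-1/2) ?u)"
      by (rule ext) (simp add: comb_def)
    ultimately show "\<exists>s\<in>N1 t. \<exists>u\<in>N1 (t + pi). v = comb 1 s 1 u" by blast
  next
    assume "\<exists>s\<in>N1 t. \<exists>u\<in>N1 (t + pi). v = comb 1 s 1 u"
    then obtain s u where s: "even_vec s" "PB s = EE t s" and u: "even_vec u" "PB u = EE (t + pi) u"
      and v: "v = comb 1 s 1 u" by (auto simp: N1_def)
    have "PB (PB s) = EE (2 * t) s" unfolding s(2) PB_EE EE_EE[OF s(1)] by simp
    moreover have "PB (PB u) = EE (2 * t) u"
    proof -
      have "PB (PB u) = EE (2 * t + 2 * pi) u"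
        unfolding u(2) PB_EE EE_EE[OF u(1)] by (rule arg_cong2[where f = EE]) simp_all
      also have "\<dots> = EE (2 * t) u" by (simp add: EE_def)
      finally show ?thesis .
    qed
    ultimately have "PB (PB v) = EE (2 * t) v" unfolding v pull_comb EE_comb by simp
    then show "v \<in> N2 t" using even_vec_comb[OF s(1) u(1)] v by (simp add: N2_def)
  qed
qed

lemma ldim_N2_le: "ldim (N2 t) \<le> ldim (N2 (- t))"
proof (rule ldim_le[OF linear_N2, where f = "pull (reflection a)"])
  show "pull (reflection a) (comb x v y w) = comb x (pull (reflection a) v) y (pull (reflection a) w)" for x y v w
    by (rule pull_comb)
  show "v = (\<lambda>_. 0)" if "pull (reflection a) v = (\<lambda>_. 0)" for v :: "'n ext"
    using arg_cong[OF that, of "pull (reflection a)"] unfolding pull_refl_refl pull_zero_fun .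
  show "pull (reflection a) v \<in> N2 (- t)" if v: "v \<in> N2 t" for v
  proof -
    have c: "(reflection a ** B) ** B = (B ** B) ** reflection a"
      by (metis B_refl matrix_mul_assoc)
    have "PB (PB (pull (reflection a) v)) = pull (reflection a) (PB (PB v))"
      unfolding pull_pull c ..
    also have "\<dots> = EE (2 * - t) (pull (reflection a) v)" using v by (simp add: N2_def a_EE)
    finally show ?thesis using v even_vec_pull[of v] by (simp add: N2_def)
  qed
qed

text \<open>Pullback is contravariant, so \<open>U B = B^5 U\<close> says that \<open>PB\<close>
  after \<open>pull U\<close> equals \<open>pull U\<close> after five times \<open>PB\<close>. On
  \<open>N1 t\<close> the latter is a rotation by \<open>5 * t\<close>, which commutes with
  \<open>pull U\<close>.\<close>

lemma N1_le_5: "ldim (N1 t) \<le> ldim (N1 (5 * t))"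
proof (rule ldim_le[OF linear_N1, where f = "pull U"])
  show "pull U (comb x v y w) = comb x (pull U v) y (pull U w)" for x y v w by (rule pull_comb)
  show "v = (\<lambda>_. 0)" if "pull U v = (\<lambda>_. 0)" for v :: "'n ext"
    using arg_cong[OF that, of "pull (transpose U)"] unfolding pull_pull U_orth pull_mat_1 pull_zero_fun .
  show "pull U v \<in> N1 (5 * t)" if "v \<in> N1 t" for v
  proof -
    have v: "even_vec v" and P: "PB v = EE t v" using that by (auto simp: N1_def)
    have "PB (pull U v) = pull U (PB (PB (PB (PB (PB v)))))"
      unfolding pull_pull U_conj by (simp only: matrix_mul_assoc)
    also have "PB (PB (PB (PB (PB v)))) = EE (5 * t) v"
      unfolding P PB_EE EE_EE[OF v] by (rule arg_cong2[where f = EE]) simp_all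
    finally have "PB (pull U v) = EE (5 * t) (pull U v)" unfolding U_EE .
    then show ?thesis using even_vec_pull[OF v] by (simp add: N1_def)
  qed
qed

end

section \<open>Antiperiodic functions invariant under multiplication by 5\<close>

lemma power_2_odd: "m \<noteq> 0 \<Longrightarrow> \<exists>j q. odd q \<and> m = 2 ^ j * (q :: nat)"
proof (induction m rule: less_induct)
  case (less m)
  show ?case
  proof (cases "odd m")
    case True
    then show ?thesis by (intro exI[of _ 0] exI[of _ m]) simp
  next
    case False
    then obtain p where p: "m = 2 * p" by blast
    then obtain j q where "odd q" "p = 2 ^ j * q" using less.IH[of p] less.prems by auto
    then show ?thesis using p by (intro exI[of _ "Suc j"] exI[of _ q]) simp
  qed
qed

text \<open>Squaring doubles the linear term of the binomial, and the quadratic term changes the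
  cofactor \<open>u\<close> by an even number only.\<close>

lemma five_power: "\<exists>u. odd u \<and> (5::nat) ^ 2 ^ i = 1 + 2 ^ (i + 2) * u"
proof (induction i)
  case 0
  show ?case by (rule exI[of _ 1]) simp
next
  case (Suc i)
  then obtain u where u: "odd u" "(5::nat) ^ 2 ^ i = 1 + 2 ^ (i + 2) * u" by blast
  have "(5::nat) ^ 2 ^ Suc i = (5 ^ 2 ^ i) * (5 ^ 2 ^ i)" by (simp add: mult_2 power_add)
  also have "\<dots> = 1 + 2 ^ (Suc i + 2) * (u + 2 ^ (i + 1) * u * u)"
    unfolding u(2) by (simp add: algebra_simps power_add)
  finally show ?case using u(1) by (intro exI[of _ "u + 2 ^ (i + 1) * u * u"]) simp
qed

text \<open>For \<open>m = 2 ^ j q\<close> with \<open>q\<close> odd and \<open>j < R\<close>, multiplication by a suitable \<open>5 ^ 2 ^ i\<close> adds an odd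
  multiple of \<open>2 ^ (R + 1)\<close>, so that \<open>f m = - f m\<close>.\<close>

lemma antiperiodic_five_invariant:
  fixes f :: "nat \<Rightarrow> int"
  assumes half: "\<And>m. f (m + 2 ^ (R + 1)) = - f m" and five: "\<And>m. f (5 * m) = f m" and f0: "f 0 = 0"
  shows "(\<And>k. m \<noteq> 2 ^ R * (2 * k + 1)) \<Longrightarrow> f m = 0"
    and "f (2 ^ R * (2 * k + 1)) = (-1) ^ k * f (2 ^ R)"
proof -
  have shift: "f (m + 2 ^ (R + 1) * p) = (-1) ^ p * f m" for m p
  proof (induction p)
    case (Suc p)
    have "f (m + 2 ^ (R + 1) * Suc p) = f ((m + 2 ^ (R + 1) * p) + 2 ^ (R + 1))" by (simp add: algebra_simps)
    then show ?case unfolding half Suc by simp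
  qed simp
  have five': "f (5 ^ e * m) = f m" for e m
    by (induction e) (simp_all add: five mult.assoc)
  show "f (2 ^ R * (2 * k + 1)) = (-1) ^ k * f (2 ^ R)"
    using shift[of "2 ^ R" k] by (simp add: algebra_simps)
  assume ne: "\<And>k. m \<noteq> 2 ^ R * (2 * k + 1)"
  show "f m = 0"
  proof (cases "m = 0")
    case False
    then obtain j q where q: "odd q" and m: "m = 2 ^ j * q" using power_2_odd by blast
    consider "j < R" | "j = R" | "j > R" by linarith
    then show ?thesis
    proof cases
      case 1
      \<comment> \<open>Chosen so that \<open>j + (i + 2) = R + 1\<close>: multiplying by
        \<open>5 ^ 2 ^ i\<close> adds an odd number of half periods.\<close>
      then obtain i where i: "R = Suc (j + i)" using less_iff_Suc_add by auto
      obtain u where u: "odd u" "(5::nat) ^ 2 ^ i = 1 + 2 ^ (i + 2) * u" using five_power by blast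
      have "5 ^ 2 ^ i * m = m + 2 ^ (R + 1) * (u * q)"
        unfolding u(2) m i by (simp add: algebra_simps power_add)
      then have "f m = (-1) ^ (u * q) * f m" using shift[of m "u * q"] five'[of "2 ^ i" m] by simp
      then show ?thesis using u(1) q by simp
    next
      case 2
      obtain k where "q = 2 * k + 1" using q by (rule oddE)
      then show ?thesis using ne[of k] m 2 by simp
    next
      case 3
      then obtain i where i: "j = Suc (R + i)" using less_iff_Suc_add by auto
      have "m = 0 + 2 ^ (R + 1) * (2 ^ i * q)" unfolding m i by (simp add: power_add)
      then show ?thesis using shift[of 0 "2 ^ i * q"] f0 by simp
    qed
  qed (simp add: f0)
qed

section \<open>Multiplicities along the axis\<close>

context holonomy
begin

lemma axial_axis: "axial x \<longleftrightarrow> x = axis M (x $ M)"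
  by (auto simp: Finite_Cartesian_Product.vec_eq_iff axial_def axis_def)

lemma axis_sphere:
  "axis M t \<in> sphere_pts l \<longleftrightarrow> t \<in> \<int> \<and> (2 * pi * t)\<^sup>2 = l\<^sup>2"
proof -
  have "(\<Sum>j\<in>UNIV. (axis M t $ j)\<^sup>2) = (\<Sum>j\<in>UNIV. if j = M then t\<^sup>2 else 0)"
    by (rule sum.cong) (simp_all add: axis_def)
  then have "(\<Sum>j\<in>UNIV. (axis M t $ j)\<^sup>2) = t\<^sup>2" by simp
  moreover have "lattice_pt (axis M t :: 'n rvec) \<longleftrightarrow> t \<in> \<int>"
    by (auto simp: lattice_pt_def axis_def)
  ultimately show ?thesis by (simp add: sphere_pts_def power_mult_distrib)
qed

lemma axis_amp_trivial:
  assumes "l / (2 * pi) \<notin> \<int>"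
  shows "forms.dim (axis_amp l) = 0"
proof -
  have "A = 0" if A: "A \<in> axis_amp l" for A
  proof -
    have "A \<mu> I = 0" for \<mu> I
    proof (cases "axial \<mu>")
      case True
      define t where "t = \<mu> $ M"
      have \<mu>: "\<mu> = axis M t" using True unfolding axial_axis t_def .
      have "\<mu> \<notin> sphere_pts l"
      proof
        assume "\<mu> \<in> sphere_pts l"
        then have t: "t \<in> \<int>" "(2 * pi * t)\<^sup>2 = l\<^sup>2" unfolding \<mu> axis_sphere by auto
        then have "l = 2 * pi * t \<or> l = 2 * pi * (- t)" unfolding power2_eq_iff by auto
        then have "l / (2 * pi) = t \<or> l / (2 * pi) = - t" by auto
        then show False using assms t(1) by auto
      qed
      then show ?thesis using A by (auto simp: axis_amp_def dest: inv_amp_support)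
    qed (use A in \<open>simp add: axis_amp_def\<close>)
    then show ?thesis by (intro ext) simp
  qed
  then have "A \<mu> I = 0" if "A \<in> axis_amp l" for A \<mu> I using that by fastforce
  then have "forms.dim (axis_amp l) \<le> card ({} :: 'n rvec set) * 2 ^ CARD('n)"
    by (intro finite_support_fin_dim(2)) auto
  then show ?thesis by simp
qed

definition angle :: "real \<Rightarrow> real" where "angle t = 2 * pi * t / 2 ^ r"

lemma rot_axis: "t \<noteq> 0 \<Longrightarrow> rot (2 * pi * t) (axis M t) w I = jj w I"
proof -
  assume t: "t \<noteq> 0"
  have "symb (axis M t) w I = (\<Sum>j\<in>UNIV. t * ((axis M 1 :: 'n rvec) $ j * cliff j w I))"
    unfolding symb_def by (rule sum.cong) (simp_all add: axis_def)
  also have "\<dots> = t * jj w I" unfolding symb_def sum_distrib_left ..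
  finally show ?thesis using t by (simp add: rot_def)
qed

lemma phase_axis: "phase (axis M t) = angle t"
  by (simp add: phase_def angle_def)

lemma axis_condition:
  assumes t: "t \<noteq> 0" and w: "even_vec w"
  shows "w = (\<lambda>I. cos (phase (axis M t)) * PB w I - sin (phase (axis M t)) * rot (2 * pi * t) (axis M t) (PB w) I)
    \<longleftrightarrow> PB w = EE (angle t) w" (is "w = ?R \<longleftrightarrow> _")
proof -
  have R: "?R = EE (- angle t) (PB w)"
    unfolding rot_axis[OF t] phase_axis by (rule ext) (simp add: EE_def comb_def)
  have ew: "even_vec (PB w)" by (rule even_vec_pull[OF w])
  show ?thesis unfolding R
  proof
    assume "w = EE (- angle t) (PB w)"
    then have "EE (angle t) w = EE (angle t) (EE (- angle t) (PB w))" by (rule arg_cong)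
    then show "PB w = EE (angle t) w" unfolding EE_EE[OF ew] by (simp add: EE_0)
  next
    assume "PB w = EE (angle t) w"
    then have "EE (- angle t) (PB w) = EE (- angle t) (EE (angle t) w)" by (rule arg_cong)
    then show "w = EE (- angle t) (PB w)" unfolding EE_EE[OF w] by (simp add: EE_0)
  qed
qed

text \<open>The axis meets the sphere in two opposite points and amplitudes are even, so the value
  at one point determines everything. The condition at the other point is the same one, as
  \<open>phase\<close> and \<open>rot\<close> both change sign.\<close>

lemma dim_axis_amp:
  assumes t: "t \<in> \<int>" "t \<noteq> 0"
  shows "forms.dim (axis_amp (2 * pi * t)) = ldim (N1 (angle t))"
proof (rule antisym)
  let ?l = "2 * pi * t" and ?e = "axis M t :: 'n rvec"
  have fe: "bB ?e = ?e" by (rule B_axis)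
  have fe': "bB (- ?e) = - ?e" unfolding mv_uminus fe ..
  have cases: "\<mu> = ?e \<or> \<mu> = - ?e" if "axial \<mu>" "\<mu> \<in> sphere_pts ?l" for \<mu>
  proof -
    have \<mu>: "\<mu> = axis M (\<mu> $ M)" using that(1) unfolding axial_axis .
    then have "(2 * pi * (\<mu> $ M))\<^sup>2 = ?l\<^sup>2" using that(2) axis_sphere[of "\<mu> $ M" ?l] by simp
    then have "(\<mu> $ M)\<^sup>2 = t\<^sup>2" by (simp add: power_mult_distrib)
    then have "\<mu> $ M = t \<or> \<mu> $ M = - t" by (auto simp: power2_eq_iff)
    moreover have "axis M (- t) = - ?e" by (simp add: Finite_Cartesian_Product.vec_eq_iff axis_def)
    ultimately show ?thesis using \<mu> by auto
  qed
  have es: "?e \<in> sphere_pts ?l" unfolding axis_sphere using t by simp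
  have es': "- ?e \<in> sphere_pts ?l" using sphere_pts_uminus es by blast
  have ax: "axial ?e" "axial (- ?e)" by (auto simp: axial_def axis_def)
  show "forms.dim (axis_amp ?l) \<le> ldim (N1 (angle t))"
    unfolding ldim_def
  proof (rule dim_le_inj[OF _ subspace_axis_amp _ _ fin_dim_at0, where f = "\<lambda>A. single (A ?e)"])
    show "linear_form_map (\<lambda>A. single (A ?e))"
      by (rule linear_form_mapI) (rule ext, rule ext, simp add: single_def form_scale_def)+
    fix A assume A: "A \<in> axis_amp ?l"
    then have A': "A \<in> inv_amp ?l" and z: "\<And>\<mu> I. \<not> axial \<mu> \<Longrightarrow> A \<mu> I = 0" by (auto simp: axis_amp_def)
    note D = inv_ampD[OF A']
    show "A = 0" if s: "single (A ?e) = 0"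
    proof -
      have 0: "A ?e = (\<lambda>_. 0)" using fun_cong[OF s, of 0] by (simp add: single_def zero_fun_def)
      have "A \<mu> I = 0" for \<mu> I
      proof (cases "axial \<mu> \<and> \<mu> \<in> sphere_pts ?l")
        case True
        then have "\<mu> = ?e \<or> \<mu> = - ?e" using cases by blast
        then show ?thesis using 0 D(3)[of ?e] by (elim disjE) simp_all
      next
        case False
        then show ?thesis using z D(1) by blast
      qed
      then show ?thesis by (intro ext) simp
    qed
    have "A ?e = (\<lambda>I. cos (phase ?e) * PB (A ?e) I - sin (phase ?e) * rot ?l ?e (PB (A ?e)) I)"
      by (rule ext) (use D(4)[of ?e] fe in simp)
    then have "PB (A ?e) = EE (angle t) (A ?e)"
      unfolding axis_condition[OF t(2) D(2)] .
    then show "single (A ?e) \<in> at0 (N1 (angle t))"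
      using D(2)[of ?e] by (intro single_at0) (simp add: N1_def)
  qed
  show "ldim (N1 (angle t)) \<le> forms.dim (axis_amp ?l)"
    unfolding ldim_def
  proof (rule dim_le_inj[OF _ subspace_at0[OF linear_N1] _ _ fin_dim_axis_amp,
        where f = "\<lambda>A \<mu>. if \<mu> = ?e \<or> \<mu> = - ?e then A 0 else (\<lambda>_. 0)"])
    let ?f = "\<lambda>(A :: 'n form) \<mu>. if \<mu> = ?e \<or> \<mu> = - ?e then A 0 else (\<lambda>_. 0)"
    show "linear_form_map ?f"
      by (rule linear_form_mapI) (rule ext, rule ext, simp add: form_scale_def)+
    fix A assume A: "A \<in> at0 (N1 (angle t))"
    have Ae: "even_vec (A 0)" "PB (A 0) = EE (angle t) (A 0)" using A by (auto simp: at0_def N1_def)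
    show "A = 0" if s: "?f A = 0"
    proof -
      have "A 0 = (\<lambda>_. 0)" using fun_cong[OF s, of ?e] by (simp add: zero_fun_def)
      then show ?thesis using at0_single[OF A] by (intro ext) (simp add: single_def)
    qed
    have key: "A 0 = (\<lambda>I. cos (phase ?e) * PB (A 0) I - sin (phase ?e) * rot ?l ?e (PB (A 0)) I)"
      unfolding axis_condition[OF t(2) Ae(1)] by (rule Ae(2))
    have "?f A \<in> inv_amp ?l"
    proof (rule inv_ampI)
      show "?f A \<mu> I = 0" if "\<mu> \<notin> sphere_pts ?l" for \<mu> I using that es es' by auto
      show "even_vec (?f A \<mu>)" for \<mu> using Ae(1) by (simp add: even_zero)
      show "?f A (- \<mu>) = ?f A \<mu>" for \<mu> by (simp add: minus_equation_iff[of \<mu>] equation_minus_iff disj_commute)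
      fix \<nu> :: "'n rvec" and I
      consider "\<nu> = ?e" | "\<nu> = - ?e" | "\<nu> \<noteq> ?e" "\<nu> \<noteq> - ?e" by blast
      then show "?f A \<nu> I = cos (phase \<nu>) * PB (?f A (bB \<nu>)) I - sin (phase \<nu>) * rot ?l \<nu> (PB (?f A (bB \<nu>))) I"
      proof cases
        case 1
        have "?f A (bB \<nu>) = A 0" "?f A \<nu> = A 0" unfolding 1 fe by simp_all
        then show ?thesis using fun_cong[OF key, of I] unfolding 1 by simp
      next
        case 2
        have "?f A (bB \<nu>) = A 0" "?f A \<nu> = A 0" unfolding 2 fe' by simp_all
        then show ?thesis using fun_cong[OF key, of I] unfolding 2 phase_uminus rot_uminus by simp
      next
        case 3
        have "bB \<nu> \<noteq> ?e" "bB \<nu> \<noteq> - ?e"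
          using 3 B_inverse(1)[of \<nu>] B_inverse(1)[of ?e] B_inverse(1)[of "- ?e"] unfolding fe fe' by auto
        then have "?f A (bB \<nu>) = (\<lambda>_. 0)" by simp
        moreover have "?f A \<nu> = (\<lambda>_. 0)" using 3 by simp
        ultimately show ?thesis by (simp add: pull_zero_fun rot_zero)
      qed
    qed
    then show "?f A \<in> axis_amp ?l" using ax unfolding axis_amp_def by auto
  qed
qed

text \<open>Defined by dimensions over the axis and not by multiplicities, so that it makes sense at
  0, where it vanishes, and its periodicity is visible.\<close>

definition asym :: "nat \<Rightarrow> int" where
  "asym m = int (ldim (N1 (angle (real m)))) - int (ldim (N1 (angle (- real m))))"

lemma angle_period: "angle (t + 2 ^ r) = angle t + 2 * pi"
  by (simp add: angle_def field_simps)

lemma angle_half: "angle (t + 2 ^ (r - 1)) = angle t + pi"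
proof -
  have "(2::real) ^ r = 2 * 2 ^ (r - 1)" using r by (cases r) auto
  then show ?thesis by (simp add: angle_def field_simps)
qed

lemma N1_angle_periodic: "N1 (angle (t + 2 ^ r)) = N1 (angle t)"
  unfolding angle_period by (rule N1_periodic)

lemma asym_0: "asym 0 = 0" by (simp add: asym_def)

text \<open>With h half the period, \<open>ldim_N2\<close> writes the equal dimensions of
  \<open>N2\<close> at \<open>m\<close> and \<open>- m\<close> as d(m) + d(m + h) = d(-m) + d(-m +
  h), and -m + h agrees with -(m + h) modulo \<open>2 ^ r\<close>.\<close>

lemma asym_half: "asym (m + 2 ^ (r - 1)) = - asym m"
proof -
  let ?d = "\<lambda>t. ldim (N1 (angle t))" and ?h = "2 ^ (r - 1) :: real"
  have h: "(2::real) ^ r = ?h + ?h" using r by (cases r) auto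
  have s: "ldim (N2 (angle t)) = ?d t + ?d (t + ?h)" for t
    unfolding angle_half by (rule ldim_N2)
  have "angle (- real m) = - angle (real m)" by (simp add: angle_def)
  then have "ldim (N2 (angle (real m))) = ldim (N2 (angle (- real m)))"
    using ldim_N2_le[of "angle (real m)"] ldim_N2_le[of "- angle (real m)"] by simp
  moreover have "?d (- real m + ?h) = ?d (- (real m + ?h))"
    using N1_angle_periodic[of "- (real m + ?h)"] unfolding h by (simp add: algebra_simps)
  ultimately show ?thesis unfolding s asym_def by simp
qed

text \<open>The injection only gives one inequality. Iterating it along the powers of 5 returns to
  \<open>m\<close> modulo \<open>2 ^ r\<close>, because \<open>5 ^ 2 ^ r\<close> is 1 modulo
  \<open>2 ^ r\<close>; so all the inequalities are equalities.\<close>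

lemma dim_5: "ldim (N1 (angle (5 * of_int m))) = ldim (N1 (angle (of_int m)))"
proof (rule antisym)
  let ?d = "\<lambda>m :: int. ldim (N1 (angle (of_int m)))"
  have le: "?d m \<le> ?d (5 * m)" for m
  proof -
    have "angle (of_int (5 * m)) = 5 * angle (of_int m)" by (simp add: angle_def)
    then show ?thesis using N1_le_5[of "angle (of_int m)"] by simp
  qed
  have iter: "?d m \<le> ?d (5 ^ e * m)" for e m
  proof (induction e)
    case (Suc e)
    then show ?case using le[of "5 ^ e * m"] by (simp add: mult.assoc)
  qed simp
  have per: "?d (m + 2 ^ r * int p) = ?d m" for m p
  proof (induction p)
    case (Suc p)
    have e: "of_int (m + 2 ^ r * int (Suc p)) = (of_int (m + 2 ^ r * int p) + 2 ^ r :: real)"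
      by (simp add: algebra_simps)
    have "?d (m + 2 ^ r * int (Suc p)) = ?d (m + 2 ^ r * int p)" unfolding e N1_angle_periodic ..
    then show ?case using Suc by simp
  qed simp
  obtain u where u: "(5::nat) ^ 2 ^ r = 1 + 2 ^ (r + 2) * u" using five_power[of r] by blast
  have "int (5 ^ 2 ^ r) = int (1 + 2 ^ (r + 2) * u)" unfolding u ..
  then have u': "(5::int) ^ 2 ^ r = 1 + 2 ^ r * int (4 * u)" by (simp add: power_add)
  obtain e where e: "(2::nat) ^ r = Suc e" by (metis gr0_implies_Suc zero_less_numeral zero_less_power)
  have per': "?d (m + 2 ^ r * (int p * m)) = ?d m" for m p
  proof (cases m rule: int_cases2)
    case (nonneg n)
    have e: "int p * m = int (p * n)" by (simp add: nonneg)
    show ?thesis unfolding e by (rule per)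
  next
    case (nonpos n)
    have e: "(m + 2 ^ r * (int p * m)) + 2 ^ r * int (p * n) = m" by (simp add: nonpos algebra_simps)
    show ?thesis using per[of "m + 2 ^ r * (int p * m)" "p * n"] unfolding e by (rule sym)
  qed
  have "?d (5 * m) \<le> ?d (5 ^ e * (5 * m))" by (rule iter)
  also have "5 ^ e * (5 * m) = 5 ^ 2 ^ r * m" unfolding e by simp
  also have "\<dots> = m + 2 ^ r * (int (4 * u) * m)" unfolding u' by (simp add: algebra_simps)
  also have "?d \<dots> = ?d m" by (rule per')
  finally show "ldim (N1 (angle (5 * of_int m))) \<le> ldim (N1 (angle (of_int m)))" by simp
  show "ldim (N1 (angle (of_int m))) \<le> ldim (N1 (angle (5 * of_int m)))" using le[of m] by simp
qed

lemma asym_5: "asym (5 * m) = asym m"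
  using dim_5[of "int m"] dim_5[of "- int m"] by (simp add: asym_def)

lemma multiplicity_diff:
  assumes "l \<noteq> 0"
  shows "int (multiplicity \<Gamma> l) - int (multiplicity \<Gamma> (- l))
    = int (forms.dim (axis_amp l)) - int (forms.dim (axis_amp (- l)))"
  using assms by (simp add: multiplicity_eq dim_inv_amp perp_amp_eq[of l])

lemma multiplicity_diff_asym:
  assumes m: "m > 0"
  shows "int (multiplicity \<Gamma> (2 * pi * real m)) - int (multiplicity \<Gamma> (- (2 * pi * real m))) = asym m"
proof -
  have d1: "forms.dim (axis_amp (2 * pi * real m)) = ldim (N1 (angle (real m)))"
    using m by (intro dim_axis_amp) auto
  have d2: "forms.dim (axis_amp (- (2 * pi * real m))) = ldim (N1 (angle (- real m)))"
  proof -
    have e: "- (2 * pi * real m) = 2 * pi * (- real m)" by simp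
    show ?thesis unfolding e using m by (intro dim_axis_amp) auto
  qed
  have nz: "2 * pi * real m \<noteq> 0" using m by simp
  show ?thesis unfolding multiplicity_diff[OF nz] d1 d2 asym_def ..
qed

abbreviation \<delta> :: int where "\<delta> \<equiv> asym (2 ^ (r - 2))"

definition freq :: "nat \<Rightarrow> real" where "freq k = 2 * pi * 2 ^ (r - 2) * real (2 * k + 1)"

lemma multiplicity_diff_freq:
  "int (multiplicity \<Gamma> (freq k)) - int (multiplicity \<Gamma> (- freq k)) = (-1) ^ k * \<delta>"
proof -
  have R: "(r - 2) + 1 = r - 1" using r by simp
  have "freq k = 2 * pi * real (2 ^ (r - 2) * (2 * k + 1))" by (simp add: freq_def algebra_simps)
  then show ?thesis
    using multiplicity_diff_asym[of "2 ^ (r - 2) * (2 * k + 1)"]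
      antiperiodic_five_invariant(2)[where f = asym and R = "r - 2" and k = k] asym_half asym_5 asym_0
    unfolding R by simp
qed

lemma multiplicity_diff_other:
  assumes l: "l > 0" and ne: "l \<notin> range freq"
  shows "multiplicity \<Gamma> l = multiplicity \<Gamma> (- l)"
proof (cases "l / (2 * pi) \<in> \<int>")
  case True
  then obtain z :: int where z: "l / (2 * pi) = of_int z" by (rule Ints_cases)
  then have lz: "l = 2 * pi * of_int z" by (simp add: field_simps)
  then have "z > 0" using l by (simp add: zero_less_mult_iff)
  then obtain m where m: "z = int m" "m > 0" by (metis zero_less_imp_eq_int)
  have lm: "l = 2 * pi * real m" using lz m by simp
  have "m \<noteq> 2 ^ (r - 2) * (2 * k + 1)" for k
  proof
    assume "m = 2 ^ (r - 2) * (2 * k + 1)"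
    then have "l = freq k" unfolding lm freq_def by (simp add: distrib_left)
    then show False using ne by blast
  qed
  moreover have R: "(r - 2) + 1 = r - 1" using r by simp
  ultimately have "asym m = 0"
    using antiperiodic_five_invariant(1)[where f = asym and R = "r - 2" and m = m] asym_half asym_5 asym_0
    unfolding R by blast
  then show ?thesis using multiplicity_diff_asym[OF m(2)] unfolding lm by simp
next
  case False
  then have "- l / (2 * pi) \<notin> \<int>" by (metis Ints_minus minus_divide_left minus_minus)
  then show ?thesis using multiplicity_diff[of l] axis_amp_trivial False l by simp
qed

end

section \<open>Convergence of the eta series by counting lattice points\<close>

lemma sum_Ints_le:
  assumes \<tau>: "\<tau> > 1"
  shows "\<exists>C \<ge> 0. \<forall>K. finite K \<longrightarrow> K \<subseteq> \<int> \<longrightarrow> (\<Sum>x\<in>K. max 1 \<bar>x\<bar> powr - \<tau>) \<le> (C :: real)"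
proof -
  let ?h = "\<lambda>k. max 1 (real k) powr - \<tau>"
  have s: "summable ?h"
  proof (rule summable_cong[THEN iffD1])
    show "\<forall>\<^sub>F k in sequentially. real k powr - \<tau> = max 1 (real k) powr - \<tau>"
      using eventually_ge_at_top[of 1] by eventually_elim simp
    show "summable (\<lambda>k. real k powr - \<tau>)" using \<tau> by (simp add: summable_real_powr_iff)
  qed
  have half: "(\<Sum>x\<in>K. max 1 \<bar>x\<bar> powr - \<tau>) \<le> suminf ?h" if K: "finite K" "K \<subseteq> \<int>" "inj_on abs K" for K
  proof -
    let ?g = "\<lambda>x :: real. nat \<lfloor>\<bar>x\<bar>\<rfloor>"
    have g: "real (?g x) = \<bar>x\<bar>" if "x \<in> K" for x
    proof -
      have "\<bar>x\<bar> \<in> \<int>" using that K(2) by auto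
      then obtain z where "\<bar>x\<bar> = of_int z" by (rule Ints_cases)
      moreover from this have "z \<ge> 0" by (metis abs_ge_zero of_int_0_le_iff)
      ultimately show ?thesis by simp
    qed
    have inj: "inj_on ?g K"
    proof (rule inj_onI)
      fix x y assume xy: "x \<in> K" "y \<in> K" "?g x = ?g y"
      have "real (?g x) = \<bar>y\<bar>" unfolding xy(3) by (rule g[OF xy(2)])
      with g[OF xy(1)] have "\<bar>x\<bar> = \<bar>y\<bar>" by (rule subst)
      then show "x = y" using K(3) xy by (simp add: inj_on_def)
    qed
    have "(\<Sum>x\<in>K. max 1 \<bar>x\<bar> powr - \<tau>) = (\<Sum>x\<in>K. ?h (?g x))"
      by (intro sum.cong refl) (simp only: g)
    also have "\<dots> = sum ?h (?g ` K)" using sum.reindex[OF inj, of ?h] by simp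
    also have "\<dots> \<le> suminf ?h" using K(1) by (intro sum_le_suminf s) auto
    finally show ?thesis .
  qed
  have "(\<Sum>x\<in>K. max 1 \<bar>x\<bar> powr - \<tau>) \<le> suminf ?h + suminf ?h" if K: "finite K" "K \<subseteq> \<int>" for K
  proof -
    let ?P = "K \<inter> {0..}" and ?N = "K \<inter> {..<0}"
    have "K = ?P \<union> ?N" by auto
    then have "(\<Sum>x\<in>K. max 1 \<bar>x\<bar> powr - \<tau>) = (\<Sum>x\<in>?P \<union> ?N. max 1 \<bar>x\<bar> powr - \<tau>)" by simp
    also have "\<dots> = (\<Sum>x\<in>?P. max 1 \<bar>x\<bar> powr - \<tau>) + (\<Sum>x\<in>?N. max 1 \<bar>x\<bar> powr - \<tau>)"
      using K(1) by (intro sum.union_disjoint) auto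
    also have "\<dots> \<le> suminf ?h + suminf ?h"
      using K by (intro add_mono half) (auto simp: inj_on_def)
    finally show ?thesis .
  qed
  moreover have "suminf ?h \<ge> 0" by (rule suminf_nonneg[OF s]) simp
  ultimately show ?thesis by (intro exI[of _ "suminf ?h + suminf ?h"]) simp
qed

text \<open>Each \<open>max 1 \<bar>\<mu> $ j\<bar>\<close> is at most the norm of a nonzero lattice
  point, so with \<open>\<tau> = \<sigma> / n\<close> the summand is at most a product over
  coordinates; enlarging \<open>X\<close> to a box makes the sum factor. The condition
  \<open>\<sigma> > n\<close> becomes \<open>\<tau> > 1\<close>.\<close>

lemma sum_lattice_le:
  assumes \<sigma>: "\<sigma> > real CARD('n::finite)"
  shows "\<exists>C. \<forall>X :: (real ^ 'n) set. finite X \<longrightarrow> (\<forall>\<mu>\<in>X. lattice_pt \<mu> \<and> \<mu> \<noteq> 0)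
    \<longrightarrow> (\<Sum>\<mu>\<in>X. norm \<mu> powr - \<sigma>) \<le> C"
proof -
  let ?n = "CARD('n)"
  define \<tau> where "\<tau> = \<sigma> / real ?n"
  have n0: "real ?n > 0" by simp
  have "\<tau> > 1" using \<sigma> n0 by (simp add: \<tau>_def field_simps)
  then obtain C where C: "C \<ge> 0" "\<And>K. finite K \<Longrightarrow> K \<subseteq> \<int> \<Longrightarrow> (\<Sum>x\<in>K. max 1 \<bar>x\<bar> powr - \<tau>) \<le> C"
    using sum_Ints_le by metis
  have tm: "norm \<mu> powr - \<sigma> \<le> (\<Prod>j\<in>UNIV. max 1 \<bar>\<mu> $ j\<bar> powr - \<tau>)"
    if \<mu>: "lattice_pt \<mu>" "\<mu> \<noteq> 0" for \<mu> :: "real ^ 'n"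
  proof -
    obtain j where j: "\<mu> $ j \<noteq> 0" using \<mu>(2) by (auto simp: Finite_Cartesian_Product.vec_eq_iff)
    have "\<bar>\<mu> $ j\<bar> \<ge> 1" using \<mu>(1) j by (intro Ints_nonzero_abs_ge1) (auto simp: lattice_pt_def)
    then have n1: "norm \<mu> \<ge> 1" using component_le_norm_cart[of \<mu> j] by linarith
    then have m: "max 1 \<bar>\<mu> $ j\<bar> \<le> norm \<mu>" for j using component_le_norm_cart[of \<mu> j] by simp
    have "norm \<mu> powr - \<sigma> = (\<Prod>j\<in>(UNIV :: 'n set). norm \<mu> powr - \<tau>)"
    proof -
      have "(norm \<mu> powr - \<tau>) ^ ?n = norm \<mu> powr (real ?n * - \<tau>)"
        using n1 by (subst powr_realpow[symmetric]) (auto simp: powr_powr mult.commute)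
      also have "real ?n * - \<tau> = - \<sigma>" using n0 by (simp add: \<tau>_def)
      finally show ?thesis by simp
    qed
    also have "\<dots> \<le> (\<Prod>j\<in>UNIV. max 1 \<bar>\<mu> $ j\<bar> powr - \<tau>)"
      using m \<open>\<tau> > 1\<close> by (intro prod_mono conjI powr_mono2') auto
    finally show ?thesis .
  qed
  have "(\<Sum>\<mu>\<in>X. norm \<mu> powr - \<sigma>) \<le> C ^ ?n"
    if X: "finite X" "\<forall>\<mu>\<in>X. lattice_pt \<mu> \<and> \<mu> \<noteq> 0" for X :: "(real ^ 'n) set"
  proof -
    define K where "K = (\<lambda>(\<mu>, j). \<mu> $ j) ` (X \<times> (UNIV :: 'n set))"
    have K: "finite K" "K \<subseteq> \<int>" using X by (auto simp: K_def lattice_pt_def)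
    have inj: "inj_on (\<lambda>\<mu> :: real ^ 'n. ($) \<mu>) X"
      by (rule inj_onI) (simp add: Finite_Cartesian_Product.vec_nth_inject)
    have fin: "finite (PiE (UNIV :: 'n set) (\<lambda>_. K))" using K(1) by (intro finite_PiE) auto
    have sub: "(\<lambda>\<mu>. ($) \<mu>) ` X \<subseteq> PiE (UNIV :: 'n set) (\<lambda>_. K)" by (force simp: K_def)
    have "(\<Sum>\<mu>\<in>X. norm \<mu> powr - \<sigma>) \<le> (\<Sum>\<mu>\<in>X. \<Prod>j\<in>UNIV. max 1 \<bar>\<mu> $ j\<bar> powr - \<tau>)"
      using X(2) by (intro sum_mono tm) auto
    also have "\<dots> = (\<Sum>g\<in>(\<lambda>\<mu>. ($) \<mu>) ` X. \<Prod>j\<in>UNIV. max 1 \<bar>g j\<bar> powr - \<tau>)"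
      using sum.reindex[OF inj, of "\<lambda>g. \<Prod>j\<in>UNIV. max 1 \<bar>g j\<bar> powr - \<tau>"] by simp
    also have "\<dots> \<le> (\<Sum>g\<in>PiE (UNIV :: 'n set) (\<lambda>_. K). \<Prod>j\<in>UNIV. max 1 \<bar>g j\<bar> powr - \<tau>)"
      by (rule sum_mono2[OF fin sub]) (simp add: prod_nonneg)
    also have "\<dots> = (\<Prod>j\<in>(UNIV :: 'n set). \<Sum>x\<in>K. max 1 \<bar>x\<bar> powr - \<tau>)"
      using K(1) by (subst prod_sum_PiE) auto
    also have "\<dots> \<le> C ^ ?n" using C(2)[OF K] by (simp add: power_mono sum_nonneg)
    finally show ?thesis .
  qed
  then show ?thesis by blast
qed

lemma sphere_norm:
  assumes "\<mu> \<in> sphere_pts l"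
  shows "2 * pi * norm \<mu> = \<bar>l\<bar>" "lattice_pt \<mu>"
proof -
  have "(norm \<mu>)\<^sup>2 = (\<Sum>j\<in>UNIV. (\<mu> $ j)\<^sup>2)"
    by (simp add: norm_eq_sqrt_inner inner_vec_def power2_eq_square sum_nonneg)
  then have "(2 * pi * norm \<mu>)\<^sup>2 = \<bar>l\<bar>\<^sup>2" using assms by (simp add: sphere_pts_def power_mult_distrib)
  then show "2 * pi * norm \<mu> = \<bar>l\<bar>" by (rule power2_eq_imp_eq) simp_all
  show "lattice_pt \<mu>" using assms by (simp add: sphere_pts_def)
qed

text \<open>Spheres for distinct positive \<open>l\<close> are disjoint, so summing over them is
  summing over lattice points.\<close>

lemma sphere_count_summable:
  assumes \<sigma>: "\<sigma> > real CARD('n::{finite,linorder})"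
  shows "(\<lambda>l. real (card (sphere_pts l :: 'n rvec set)) * l powr - \<sigma>) summable_on {0<..}"
proof -
  obtain C where C: "\<forall>X :: 'n rvec set. finite X \<longrightarrow> (\<forall>\<mu>\<in>X. lattice_pt \<mu> \<and> \<mu> \<noteq> 0)
    \<longrightarrow> (\<Sum>\<mu>\<in>X. norm \<mu> powr - \<sigma>) \<le> C"
    using sum_lattice_le[OF \<sigma>] by (rule exE)
  have bound: "(\<Sum>l\<in>F. real (card (sphere_pts l :: 'n rvec set)) * l powr - \<sigma>) \<le> C"
    if F: "finite F" "F \<subseteq> {0<..}" for F
  proof -
    let ?S = "\<lambda>l. sphere_pts l :: 'n rvec set"
    have t: "l powr - \<sigma> \<le> norm \<mu> powr - \<sigma>" and nz: "\<mu> \<noteq> 0" if "l > 0" "\<mu> \<in> ?S l" for l \<mu>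
    proof -
      have e: "2 * pi * norm \<mu> = l" using sphere_norm(1)[OF that(2)] that(1) by simp
      show nz: "\<mu> \<noteq> 0" using e that(1) by auto
      have "1 * norm \<mu> \<le> 2 * pi * norm \<mu>" using pi_ge_two by (intro mult_right_mono) auto
      then have "norm \<mu> \<le> l" using e by simp
      then show "l powr - \<sigma> \<le> norm \<mu> powr - \<sigma>"
        using nz \<sigma> by (intro powr_mono2') (auto intro: le_less_trans)
    qed
    have dj: "?S l \<inter> ?S l' = {}" if "l \<in> F" "l' \<in> F" "l \<noteq> l'" for l l'
    proof -
      have "l > 0" "l' > 0" using that F(2) by auto
      then show ?thesis using sphere_norm(1)[of _ l] sphere_norm(1)[of _ l'] that(3) by force
    qed
    have "(\<Sum>l\<in>F. real (card (?S l)) * l powr - \<sigma>) = (\<Sum>l\<in>F. \<Sum>\<mu>\<in>?S l. l powr - \<sigma>)" by simp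
    also have "\<dots> \<le> (\<Sum>l\<in>F. \<Sum>\<mu>\<in>?S l. norm \<mu> powr - \<sigma>)"
      using F(2) t by (intro sum_mono) auto
    also have "\<dots> = (\<Sum>\<mu>\<in>(\<Union>l\<in>F. ?S l). norm \<mu> powr - \<sigma>)"
      using F(1) finite_sphere_pts dj by (intro sum.UNION_disjoint[symmetric]) auto
    also have "\<dots> \<le> C"
      by (rule C[rule_format]) (use F finite_sphere_pts nz sphere_norm(2) in auto)
    finally show ?thesis .
  qed
  show ?thesis
    by (rule nonneg_bdd_above_summable_on) (auto intro!: bdd_aboveI2[where M = C] bound)
qed

section \<open>The eta function in closed form\<close>

context holonomy
begin

lemma multiplicity_le:
  assumes "l \<noteq> 0"
  shows "real (multiplicity \<Gamma> l) \<le> 2 ^ CARD('n) * real (card (sphere_pts l :: 'n rvec set))"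
proof -
  have "multiplicity \<Gamma> l \<le> card (sphere_pts l :: 'n rvec set) * 2 ^ CARD('n)"
    unfolding multiplicity_eq[OF assms]
    by (rule finite_support_fin_dim(2)[OF finite_sphere_pts]) (rule inv_amp_support)
  then have "real (multiplicity \<Gamma> l) \<le> real (card (sphere_pts l :: 'n rvec set) * 2 ^ CARD('n))"
    by (rule of_nat_mono)
  then show ?thesis by (simp add: mult.commute)
qed

lemma multiplicity_summable:
  assumes s: "Re s > real CARD('n)" and e: "e = 1 \<or> e = -1"
  shows "(\<lambda>l. of_nat (multiplicity \<Gamma> (e * l)) * of_real l powr - s :: complex) summable_on {0<..}"
proof (rule Infinite_Sum.abs_summable_summable, rule Infinite_Sum.abs_summable_on_comparison_test')
  show "(\<lambda>l. 2 ^ CARD('n) * (real (card (sphere_pts l :: 'n rvec set)) * l powr - Re s)) summable_on {0<..}"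
    by (rule summable_on_cmult_right[OF sphere_count_summable[OF s]])
  fix l :: real assume "l \<in> {0<..}"
  then have l: "l > 0" by simp
  have sp: "sphere_pts (e * l) = (sphere_pts l :: 'n rvec set)" using e by (auto simp: sphere_minus)
  have "norm (of_nat (multiplicity \<Gamma> (e * l)) * of_real l powr - s :: complex)
      = real (multiplicity \<Gamma> (e * l)) * l powr - Re s"
    using l by (simp add: norm_mult norm_powr_real_powr)
  also have "\<dots> \<le> (2 ^ CARD('n) * real (card (sphere_pts (e * l) :: 'n rvec set))) * l powr - Re s"
    using l e by (intro mult_right_mono multiplicity_le) auto
  finally show "norm (of_nat (multiplicity \<Gamma> (e * l)) * of_real l powr - s :: complex)
      \<le> 2 ^ CARD('n) * (real (card (sphere_pts l :: 'n rvec set)) * l powr - Re s)"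
    unfolding sp by (simp add: mult_ac)
qed

text \<open>Lets the eta series run over all nonzero reals, an index set symmetric under
  \<open>l \<mapsto> - l\<close>.\<close>

lemma multiplicity_0: "l \<notin> spectrum \<Gamma> \<Longrightarrow> l \<noteq> 0 \<Longrightarrow> multiplicity \<Gamma> l = 0"
proof -
  assume l: "l \<notin> spectrum \<Gamma>" "l \<noteq> 0"
  then have "\<forall>\<phi>\<in>eigenspace \<Gamma> l. \<phi> = 0" by (auto simp: spectrum_def)
  then have z: "A \<mu> I = 0" if "A \<in> eigenspace \<Gamma> l" for A \<mu> I using that by (metis zero_fun_apply)
  have "forms.dim (eigenspace \<Gamma> l) \<le> card ({} :: 'n rvec set) * 2 ^ CARD('n)"
    by (rule finite_support_fin_dim(2)) (use z in auto)
  then show ?thesis by (simp add: multiplicity_def)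
qed

lemma inj_freq: "inj freq"
  by (rule injI) (simp add: freq_def)

lemma freq_pos: "freq k > 0"
  by (simp add: freq_def)

definition eta_closed :: "complex \<Rightarrow> complex" where
  "eta_closed s = of_int \<delta> * (of_real (2 * pi * 2 ^ (r - 2)) powr - s * L4 s)"

text \<open>Absolute convergence of both halves permits pairing \<open>l\<close> with
  \<open>- l\<close>, so that only differences of multiplicities remain.\<close>

lemma eta_series_eq:
  assumes s: "Re s > real CARD('n)"
  shows "eta_series \<Gamma> s = eta_closed s"
proof -
  let ?m = "\<lambda>l. of_nat (multiplicity \<Gamma> l) :: complex"
  let ?p = "\<lambda>l :: real. of_real l powr - s :: complex"
  let ?T = "\<lambda>l :: real. ?m l * of_real (sgn l) * of_real \<bar>l\<bar> powr - s"
  let ?G = "\<lambda>l. (?m l - ?m (- l)) * ?p l"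
  have s1: "Re s > 1" using s card_mod_4 by (cases "CARD('n)") auto
  have sm: "(\<lambda>l. ?m l * ?p l) summable_on {0<..}" "(\<lambda>l. ?m (- l) * ?p l) summable_on {0<..}"
    using multiplicity_summable[OF s, of 1] multiplicity_summable[OF s, of "-1"] by simp_all
  have neg: "uminus ` {0<..} = {..<(0::real)}" by (simp add: image_uminus_greaterThan)
  have inj: "inj_on uminus {0<..(0::real)}" "inj_on uminus {0::real<..}" by auto
  have Tp: "?T l = ?m l * ?p l" if "l \<in> {0<..}" for l using that by simp
  have Tn: "(?T \<circ> uminus) l = - (?m (- l) * ?p l)" if "l \<in> {0<..}" for l using that by simp
  have Sp: "?T summable_on {0<..}"
    by (rule summable_on_cong[THEN iffD2, OF Tp sm(1)])
  have Su: "(\<lambda>l. - (?m (- l) * ?p l)) summable_on {0<..}"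
    using summable_on_cmult_right[OF sm(2), of "-1"] by simp
  have Sn': "(?T \<circ> uminus) summable_on {0<..}"
    by (rule summable_on_cong[THEN iffD2, OF Tn Su])
  have Sn: "?T summable_on {..<0}"
    using summable_on_reindex[OF inj(2), of ?T] Sn' unfolding neg by blast
  have "eta_series \<Gamma> s = infsum ?T ({0<..} \<union> {..<0})"
    unfolding eta_series_def
    by (rule infsum_cong_neutral) (auto simp: multiplicity_0)
  also have "\<dots> = infsum ?T {0<..} + infsum ?T {..<0}"
    by (rule infsum_Un_disjoint[OF Sp Sn]) auto
  also have "infsum ?T {..<0} = infsum (?T \<circ> uminus) {0<..}"
    using infsum_reindex[OF inj(2), of ?T] unfolding neg .
  also have "\<dots> = infsum (\<lambda>l. - (?m (- l) * ?p l)) {0<..}"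
    by (rule infsum_cong) (rule Tn)
  also have "infsum ?T {0<..} = infsum (\<lambda>l. ?m l * ?p l) {0<..}"
    by (rule infsum_cong) (rule Tp)
  also have "infsum (\<lambda>l. ?m l * ?p l) {0<..} + infsum (\<lambda>l. - (?m (- l) * ?p l)) {0<..}
      = infsum (\<lambda>l. ?m l * ?p l + - (?m (- l) * ?p l)) {0<..}"
    by (rule infsum_add[OF sm(1) Su, symmetric])
  also have "\<dots> = infsum ?G {0<..}"
    by (rule infsum_cong) (simp only: left_diff_distrib add_uminus_conv_diff)
  \<comment> \<open>Off the odd multiples of the base frequency the two multiplicities
    agree.\<close>
  also have "\<dots> = infsum ?G (range freq)"
    by (rule infsum_cong_neutral) (auto simp: freq_pos multiplicity_diff_other)
  also have "\<dots> = infsum (?G \<circ> freq) UNIV" by (rule infsum_reindex[OF inj_freq])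
  also have "\<dots> = eta_closed s"
  proof (rule infsumI)
    let ?c = "2 * pi * 2 ^ (r - 2) :: real"
    let ?L = "\<lambda>k. (-1) ^ k * of_nat (2 * k + 1) powr - s :: complex"
    have e: "(?G \<circ> freq) k = of_int \<delta> * (of_real ?c powr - s * ?L k)" for k
    proof -
      have "of_int (int (multiplicity \<Gamma> (freq k)) - int (multiplicity \<Gamma> (- freq k)))
          = (of_int ((-1) ^ k * \<delta>) :: complex)" unfolding multiplicity_diff_freq ..
      then have "?m (freq k) - ?m (- freq k) = (-1) ^ k * of_int \<delta>" by simp
      moreover have "?p (freq k) = of_real ?c powr - s * of_nat (2 * k + 1) powr - s"
      proof -
        have "of_real (freq k) = (of_real ?c * of_real (real (2 * k + 1)) :: complex)"
          unfolding freq_def by (rule of_real_mult)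
        moreover have "(of_real ?c * of_real (real (2 * k + 1)) :: complex) powr - s
            = of_real ?c powr - s * of_real (real (2 * k + 1)) powr - s"
          by (rule powr_times_real) auto
        ultimately show ?thesis by (simp only: of_real_of_nat_eq)
      qed
      ultimately show ?thesis by (simp add: mult_ac)
    qed
    have "(?L has_sum L4 s) UNIV"
      using norm_summable_imp_has_sum[OF summable_L4[OF s1]] summable_sums[OF summable_norm_cancel[OF summable_L4[OF s1]]]
      unfolding L4_series[OF s1] by blast
    then have "((\<lambda>k. of_int \<delta> * (of_real ?c powr - s * ?L k)) has_sum eta_closed s) UNIV"
      unfolding eta_closed_def by (intro has_sum_cmult_right)
    moreover have "?G \<circ> freq = (\<lambda>k. of_int \<delta> * (of_real ?c powr - s * ?L k))" by (rule ext) (rule e)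
    ultimately show "(?G \<circ> freq has_sum eta_closed s) UNIV" by (simp only:)
  qed
  finally show ?thesis .
qed

lemma eta_function_closed: "eta_function \<Gamma> = eta_closed"
proof (rule eta_function_eq[OF _ eta_series_eq])
  have "(of_real (2 * pi * 2 ^ (r - 2)) :: complex) \<noteq> 0" by simp
  then have "(\<lambda>s. of_real (2 * pi * 2 ^ (r - 2)) powr - s :: complex) holomorphic_on UNIV"
    by (intro holomorphic_intros)
  then show "eta_closed holomorphic_on UNIV"
    unfolding eta_closed_def by (intro holomorphic_intros holomorphic_L4)
qed

lemma eta_invariant_closed: "eta_invariant \<Gamma> = of_int \<delta> / 2"
proof -
  have "(of_real (2 * pi * 2 ^ (r - 2)) :: complex) \<noteq> 0" by simp
  then have "of_real (2 * pi * 2 ^ (r - 2)) powr - (0 :: complex) = (1 :: complex)"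
    unfolding powr_def by simp
  then show ?thesis unfolding eta_invariant_def eta_function_closed eta_closed_def L4_0 by simp
qed

lemma \<Gamma>_group_eq: "B = mat_transfer (B_mat r k k') \<Longrightarrow> \<Gamma>_group r k k' = \<Gamma>"
  unfolding \<Gamma>_def gen_def \<Gamma>_group_def by simp

end

text \<open>Apart from the integer \<open>d\<close> the closed form depends on \<open>r\<close>
  alone, neither on the dimension nor on the numbers of blocks. Manifolds of different dimensions
  can therefore be compared.\<close>

lemma family_eta:
  fixes \<Gamma> :: "'n::{finite,linorder} self_map set"
  assumes r: "r \<ge> 2" and \<Gamma>: "\<Gamma> \<in> family_F r"
  shows "\<exists>d :: int. eta_function \<Gamma> = (\<lambda>s. of_int d * (of_real (2 * pi * 2 ^ (r - 2)) powr - s * L4 s))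
    \<and> eta_invariant \<Gamma> = of_int d / 2"
proof -
  obtain k k' where \<Gamma>': "\<Gamma> = \<Gamma>_group r k k'" and k: "k' 1 = 0" "odd (k 1 + k' 1)" "CARD('n) = B_dim r k k'"
    using \<Gamma> unfolding family_F_def by blast
  obtain U :: "'n sq_matrix" and a b where H: "holonomy (mat_transfer (B_mat r k k')) U r a b"
    using holonomy_exists[OF r k] by blast
  interpret holonomy "mat_transfer (B_mat r k k') :: 'n sq_matrix" U r a b by (rule H)
  show ?thesis
    unfolding \<Gamma>' \<Gamma>_group_eq[OF refl] eta_function_closed eta_invariant_closed
    by (rule exI[of _ \<delta>]) (simp add: eta_closed_def fun_eq_iff)
qed

theorem mainTheorem4:
  fixes r :: nat
    and \<Gamma> :: "'n::{finite,linorder} self_map set"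
    and \<Gamma>' :: "'m::{finite,linorder} self_map set"
  assumes "r \<ge> 2"
    and "\<Gamma> \<in> family_F r"
    and "\<Gamma>' \<in> family_F r"
    and "eta_invariant \<Gamma> = eta_invariant \<Gamma>'"
  shows "eta_function \<Gamma> = eta_function \<Gamma>'"
proof -
  obtain d where d: "eta_function \<Gamma> = (\<lambda>s. of_int d * (of_real (2 * pi * 2 ^ (r - 2)) powr - s * L4 s))"
    "eta_invariant \<Gamma> = of_int d / 2"
    using family_eta[OF assms(1,2)] by blast
  obtain d' where d': "eta_function \<Gamma>' = (\<lambda>s. of_int d' * (of_real (2 * pi * 2 ^ (r - 2)) powr - s * L4 s))"
    "eta_invariant \<Gamma>' = of_int d' / 2"
    using family_eta[OF assms(1,3)] by blast
  have "d = d'" using assms(4) unfolding d(2) d'(2) by simp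
  then show ?thesis unfolding d(1) d'(1) by simp
qed

end
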